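(* Let $n\ge 2$ and let $d=kn$ for some positive integer $k$. Then the monodromy map $$\nu:\mathcal{P}_{n,d}\to\mathcal{B},$$ sending a canonically normalized meromorphic cyclic $\mathrm{SL}(n,\mathbb{C})$-oper on the Riemann sphere with a single pole (at $\infty$) to its Stokes data, is a holomorphic immersion.
   Context: Fix integers $n\ge2$, $k\ge1$ and put $d=kn$. **The space $\mathcal{P}_{n,d}$.** A point of $\mathcal{P}_{n,d}$ is a connection $\nabla=d-A(z)\,dz$ on the trivial rank $n$ bundle over $\mathbb{C}$, where $A(z)$ has $1$'s on the first superdiagonal, the polynomial $p(z)$ in the bottom-left entry (row $n$, column $1$), and zeros elsewhere, and where $p(z)=z^d+c_{d-2}z^{d-2}+\dots+c_1z+c_0$ is monic of degree $d$ with vanishing $z^{d-1}$-coefficient. Thus $\mathcal{P}_{n,d}\cong\mathbb{C}^{d-1}$ is an affine space modeled on the polynomials of degree at most $d-2$, with its natural complex structure. (Each point carries the fixed frame $f_0$ and fixed reference direction described below.) **The associated semisimple connection at $\infty$.** Let $g(z)=\mathrm{diag}(z^{nk},z^{(n-1)k},\dots,z^{k})$ and $B=\frac{dg}{dz}g^{-1}+gAg^{-1}$. Near $z=\infty$ one has $B(z)=z^k\sum_{j\ge0}A_jz^{-j}$, where $A_0$ is the cyclic permutation matrix with $1$'s on the first superdiagonal and in the bottom-left entry; its eigenvalues are the $n$-th roots of unity, which are distinct. Put $\nabla_0=d-B(z)\,dz$. Fix once and for all $f_0\in\mathrm{GL}(n,\mathbb{C})$ with $f_0^{-1}A_0f_0=\mathrm{diag}(\lambda_1,\dots,\lambda_n)$.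 **Formal solution.** There are a unique formal series $\widehat Y\in \mathrm{GL}(n,\mathbb{C}[[z^{-1}]])$ with constant term $f_0$, a unique constant diagonal matrix $\Lambda$ (exponent of formal monodromy), and a unique diagonal matrix $Q$ of polynomials in $z$ of degree $k+1$ without constant term and with leading term $\frac{z^{k+1}}{k+1}\mathrm{diag}(\lambda_1,\dots,\lambda_n)$, such that $\frac{d}{dz}\widehat Y=B\widehat Y-\widehat Y\left(\frac{dQ}{dz}+\Lambda z^{-1}\right)$. **Anti-Stokes directions and sectors.** An anti-Stokes direction is a direction $\theta$ such that for some $i\ne j$, $(\lambda_i-\lambda_j)z^{k+1}\in\mathbb{R}_{<0}$ whenever $\arg z=\theta$. Let $\theta_0=\frac{\pi}{4n(k+1)}$ (it is not an anti-Stokes direction). Let $d_1<d_2<\dots<d_r$ be the anti-Stokes directions in $(\theta_0,\theta_0+2\pi)$ and $d_{r+1}=d_1+2\pi$; $r$ is divisible by $2k+2$, and we write $r=(2k+2)\ell$. For $1\le i\le r$ let $\mathrm{Sect}_i=\{d_i<\arg z<d_{i+1}\}$ and $\widehat{\mathrm{Sect}}_i=\{d_i-\frac{\pi}{2(k+1)}<\arg z<d_{i+1}+\frac{\pi}{2(k+1)}\}$, where $\arg z$, and hence $\log z$ and $z^\Lambda$, are continued continuously. **Canonical solutions.** For $1\le i\le r$ let $\Phi_i$ be the unique holomorphic fundamental solution of $\frac{dY}{dz}=BY$ on $\mathrm{Sect}_i$ (for $|z|$ large) whose analytic continuation to $\widehat{\mathrm{Sect}}_i$ satisfies $\Phi_i\sim\widehat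 Y z^{\Lambda}e^{Q}$ as $z\to\infty$ in $\widehat{\mathrm{Sect}}_i$, i.e. $\Phi_ie^{-Q}z^{-\Lambda}$ has asymptotic expansion $\widehat Y$. (Here $f\sim\sum_j c_jz^{-j}$ means $z^m\big(f-\sum_{j=0}^m c_jz^{-j}\big)\to0$ for all $m\ge0$.) **Stokes data.** The Stokes factors are $K_{i+1}=\Phi_{i+1}^{-1}\Phi_i$ for $1\le i\le r-1$, and $K_1=\Phi_1^{-1}\Phi_r\exp(-2\pi\sqrt{-1}\,\Lambda)$, where in each case the earlier solution (in the second case $\Phi_r$) is analytically continued counterclockwise into the next sector. The Stokes matrices are $S_i=K_{i\ell}K_{i\ell-1}\cdots K_{(i-1)\ell+1}$ for $1\le i\le 2k+2$. There is a unique permutation matrix $P$ (the same for all points of $\mathcal{P}_{n,d}$) such that $P^{-1}S_iP\in U_+$ for $i$ odd and $P^{-1}S_iP\in U_-$ for $i$ even, where $U_+$, $U_-$ are the upper, resp. lower, triangular unipotent subgroups of $\mathrm{SL}(n,\mathbb{C})$. One has $S_{2k+2}\cdots S_1\exp(2\pi\sqrt{-1}\,\Lambda)=I_n$. **The space $\mathcal{B}$ and the map $\nu$.** Let $T\subset\mathrm{SL}(n,\mathbb{C})$ be the diagonal subgroup and $$\mathcal{B}=\{(S_1,\dots,S_{2k+2})\in(U_+\times U_-)^{k+1}\mid S_{2k+2}\cdots S_2S_1\in T\},$$ regarded as a complex manifold. Then $\nu(\nabla)=(P^{-1}S_1P,\dots,P^{-1}S_{2k+2}P)$. *)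

theory Defs
  imports "HOL-Complex_Analysis.Complex_Analysis"
begin

(* "$" is vector and matrix indexing throughout *)
no_notation fps_nth (infixl "$" 75)

(* Matrices are complex^'n^'n.  Rows and columns are counted by the linear order of the finite
   index type: pos i is the 0-based position of i, so row r of the mathematics is the i with
   pos i = r - 1. *)

type_synonym 'n cvec = "(complex, 'n) vec"
type_synonym 'n cmat = "((complex, 'n) vec, 'n) vec"

definition pos :: "'a::{finite,wellorder} \<Rightarrow> nat" where
  "pos i = card {j. j < i}"

definition diag_mat :: "'a::zero^'n \<Rightarrow> 'a^'n^'n" where
  "diag_mat v = (\<chi> i j. if i = j then v $ i else 0)"

subsection \<open>The space of cyclic opers\<close>

(* The connection d - A(z) dz is represented by the matrix function A. *)

definition oper_matrix :: "complex poly \<Rightarrow> complex \<Rightarrow> 'n::{finite,wellorder} cmat" where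
  "oper_matrix p z = (\<chi> i j.
     if pos j = pos i + 1 then 1
     else if pos i = CARD('n) - 1 \<and> pos j = 0 then poly p z
     else 0)"

definition cyclic_opers :: "nat \<Rightarrow> (complex \<Rightarrow> 'n::{finite,wellorder} cmat) set" where
  "cyclic_opers k = {oper_matrix p | p.
     degree p = k * CARD('n) \<and> lead_coeff p = 1 \<and> coeff p (k * CARD('n) - 1) = 0}"

(* The global affine coordinates (c_0, ..., c_{d-2}), d = kn, which give the space of opers its
   complex structure; the index type of c is meant to have d - 1 elements. *)

definition oper_of_coeffs ::
  "nat \<Rightarrow> complex^'m::{finite,wellorder} \<Rightarrow> complex \<Rightarrow> 'n::{finite,wellorder} cmat" where
  "oper_of_coeffs k c =
     oper_matrix (monom 1 (k * CARD('n)) + (\<Sum>j\<in>UNIV. monom (c $ j) (pos j)))"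

subsection \<open>The associated connection and its formal solution at infinity\<close>

definition gauge :: "nat \<Rightarrow> complex \<Rightarrow> 'n::{finite,wellorder} cmat" where
  "gauge k z = diag_mat (\<chi> i. z ^ ((CARD('n) - pos i) * k))"

definition assoc_matrix ::
  "nat \<Rightarrow> (complex \<Rightarrow> 'n cmat) \<Rightarrow> complex \<Rightarrow> 'n::{finite,wellorder} cmat" where
  "assoc_matrix k A z =
     (\<chi> i j. deriv (\<lambda>u. gauge k u $ i $ j) z) ** matrix_inv (gauge k z)
     + gauge k z ** A z ** matrix_inv (gauge k z)"

definition cyclic_perm_matrix :: "'n::{finite,wellorder} cmat" where
  "cyclic_perm_matrix = (\<chi> i j.
     if pos j = pos i + 1 \<or> (pos i = CARD('n) - 1 \<and> pos j = 0) then 1 else 0)"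

(* Formal series in 1/z are formal Laurent series in the local coordinate x = 1/z, for which
   d/dz = - x^2 d/dx.  Y has entries in C[[x]]; its constant term f0 is invertible in all uses,
   so that Y lies in GL(n, C[[x]]).  L is the diagonal of the exponent of formal monodromy. *)

definition formal_solution ::
  "nat \<Rightarrow> 'n cmat \<Rightarrow> 'n cvec \<Rightarrow> (complex \<Rightarrow> 'n cmat)
   \<Rightarrow> complex fps^'n^'n \<Rightarrow> 'n cvec \<Rightarrow> complex poly^'n \<Rightarrow> bool" where
  "formal_solution k f0 lam B Y L Q \<longleftrightarrow>
     (\<forall>i j. fps_nth (Y $ i $ j) 0 = f0 $ i $ j) \<and>
     (\<forall>i. degree (Q $ i) = k + 1 \<and> coeff (Q $ i) 0 = 0 \<and>
          coeff (Q $ i) (k + 1) = lam $ i / of_nat (k + 1)) \<and>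
     (let Yhat = (\<chi> i j. fps_to_fls (Y $ i $ j));
          Bhat = (\<chi> i j. laurent_expansion (\<lambda>x. B (1 / x) $ i $ j) 0);
          Dhat = diag_mat (\<chi> i. laurent_expansion
                   (\<lambda>x. poly (pderiv (Q $ i)) (1 / x) + L $ i * x) 0)
      in (\<chi> i j. - (fls_X ^ 2) * fls_deriv (Yhat $ i $ j)) = Bhat ** Yhat - Yhat ** Dhat)"

definition formal_data ::
  "nat \<Rightarrow> 'n cmat \<Rightarrow> 'n cvec \<Rightarrow> (complex \<Rightarrow> 'n cmat)
   \<Rightarrow> (complex fps^'n^'n) \<times> 'n cvec \<times> (complex poly^'n)" where
  "formal_data k f0 lam B = (THE (Y, L, Q). formal_solution k f0 lam B Y L Q)"

definition formal_Y where "formal_Y k f0 lam B = fst (formal_data k f0 lam B)"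
definition formal_L where "formal_L k f0 lam B = fst (snd (formal_data k f0 lam B))"
definition formal_Q where "formal_Q k f0 lam B = snd (snd (formal_data k f0 lam B))"

subsection \<open>Anti-Stokes directions and sectors\<close>

definition anti_stokes :: "nat \<Rightarrow> 'n::finite cvec \<Rightarrow> real \<Rightarrow> bool" where
  "anti_stokes k lam \<theta> \<longleftrightarrow> (\<exists>i j. i \<noteq> j \<and>
     (\<forall>\<rho>>0. \<exists>t<0. (lam $ i - lam $ j) * rcis \<rho> \<theta> ^ (k + 1) = complex_of_real t))"

definition theta0 :: "'n::finite itself \<Rightarrow> nat \<Rightarrow> real" where
  "theta0 _ k = pi / (4 * real CARD('n) * real (k + 1))"

definition anti_stokes_set :: "nat \<Rightarrow> 'n::finite cvec \<Rightarrow> real set" where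
  "anti_stokes_set k lam =
     {\<theta>. theta0 TYPE('n) k < \<theta> \<and> \<theta> < theta0 TYPE('n) k + 2 * pi \<and> anti_stokes k lam \<theta>}"

definition num_dirs :: "nat \<Rightarrow> 'n::finite cvec \<Rightarrow> nat" where
  "num_dirs k lam = card (anti_stokes_set k lam)"

(* d_1 < ... < d_r, and d_{r+1} = d_1 + 2 pi; only indices 1, ..., r + 1 are meaningful *)

definition stokes_dir :: "nat \<Rightarrow> 'n::finite cvec \<Rightarrow> nat \<Rightarrow> real" where
  "stokes_dir k lam i =
     (let ds = sorted_list_of_set (anti_stokes_set k lam)
      in if i \<le> num_dirs k lam then ds ! (i - 1) else ds ! 0 + 2 * pi)"

definition big_sector :: "nat \<Rightarrow> 'n::finite cvec \<Rightarrow> nat \<Rightarrow> real set" where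
  "big_sector k lam i =
     {stokes_dir k lam i - pi / (2 * real (k + 1)) <..<
      stokes_dir k lam (i + 1) + pi / (2 * real (k + 1))}"

subsection \<open>Canonical solutions\<close>

(* Solutions are written in the variable w = log z: Re w = log |z|, Im w = arg z, and
   z powr L = exp (w L) is then the continuously continued branch.  Since B is holomorphic on the
   punctured plane, every local solution near infinity continues to the whole universal cover of
   the punctured plane, i.e. to an entire function of w; in this variable the equation
   dY/dz = B Y reads dY/dw = exp w * B (exp w) Y.  Analytic continuation across sectors, and
   (by w + 2 pi i) once counterclockwise around infinity, is therefore built in.

   As usual for asymptotic expansions in open sectors, "z tends to infinity in the sector" means
   uniformly in every closed subsector; uniformity up to the boundary rays of the big sector
   fails in general. *)

definition closed_sector_filter :: "real \<Rightarrow> real \<Rightarrow> complex filter" where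
  "closed_sector_filter \<alpha> \<beta> =
     inf (filtercomap Re at_top) (principal {w. Im w \<in> {\<alpha>..\<beta>}})"

definition asymptotic_in_sector ::
  "real set \<Rightarrow> (complex \<Rightarrow> complex) \<Rightarrow> complex fps \<Rightarrow> bool" where
  "asymptotic_in_sector I f F \<longleftrightarrow> (\<forall>\<alpha> \<beta> m. {\<alpha>..\<beta>} \<subseteq> I \<longrightarrow>
     ((\<lambda>w. exp w ^ m * (f w - (\<Sum>j\<le>m. fps_nth F j * inverse (exp w) ^ j))) \<longlongrightarrow> 0)
       (closed_sector_filter \<alpha> \<beta>))"

definition fundamental_solution ::
  "(complex \<Rightarrow> 'n::finite cmat) \<Rightarrow> (complex \<Rightarrow> 'n cmat) \<Rightarrow> bool" where
  "fundamental_solution B \<Phi> \<longleftrightarrow> (\<forall>w. invertible (\<Phi> w)) \<and>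
     (\<forall>w i j. ((\<lambda>u. \<Phi> u $ i $ j) has_field_derivative
                 exp w * (B (exp w) ** \<Phi> w) $ i $ j) (at w))"

definition canonical_solution ::
  "nat \<Rightarrow> 'n::finite cmat \<Rightarrow> 'n cvec \<Rightarrow> (complex \<Rightarrow> 'n cmat) \<Rightarrow> nat
   \<Rightarrow> complex \<Rightarrow> 'n cmat" where
  "canonical_solution k f0 lam B i = (THE \<Phi>. fundamental_solution B \<Phi> \<and>
     (\<forall>a b. asymptotic_in_sector (big_sector k lam i)
        (\<lambda>w. (\<Phi> w
               ** diag_mat (\<chi> j. exp (- poly (formal_Q k f0 lam B $ j) (exp w)))
               ** diag_mat (\<chi> j. exp (- formal_L k f0 lam B $ j * w))) $ a $ b)
        (formal_Y k f0 lam B $ a $ b)))"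

subsection \<open>Stokes data\<close>

definition stokes_factor ::
  "nat \<Rightarrow> 'n::finite cmat \<Rightarrow> 'n cvec \<Rightarrow> (complex \<Rightarrow> 'n cmat) \<Rightarrow> nat \<Rightarrow> 'n cmat"
  where
  "stokes_factor k f0 lam B i =
     (let \<Phi> = canonical_solution k f0 lam B; r = num_dirs k lam; L = formal_L k f0 lam B
      in if i = 1
         then (THE K. \<forall>w. K = matrix_inv (\<Phi> 1 w) ** \<Phi> r (w + 2 * of_real pi * \<i>)
                               ** diag_mat (\<chi> j. exp (- 2 * of_real pi * \<i> * L $ j)))
         else (THE K. \<forall>w. K = matrix_inv (\<Phi> i w) ** \<Phi> (i - 1) w))"

(* M b ** M (b - 1) ** ... ** M a *)

definition desc_prod :: "(nat \<Rightarrow> 'n::finite cmat) \<Rightarrow> nat \<Rightarrow> nat \<Rightarrow> 'n cmat" where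
  "desc_prod M a b = foldr (\<lambda>i N. M i ** N) (rev [a..<b + 1]) (mat 1)"

definition stokes_matrix ::
  "nat \<Rightarrow> 'n::finite cmat \<Rightarrow> 'n cvec \<Rightarrow> (complex \<Rightarrow> 'n cmat) \<Rightarrow> nat \<Rightarrow> 'n cmat"
  where
  "stokes_matrix k f0 lam B i =
     (let l = num_dirs k lam div (2 * k + 2)
      in desc_prod (stokes_factor k f0 lam B) ((i - 1) * l + 1) (i * l))"

definition upper_unipotent :: "('n::{finite,wellorder} cmat) set" where
  "upper_unipotent = {M. (\<forall>i. M $ i $ i = 1) \<and> (\<forall>i j. j < i \<longrightarrow> M $ i $ j = 0)}"

definition lower_unipotent :: "('n::{finite,wellorder} cmat) set" where
  "lower_unipotent = {M. (\<forall>i. M $ i $ i = 1) \<and> (\<forall>i j. i < j \<longrightarrow> M $ i $ j = 0)}"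

definition diagonal_SL :: "('n::{finite,wellorder} cmat) set" where
  "diagonal_SL = {M. (\<forall>i j. i \<noteq> j \<longrightarrow> M $ i $ j = 0) \<and> det M = 1}"

definition unipotent_at :: "nat \<Rightarrow> ('n::{finite,wellorder} cmat) set" where
  "unipotent_at i = (if odd i then upper_unipotent else lower_unipotent)"

definition permutation_matrix :: "'n::finite cmat \<Rightarrow> bool" where
  "permutation_matrix P \<longleftrightarrow> (\<exists>\<sigma>. bij \<sigma> \<and> P = (\<chi> i j. if i = \<sigma> j then 1 else 0))"

(* One and the same permutation matrix for all opers; it is in fact unique. *)

definition stokes_perm ::
  "nat \<Rightarrow> 'n cmat \<Rightarrow> 'n cvec \<Rightarrow> 'n::{finite,wellorder} cmat" where
  "stokes_perm k f0 lam = (SOME P. permutation_matrix P \<and>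
     (\<forall>A\<in>cyclic_opers k. \<forall>i\<in>{1..2 * k + 2}.
        matrix_inv P ** stokes_matrix k f0 lam (assoc_matrix k A) i ** P \<in> unipotent_at i))"

(* The space B, a set of (2k+2)-tuples indexed by {1..2k+2}. *)

definition stokes_space ::
  "nat \<Rightarrow> (nat \<Rightarrow> 'n::{finite,wellorder} cmat) set" where
  "stokes_space k =
     {S \<in> PiE {1..2 * k + 2} unipotent_at. desc_prod S 1 (2 * k + 2) \<in> diagonal_SL}"

definition monodromy_map ::
  "nat \<Rightarrow> 'n cmat \<Rightarrow> 'n cvec \<Rightarrow> (complex \<Rightarrow> 'n cmat)
   \<Rightarrow> nat \<Rightarrow> 'n::{finite,wellorder} cmat" where
  "monodromy_map k f0 lam A = restrict
     (\<lambda>i. matrix_inv (stokes_perm k f0 lam)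
            ** stokes_matrix k f0 lam (assoc_matrix k A) i ** stokes_perm k f0 lam)
     {1..2 * k + 2}"

subsection \<open>Holomorphic immersions\<close>

definition has_holomorphic_derivative ::
  "(complex^'m \<Rightarrow> complex) \<Rightarrow> (complex^'m \<Rightarrow> complex) \<Rightarrow> complex^'m \<Rightarrow> bool" where
  "has_holomorphic_derivative f D c \<longleftrightarrow>
     (f has_derivative D) (at c) \<and> Vector_Spaces.linear (*s) (*) D"

(* A holomorphic immersion of C^m into an embedded complex submanifold X of the vector space of
   I-indexed tuples of matrices (I finite): f takes values in X, is holomorphic, and has an
   injective differential at every point.  For embedded X, holomorphy and injectivity of the
   differential may be tested in the ambient space, because a map into X is holomorphic iff it is
   so as a map to the ambient space, and the tangent spaces of X embed in the ambient space.
   The set stokes_space k is such a submanifold: eliminating the last two factors via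
   S_{2k} ... S_1 = inverse S_{2k+1} ** inverse S_{2k+2} ** t with t in T exhibits it as the graph
   of a holomorphic map on the open set of those (S_1, ..., S_{2k}) whose product S_{2k} ... S_1
   lies in the big cell U_+ U_- T. *)

definition holomorphic_immersion_into ::
  "'i set \<Rightarrow> (complex^'m \<Rightarrow> 'i \<Rightarrow> 'n::finite cmat) \<Rightarrow> ('i \<Rightarrow> 'n cmat) set \<Rightarrow> bool" where
  "holomorphic_immersion_into I f X \<longleftrightarrow> range f \<subseteq> X \<and>
     (\<forall>c. \<exists>D :: complex^'m \<Rightarrow> 'i \<Rightarrow> 'n cmat.
        (\<forall>i\<in>I. \<forall>a b. has_holomorphic_derivative (\<lambda>x. f x i $ a $ b) (\<lambda>v. D v i $ a $ b) c) \<and>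
        (\<forall>v. (\<forall>i\<in>I. D v i = 0) \<longrightarrow> v = 0))"

subsection \<open>The coordinates parametrise the space of opers\<close>

lemma bij_betw_pos: "bij_betw (pos :: 'a::{finite,wellorder} \<Rightarrow> nat) UNIV {..<CARD('a)}"
proof -
  have lt: "pos i < pos j" if "i < j" for i j :: 'a
    unfolding pos_def using that by (intro psubset_card_mono) auto
  have inj: "inj (pos :: 'a \<Rightarrow> nat)"
    by (rule injI) (metis lt less_irrefl neqE)
  have "pos i < CARD('a)" for i :: 'a
    unfolding pos_def by (intro psubset_card_mono) auto
  hence "range (pos :: 'a \<Rightarrow> nat) = {..<CARD('a)}"
    using inj by (intro card_subset_eq) (auto simp: card_image)
  thus ?thesis using inj by (simp add: bij_betw_def)
qed

lemma oper_matrix_inj: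
  assumes "CARD('n::{finite,wellorder}) \<ge> 2"
    and "(oper_matrix p :: complex \<Rightarrow> 'n cmat) = oper_matrix q"
  shows "p = q"
proof -
  obtain i j :: 'n where "pos i = CARD('n) - 1" "pos j = 0"
    using bij_betw_pos[where 'a='n] assms(1) unfolding bij_betw_def
    by (metis diff_less imageE lessThan_iff less_numeral_extra(1) zero_less_card_finite)
  hence "poly p z = poly q z" for z
    using arg_cong[OF fun_cong[OF assms(2), of z], of "\<lambda>M. M $ i $ j"]
    by (simp add: oper_matrix_def)
  thus ?thesis by (simp add: poly_eq_poly_eq_iff[symmetric] fun_eq_iff)
qed

lemma bij_betw_oper_of_coeffs:
  assumes n: "CARD('n::{finite,wellorder}) \<ge> 2" and k: "k \<ge> 1"
    and m: "CARD('m::{finite,wellorder}) = k * CARD('n) - 1"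
  shows "bij_betw (oper_of_coeffs k :: 'm cvec \<Rightarrow> complex \<Rightarrow> 'n cmat)
           UNIV (cyclic_opers k)"
proof -
  define d where "d = k * CARD('n)"
  define pp where "pp = (\<lambda>c :: 'm cvec. monom 1 d + (\<Sum>j\<in>UNIV. monom (c $ j) (pos j)))"
  have bij: "bij_betw (pos :: 'm \<Rightarrow> nat) UNIV {..<d - 1}"
    using bij_betw_pos[where 'a='m] m by (simp add: d_def)
  have d2: "d \<ge> 2" unfolding d_def using n k
    by (metis mult_le_mono nat_mult_1)
  have pos_less: "pos (j::'m) < d - 1" for j using bij by (auto simp: bij_betw_def)
  have inj: "pos (i::'m) = pos j \<longleftrightarrow> i = j" for i j using bij by (auto simp: bij_betw_def inj_def)
  have coeff_pos: "coeff (pp c) (pos j) = c $ j" for c j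
    using pos_less[of j] by (simp add: pp_def coeff_sum inj)
  have coeff_hi: "coeff (pp c) e = (if e = d then 1 else 0)" if "e \<ge> d - 1" for c e
  proof -
    have "pos j \<noteq> e" for j :: 'm using pos_less[of j] that by simp
    thus ?thesis by (simp add: pp_def coeff_sum)
  qed
  have deg: "degree (pp c) = d" for c
    using d2 by (intro antisym degree_le le_degree) (auto simp: coeff_hi)
  have "inj pp"
    by (rule injI) (metis coeff_pos vec_eq_iff)
  have surj: "p \<in> range pp" if p: "degree p = d" "lead_coeff p = 1" "coeff p (d - 1) = 0" for p
  proof -
    have "p = pp (\<chi> j. coeff p (pos j))"
    proof (rule poly_eqI)
      fix e show "coeff p e = coeff (pp (\<chi> j. coeff p (pos j))) e"
      proof (cases "e < d - 1")
        case True
        then obtain j :: 'm where "e = pos j" using bij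
          by (metis bij_betw_imp_surj_on imageE lessThan_iff)
        thus ?thesis by (simp add: coeff_pos)
      next
        case False
        hence "e = d - 1 \<or> e = d \<or> e > d" by linarith
        thus ?thesis using False p d2 by (auto simp: coeff_hi coeff_eq_0)
      qed
    qed
    thus ?thesis by blast
  qed
  have eq: "oper_of_coeffs k = (\<lambda>c::'m cvec. oper_matrix (pp c) :: complex \<Rightarrow> 'n cmat)"
    by (simp add: oper_of_coeffs_def pp_def d_def fun_eq_iff)
  have "{p. degree p = d \<and> lead_coeff p = 1 \<and> coeff p (d - 1) = 0} = range pp"
    using surj d2 by (auto simp: deg coeff_hi)
  moreover have "cyclic_opers k = (oper_matrix :: _ \<Rightarrow> complex \<Rightarrow> 'n cmat) `
      {p. degree p = d \<and> lead_coeff p = 1 \<and> coeff p (d - 1) = 0}"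
    unfolding cyclic_opers_def d_def by blast
  moreover have "inj (\<lambda>c. oper_matrix (pp c) :: complex \<Rightarrow> 'n cmat)"
    by (rule injI) (drule oper_matrix_inj[OF n], erule injD[OF \<open>inj pp\<close>])
  ultimately show ?thesis unfolding eq bij_betw_def by auto
qed

end

theory Submission
  imports Defs
begin

text \<open>
  A canonical solution is \<open>\<Phi> = g \<Psi> Z\<close>, where \<open>\<Psi>\<close> is an entire fundamental matrix of the oper,
  \<open>g\<close> is the gauge transformation and \<open>Z\<close> depends only on the oper.  It is constructed by
  solving Volterra equations along rays, starting from a truncation of the formal solution; all
  estimates are locally uniform in the coefficients of the oper, hence \<open>Z\<close> is holomorphic in them.
  The Stokes matrices are \<open>S\<^sub>i = Z\<^sub>i\<^sup>-\<^sup>1 Z\<^sub>i\<^sub>-\<^sub>1\<close>.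

  If a tangent vector kills all the \<open>S\<^sub>i\<close>, then the logarithmic derivatives of the \<open>Z\<^sub>i\<close> in its
  direction coincide, so the logarithmic derivatives of the \<open>\<Psi> Z\<^sub>i\<close> are one entire matrix \<open>N\<close> with
  \<open>N' = [A, N] + q E\<close>, where \<open>q\<close> is the variation of the polynomial of the oper.  Since the two leading
  coefficients of the exponent are constant, \<open>g N g\<^sup>-\<^sup>1 = o(z\<^sup>k)\<close> in all sectors, and Liouville's theorem
  makes \<open>N\<close> lower triangular.  The differential equation then forces \<open>q = 0\<close>.
\<close>

text \<open>The formal data, the canonical solutions and the Stokes factors are given by unique
  description, so each must be shown to exist and to be unique before anything can be
  differentiated. One fact serves all these purposes: the constant matrix M relating two solutions
  with the same expansion turns, after normalisation, into M_ab exp (E_a - E_b), and every open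
  half-plane of z^(k+1) centred at a direction that is not anti-Stokes contains, for each ordered
  pair a, b, a ray on which this exponential does not decay. It also glues solutions that were built
  for one accuracy, one ball of parameters and one sector. The coordinate v = z^(k+1) exp (- i eta)
  makes the leading exponents linear. Rays of growth are then straight lines, and cones that nearly
  fill a half-plane are stable under translation along them. The growth of N is controlled without
  estimating an equation for the varied solutions: the bounds for the solutions are uniform in the
  parameters, and Cauchy's inequality along a complex line of parameters passes them on to the
  derivative.\<close>

subsection \<open>Holomorphic functions of several variables\<close>

definition holo_on :: "((complex^'m) \<times> complex) set \<Rightarrow> ((complex^'m) \<times> complex \<Rightarrow> complex) \<Rightarrow> bool" where
  "holo_on S f \<longleftrightarrow> continuous_on S f \<and>
     (\<forall>U g. open U \<and> (\<forall>i. (\<lambda>t. fst (g t) $ i) holomorphic_on U) \<and> (\<lambda>t. snd (g t)) holomorphic_on U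
        \<and> g ` U \<subseteq> S \<longrightarrow> (\<lambda>t. f (g t)) holomorphic_on U)"

lemma holo_on_continuous: "holo_on S f \<Longrightarrow> continuous_on S f"
  by (simp add: holo_on_def)

lemma holo_onD:
  assumes "holo_on S f" "open U" "\<And>i. (\<lambda>t. fst (g t) $ i) holomorphic_on U"
    "(\<lambda>t. snd (g t)) holomorphic_on U" "g ` U \<subseteq> S"
  shows "(\<lambda>t. f (g t)) holomorphic_on U"
  using assms by (auto simp: holo_on_def)

lemma holo_onI:
  assumes "continuous_on S f"
    and "\<And>U g. \<lbrakk>open U; \<And>i. (\<lambda>t. fst (g t) $ i) holomorphic_on U;
      (\<lambda>t. snd (g t)) holomorphic_on U; g ` U \<subseteq> S\<rbrakk> \<Longrightarrow> (\<lambda>t. f (g t)) holomorphic_on U"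
  shows "holo_on S f"
  using assms by (auto simp: holo_on_def)

lemma holo_on_cong:
  assumes "\<And>q. q \<in> S \<Longrightarrow> f q = g q"
  shows "holo_on S f \<longleftrightarrow> holo_on S g"
proof -
  have "holo_on S g" if h: "holo_on S f" and eq: "\<And>q. q \<in> S \<Longrightarrow> f q = g q" for f g
  proof (rule holo_onI)
    show "continuous_on S g" using holo_on_continuous[OF h] eq by (simp cong: continuous_on_cong)
    fix U \<gamma> assume A: "open U" "\<And>i. (\<lambda>t. fst (\<gamma> t) $ i) holomorphic_on U"
      "(\<lambda>t. snd (\<gamma> t)) holomorphic_on U" "\<gamma> ` U \<subseteq> S"
    have "(\<lambda>t. f (\<gamma> t)) holomorphic_on U" by (rule holo_onD[OF h A])
    thus "(\<lambda>t. g (\<gamma> t)) holomorphic_on U"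
      by (rule holomorphic_transform) (use A(4) eq in blast)
  qed
  from this[of f g] this[of g f] assms show ?thesis by fastforce
qed

lemma holo_on_subset: "holo_on S f \<Longrightarrow> T \<subseteq> S \<Longrightarrow> holo_on T f"
  unfolding holo_on_def by (meson continuous_on_subset order_trans)

lemma holo_on_local:
  assumes "\<And>q. q \<in> S \<Longrightarrow> \<exists>N. open N \<and> q \<in> N \<and> holo_on (S \<inter> N) f"
  shows "holo_on S f"
proof (rule holo_onI)
  show "continuous_on S f"
    unfolding continuous_on_eq_continuous_within
  proof
    fix q assume q: "q \<in> S"
    obtain N where N: "open N" "q \<in> N" "holo_on (S \<inter> N) f" using assms[OF q] by blast
    have "continuous (at q within S \<inter> N) f"
      using holo_on_continuous[OF N(3)] q N by (simp add: continuous_on_eq_continuous_within)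
    moreover have "at q within S \<inter> N = at q within S"
      using N by (intro at_within_nhd[of _ N]) auto
    ultimately show "continuous (at q within S) f" by simp
  qed
  fix U g assume A: "open U" "\<And>i. (\<lambda>t. fst (g t) $ i) holomorphic_on U"
      "(\<lambda>t. snd (g t)) holomorphic_on U" "g ` U \<subseteq> S"
  have contg: "continuous_on U g"
  proof -
    have "continuous_on U (\<lambda>t. (\<chi> i. fst (g t) $ i))"
      by (intro continuous_on_vec_lambda holomorphic_on_imp_continuous_on A)
    moreover have "continuous_on U (\<lambda>t. snd (g t))" by (intro holomorphic_on_imp_continuous_on A)
    ultimately have "continuous_on U (\<lambda>t. (fst (g t), snd (g t)))"
      by (intro continuous_on_Pair) simp_all
    thus ?thesis by simp
  qed
  have "(\<lambda>t. f (g t)) field_differentiable (at t)" if t: "t \<in> U" for t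
  proof -
    obtain N where N: "open N" "g t \<in> N" "holo_on (S \<inter> N) f" using assms A(4) t by blast
    define V where "V = U \<inter> g -` N"
    have V: "open V" "t \<in> V" "V \<subseteq> U"
      unfolding V_def using contg A(1) N t by (auto intro: continuous_open_preimage)
    have "(\<lambda>t. f (g t)) holomorphic_on V"
      by (rule holo_onD[OF N(3) V(1)])
        (use A V in \<open>auto intro: holomorphic_on_subset simp: V_def\<close>)
    thus ?thesis using V by (simp add: holomorphic_on_imp_differentiable_at)
  qed
  thus "(\<lambda>t. f (g t)) holomorphic_on U"
    by (simp add: holomorphic_on_def field_differentiable_at_within)
qed

named_theorems holo_intros

lemma holo_on_const [holo_intros]: "holo_on S (\<lambda>q. a)"
  by (rule holo_onI) auto

lemma holo_on_fst [holo_intros]: "holo_on S (\<lambda>q. fst q $ i)"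
  by (rule holo_onI) (auto intro!: continuous_intros)

lemma holo_on_snd [holo_intros]: "holo_on S (\<lambda>q. snd q)"
  by (rule holo_onI) (auto intro!: continuous_intros)

lemma holo_on_compose:
  assumes f: "holo_on S f" and g: "g holomorphic_on T" and sub: "\<And>q. q \<in> S \<Longrightarrow> f q \<in> T"
  shows "holo_on S (\<lambda>q. g (f q))"
proof (rule holo_onI)
  show "continuous_on S (\<lambda>q. g (f q))"
    by (rule continuous_on_compose2[OF holomorphic_on_imp_continuous_on[OF g] holo_on_continuous[OF f]])
      (use sub in auto)
  fix U \<gamma> assume A: "open U" "\<And>i. (\<lambda>t. fst (\<gamma> t) $ i) holomorphic_on U"
      "(\<lambda>t. snd (\<gamma> t)) holomorphic_on U" "\<gamma> ` U \<subseteq> S"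
  show "(\<lambda>t. g (f (\<gamma> t))) holomorphic_on U"
    by (rule holomorphic_on_compose_gen[OF holo_onD[OF f A] g, unfolded o_def])
      (use sub A(4) in blast)
qed

text \<open>Substitution in the last variable with the parameters kept. With a constant substitution
  it yields functions of the parameters alone, which is how connection matrices are shown to be
  holomorphic.\<close>

lemma holo_on_reparam:
  assumes f: "holo_on T f" and h: "holo_on S \<phi>" and sub: "\<And>q. q \<in> S \<Longrightarrow> (fst q, \<phi> q) \<in> T"
  shows "holo_on S (\<lambda>q. f (fst q, \<phi> q))"
proof (rule holo_onI)
  have "continuous_on S (\<lambda>q. (fst q, \<phi> q))"
    by (intro continuous_on_Pair continuous_intros holo_on_continuous[OF h])
  thus "continuous_on S (\<lambda>q. f (fst q, \<phi> q))"
    by (rule continuous_on_compose2[OF holo_on_continuous[OF f]]) (use sub in auto)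
  fix U \<gamma> assume A: "open U" "\<And>i. (\<lambda>t. fst (\<gamma> t) $ i) holomorphic_on U"
      "(\<lambda>t. snd (\<gamma> t)) holomorphic_on U" "\<gamma> ` U \<subseteq> S"
  show "(\<lambda>t. f (fst (\<gamma> t), \<phi> (\<gamma> t))) holomorphic_on U"
  proof (rule holo_onD[OF f A(1), of "\<lambda>t. (fst (\<gamma> t), \<phi> (\<gamma> t))", unfolded fst_conv snd_conv])
    show "(\<lambda>t. (fst (\<gamma> t), \<phi> (\<gamma> t))) ` U \<subseteq> T" using sub A(4) by blast
  qed (rule A holo_onD[OF h A])+
qed

lemma holo_on_add [holo_intros]: "holo_on S f \<Longrightarrow> holo_on S g \<Longrightarrow> holo_on S (\<lambda>q. f q + g q)"
  and holo_on_diff [holo_intros]: "holo_on S f \<Longrightarrow> holo_on S g \<Longrightarrow> holo_on S (\<lambda>q. f q - g q)"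
  and holo_on_mult [holo_intros]: "holo_on S f \<Longrightarrow> holo_on S g \<Longrightarrow> holo_on S (\<lambda>q. f q * g q)"
  and holo_on_minus [holo_intros]: "holo_on S f \<Longrightarrow> holo_on S (\<lambda>q. - f q)"
  and holo_on_power [holo_intros]: "holo_on S f \<Longrightarrow> holo_on S (\<lambda>q. f q ^ n)"
  unfolding holo_on_def by (auto intro!: continuous_intros holomorphic_intros)

lemma holo_on_divide [holo_intros]:
  assumes "holo_on S f" "holo_on S g" "\<And>q. q \<in> S \<Longrightarrow> g q \<noteq> 0"
  shows "holo_on S (\<lambda>q. f q / g q)"
proof -
  have "holo_on S (\<lambda>q. inverse (g q))"
    by (rule holo_on_compose[OF assms(2), of inverse "-{0}"])
      (use assms(3) in \<open>auto intro!: holomorphic_intros\<close>)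
  with assms(1) show ?thesis unfolding divide_inverse by (intro holo_intros)
qed

lemma holo_on_exp [holo_intros]: "holo_on S f \<Longrightarrow> holo_on S (\<lambda>q. exp (f q))"
  by (rule holo_on_compose[where T=UNIV]) (auto intro: holomorphic_intros)

lemma holo_on_sum [holo_intros]:
  "(\<And>i. i \<in> I \<Longrightarrow> holo_on S (f i)) \<Longrightarrow> holo_on S (\<lambda>q. \<Sum>i\<in>I. f i q)"
  by (induction I rule: infinite_finite_induct) (auto intro: holo_intros)

lemma holo_on_prod [holo_intros]:
  "(\<And>i. i \<in> I \<Longrightarrow> holo_on S (f i)) \<Longrightarrow> holo_on S (\<lambda>q. \<Prod>i\<in>I. f i q)"
  by (induction I rule: infinite_finite_induct) (auto intro: holo_intros)

lemma holo_on_if [holo_intros]: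
  "holo_on S f \<Longrightarrow> holo_on S g \<Longrightarrow> holo_on S (\<lambda>q. if b then f q else g q)"
  by (cases b) simp_all

section \<open>Slices, uniform limits and integrals of holomorphic families\<close>

lemma holo_on_slice:
  assumes "holo_on S f" "open U" "\<And>v. v \<in> U \<Longrightarrow> (c, v) \<in> S"
  shows "(\<lambda>v. f (c, v)) holomorphic_on U"
  by (rule holo_onD[OF assms(1,2), of "\<lambda>v. (c, v)"]) (use assms(3) in \<open>auto intro: holomorphic_intros\<close>)

lemma holo_on_line:
  assumes "holo_on S f" "open U" "\<And>t. t \<in> U \<Longrightarrow> (a + t *s b, v) \<in> S"
  shows "(\<lambda>t. f (a + t *s b, v)) holomorphic_on U"
  by (rule holo_onD[OF assms(1,2), of "\<lambda>t. (a + t *s b, v)"])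
     (use assms(3) in \<open>auto intro!: holomorphic_intros\<close>)

lemma holo_on_uniform_limit:
  assumes f: "\<And>n. holo_on S (f n)" and lim: "uniform_limit S f g sequentially"
  shows "holo_on S g"
proof (rule holo_onI)
  show "continuous_on S g"
    by (rule uniform_limit_theorem[OF _ lim]) (auto simp: holo_on_continuous[OF f])
  fix U \<gamma> assume A: "open U" "\<And>i. (\<lambda>t. fst (\<gamma> t) $ i) holomorphic_on U"
      "(\<lambda>t. snd (\<gamma> t)) holomorphic_on U" "\<gamma> ` U \<subseteq> S"
  show "(\<lambda>t. g (\<gamma> t)) holomorphic_on U"
  proof (rule holomorphic_uniform_sequence[OF A(1), of "\<lambda>n t. f n (\<gamma> t)"])
    show "(\<lambda>t. f n (\<gamma> t)) holomorphic_on U" for n by (rule holo_onD[OF f A])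
    fix x assume "x \<in> U"
    then obtain d where d: "d > 0" "cball x d \<subseteq> U" using A(1) open_contains_cball by blast
    have "uniform_limit U (\<lambda>n t. f n (\<gamma> t)) (\<lambda>t. g (\<gamma> t)) sequentially"
      using lim A(4) unfolding uniform_limit_iff by (smt (verit) eventually_mono image_subset_iff)
    thus "\<exists>d>0. cball x d \<subseteq> U \<and> uniform_limit (cball x d) (\<lambda>n t. f n (\<gamma> t)) (\<lambda>t. g (\<gamma> t)) sequentially"
      using d uniform_limit_on_subset by blast
  qed
qed

text \<open>Differentiation under the integral sign asks for a jointly continuous derivative, while
  only \<open>f\<close> itself is jointly continuous by assumption. Cauchy's formula on a circle
  around the point expresses the derivative through values of \<open>f\<close> and so supplies its
  continuity.\<close>

lemma holomorphic_on_integral_param: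
  fixes f :: "complex \<Rightarrow> real \<Rightarrow> complex"
  assumes U: "open U" and cont: "continuous_on (U \<times> {a..b}) (\<lambda>(z, t). f z t)"
    and hol: "\<And>t. t \<in> {a..b} \<Longrightarrow> (\<lambda>z. f z t) holomorphic_on U"
  shows "(\<lambda>z. integral {a..b} (f z)) holomorphic_on U"
proof -
  have "(\<lambda>z. integral {a..b} (f z)) field_differentiable (at z0)" if z0: "z0 \<in> U" for z0
  proof -
    obtain r where r: "r > 0" "cball z0 r \<subseteq> U" using z0 U open_contains_cball by blast
    define g where "g = circlepath z0 r"
    define fx where "fx = (\<lambda>z t. 1 / (2 * of_real pi * \<i>) * contour_integral g (\<lambda>u. f u t / (u - z)^2))"
    have der: "((\<lambda>z. f z t) has_field_derivative fx z t) (at z)" if "z \<in> ball z0 r" "t \<in> {a..b}" for z t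
      unfolding fx_def g_def
      by (rule Cauchy_derivative_integral_circlepath(2))
        (use hol[OF that(2)] r that in \<open>auto intro: holomorphic_on_subset continuous_on_subset
            holomorphic_on_imp_continuous_on dest: subsetD[OF ball_subset_cball]\<close>)
    have gimg: "g s \<in> U" "dist z0 (g s) = r" for s
    proof -
      show "dist z0 (g s) = r" using r by (simp add: g_def circlepath dist_norm norm_mult)
      thus "g s \<in> U" using r by auto
    qed
    have contg: "continuous_on A g" for A
      unfolding g_def circlepath by (intro continuous_intros)
    have vd: "vector_derivative g (at s) = 2 * of_real pi * \<i> * of_real r * exp (2 * of_real pi * \<i> * of_real s)" for s
      unfolding g_def by (simp add: vector_derivative_circlepath)
    have "continuous_on ((ball z0 r \<times> {a..b}) \<times> cbox 0 1)
       (\<lambda>(q, s). f (g s) (snd q) / (g s - fst q)^2 * (2 * of_real pi * \<i> * of_real r * exp (2 * of_real pi * \<i> * of_real s)))"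
    proof -
      have "continuous_on ((ball z0 r \<times> {a..b}) \<times> cbox (0::real) 1) (\<lambda>p. (\<lambda>(z, t). f z t) (g (snd p), snd (fst p)))"
        by (rule continuous_on_compose2[OF cont]) (use gimg in \<open>auto intro!: continuous_intros continuous_on_compose2[OF contg[of UNIV]]\<close>)
      moreover have "g s - z \<noteq> 0" if "z \<in> ball z0 r" for s z using gimg(2)[of s] that by auto
      ultimately show ?thesis
        unfolding case_prod_beta
        by (intro continuous_intros continuous_on_compose2[OF contg[of UNIV]]) auto
    qed
    from integral_continuous_on_param[OF this]
    have "continuous_on (ball z0 r \<times> {a..b}) (\<lambda>q. contour_integral g (\<lambda>u. f u (snd q) / (u - fst q)^2))"
      by (simp add: contour_integral_integral vd box_real)
    hence "continuous_on (ball z0 r \<times> {a..b}) (\<lambda>(z, t). fx z t)"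
      unfolding fx_def split_beta by (intro continuous_intros)
    moreover have "f z integrable_on {a..b}" if "z \<in> ball z0 r" for z
    proof -
      have "z \<in> U" using that r by auto
      hence "continuous_on {a..b} (\<lambda>t. (\<lambda>(z, t). f z t) (z, t))"
        by (intro continuous_on_compose2[OF cont]) (auto intro!: continuous_intros)
      thus ?thesis by (simp add: integrable_continuous_real)
    qed
    ultimately have "(\<lambda>z. integral (cbox a b) (f z)) holomorphic_on ball z0 r"
      by (intro leibniz_rule_holomorphic[where fx=fx] has_field_derivative_at_within[OF der]) auto
    thus ?thesis using r by (simp add: holomorphic_on_imp_differentiable_at)
  qed
  thus ?thesis by (simp add: holomorphic_on_def field_differentiable_at_within)
qed

lemma holo_on_integral:
  fixes a b :: real
  assumes cont: "continuous_on (S \<times> {a..b}) (\<lambda>(q, t). f q t)"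
    and hol: "\<And>t. t \<in> {a..b} \<Longrightarrow> holo_on S (\<lambda>q. f q t)"
  shows "holo_on S (\<lambda>q. integral {a..b} (f q))"
proof (rule holo_onI)
  show "continuous_on S (\<lambda>q. integral {a..b} (f q))"
    using integral_continuous_on_param[of S a b f] cont by (simp add: box_real)
  fix U \<gamma> assume A: "open U" "\<And>i. (\<lambda>t. fst (\<gamma> t) $ i) holomorphic_on U"
      "(\<lambda>t. snd (\<gamma> t)) holomorphic_on U" "\<gamma> ` U \<subseteq> S"
  have contg: "continuous_on U \<gamma>"
  proof -
    have "continuous_on U (\<lambda>t. (\<chi> i. fst (\<gamma> t) $ i))"
      by (intro continuous_on_vec_lambda holomorphic_on_imp_continuous_on A)
    moreover have "continuous_on U (\<lambda>t. snd (\<gamma> t))" by (intro holomorphic_on_imp_continuous_on A)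
    ultimately have "continuous_on U (\<lambda>t. (fst (\<gamma> t), snd (\<gamma> t)))"
      by (intro continuous_on_Pair) simp_all
    thus ?thesis by simp
  qed
  show "(\<lambda>t. integral {a..b} (f (\<gamma> t))) holomorphic_on U"
  proof (rule holomorphic_on_integral_param[OF A(1)])
    have "continuous_on (U \<times> {a..b}) (\<lambda>p. (\<lambda>(q, t). f q t) (\<gamma> (fst p), snd p))"
      by (rule continuous_on_compose2[OF cont])
        (use A(4) in \<open>auto intro!: continuous_intros continuous_on_compose2[OF contg]\<close>)
    thus "continuous_on (U \<times> {a..b}) (\<lambda>(z, t). f (\<gamma> z) t)" by (simp add: split_beta)
    show "(\<lambda>z. f (\<gamma> z) t) holomorphic_on U" if "t \<in> {a..b}" for t by (rule holo_onD[OF hol[OF that] A])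
  qed
qed

section \<open>Determinants and inverses of holomorphic matrices\<close>

lemma holo_on_det:
  fixes M :: "(complex^'m) \<times> complex \<Rightarrow> complex^'n^'n"
  assumes "\<And>i j. holo_on S (\<lambda>q. M q $ i $ j)"
  shows "holo_on S (\<lambda>q. det (M q))"
  unfolding det_def by (intro holo_intros assms)

lemma matrix_inv_mult:
  fixes A :: "'a::semiring_1^'n^'n"
  assumes "invertible A"
  shows matrix_inv_mult_right: "A ** matrix_inv A = mat 1"
    and matrix_inv_mult_left: "matrix_inv A ** A = mat 1"
  using someI_ex[OF assms[unfolded invertible_def]] by (simp_all add: matrix_inv_def)

text \<open>Makes the entries of the inverse rational in the entries of A, so that holomorphy and
  limits pass to the inverse.\<close>

lemma matrix_inv_cramer:
  fixes A :: "complex^'n^'n"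
  assumes "det A \<noteq> 0"
  shows "matrix_inv A $ i $ j = det (\<chi> a b. if b = i then (if a = j then 1 else 0) else A $ a $ b) / det A"
proof -
  have inv: "invertible A" using assms by (simp add: invertible_det_nz)
  have "A ** matrix_inv A = mat 1" using inv by (rule matrix_inv_mult_right)
  hence "A *v (matrix_inv A *v axis j 1) = axis j 1" by (simp add: matrix_vector_mul_assoc)
  hence "matrix_inv A *v axis j 1 = (\<chi> k. det (\<chi> a b. if b = k then axis j 1 $ a else A $ a $ b) / det A)"
    using cramer[OF assms] by blast
  moreover have "(matrix_inv A *v axis j 1) $ i = matrix_inv A $ i $ j"
    by (simp add: matrix_vector_mult_def axis_def if_distrib cong: if_cong)
  moreover have "axis j 1 $ a = (if a = j then 1 else 0 :: complex)" for a by (simp add: axis_def)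
  ultimately show ?thesis by (simp only: vec_lambda_beta)
qed

lemma holo_on_matrix_inv:
  fixes M :: "(complex^'m) \<times> complex \<Rightarrow> complex^'n^'n"
  assumes "\<And>i j. holo_on S (\<lambda>q. M q $ i $ j)" and nz: "\<And>q. q \<in> S \<Longrightarrow> det (M q) \<noteq> 0"
  shows "holo_on S (\<lambda>q. matrix_inv (M q) $ i $ j)"
proof -
  have "holo_on S (\<lambda>q. det (\<chi> a b. if b = i then (if a = j then 1 else 0) else M q $ a $ b) / det (M q))"
    by (intro holo_intros holo_on_det assms nz) (auto intro!: holo_intros assms)
  thus ?thesis
    by (subst holo_on_cong[where g="\<lambda>q. det (\<chi> a b. if b = i then (if a = j then 1 else 0) else M q $ a $ b) / det (M q)"])
       (auto simp: matrix_inv_cramer nz)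
qed

lemma holo_on_matrix_mult:
  fixes M :: "(complex^'m) \<times> complex \<Rightarrow> complex^'n^'n"
  assumes "\<And>i j. holo_on S (\<lambda>q. M q $ i $ j)" "\<And>i j. holo_on S (\<lambda>q. N q $ i $ j)"
  shows "holo_on S (\<lambda>q. (M q ** N q) $ i $ j)"
  unfolding matrix_matrix_mult_def vec_lambda_beta by (intro holo_intros assms)

text \<open>Cauchy's estimate on discs of radius R/4 bounds the second derivative near 0 by 2 K /
  (R/4)^2 = 32 K / R^2. The constant is explicit because the bound must be uniform over base points
  and directions when it is applied on complex lines.\<close>

lemma holomorphic_remainder:
  assumes hol: "g holomorphic_on ball 0 R" and K: "\<And>z. z \<in> ball 0 R \<Longrightarrow> norm (g z) \<le> K"
    and t: "norm t \<le> R / 4" and R: "R > 0"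
  shows "norm (g t - g 0 - deriv g 0 * t) \<le> 32 * K * norm t ^ 2 / R\<^sup>2"
proof -
  have b: "norm ((deriv ^^ 2) g z) \<le> 2 * K / (R / 4)^2" if z: "z \<in> cball 0 (R / 4)" for z
  proof -
    have sub: "cball z (R/4) \<subseteq> ball 0 R"
    proof
      fix x assume "x \<in> cball z (R/4)"
      hence "norm (x - z) \<le> R / 4" by (simp add: dist_norm norm_minus_commute)
      moreover have "norm x \<le> norm (x - z) + norm z" using norm_triangle_ineq[of "x - z" z] by simp
      ultimately show "x \<in> ball 0 R" using z R by simp
    qed
    have "norm ((deriv ^^ 2) g z) \<le> fact 2 * K / (R / 4)^2"
    proof (rule Cauchy_inequality)
      show "g holomorphic_on ball z (R/4)" "continuous_on (cball z (R/4)) g"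
        using sub hol by (auto intro: holomorphic_on_subset[OF hol] holomorphic_on_imp_continuous_on
            dest: subsetD[OF ball_subset_cball])
      show "norm (g x) \<le> K" if "norm (z - x) = R / 4" for x
        using that sub K by (auto simp: subset_iff dist_norm)
    qed (use R in auto)
    thus ?thesis by simp
  qed
  have "norm (g t - (\<Sum>i\<le>1. (deriv ^^ i) g 0 * (t - 0) ^ i / fact i))
      \<le> 2 * K / (R/4)^2 * norm (t - 0) ^ Suc 1 / fact 1"
  proof (rule complex_Taylor[where f="\<lambda>i. (deriv ^^ i) g" and S="cball 0 (R/4)" and n=1 and w=0,
        simplified funpow_0])
    fix i and z :: complex assume z: "z \<in> cball 0 (R/4)" "i \<le> (1::nat)"
    have "(deriv ^^ i) g holomorphic_on ball 0 R" by (intro holomorphic_higher_deriv hol) auto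
    hence "((deriv ^^ i) g has_field_derivative deriv ((deriv ^^ i) g) z) (at z)"
      using z R by (intro holomorphic_derivI[of _ "ball 0 R"]) auto
    thus "((deriv ^^ i) g has_field_derivative (deriv ^^ Suc i) g z) (at z within cball 0 (R/4))"
      by (simp add: has_field_derivative_at_within)
  next
    fix z :: complex assume "z \<in> cball 0 (R/4)"
    thus "norm ((deriv ^^ Suc 1) g z) \<le> 2 * K / (R/4)^2" using b[of z] by (simp add: eval_nat_numeral)
  qed (use t R in auto)
  thus ?thesis by (simp add: power2_eq_square algebra_simps)
qed


text \<open>Holomorphy on complex lines together with a local bound gives a second order remainder
  uniform in base point and direction. Homogeneity of the directional derivative is the chain rule;
  additivity needs its continuity in the base point. With the remainder this amounts to a complex
  linear Frechet derivative.\<close>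

lemma holo_on_imp_has_holomorphic_derivative:
  fixes f :: "complex^'m \<Rightarrow> complex"
  assumes f: "holo_on UNIV (\<lambda>q. f (fst q))"
  shows "has_holomorphic_derivative f (\<lambda>v. deriv (\<lambda>t. f (x + t *s v)) 0) x"
proof -
  define dl where "dl = (\<lambda>y h. deriv (\<lambda>t. f (y + t *s h)) 0)"
  have line: "(\<lambda>t. f (y + t *s h)) holomorphic_on UNIV" for y h
    using holo_on_line[OF f, of UNIV y h] by simp
  have cont: "continuous_on UNIV f"
    using continuous_on_compose2[OF holo_on_continuous[OF f], of UNIV "\<lambda>y. (y, 0)"]
    by (simp add: continuous_on_Pair)
  have "\<exists>\<rho>>0. \<forall>y. dist y x < \<rho> \<longrightarrow> dist (f y) (f x) < 1"
    using cont unfolding continuous_on_iff by (metis UNIV_I zero_less_one)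
  then obtain \<rho> where \<rho>: "\<rho> > 0" and near: "\<And>y. dist y x < \<rho> \<Longrightarrow> dist (f y) (f x) < 1" by blast
  define K where "K = norm (f x) + 1"
  have K: "norm (f y) \<le> K" if "norm (y - x) < \<rho>" for y
    using near[of y] that norm_triangle_ineq2[of "f y" "f x"] by (simp add: K_def dist_norm)
  have smult_scaleR: "r *\<^sub>R h = of_real r *s h" for r and h :: "complex^'m"
    by (simp add: vec_eq_iff scaleR_conv_of_real[where 'a=complex])
  have norm_smult: "norm (t *s h) = norm t * norm h" for t and h :: "complex^'m"
    by (simp add: norm_vec_def L2_set_def norm_mult power_mult_distrib real_sqrt_mult
        sum_distrib_left[symmetric])
  \<comment> \<open>On the line through y in direction h the function is bounded by K for |t| < R =
    rho / (2 |h|), and 32 K / R^2 = 128 K |h|^2 / rho^2.\<close>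
  have rem: "norm (f (y + h) - f y - dl y h) \<le> 128 * K / \<rho>\<^sup>2 * norm h ^ 2"
    if y: "norm (y - x) \<le> \<rho> / 2" and h: "norm h \<le> \<rho> / 8" for y h
  proof (cases "h = 0")
    case True thus ?thesis by (simp add: dl_def)
  next
    case False
    define R where "R = \<rho> / (2 * norm h)"
    have R: "R > 0" using False \<rho> by (simp add: R_def)
    have "norm (f (y + 1 *s h) - f (y + 0 *s h) - deriv (\<lambda>t. f (y + t *s h)) 0 * 1)
        \<le> 32 * K * norm (1::complex) ^ 2 / R\<^sup>2"
    proof (rule holomorphic_remainder[of "\<lambda>t. f (y + t *s h)"])
      show "(\<lambda>t. f (y + t *s h)) holomorphic_on ball 0 R" by (rule holomorphic_on_subset[OF line]) simp
      show "norm (1::complex) \<le> R / 4" using h False \<rho> by (simp add: R_def field_simps)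
      fix z :: complex assume "z \<in> ball 0 R"
      hence "norm z * norm h < \<rho> / 2" using False by (simp add: R_def field_simps)
      moreover have "norm (y + z *s h - x) \<le> norm (y - x) + norm (z *s h)"
        using norm_triangle_ineq[of "y - x" "z *s h"] by (simp add: algebra_simps)
      ultimately show "norm (f (y + z *s h)) \<le> K" using y by (intro K) (simp add: norm_smult)
    qed fact
    thus ?thesis by (simp add: dl_def R_def power2_eq_square field_simps)
  qed
  define C where "C = 128 * K / \<rho>\<^sup>2"
  have C: "C \<ge> 0" by (simp add: C_def K_def)
  have hom: "dl y (c *s h) = c * dl y h" for y c h
  proof -
    have "((\<lambda>t. f (y + t *s h)) has_field_derivative dl y h) (at (c * 0))"
      unfolding dl_def using line[of y h] by (simp add: holomorphic_derivI)
    from DERIV_chain'[OF DERIV_cmult_Id[of c] this]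
    have "((\<lambda>t. f (y + (c * t) *s h)) has_field_derivative dl y h * c) (at 0)" by simp
    thus ?thesis unfolding dl_def
      by (intro DERIV_imp_deriv) (simp add: vector_smult_assoc mult.commute dl_def)
  qed
  \<comment> \<open>By the remainder bound the difference quotients with step 1/n converge uniformly
    near x, so the directional derivative is continuous in the base point.\<close>
  have dcont: "((\<lambda>n. dl (x + z n) h) \<longlonglongrightarrow> dl x h)" if z: "z \<longlonglongrightarrow> 0" for z :: "nat \<Rightarrow> complex^'m" and h
  proof -
    have "uniform_limit (cball x (\<rho>/2)) (\<lambda>n y. of_nat n * (f (y + (1 / of_nat n) *s h) - f y)) (\<lambda>y. dl y h) sequentially"
    proof (rule uniform_limitI)
      fix e :: real assume e: "e > 0"
      obtain N where N: "real N > max 0 (max (8 * norm h / \<rho>) (C * norm h ^ 2 / e))"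
        using reals_Archimedean2 by blast
      show "\<forall>\<^sub>F n in sequentially. \<forall>y\<in>cball x (\<rho>/2). dist (of_nat n * (f (y + (1 / of_nat n) *s h) - f y)) (dl y h) < e"
      proof (rule eventually_sequentiallyI[of N], intro ballI)
        fix n y assume n: "N \<le> n" and y: "y \<in> cball x (\<rho>/2)"
        have n0: "real n > 0" using N n by simp
        have n1: "real n > 8 * norm h / \<rho>" "real n > C * norm h ^ 2 / e" using N n by (auto simp: max_less_iff_conj)
        have nh: "norm ((1 / of_nat n :: complex) *s h) = norm h / n" by (simp add: norm_smult norm_divide)
        have "norm (f (y + (1 / of_nat n) *s h) - f y - dl y ((1 / of_nat n) *s h)) \<le> C * (norm h / n) ^ 2"
          unfolding C_def nh[symmetric]
          by (rule rem) (use y n1 n0 \<rho> in \<open>auto simp: dist_norm norm_minus_commute nh field_simps\<close>)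
        hence "norm (of_nat n * (f (y + (1 / of_nat n) *s h) - f y - dl y ((1 / of_nat n) *s h))) \<le> real n * (C * (norm h / n) ^ 2)"
          by (simp add: norm_mult mult_left_mono)
        also have "\<dots> = C * norm h ^ 2 / n" using n0 by (simp add: power2_eq_square)
        also have "\<dots> < e" using n1 n0 e by (simp add: field_simps)
        finally show "dist (of_nat n * (f (y + (1 / of_nat n) *s h) - f y)) (dl y h) < e"
          using n0 by (simp add: dist_norm hom algebra_simps)
      qed
    qed
    hence "continuous_on (cball x (\<rho>/2)) (\<lambda>y. dl y h)"
      by (rule uniform_limit_theorem[rotated])
        (auto intro!: always_eventually continuous_intros continuous_on_compose2[OF cont])
    hence "isCont (\<lambda>y. dl y h) x" using \<rho> by (simp add: continuous_on_interior)
    moreover have "(\<lambda>n. x + z n) \<longlonglongrightarrow> x + 0" by (intro tendsto_intros z)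
    ultimately show ?thesis using isCont_tendsto_compose[of x "\<lambda>y. dl y h" "\<lambda>n. x + z n"] by simp
  qed
  \<comment> \<open>The increment along h + h' is split at x + t h. The quotient for h' then has a
    moving base point, which is where continuity in the base point enters.\<close>
  have add: "dl x (h + h') = dl x h + dl x h'" for h h'
  proof -
    define \<tau> where "\<tau> = (\<lambda>n. 1 / of_nat (Suc n) :: complex)"
    have \<tau>0: "\<tau> \<longlonglongrightarrow> 0" unfolding \<tau>_def by (rule lim_1_over_n[THEN LIMSEQ_Suc])
    have \<tau>nz: "\<tau> n \<noteq> 0" for n unfolding \<tau>_def by (metis divide_eq_0_iff of_nat_neq_0 one_neq_zero)
    have sm: "(\<lambda>n. \<tau> n *s g) \<longlonglongrightarrow> 0" for g :: "complex^'m"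
    proof -
      have "(\<lambda>n. norm (\<tau> n) * norm g) \<longlonglongrightarrow> norm (0::complex) * norm g" by (intro tendsto_intros \<tau>0)
      thus ?thesis by (intro tendsto_norm_zero_cancel[of "\<lambda>n. \<tau> n *s g"]) (simp add: norm_smult)
    qed
    have quot: "(\<lambda>n. (f (x + z n + \<tau> n *s g) - f (x + z n)) / \<tau> n) \<longlonglongrightarrow> dl x g" if z: "z \<longlonglongrightarrow> 0" for z :: "nat \<Rightarrow> complex^'m" and g
    proof -
      have "(\<lambda>n. (f (x + z n + \<tau> n *s g) - f (x + z n)) / \<tau> n - dl (x + z n) g) \<longlonglongrightarrow> 0"
      proof (rule Lim_null_comparison)
        have "\<forall>\<^sub>F n in sequentially. norm (z n) < \<rho> / 2" "\<forall>\<^sub>F n in sequentially. norm (\<tau> n *s g) < \<rho> / 8"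
          using tendstoD[OF z, of "\<rho> / 2"] tendstoD[OF sm[of g], of "\<rho> / 8"] \<rho> by simp_all
        thus "\<forall>\<^sub>F n in sequentially. norm ((f (x + z n + \<tau> n *s g) - f (x + z n)) / \<tau> n - dl (x + z n) g)
            \<le> C * norm (\<tau> n) * norm g ^ 2"
        proof eventually_elim
          case (elim n)
          have "norm (f (x + z n + \<tau> n *s g) - f (x + z n) - dl (x + z n) (\<tau> n *s g)) \<le> C * norm (\<tau> n *s g) ^ 2"
            unfolding C_def by (rule rem) (use elim in auto)
          hence "norm (f (x + z n + \<tau> n *s g) - f (x + z n) - \<tau> n * dl (x + z n) g) / norm (\<tau> n) \<le> C * norm (\<tau> n *s g) ^ 2 / norm (\<tau> n)"
            by (simp add: hom divide_right_mono)
          also have "\<dots> = C * norm (\<tau> n) * norm g ^ 2" using \<tau>nz[of n] by (simp add: norm_smult power2_eq_square)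
          finally show ?case using \<tau>nz[of n] by (simp add: norm_divide[symmetric] diff_divide_distrib)
        qed
        show "(\<lambda>n. C * norm (\<tau> n) * norm g ^ 2) \<longlonglongrightarrow> 0"
          using tendsto_mult[OF tendsto_mult[OF tendsto_const[of C] tendsto_norm[OF \<tau>0]] tendsto_const[of "norm g ^ 2"]] by simp
      qed
      from tendsto_add[OF this dcont[OF z, of g]] show ?thesis by simp
    qed
    have "(\<lambda>n. (f (x + \<tau> n *s h + \<tau> n *s h') - f (x + \<tau> n *s h)) / \<tau> n + (f (x + 0 + \<tau> n *s h) - f (x + 0)) / \<tau> n) \<longlonglongrightarrow> dl x h' + dl x h"
      by (intro tendsto_add quot sm) auto
    moreover have "(\<lambda>n. (f (x + 0 + \<tau> n *s (h + h')) - f (x + 0)) / \<tau> n) \<longlonglongrightarrow> dl x (h + h')"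
      by (intro quot) auto
    ultimately show ?thesis
      by (auto simp: vector_add_ldistrib add.assoc diff_divide_distrib dest: LIMSEQ_unique)
  qed
  have scale: "dl x (r *\<^sub>R h) = r *\<^sub>R dl x h" for r h
    unfolding smult_scaleR hom by (simp add: scaleR_conv_of_real)
  have "linear (dl x)" by (intro linearI add scale)
  hence bl: "bounded_linear (dl x)" by (simp add: linear_conv_bounded_linear)
  have "(f has_derivative dl x) (at x)"
  proof (rule has_derivativeI[OF bl])
    show "((\<lambda>y. ((f y - f x) - dl x (y - x)) /\<^sub>R norm (y - x)) \<longlongrightarrow> 0) (at x)"
    proof (rule Lim_null_comparison)
      have "\<forall>\<^sub>F y in at x. dist y x < \<rho> / 8" unfolding eventually_at using \<rho> by (intro exI[of _ "\<rho> / 8"]) auto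
      thus "\<forall>\<^sub>F y in at x. norm (((f y - f x) - dl x (y - x)) /\<^sub>R norm (y - x)) \<le> C * norm (y - x)"
      proof eventually_elim
        case (elim y)
        have "norm (f (x + (y - x)) - f x - dl x (y - x)) \<le> C * norm (y - x) ^ 2"
          unfolding C_def by (rule rem) (use elim \<rho> in \<open>auto simp: dist_norm\<close>)
        hence "inverse (norm (y - x)) * norm (f y - f x - dl x (y - x)) \<le> inverse (norm (y - x)) * (C * norm (y - x) ^ 2)"
          by (intro mult_left_mono) auto
        also have "\<dots> = C * norm (y - x)" by (cases "y = x") (simp_all add: power2_eq_square)
        finally show ?case by simp
      qed
      have "((\<lambda>y. C * norm (y - x)) \<longlongrightarrow> C * norm (x - x)) (at x)" by (intro tendsto_intros)
      thus "((\<lambda>y. C * norm (y - x)) \<longlongrightarrow> 0) (at x)" by simp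
    qed
  qed
  moreover have "Vector_Spaces.linear (*s) (*) (dl x)"
    by (rule Vector_Spaces.linear.intro)
      (auto simp: module_hom_axioms_def module_hom_def add hom vec.module_axioms
          vector_space_over_itself.module_axioms
        intro!: vec.vector_space_axioms vector_space_over_itself.vector_space_axioms)
  ultimately show ?thesis by (simp add: has_holomorphic_derivative_def dl_def)
qed

subsection \<open>Linear differential equations with a small perturbation\<close>

text \<open>A sector of half-opening arctan kappa with its apex at R on the real axis. It is convex
  and stable under translation by directions e with Re e = 1 and |Im e| <= kappa, along which Re v
  grows at unit speed; for large kappa it approaches a half-plane.\<close>

definition half_cone :: "real \<Rightarrow> real \<Rightarrow> complex set" where
  "half_cone \<kappa> R = {v. \<bar>Im v\<bar> < \<kappa> * (Re v - R)}"

lemma open_half_cone: "open (half_cone \<kappa> R)"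
  unfolding half_cone_def by (intro open_Collect_less continuous_intros)

lemma half_cone_Re:
  assumes "v \<in> half_cone \<kappa> R" "\<kappa> > 0"
  shows "Re v > R"
proof -
  have "0 < \<kappa> * (Re v - R)" using assms abs_ge_zero[of "Im v"] unfolding half_cone_def by auto
  thus ?thesis using assms(2) by (simp add: zero_less_mult_iff)
qed

lemma convex_half_cone: "convex (half_cone \<kappa> R)"
proof -
  have iff: "\<bar>Im v\<bar> < \<kappa> * (Re v - R) \<longleftrightarrow> Im v - \<kappa> * Re v < - (\<kappa> * R) \<and> - Im v - \<kappa> * Re v < - (\<kappa> * R)" for v
    unfolding right_diff_distrib by linarith
  have "half_cone \<kappa> R = {v. Complex (-\<kappa>) 1 \<bullet> v < - (\<kappa> * R)} \<inter> {v. Complex (-\<kappa>) (-1) \<bullet> v < - (\<kappa> * R)}"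
    unfolding half_cone_def iff by (auto simp: inner_complex_def)
  thus ?thesis by (simp add: convex_Int convex_halfspace_lt)
qed

lemma half_cone_ray:
  assumes v: "v \<in> half_cone \<kappa> R" and e: "Re e = 1" "\<bar>Im e\<bar> \<le> \<kappa>" and s: "s \<ge> 0"
  shows "v + of_real s * e \<in> half_cone \<kappa> R"
proof -
  have "\<bar>Im v + s * Im e\<bar> \<le> \<bar>Im v\<bar> + s * \<bar>Im e\<bar>" using s abs_triangle_ineq[of "Im v" "s * Im e"]
    by (simp add: abs_mult)
  also have "\<dots> \<le> \<bar>Im v\<bar> + s * \<kappa>" using e s by (simp add: mult_left_mono)
  finally show ?thesis using v e by (simp add: half_cone_def algebra_simps)
qed

lemma has_integral_inverse_power:
  fixes a :: real
  assumes "a + p > 0" "p \<le> q" "m \<ge> 1"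
  shows "((\<lambda>s. 1 / (a + s) ^ Suc m) has_integral (1 / (m * (a + p) ^ m) - 1 / (m * (a + q) ^ m))) {p..q}"
proof -
  have "((\<lambda>s. - 1 / (m * (a + s) ^ m)) has_vector_derivative 1 / (a + s) ^ Suc m) (at s within {p..q})"
    if "s \<in> {p..q}" for s
  proof -
    have "a + s > 0" using that assms by auto
    have D: "((\<lambda>y. - 1 / (m * y ^ m)) has_real_derivative 1 / y ^ Suc m) (at y)" if "y > 0" for y
    proof -
      obtain m' where "m = Suc m'" using assms(3) by (cases m) auto
      have "((\<lambda>y. y ^ m) has_real_derivative real m * y ^ m') (at y)"
        using DERIV_pow[of m y] \<open>m = Suc m'\<close> by simp
      moreover have "y ^ m \<noteq> 0" using that by simp
      ultimately have "((\<lambda>y. - 1 / m * inverse (y ^ m)) has_real_derivative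
          - 1 / m * - (inverse (y ^ m) * (real m * y ^ m') * inverse (y ^ m))) (at y)"
        by (intro DERIV_cmult DERIV_inverse')
      moreover have "- 1 / m * - (inverse (y ^ m) * (real m * y ^ m') * inverse (y ^ m)) = 1 / y ^ Suc m"
        using that assms(3) \<open>m = Suc m'\<close> by (simp add: divide_inverse del: of_nat_Suc)
      moreover have "- 1 / m * inverse (y ^ m) = - 1 / (m * y ^ m)" for y :: real
        by (simp add: divide_inverse)
      ultimately show ?thesis by (simp only:)
    qed
    have "((\<lambda>s. - 1 / (m * (a + s) ^ m)) has_real_derivative 1 / (a + s) ^ Suc m * (0 + 1)) (at s)"
      by (rule DERIV_chain'[OF DERIV_add[OF DERIV_const DERIV_ident] D]) fact
    hence "((\<lambda>s. - 1 / (m * (a + s) ^ m)) has_real_derivative 1 / (a + s) ^ Suc m) (at s)" by simp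
    thus ?thesis
      by (simp add: has_real_derivative_iff_has_vector_derivative has_vector_derivative_at_within)
  qed
  from fundamental_theorem_of_calculus[OF assms(2) this] show ?thesis by simp
qed

lemma uniform_limit_slice:
  assumes "uniform_limit (S \<times> T) f g F" "c \<in> S"
  shows "uniform_limit T (\<lambda>n u. f n (c, u)) (\<lambda>u. g (c, u)) F"
proof (rule uniform_limitI)
  fix \<epsilon> :: real assume "\<epsilon> > 0"
  from uniform_limitD[OF assms(1) this] show "\<forall>\<^sub>F n in F. \<forall>u\<in>T. dist (f n (c, u)) (g (c, u)) < \<epsilon>"
    by (rule eventually_mono) (use assms(2) in blast)
qed

text \<open>The solution of \<open>J' = d J + g\<close> obtained by integrating from infinity along the rays of
  direction \<open>e\<close>, on which \<open>exp E\<close> grows.\<close>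

lemma ray_integral_operator:
  fixes S :: "(complex^'m) set" and m :: nat and \<kappa> R :: real
  defines "DD \<equiv> S \<times> half_cone \<kappa> R"
  assumes \<kappa>: "\<kappa> > 0" and R: "R > 0" and m: "m \<ge> 1"
    and e: "Re e = 1" "\<bar>Im e\<bar> \<le> \<kappa>"
    and E: "holo_on DD E"
    and dE: "\<And>c v. c \<in> S \<Longrightarrow> v \<in> half_cone \<kappa> R \<Longrightarrow> ((\<lambda>u. E (c, u)) has_field_derivative d (c, v)) (at v)"
    and pos: "\<And>c v. c \<in> S \<Longrightarrow> v \<in> half_cone \<kappa> R \<Longrightarrow> Re (d (c, v) * e) \<ge> 0"
    and g: "holo_on DD g"
    and B: "\<And>c v. c \<in> S \<Longrightarrow> v \<in> half_cone \<kappa> R \<Longrightarrow> norm (g (c, v)) \<le> B / Re v ^ Suc m" "B \<ge> 0"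
  obtains J where "holo_on DD J"
    and "\<And>c v. c \<in> S \<Longrightarrow> v \<in> half_cone \<kappa> R \<Longrightarrow> norm (J (c, v)) \<le> B * norm e / (m * Re v ^ m)"
    and "\<And>c v. c \<in> S \<Longrightarrow> v \<in> half_cone \<kappa> R \<Longrightarrow>
           ((\<lambda>u. J (c, u)) has_field_derivative d (c, v) * J (c, v) + g (c, v)) (at v)"
proof -
  have Re_ray: "Re (v + of_real s * e) = Re v + s" for v s using e by simp
  have ray: "v + of_real s * e \<in> half_cone \<kappa> R" if "v \<in> half_cone \<kappa> R" "s \<ge> 0" for v s
    by (rule half_cone_ray[OF that(1) e that(2)])
  \<comment> \<open>The intended solution is the integral over all s > 0 of - e exp (E(v) - E(v + s
    e)) g(v + s e); this is the integrand.\<close>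
  define \<phi> where "\<phi> = (\<lambda>q s. - e * (exp (E q - E (fst q, snd q + of_real s * e)) * g (fst q, snd q + of_real s * e)))"
  \<comment> \<open>Re (d e) >= 0 says that Re E does not decrease along the ray, so the exponential
    in the integrand has norm at most 1.\<close>
  have mono: "Re (E (c, v)) \<le> Re (E (c, v + of_real s * e))" if c: "c \<in> S" and v: "v \<in> half_cone \<kappa> R" and s: "s \<ge> 0" for c v s
  proof -
    have "Re (E (c, v + of_real 0 * e)) \<le> Re (E (c, v + of_real s * e))"
    proof (rule DERIV_nonneg_imp_nondecreasing[OF s])
      fix x :: real assume x: "0 \<le> x" "x \<le> s"
      have 1: "((\<lambda>s. v + of_real s * e) has_vector_derivative e) (at x)"
        by (auto intro!: derivative_eq_intros simp: has_vector_derivative_def scaleR_conv_of_real)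
      have "((\<lambda>u. E (c, u)) has_field_derivative d (c, v + of_real x * e)) (at (v + of_real x * e))"
        by (intro dE c ray v x)
      from field_vector_diff_chain_at[OF 1 this]
      have "((\<lambda>s. E (c, v + of_real s * e)) has_vector_derivative e * d (c, v + of_real x * e)) (at x)"
        by (simp add: o_def)
      from bounded_linear.has_vector_derivative[OF bounded_linear_Re this]
      have "((\<lambda>s. Re (E (c, v + of_real s * e))) has_real_derivative Re (e * d (c, v + of_real x * e))) (at x)"
        by (simp add: has_real_derivative_iff_has_vector_derivative)
      moreover have "Re (e * d (c, v + of_real x * e)) \<ge> 0" using pos[OF c ray[OF v x(1)]] by (simp add: mult.commute)
      ultimately show "\<exists>y. ((\<lambda>s. Re (E (c, v + of_real s * e))) has_real_derivative y) (at x) \<and> 0 \<le> y" by blast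
    qed
    thus ?thesis by simp
  qed
  have nexp: "norm (exp (E (c, v) - E (c, v + of_real s * e))) \<le> 1" if "c \<in> S" "v \<in> half_cone \<kappa> R" "s \<ge> 0" for c v s
    using mono[OF that] by (simp add: norm_exp_eq_Re)
  have n\<phi>: "norm (\<phi> (c, v) s) \<le> B * norm e * (1 / (Re v + s) ^ Suc m)" if c: "c \<in> S" and v: "v \<in> half_cone \<kappa> R" and s: "s \<ge> 0" for c v s
  proof -
    have "norm (g (c, v + of_real s * e)) \<le> B / (Re v + s) ^ Suc m"
      using B(1)[OF c ray[OF v s]] by (simp only: Re_ray)
    hence "norm (exp (E (c, v) - E (c, v + of_real s * e))) * norm (g (c, v + of_real s * e)) \<le> 1 * (B / (Re v + s) ^ Suc m)"
      by (intro mult_mono nexp that) auto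
    from mult_left_mono[OF this, of "norm e"] show ?thesis
      by (simp add: \<phi>_def norm_mult mult_ac)
  qed
  define JT where "JT = (\<lambda>n q. integral {0..real n} (\<phi> q))"
  have DDc: "continuous_on (DD \<times> {0..b}) (\<lambda>p. E (fst (fst p), snd (fst p) + of_real (snd p) * e))"
    "continuous_on (DD \<times> {0..b}) (\<lambda>p. g (fst (fst p), snd (fst p) + of_real (snd p) * e))"
    "continuous_on (DD \<times> {0..b}) (\<lambda>p. E (fst p))" for b :: real
    by (rule continuous_on_compose2[OF holo_on_continuous[OF E]] continuous_on_compose2[OF holo_on_continuous[OF g]],
        (auto intro!: continuous_intros ray simp: DD_def)[2])+
  have cont\<phi>: "continuous_on (DD \<times> {0..b}) (\<lambda>(q, s). \<phi> q s)" for b :: real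
    unfolding \<phi>_def split_beta by (intro continuous_intros DDc)
  have JT: "holo_on DD (JT n)" for n
    unfolding JT_def
  proof (rule holo_on_integral[OF cont\<phi>])
    fix s assume "s \<in> {0..real n}"
    hence sub: "(fst q, snd q + of_real s * e) \<in> DD" if "q \<in> DD" for q
      using ray[of "snd q" s] that by (cases q) (simp add: DD_def)
    have rh: "holo_on DD (\<lambda>q. snd q + of_real s * e)" by (intro holo_on_add holo_on_snd holo_on_const)
    have "holo_on DD (\<lambda>q. E (fst q, snd q + of_real s * e))"
      by (rule holo_on_reparam[OF E rh sub])
    moreover have "holo_on DD (\<lambda>q. g (fst q, snd q + of_real s * e))"
      by (rule holo_on_reparam[OF g rh sub])
    ultimately show "holo_on DD (\<lambda>q. \<phi> q s)" unfolding \<phi>_def by (intro holo_intros E)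
  qed
  have \<phi>int: "\<phi> (c, v) integrable_on {a..b}" if "c \<in> S" "v \<in> half_cone \<kappa> R" "a \<ge> 0" for c v a b
  proof -
    have "continuous_on {a..b} (\<lambda>s. (\<lambda>(q, s). \<phi> q s) ((c, v), s))"
      by (rule continuous_on_compose2[OF cont\<phi>[of b]]) (use that in \<open>auto intro!: continuous_intros simp: DD_def\<close>)
    thus ?thesis by (simp add: integrable_continuous_real)
  qed
  have tail: "norm (JT n' (c, v) - JT n (c, v)) \<le> B * norm e / (m * (Re v + n) ^ m)"
    if c: "c \<in> S" and v: "v \<in> half_cone \<kappa> R" and n: "n \<le> n'" for c v n n'
  proof -
    have Rv: "Re v > 0" using half_cone_Re[OF v \<kappa>] R by simp
    have hi: "((\<lambda>s. 1 / (Re v + s) ^ Suc m) has_integral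
       (1 / (m * (Re v + n) ^ m) - 1 / (m * (Re v + n') ^ m))) {real n..real n'}"
      by (rule has_integral_inverse_power) (use Rv n m in auto)
    have "JT n' (c, v) = JT n (c, v) + integral {real n..real n'} (\<phi> (c, v))"
      unfolding JT_def using n by (intro Henstock_Kurzweil_Integration.integral_combine[symmetric] \<phi>int c v) auto
    hence "norm (JT n' (c, v) - JT n (c, v)) = norm (integral {real n..real n'} (\<phi> (c, v)))" by simp
    also have "\<dots> \<le> integral {real n..real n'} (\<lambda>s. B * norm e * (1 / (Re v + s) ^ Suc m))"
    proof (rule integral_norm_bound_integral)
      show "\<phi> (c, v) integrable_on {real n..real n'}" by (intro \<phi>int c v) simp
      show "(\<lambda>s. B * norm e * (1 / (Re v + s) ^ Suc m)) integrable_on {real n..real n'}"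
        by (rule has_integral_integrable[OF has_integral_mult_right[OF hi]])
      fix s assume "s \<in> {real n..real n'}"
      thus "norm (\<phi> (c, v) s) \<le> B * norm e * (1 / (Re v + s) ^ Suc m)" by (intro n\<phi> c v) auto
    qed
    also have "\<dots> = B * norm e * (1 / (m * (Re v + n) ^ m) - 1 / (m * (Re v + n') ^ m))"
      by (rule integral_unique) (rule has_integral_mult_right[OF hi])
    also have "\<dots> \<le> B * norm e * (1 / (m * (Re v + n) ^ m))"
      using B(2) Rv by (intro mult_left_mono) auto
    finally show ?thesis by simp
  qed
  define b where "b = (\<lambda>n. B * norm e / (m * (R + real n) ^ m))"
  have tailb: "norm (JT n' q - JT n q) \<le> b n" if q: "q \<in> DD" and n: "n \<le> n'" for q n n'
  proof -
    obtain c v where [simp]: "q = (c, v)" and c: "c \<in> S" and v: "v \<in> half_cone \<kappa> R" using q by (auto simp: DD_def)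
    have "(R + n) ^ m \<le> (Re v + n) ^ m" using half_cone_Re[OF v \<kappa>] R by (intro power_mono) auto
    hence "B * norm e / (m * (Re v + n) ^ m) \<le> b n"
      unfolding b_def using R B(2) m
      by (intro frac_le mult_left_mono mult_pos_pos zero_less_power add_pos_nonneg) auto
    thus ?thesis using tail[OF c v n] by simp
  qed
  have b0: "b \<longlonglongrightarrow> 0"
  proof -
    have "(\<lambda>n. inverse (R + real n)) \<longlonglongrightarrow> 0"
      by (intro tendsto_inverse_0_at_top filterlim_tendsto_add_at_top[OF tendsto_const] filterlim_real_sequentially)
    hence "(\<lambda>n. (B * norm e / m) * inverse (R + real n) ^ m) \<longlonglongrightarrow> (B * norm e / m) * 0 ^ m" by (intro tendsto_intros)
    thus ?thesis using m by (simp add: b_def field_simps power_0_left)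
  qed
  have "uniformly_Cauchy_on DD JT"
    unfolding uniformly_Cauchy_on_def
  proof (intro allI impI)
    fix \<epsilon> :: real assume \<epsilon>: "\<epsilon> > 0"
    obtain N where N: "\<And>n. n \<ge> N \<Longrightarrow> b n < \<epsilon>"
      using order_tendstoD(2)[OF b0 \<epsilon>] by (auto simp: eventually_sequentially)
    have "dist (JT n q) (JT n' q) < \<epsilon>" if "q \<in> DD" "n \<ge> N" "n' \<ge> N" for q n n'
      using tailb[OF that(1), of n n'] tailb[OF that(1), of n' n] N[OF that(2)] N[OF that(3)]
      by (cases "n \<le> n'") (auto simp: dist_norm norm_minus_commute)
    thus "\<exists>M. \<forall>x\<in>DD. \<forall>m\<ge>M. \<forall>n\<ge>M. dist (JT m x) (JT n x) < \<epsilon>" by blast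
  qed
  then obtain J where J: "uniform_limit DD JT J sequentially"
    using Cauchy_uniformly_convergent by (auto simp: uniformly_convergent_on_def)
  have hJ: "holo_on DD J" by (rule holo_on_uniform_limit[OF JT J])
  have lim: "(\<lambda>n. JT n (c, v)) \<longlonglongrightarrow> J (c, v)" if "c \<in> S" "v \<in> half_cone \<kappa> R" for c v
    using tendsto_uniform_limitI[OF J, of "(c, v)"] that by (simp add: DD_def)
  show thesis
  proof (rule that[OF hJ])
    fix c v assume c: "c \<in> S" and v: "v \<in> half_cone \<kappa> R"
    have "norm (JT n (c, v)) \<le> B * norm e / (m * Re v ^ m)" for n
      using tail[OF c v, of 0 n] by (simp add: JT_def)
    thus "norm (J (c, v)) \<le> B * norm e / (m * Re v ^ m)"
      by (intro LIMSEQ_le_const2[OF tendsto_norm[OF lim[OF c v]]]) auto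
  next
    fix c v assume c: "c \<in> S" and v: "v \<in> half_cone \<kappa> R"
    define G where "G = (\<lambda>u. exp (- E (c, u)) * g (c, u))"
    have Gh: "G holomorphic_on half_cone \<kappa> R"
      unfolding G_def using c
      by (intro holomorphic_intros holo_on_slice[OF E open_half_cone] holo_on_slice[OF g open_half_cone]) (auto simp: DD_def)
    \<comment> \<open>A primitive P of exp (- E) g turns the truncated integral into - exp (E(v))
      (P(v + n e) - P(v)), which can be differentiated in v directly.\<close>
    obtain P where P: "\<And>u. u \<in> half_cone \<kappa> R \<Longrightarrow> (P has_field_derivative G u) (at u within half_cone \<kappa> R)"
      using holomorphic_convex_primitive'[OF convex_half_cone open_half_cone Gh] by blast
    have P: "(P has_field_derivative G u) (at u)" if "u \<in> half_cone \<kappa> R" for u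
      using P[OF that] that by (simp add: at_within_open[OF _ open_half_cone])
    have JTP: "JT n (c, u) = - exp (E (c, u)) * (P (u + of_real n * e) - P u)" if u: "u \<in> half_cone \<kappa> R" for n u
    proof -
      have "((\<lambda>s. - exp (E (c, u)) * P (u + of_real s * e)) has_vector_derivative \<phi> (c, u) s) (at s within {0..real n})"
        if s: "s \<in> {0..real n}" for s
      proof -
        have 1: "((\<lambda>s. u + of_real s * e) has_vector_derivative e) (at s)"
          by (auto intro!: derivative_eq_intros simp: has_vector_derivative_def scaleR_conv_of_real)
        have "(P has_field_derivative G (u + of_real s * e)) (at (u + of_real s * e))" using s by (intro P ray u) auto
        from field_vector_diff_chain_at[OF 1 this]
        have "((\<lambda>s. - exp (E (c, u)) * P (u + of_real s * e)) has_vector_derivative - exp (E (c, u)) * (e * G (u + of_real s * e))) (at s)"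
          by (intro has_vector_derivative_mult_right) (simp add: o_def)
        moreover have "- exp (E (c, u)) * (e * G (u + of_real s * e)) = \<phi> (c, u) s"
          by (simp add: \<phi>_def G_def exp_diff exp_minus field_simps)
        ultimately show ?thesis by (simp add: has_vector_derivative_at_within)
      qed
      from fundamental_theorem_of_calculus[OF _ this]
      have "(\<phi> (c, u) has_integral (- exp (E (c, u)) * P (u + of_real (real n) * e) - - exp (E (c, u)) * P (u + of_real 0 * e))) {0..real n}" by auto
      from integral_unique[OF this] show ?thesis by (simp add: JT_def algebra_simps)
    qed
    \<comment> \<open>Besides d J + g the derivative of the truncated integral contains a boundary
      term at the far end v + n e. It tends to 0, since g decays there and the exponential stays
      bounded.\<close>
    have JTd: "((\<lambda>u. JT n (c, u)) has_field_derivative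
        d (c, u) * JT n (c, u) - exp (E (c, u) - E (c, u + of_real (real n) * e)) * g (c, u + of_real (real n) * e) + g (c, u)) (at u)"
      if u: "u \<in> half_cone \<kappa> R" for n u
    proof -
      have "(P has_field_derivative G (u + of_real n * e)) (at (u + of_real n * e))"
        using ray[OF u, of "real n"] by (intro P) simp
      hence 1: "((\<lambda>u. P (u + of_real n * e)) has_field_derivative G (u + of_real n * e)) (at u)"
        by (simp add: DERIV_shift)
      have "((\<lambda>u. - exp (E (c, u)) * (P (u + of_real n * e) - P u)) has_field_derivative
          - exp (E (c, u)) * d (c, u) * (P (u + of_real n * e) - P u) - exp (E (c, u)) * (G (u + of_real n * e) - G u)) (at u)"
        by (rule derivative_eq_intros 1 P[OF u] dE[OF c u] refl | simp add: algebra_simps)+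
      moreover have "- exp (E (c, u)) * d (c, u) * (P (u + of_real n * e) - P u) - exp (E (c, u)) * (G (u + of_real n * e) - G u)
         = d (c, u) * JT n (c, u) - exp (E (c, u) - E (c, u + of_real n * e)) * g (c, u + of_real n * e) + g (c, u)"
        unfolding JTP[OF u] by (simp add: G_def exp_diff exp_minus field_simps)
      ultimately have "((\<lambda>u. - exp (E (c, u)) * (P (u + of_real n * e) - P u)) has_field_derivative
         d (c, u) * JT n (c, u) - exp (E (c, u) - E (c, u + of_real n * e)) * g (c, u + of_real n * e) + g (c, u)) (at u)" by simp
      thus ?thesis
        by (rule has_field_derivative_transform_within_open[OF _ open_half_cone u]) (simp add: JTP)
    qed
    have "\<exists>g'. \<forall>x\<in>half_cone \<kappa> R. ((\<lambda>u. J (c, u)) has_field_derivative g' x) (at x) \<and>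
       (\<lambda>n. d (c, x) * JT n (c, x) - exp (E (c, x) - E (c, x + of_real (real n) * e)) * g (c, x + of_real (real n) * e) + g (c, x)) \<longlonglongrightarrow> g' x"
    proof (rule has_complex_derivative_uniform_sequence[OF open_half_cone JTd])
      fix x assume "x \<in> half_cone \<kappa> R"
      then obtain r where r: "r > 0" "cball x r \<subseteq> half_cone \<kappa> R" using open_half_cone open_contains_cball by blast
      have "uniform_limit (half_cone \<kappa> R) (\<lambda>n u. JT n (c, u)) (\<lambda>u. J (c, u)) sequentially"
        by (rule uniform_limit_slice[OF J[unfolded DD_def] c])
      thus "\<exists>d>0. cball x d \<subseteq> half_cone \<kappa> R \<and> uniform_limit (cball x d) (\<lambda>n u. JT n (c, u)) (\<lambda>u. J (c, u)) sequentially"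
        using r uniform_limit_on_subset by blast
    qed
    then obtain g' where g': "((\<lambda>u. J (c, u)) has_field_derivative g') (at v)"
       "(\<lambda>n. d (c, v) * JT n (c, v) - exp (E (c, v) - E (c, v + of_real (real n) * e)) * g (c, v + of_real (real n) * e) + g (c, v)) \<longlonglongrightarrow> g'"
      using v by blast
    have "(\<lambda>n. exp (E (c, v) - E (c, v + of_real (real n) * e)) * g (c, v + of_real (real n) * e)) \<longlonglongrightarrow> 0"
    proof (rule Lim_null_comparison)
      show "\<forall>\<^sub>F n in sequentially. norm (exp (E (c, v) - E (c, v + of_real (real n) * e)) * g (c, v + of_real (real n) * e))
          \<le> B * inverse (Re v + real n) ^ Suc m"
      proof (intro always_eventually allI)
        fix n
        have "norm (g (c, v + of_real (real n) * e)) \<le> B / (Re v + real n) ^ Suc m"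
          using B(1)[OF c ray[OF v, of "real n"]] by (simp only: Re_ray of_nat_0_le_iff)
        hence "norm (exp (E (c, v) - E (c, v + of_real (real n) * e))) * norm (g (c, v + of_real (real n) * e)) \<le> 1 * (B / (Re v + real n) ^ Suc m)"
          by (intro mult_mono nexp c v) auto
        thus "norm (exp (E (c, v) - E (c, v + of_real (real n) * e)) * g (c, v + of_real (real n) * e)) \<le> B * inverse (Re v + real n) ^ Suc m"
          by (simp add: norm_mult divide_inverse power_inverse)
      qed
      have "(\<lambda>n. inverse (Re v + real n)) \<longlonglongrightarrow> 0"
        by (intro tendsto_inverse_0_at_top filterlim_tendsto_add_at_top[OF tendsto_const] filterlim_real_sequentially)
      hence "(\<lambda>n. B * inverse (Re v + real n) ^ Suc m) \<longlonglongrightarrow> B * 0 ^ Suc m" by (intro tendsto_intros)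
      thus "(\<lambda>n. B * inverse (Re v + real n) ^ Suc m) \<longlonglongrightarrow> 0" by simp
    qed
    hence "(\<lambda>n. d (c, v) * JT n (c, v) - exp (E (c, v) - E (c, v + of_real (real n) * e)) * g (c, v + of_real (real n) * e) + g (c, v)) \<longlonglongrightarrow>
        d (c, v) * J (c, v) - 0 + g (c, v)"
      by (intro tendsto_intros lim c v)
    from LIMSEQ_unique[OF g'(2) this] g'(1)
    show "((\<lambda>u. J (c, u)) has_field_derivative d (c, v) * J (c, v) + g (c, v)) (at v)" by simp
  qed
qed

text \<open>The solution of h' = d h + M h near the unit vector with index b is a series of iterated
  ray integrals. Each integration turns the order - (m + 1) of M into - m, and \<open>small\<close>
  makes each iteration shrink by 1/2. As d vanishes at the index b, the constant unit vector solves
  the unperturbed system and starts the series.\<close>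

lemma small_perturbation_solution:
  fixes S :: "(complex^'m) set" and m :: nat and \<kappa> R :: real and M :: "'n::finite \<Rightarrow> 'n \<Rightarrow> (complex^'m) \<times> complex \<Rightarrow> complex"
  defines "DD \<equiv> S \<times> half_cone \<kappa> R"
  assumes \<kappa>: "\<kappa> > 0" and R: "R > 0" and m: "m \<ge> 1"
    and e: "\<And>i. Re (e i) = 1" "\<And>i. \<bar>Im (e i)\<bar> \<le> \<kappa>"
    and E: "\<And>i. holo_on DD (E i)"
    and dE: "\<And>i c v. c \<in> S \<Longrightarrow> v \<in> half_cone \<kappa> R \<Longrightarrow> ((\<lambda>u. E i (c, u)) has_field_derivative d i (c, v)) (at v)"
    and pos: "\<And>i c v. c \<in> S \<Longrightarrow> v \<in> half_cone \<kappa> R \<Longrightarrow> Re (d i (c, v) * e i) \<ge> 0"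
    and db: "\<And>q. d b q = 0"
    and M: "\<And>i j. holo_on DD (M i j)"
    and K: "\<And>i j c v. c \<in> S \<Longrightarrow> v \<in> half_cone \<kappa> R \<Longrightarrow> norm (M i j (c, v)) \<le> K / Re v ^ Suc m" "K \<ge> 0"
    and small: "2 * (real CARD('n) * K * (1 + \<kappa>)) \<le> R ^ m"
  obtains h where "\<And>i. holo_on DD (h i)"
    and "\<And>i c v. c \<in> S \<Longrightarrow> v \<in> half_cone \<kappa> R \<Longrightarrow>
           norm (h i (c, v) - (if i = b then 1 else 0)) \<le> 2 * (real CARD('n) * K * (1 + \<kappa>)) / Re v ^ m"
    and "\<And>i c v. c \<in> S \<Longrightarrow> v \<in> half_cone \<kappa> R \<Longrightarrow>
           ((\<lambda>u. h i (c, u)) has_field_derivative d i (c, v) * h i (c, v) + (\<Sum>j\<in>UNIV. M i j (c, v) * h j (c, v))) (at v)"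
proof -
  \<comment> \<open>A / Re v ^ m bounds one iteration: there are \<open>CARD('n)\<close> summands,
    entries of M are at most K / Re v ^ (m + 1), and the directions have norm at most 1 +
    kappa.\<close>
  define A where "A = real CARD('n) * K * (1 + \<kappa>)"
  have A0: "A \<ge> 0" using K(2) \<kappa> by (simp add: A_def)
  have e_norm: "norm (e i) \<le> 1 + \<kappa>" for i
    using cmod_le[of "e i"] e by (smt (verit))
  have Re_pos: "Re v > 0" if "v \<in> half_cone \<kappa> R" for v using half_cone_Re[OF that \<kappa>] R by simp
  have A_half: "A / Re v ^ m \<le> 1 / 2" if "v \<in> half_cone \<kappa> R" for v
  proof -
    have "R ^ m \<le> Re v ^ m" using half_cone_Re[OF that \<kappa>] R by (intro power_mono) auto
    hence "2 * A \<le> Re v ^ m" using small by (simp add: A_def)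
    thus ?thesis using Re_pos[OF that] by (simp add: field_simps)
  qed
  \<comment> \<open>P holds the geometric bound for the n-th term of the series; Q says that the
    next term is the ray integral of M applied to it and decays to order m.\<close>
  define P where "P = (\<lambda>n (u :: 'n \<Rightarrow> (complex^'m) \<times> complex \<Rightarrow> complex).
     (\<forall>i. holo_on DD (u i)) \<and> (\<forall>i. \<forall>q\<in>DD. norm (u i q) \<le> (1/2) ^ n) \<and> (n = 0 \<longrightarrow> u = (\<lambda>i q. if i = b then 1 else 0)))"
  define Q where "Q = (\<lambda>(n::nat) (u :: 'n \<Rightarrow> (complex^'m) \<times> complex \<Rightarrow> complex) (u' :: 'n \<Rightarrow> (complex^'m) \<times> complex \<Rightarrow> complex).
     (\<forall>i. \<forall>c\<in>S. \<forall>v\<in>half_cone \<kappa> R. norm (u' i (c, v)) \<le> A * (1/2) ^ n / Re v ^ m \<and>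
        ((\<lambda>x. u' i (c, x)) has_field_derivative d i (c, v) * u' i (c, v) + (\<Sum>j\<in>UNIV. M i j (c, v) * u j (c, v))) (at v)))"
  have "\<exists>u. \<forall>n. P n (u n) \<and> Q n (u n) (u (Suc n))"
  proof (rule dependent_nat_choice)
    show "\<exists>u. P 0 u" by (auto simp: P_def intro!: holo_intros)
    fix u n assume u: "P n u"
    have "\<forall>i. \<exists>J. holo_on DD J \<and> (\<forall>c\<in>S. \<forall>v\<in>half_cone \<kappa> R. norm (J (c, v)) \<le> A * (1/2) ^ n / Re v ^ m \<and>
        ((\<lambda>x. J (c, x)) has_field_derivative d i (c, v) * J (c, v) + (\<Sum>j\<in>UNIV. M i j (c, v) * u j (c, v))) (at v))" (is "\<forall>i. ?Ex i")
    proof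
      fix i
      define B where "B = real CARD('n) * K * (1/2) ^ n"
      have B0: "B \<ge> 0" using K(2) by (simp add: B_def)
      have hol: "holo_on DD (\<lambda>q. \<Sum>j\<in>UNIV. M i j q * u j q)" using u M by (auto intro!: holo_intros simp: P_def)
      have bnd: "norm (\<Sum>j\<in>UNIV. M i j (c, v) * u j (c, v)) \<le> B / Re v ^ Suc m" if c: "c \<in> S" and v: "v \<in> half_cone \<kappa> R" for c v
      proof -
        have "norm (\<Sum>j\<in>UNIV. M i j (c, v) * u j (c, v)) \<le> (\<Sum>j\<in>(UNIV::'n set). K / Re v ^ Suc m * (1/2) ^ n)"
        proof (rule sum_norm_le)
          fix j
          have "norm (u j (c, v)) \<le> (1/2) ^ n" using u c v by (auto simp: P_def DD_def)
          thus "norm (M i j (c, v) * u j (c, v)) \<le> K / Re v ^ Suc m * (1/2) ^ n"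
            unfolding norm_mult using K c v Re_pos[OF v] by (intro mult_mono) (auto simp del: power_Suc)
        qed
        also have "\<dots> = B / Re v ^ Suc m" by (simp add: B_def)
        finally show ?thesis .
      qed
      obtain J where J: "holo_on DD J"
        "\<And>c v. c \<in> S \<Longrightarrow> v \<in> half_cone \<kappa> R \<Longrightarrow> norm (J (c, v)) \<le> B * norm (e i) / (m * Re v ^ m)"
        "\<And>c v. c \<in> S \<Longrightarrow> v \<in> half_cone \<kappa> R \<Longrightarrow>
           ((\<lambda>u. J (c, u)) has_field_derivative d i (c, v) * J (c, v) + (\<Sum>j\<in>UNIV. M i j (c, v) * u j (c, v))) (at v)"
        using ray_integral_operator[OF \<kappa> R m e(1,2)[of i] E[of i, unfolded DD_def] dE[of _ _ i] pos[of _ _ i] hol[unfolded DD_def] bnd B0, folded DD_def]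
        by blast
      have "norm (J (c, v)) \<le> A * (1/2) ^ n / Re v ^ m" if c: "c \<in> S" and v: "v \<in> half_cone \<kappa> R" for c v
      proof -
        have "norm (J (c, v)) \<le> B * norm (e i) / (m * Re v ^ m)" by (rule J(2)[OF c v])
        also have "\<dots> \<le> B * (1 + \<kappa>) / (1 * Re v ^ m)"
          using B0 e_norm[of i] m Re_pos[OF v] \<kappa> by (intro frac_le mult_left_mono mult_right_mono) auto
        finally show ?thesis by (simp add: A_def B_def mult_ac)
      qed
      with J show "?Ex i" by blast
    qed
    from choice[OF this] obtain u' where u'_all: "\<forall>i. holo_on DD (u' i) \<and> (\<forall>c\<in>S. \<forall>v\<in>half_cone \<kappa> R. norm (u' i (c, v)) \<le> A * (1/2) ^ n / Re v ^ m \<and>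
        ((\<lambda>x. u' i (c, x)) has_field_derivative d i (c, v) * u' i (c, v) + (\<Sum>j\<in>UNIV. M i j (c, v) * u j (c, v))) (at v))"
      by blast
    note u' = u'_all[rule_format, THEN conjunct1] u'_all[rule_format, THEN conjunct2, rule_format, THEN conjunct1]
      u'_all[rule_format, THEN conjunct2, rule_format, THEN conjunct2]
    have "norm (u' i (c, v)) \<le> (1/2) ^ Suc n" if c: "c \<in> S" and v: "v \<in> half_cone \<kappa> R" for i c v
    proof -
      have "norm (u' i (c, v)) \<le> A * (1/2) ^ n / Re v ^ m" by (rule u'(2)[OF c v])
      also have "\<dots> = A / Re v ^ m * (1/2) ^ n" by simp
      also have "\<dots> \<le> 1/2 * (1/2) ^ n" by (intro mult_right_mono A_half v) simp
      also have "\<dots> = (1/2) ^ Suc n" by simp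
      finally show ?thesis .
    qed
    hence "P (Suc n) u'" using u'(1) by (auto simp: P_def DD_def)
    moreover have "Q n u u'" using u' by (auto simp: Q_def)
    ultimately show "\<exists>u'. P (Suc n) u' \<and> Q n u u'" by blast
  qed
  then obtain u where uP: "\<And>n. P n (u n)" and uQ: "\<And>n. Q n (u n) (u (Suc n))" by blast
  have u0: "u 0 = (\<lambda>i q. if i = b then 1 else 0)" using uP[of 0] by (simp add: P_def)
  define h where "h = (\<lambda>i q. \<Sum>n. u n i q)"
  define H where "H = (\<lambda>n i q. \<Sum>k<n. u k i q)"
  have sgeo: "summable (\<lambda>n. (1/2::real) ^ n)" by (rule summable_geometric) simp
  have lim: "uniform_limit DD (\<lambda>n. H n i) (h i) sequentially" for i
    unfolding h_def H_def by (rule Weierstrass_m_test[OF _ sgeo]) (use uP in \<open>auto simp: P_def\<close>)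
  have limp: "(\<lambda>n. H n i (c, v)) \<longlonglongrightarrow> h i (c, v)" if "c \<in> S" "v \<in> half_cone \<kappa> R" for i c v
    using tendsto_uniform_limitI[OF lim, of "(c, v)"] that by (simp add: DD_def)
  have hh: "holo_on DD (h i)" for i
    by (rule holo_on_uniform_limit[OF _ lim]) (use uP in \<open>auto simp: H_def P_def intro!: holo_intros\<close>)
  show thesis
  proof (rule that[OF hh])
    fix i c v assume c: "c \<in> S" and v: "v \<in> half_cone \<kappa> R"
    have sm: "summable (\<lambda>n. norm (u n i (c, v)))"
      by (rule summable_comparison_test'[OF sgeo, of 0]) (use uP c v in \<open>auto simp: P_def DD_def\<close>)
    have sm1: "summable (\<lambda>n. norm (u (Suc n) i (c, v)))" using sm by (subst summable_Suc_iff)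
    have geo: "summable (\<lambda>n. A / Re v ^ m * (1/2) ^ n)" by (intro summable_mult sgeo)
    have "h i (c, v) - u 0 i (c, v) = (\<Sum>n. u (Suc n) i (c, v))"
      unfolding h_def using suminf_split_head[OF summable_norm_cancel[OF sm]] by simp
    hence "norm (h i (c, v) - u 0 i (c, v)) \<le> (\<Sum>n. norm (u (Suc n) i (c, v)))" using summable_norm[OF sm1] by simp
    also have "\<dots> \<le> (\<Sum>n. A / Re v ^ m * (1/2) ^ n)"
      using uQ c v by (intro suminf_le sm1 geo) (simp add: Q_def)
    also have "\<dots> = A / Re v ^ m * 2" by (subst suminf_mult[OF sgeo]) (simp add: suminf_geometric)
    finally show "norm (h i (c, v) - (if i = b then 1 else 0)) \<le> 2 * (real CARD('n) * K * (1 + \<kappa>)) / Re v ^ m"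
      by (simp add: u0 A_def mult_ac)
  next
    fix i c v assume c: "c \<in> S" and v: "v \<in> half_cone \<kappa> R"
    have ud: "((\<lambda>x. u (Suc k) i (c, x)) has_field_derivative d i (c, x) * u (Suc k) i (c, x) + (\<Sum>j\<in>UNIV. M i j (c, x) * u k j (c, x))) (at x)"
      if "x \<in> half_cone \<kappa> R" for k x using uQ[of k] c that by (simp add: Q_def)
    \<comment> \<open>A partial sum satisfies the equation with the perturbation lagging one term
      behind, and this lag disappears in the limit.\<close>
    have Hd: "((\<lambda>x. H (Suc n) i (c, x)) has_field_derivative d i (c, x) * H (Suc n) i (c, x) + (\<Sum>j\<in>UNIV. M i j (c, x) * H n j (c, x))) (at x)"
      if x: "x \<in> half_cone \<kappa> R" for n x
    proof (induction n)
      case 0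
      show ?case by (cases "i = b") (simp_all add: H_def u0 db)
    next
      case (Suc n)
      have "((\<lambda>x. H (Suc n) i (c, x) + u (Suc n) i (c, x)) has_field_derivative
         (d i (c, x) * H (Suc n) i (c, x) + (\<Sum>j\<in>UNIV. M i j (c, x) * H n j (c, x))) +
         (d i (c, x) * u (Suc n) i (c, x) + (\<Sum>j\<in>UNIV. M i j (c, x) * u n j (c, x)))) (at x)"
        by (rule DERIV_add[OF Suc ud[OF x]])
      thus ?case by (simp add: H_def sum.distrib algebra_simps)
    qed
    have "\<exists>g'. \<forall>x\<in>half_cone \<kappa> R. ((\<lambda>u. h i (c, u)) has_field_derivative g' x) (at x) \<and>
       (\<lambda>n. d i (c, x) * H (Suc n) i (c, x) + (\<Sum>j\<in>UNIV. M i j (c, x) * H n j (c, x))) \<longlonglongrightarrow> g' x"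
    proof (rule has_complex_derivative_uniform_sequence[OF open_half_cone Hd])
      fix x assume "x \<in> half_cone \<kappa> R"
      then obtain r where r: "r > 0" "cball x r \<subseteq> half_cone \<kappa> R" using open_half_cone open_contains_cball by blast
      have "uniform_limit DD (\<lambda>n. H (Suc n) i) (h i) sequentially"
        using filterlim_compose[OF lim[of i] filterlim_Suc] by simp
      hence "uniform_limit (half_cone \<kappa> R) (\<lambda>n u. H (Suc n) i (c, u)) (\<lambda>u. h i (c, u)) sequentially"
        unfolding DD_def by (rule uniform_limit_slice[OF _ c])
      thus "\<exists>d>0. cball x d \<subseteq> half_cone \<kappa> R \<and> uniform_limit (cball x d) (\<lambda>n u. H (Suc n) i (c, u)) (\<lambda>u. h i (c, u)) sequentially"
        using r uniform_limit_on_subset by blast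
    qed
    then obtain g' where g': "((\<lambda>u. h i (c, u)) has_field_derivative g') (at v)"
      "(\<lambda>n. d i (c, v) * H (Suc n) i (c, v) + (\<Sum>j\<in>UNIV. M i j (c, v) * H n j (c, v))) \<longlonglongrightarrow> g'" using v by blast
    have "(\<lambda>n. d i (c, v) * H (Suc n) i (c, v) + (\<Sum>j\<in>UNIV. M i j (c, v) * H n j (c, v))) \<longlonglongrightarrow>
        d i (c, v) * h i (c, v) + (\<Sum>j\<in>UNIV. M i j (c, v) * h j (c, v))"
      by (intro tendsto_intros limp c v filterlim_compose[OF limp filterlim_Suc, of c v i, unfolded o_def])
    from LIMSEQ_unique[OF g'(2) this] g'(1)
    show "((\<lambda>u. h i (c, u)) has_field_derivative d i (c, v) * h i (c, v) + (\<Sum>j\<in>UNIV. M i j (c, v) * h j (c, v))) (at v)"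
      by simp
  qed
qed

text \<open>Picard iteration from the unit vector at z = 0. The bounds (k r)^n / n! hold on balls of
  parameters and variable together, so the limit is jointly holomorphic.\<close>

lemma entire_fundamental_columns:
  fixes A :: "'n::finite \<Rightarrow> 'n \<Rightarrow> (complex^'m) \<times> complex \<Rightarrow> complex"
  assumes A: "\<And>i j. holo_on UNIV (A i j)"
  obtains h where "\<And>i. holo_on UNIV (h i)"
    and "\<And>i c. h i (c, 0) = (if i = b then 1 else 0)"
    and "\<And>i c z. ((\<lambda>u. h i (c, u)) has_field_derivative (\<Sum>j\<in>UNIV. A i j (c, z) * h j (c, z))) (at z)"
proof -
  \<comment> \<open>Integration from 0 to z along the segment, with the parameters fixed.\<close>
  define I where "I = (\<lambda>f (q :: (complex^'m) \<times> complex). snd q * integral {0..1} (\<lambda>s. f (fst q, of_real s * snd q)))"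
  have contI: "continuous_on (T \<times> {0..1}) (\<lambda>(q, s). f (fst q, of_real s * snd q))"
    if "holo_on UNIV f" for f and T :: "((complex^'m) \<times> complex) set"
    unfolding split_beta
    by (rule continuous_on_compose2[OF holo_on_continuous[OF that]]) (auto intro!: continuous_intros)
  have I_holo: "holo_on UNIV (I f)" if f: "holo_on UNIV f" for f
    unfolding I_def
  proof (intro holo_on_mult holo_on_snd holo_on_integral)
    show "continuous_on (UNIV \<times> {0..1}) (\<lambda>(q, s). f (fst q, of_real s * snd q))" by (rule contI[OF f])
    fix s :: real
    have "holo_on UNIV (\<lambda>q :: (complex^'m) \<times> complex. of_real s * snd q)" by (intro holo_on_mult holo_on_snd holo_on_const)
    from holo_on_reparam[OF f this] show "holo_on UNIV (\<lambda>q. f (fst q, of_real s * snd q))" by simp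
  qed
  have I_der: "((\<lambda>u. I f (c, u)) has_field_derivative f (c, z)) (at z)" if f: "holo_on UNIV f" for f c z
  proof -
    have "(\<lambda>u. f (c, u)) holomorphic_on UNIV" by (rule holo_on_slice[OF f]) auto
    then obtain P where P: "\<And>u. (P has_field_derivative f (c, u)) (at u)"
      using holomorphic_convex_primitive'[of UNIV "\<lambda>u. f (c, u)"] by (auto simp: )
    have "I f (c, u) = P u - P 0" for u
    proof -
      have "((\<lambda>s. P (of_real s * u)) has_vector_derivative u * f (c, of_real s * u)) (at s within {0..1})" for s
      proof -
        have 1: "((\<lambda>s. of_real s * u) has_vector_derivative u) (at s)"
          by (auto intro!: derivative_eq_intros simp: has_vector_derivative_def scaleR_conv_of_real)
        from field_vector_diff_chain_at[OF 1 P] show ?thesis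
          by (simp add: o_def has_vector_derivative_at_within)
      qed
      from fundamental_theorem_of_calculus[OF _ this]
      have "((\<lambda>s. u * f (c, of_real s * u)) has_integral (P (of_real 1 * u) - P (of_real 0 * u))) {0..1}" by auto
      from integral_unique[OF this] show ?thesis by (simp add: I_def)
    qed
    moreover have "((\<lambda>u. P u - P 0) has_field_derivative f (c, z)) (at z)"
      using DERIV_diff[OF P[of z] DERIV_const[of "P 0"]] by simp
    ultimately show ?thesis by simp
  qed
  have I_bound: "norm (I f (c, z)) \<le> B * norm z ^ Suc n / real (Suc n)"
    if f: "holo_on UNIV f" and B: "\<And>s. s \<in> {0..1} \<Longrightarrow> norm (f (c, of_real s * z)) \<le> B * (s * norm z) ^ n" for f c z n B
  proof -
    have hi: "((\<lambda>s. B * norm z ^ n * s ^ n) has_integral B * norm z ^ n * (1 ^ Suc n / Suc n - 0 ^ Suc n / Suc n)) {0..1}"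
    proof (intro has_integral_mult_right fundamental_theorem_of_calculus)
      fix s :: real
      have "((\<lambda>s. s ^ Suc n / Suc n) has_real_derivative s ^ n) (at s within {0..1})"
        by (auto intro!: derivative_eq_intros simp del: power_Suc of_nat_Suc)
      thus "((\<lambda>s. s ^ Suc n / Suc n) has_vector_derivative s ^ n) (at s within {0..1})"
        by (simp add: has_real_derivative_iff_has_vector_derivative)
    qed simp
    have "continuous_on {0..1} (\<lambda>s. (\<lambda>(q, s). f (fst q, of_real s * snd q)) ((c, z), s))"
      by (rule continuous_on_compose2[OF contI[OF f, of UNIV]]) (auto intro!: continuous_intros)
    hence ci: "(\<lambda>s. f (c, of_real s * z)) integrable_on {0..1}" by (simp add: integrable_continuous_real)
    have "norm (integral {0..1} (\<lambda>s. f (c, of_real s * z))) \<le> integral {0..1} (\<lambda>s. B * norm z ^ n * s ^ n)"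
      by (rule integral_norm_bound_integral[OF ci has_integral_integrable[OF hi]])
        (use B in \<open>auto simp: power_mult_distrib mult_ac\<close>)
    also have "\<dots> = B * norm z ^ n / Suc n" using integral_unique[OF hi] by simp
    finally have "norm z * norm (integral {0..1} (\<lambda>s. f (c, of_real s * z))) \<le> norm z * (B * norm z ^ n / Suc n)"
      by (rule mult_left_mono) simp
    thus ?thesis by (simp add: I_def norm_mult mult_ac)
  qed
  define u where "u = (\<lambda>n. rec_nat (\<lambda>i (q::(complex^'m) \<times> complex). if i = b then 1 else 0 :: complex) (\<lambda>n u i. I (\<lambda>q. \<Sum>j\<in>UNIV. A i j q * u j q)) n)"
  have u0: "u 0 i q = (if i = b then 1 else 0)" for i q by (simp add: u_def)
  have uS: "u (Suc n) i = I (\<lambda>q. \<Sum>j\<in>UNIV. A i j q * u n j q)" for n i by (simp add: u_def)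
  have u_holo: "holo_on UNIV (u n i)" for n i
  proof (induction n arbitrary: i)
    case 0
    have "u 0 i = (\<lambda>q. if i = b then 1 else 0)" by (simp add: u_def)
    thus ?case by (auto intro!: holo_intros)
  next
    case (Suc n) thus ?case unfolding uS by (intro I_holo holo_intros A)
  qed
  have Au_holo: "holo_on UNIV (\<lambda>q. \<Sum>j\<in>UNIV. A i j q * u n j q)" for n i by (intro holo_intros A u_holo)
  define h where "h = (\<lambda>i q. \<Sum>n. u n i q)"
  define H where "H = (\<lambda>n i q. \<Sum>k<n. u k i q)"
  have lim: "uniform_limit (cball 0 r) (\<lambda>n. H n i) (h i) sequentially" for i r
  proof -
    have "\<exists>a\<ge>0. \<forall>i j. \<forall>q\<in>cball 0 r. norm (A i j q) \<le> a"
    proof -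
      have "\<exists>a\<ge>0. \<forall>q\<in>cball 0 r. norm (A i j q) \<le> a" for i j
      proof -
        have "compact (A i j ` cball 0 r)"
          by (intro compact_continuous_image continuous_on_subset[OF holo_on_continuous[OF A]]) auto
        from compact_imp_bounded[OF this] obtain a where "\<forall>x\<in>A i j ` cball 0 r. norm x \<le> a" by (auto simp: bounded_iff)
        thus ?thesis by (intro exI[of _ "max a 0"]) auto
      qed
      then obtain a where a: "\<And>i j. a i j \<ge> 0" "\<And>i j q. q \<in> cball 0 r \<Longrightarrow> norm (A i j q) \<le> a i j" by metis
      have "a i j \<le> (\<Sum>i\<in>UNIV. \<Sum>j\<in>UNIV. a i j)" for i j
        using member_le_sum[of j UNIV "a i"] member_le_sum[of i UNIV "\<lambda>i. \<Sum>j\<in>UNIV. a i j"] a(1)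
        by (fastforce intro: sum_nonneg)
      thus ?thesis using a by (intro exI[of _ "\<Sum>i\<in>UNIV. \<Sum>j\<in>UNIV. a i j"]) (meson order_trans sum_nonneg)
    qed
    then obtain a where a: "a \<ge> 0" "\<And>i j q. q \<in> cball 0 r \<Longrightarrow> norm (A i j q) \<le> a" by blast
    define k where "k = real CARD('n) * a"
    have k0: "k \<ge> 0" using a by (simp add: k_def)
    have in_ball: "norm (c, of_real s * z) \<le> norm (c, z)" if "s \<in> {0..1}" for c :: "complex^'m" and s and z :: complex
    proof -
      have "\<bar>s\<bar> * norm z \<le> 1 * norm z" using that by (intro mult_right_mono) auto
      thus ?thesis by (simp add: norm_Pair norm_mult power_mono)
    qed
    have bnd: "norm (u n i (c, z)) \<le> k ^ n / fact n * norm z ^ n" if "(c, z) \<in> cball 0 r" for n i c z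
      using that
    proof (induction n arbitrary: i z)
      case 0 thus ?case by (simp add: u0)
    next
      case (Suc n)
      have "norm (\<Sum>j\<in>UNIV. A i j (c, of_real s * z) * u n j (c, of_real s * z)) \<le> (k * (k ^ n / fact n)) * (s * norm z) ^ n"
        if s: "s \<in> {0..1}" for s
      proof -
        have mem: "(c, of_real s * z) \<in> cball 0 r" using in_ball[OF s, of c z] Suc.prems by simp
        have "norm (\<Sum>j\<in>UNIV. A i j (c, of_real s * z) * u n j (c, of_real s * z)) \<le> (\<Sum>j\<in>(UNIV::'n set). a * (k ^ n / fact n * norm (of_real s * z) ^ n))"
        proof (rule sum_norm_le)
          fix j
          have "norm (u n j (c, of_real s * z)) \<le> k ^ n / fact n * norm (of_real s * z) ^ n" by (rule Suc.IH[OF mem])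
          thus "norm (A i j (c, of_real s * z) * u n j (c, of_real s * z)) \<le> a * (k ^ n / fact n * norm (of_real s * z) ^ n)"
            unfolding norm_mult[of "A i j _"] by (intro mult_mono a mem) auto
        qed
        also have "\<dots> = (k * (k ^ n / fact n)) * (s * norm z) ^ n" using s by (simp add: k_def norm_mult)
        finally show ?thesis .
      qed
      from I_bound[OF Au_holo this]
      have "norm (u (Suc n) i (c, z)) \<le> k * (k ^ n / fact n) * norm z ^ Suc n / real (Suc n)" by (simp add: uS)
      thus ?case by (simp add: field_simps)
    qed
    have "norm (u n i q) \<le> (k * r) ^ n / fact n" if q: "q \<in> cball 0 r" for n q
    proof -
      obtain c z where [simp]: "q = (c, z)" by (cases q)
      have "norm z \<le> r" using q norm_snd_le[of z c] by (simp add: norm_Pair_le order_trans)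
      hence "k ^ n / fact n * norm z ^ n \<le> k ^ n / fact n * r ^ n"
        using k0 by (intro mult_left_mono power_mono) auto
      thus ?thesis using bnd[of c z n i] q by (simp add: power_mult_distrib)
    qed
    moreover have "summable (\<lambda>n. (k * r) ^ n / fact n)"
      using summable_exp[of "k * r"] by (simp add: field_simps)
    ultimately show ?thesis unfolding h_def H_def by (rule Weierstrass_m_test)
  qed
  have h_holo: "holo_on UNIV (h i)" for i
  proof (rule holo_on_local)
    fix q :: "(complex^'m) \<times> complex"
    have "uniform_limit (ball 0 (norm q + 1)) (\<lambda>n. H n i) (h i) sequentially"
      by (rule uniform_limit_on_subset[OF lim ball_subset_cball])
    hence "holo_on (ball 0 (norm q + 1)) (h i)"
      by (rule holo_on_uniform_limit[rotated]) (auto simp: H_def intro!: holo_intros holo_on_subset[OF u_holo])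
    thus "\<exists>N. open N \<and> q \<in> N \<and> holo_on (UNIV \<inter> N) (h i)" by (intro exI[of _ "ball 0 (norm q + 1)"]) auto
  qed
  have limp: "(\<lambda>n. H n i q) \<longlonglongrightarrow> h i q" for i q
    by (rule tendsto_uniform_limitI[OF lim[where r="norm q"]]) auto
  show thesis
  proof (rule that[OF h_holo])
    fix i c
    have "H (Suc n) i (c, 0) = (if i = b then 1 else 0)" for n
      by (induction n) (simp_all add: H_def u0 uS I_def)
    hence "(\<lambda>n. H (Suc n) i (c, 0)) \<longlonglongrightarrow> (if i = b then 1 else 0)" by simp
    thus "h i (c, 0) = (if i = b then 1 else 0)"
      using LIMSEQ_unique[OF LIMSEQ_Suc[OF limp]] by blast
  next
    fix i c z
    have Hd: "((\<lambda>x. H (Suc n) i (c, x)) has_field_derivative (\<Sum>j\<in>UNIV. A i j (c, x) * H n j (c, x))) (at x)" for n x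
    proof (induction n)
      case 0 show ?case by (simp add: H_def u0)
    next
      case (Suc n)
      have "((\<lambda>x. H (Suc n) i (c, x) + u (Suc n) i (c, x)) has_field_derivative
         (\<Sum>j\<in>UNIV. A i j (c, x) * H n j (c, x)) + (\<Sum>j\<in>UNIV. A i j (c, x) * u n j (c, x))) (at x)"
        unfolding uS by (rule DERIV_add[OF Suc I_der[OF Au_holo]])
      thus ?case by (simp add: H_def sum.distrib algebra_simps)
    qed
    have "\<exists>g'. \<forall>x\<in>UNIV. ((\<lambda>u. h i (c, u)) has_field_derivative g' x) (at x) \<and>
       (\<lambda>n. (\<Sum>j\<in>UNIV. A i j (c, x) * H n j (c, x))) \<longlonglongrightarrow> g' x"
    proof (rule has_complex_derivative_uniform_sequence[OF open_UNIV Hd])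
      fix x :: complex
      have "uniform_limit (cball 0 (norm c + norm x + 1)) (\<lambda>n. H (Suc n) i) (h i) sequentially"
        using filterlim_compose[OF lim filterlim_Suc] by simp
      moreover have "{c} \<times> cball x 1 \<subseteq> cball 0 (norm c + norm x + 1)"
      proof
        fix p assume "p \<in> {c} \<times> cball x 1"
        then obtain y where y: "p = (c, y)" "norm (x - y) \<le> 1" by (auto simp: dist_norm)
        have "norm (c, y) \<le> norm c + norm y" by (rule norm_Pair_le)
        also have "norm y \<le> norm x + norm (x - y)" using norm_triangle_ineq4[of x "x - y"] by simp
        finally show "p \<in> cball 0 (norm c + norm x + 1)" using y by simp
      qed
      ultimately have "uniform_limit ({c} \<times> cball x 1) (\<lambda>n. H (Suc n) i) (h i) sequentially"
        by (rule uniform_limit_on_subset)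
      hence "uniform_limit (cball x 1) (\<lambda>n u. H (Suc n) i (c, u)) (\<lambda>u. h i (c, u)) sequentially"
        by (rule uniform_limit_slice) simp
      thus "\<exists>d>0. cball x d \<subseteq> UNIV \<and> uniform_limit (cball x d) (\<lambda>n u. H (Suc n) i (c, u)) (\<lambda>u. h i (c, u)) sequentially"
        by (intro exI[of _ 1]) auto
    qed
    then obtain g' where g': "((\<lambda>u. h i (c, u)) has_field_derivative g') (at z)"
      "(\<lambda>n. (\<Sum>j\<in>UNIV. A i j (c, z) * H n j (c, z))) \<longlonglongrightarrow> g'" by blast
    have "(\<lambda>n. (\<Sum>j\<in>UNIV. A i j (c, z) * H n j (c, z))) \<longlonglongrightarrow> (\<Sum>j\<in>UNIV. A i j (c, z) * h j (c, z))"
      by (intro tendsto_intros limp)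
    from LIMSEQ_unique[OF g'(2) this] g'(1)
    show "((\<lambda>u. h i (c, u)) has_field_derivative (\<Sum>j\<in>UNIV. A i j (c, z) * h j (c, z))) (at z)" by simp
  qed
qed

section \<open>Derivatives of matrix functions and entire fundamental matrices\<close>

definition has_matrix_derivative :: "(complex \<Rightarrow> complex^'n^'n) \<Rightarrow> complex^'n^'n \<Rightarrow> complex \<Rightarrow> bool" where
  "has_matrix_derivative M M' z \<longleftrightarrow> (\<forall>i j. ((\<lambda>u. M u $ i $ j) has_field_derivative M' $ i $ j) (at z))"

lemma has_matrix_derivative_mult:
  assumes "has_matrix_derivative M M' z" "has_matrix_derivative N N' z"
  shows "has_matrix_derivative (\<lambda>u. M u ** N u) (M' ** N z + M z ** N') z"
  unfolding has_matrix_derivative_def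
proof (intro allI)
  fix i j
  have "((\<lambda>u. \<Sum>k\<in>UNIV. M u $ i $ k * N u $ k $ j) has_field_derivative
     (\<Sum>k\<in>UNIV. M' $ i $ k * N z $ k $ j + N' $ k $ j * M z $ i $ k)) (at z)"
    using assms unfolding has_matrix_derivative_def by (intro DERIV_sum DERIV_mult) auto
  thus "((\<lambda>u. (M u ** N u) $ i $ j) has_field_derivative (M' ** N z + M z ** N') $ i $ j) (at z)"
    by (simp add: matrix_matrix_mult_def sum.distrib mult.commute)
qed

lemma has_matrix_derivative_const: "has_matrix_derivative (\<lambda>u. C) 0 z"
  by (simp add: has_matrix_derivative_def)

lemma has_matrix_derivative_unique:
  assumes "has_matrix_derivative M M' z" "has_matrix_derivative M M'' z"
  shows "M' = M''"
  using assms unfolding has_matrix_derivative_def vec_eq_iff by (meson DERIV_unique)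

lemma has_matrix_derivative_zero_constant:
  assumes "\<And>z. z \<in> S \<Longrightarrow> has_matrix_derivative M 0 z" "convex S" "z \<in> S" "z' \<in> S"
  shows "M z = M z'"
proof -
  have "M z $ i $ j = M z' $ i $ j" for i j
  proof -
    have "\<exists>c. \<forall>x\<in>S. M x $ i $ j = c"
      by (rule has_field_derivative_zero_constant[OF assms(2)])
        (use assms(1) in \<open>auto simp: has_matrix_derivative_def intro: has_field_derivative_at_within\<close>)
    thus ?thesis using assms(3,4) by auto
  qed
  thus ?thesis by (simp add: vec_eq_iff)
qed

lemma left_inverse_right_inverse_matrix:
  fixes A B :: "complex^'n^'n"
  assumes "A ** B = mat 1"
  shows "invertible A" "invertible B" "matrix_inv A = B" "matrix_inv B = A"
proof -
  have BA: "B ** A = mat 1" using assms by (simp add: matrix_left_right_inverse)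
  show iA: "invertible A" and iB: "invertible B" using assms BA unfolding invertible_def by blast+
  have "matrix_inv A = matrix_inv A ** (A ** B)" by (simp add: assms)
  also have "\<dots> = B" by (simp add: matrix_mul_assoc matrix_inv_mult_left[OF iA])
  finally show "matrix_inv A = B" .
  have "matrix_inv B = matrix_inv B ** (B ** A)" by (simp add: BA)
  also have "\<dots> = A" by (simp add: matrix_mul_assoc matrix_inv_mult_left[OF iB])
  finally show "matrix_inv B = A" .
qed

lemma has_matrix_derivative_transpose:
  "has_matrix_derivative M M' z \<Longrightarrow> has_matrix_derivative (\<lambda>u. transpose (M u)) (transpose M') z"
  by (simp add: has_matrix_derivative_def transpose_def)

text \<open>Invertibility comes from the adjoint equation: if X' = - A^T X and X(0) = 1, then X^T
  Psi has derivative zero and equals the identity everywhere.\<close>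

lemma entire_fundamental_matrix:
  fixes A :: "(complex^'m) \<times> complex \<Rightarrow> complex^'n^'n"
  assumes A: "\<And>i j. holo_on UNIV (\<lambda>q. A q $ i $ j)"
  obtains \<Psi> where "\<And>i j. holo_on UNIV (\<lambda>q. \<Psi> q $ i $ j)"
    and "\<And>q. invertible (\<Psi> q)"
    and "\<And>c z. has_matrix_derivative (\<lambda>u. \<Psi> (c, u)) (A (c, z) ** \<Psi> (c, z)) z"
proof -
  have ex: "\<exists>\<Psi> :: (complex^'m) \<times> complex \<Rightarrow> complex^'n^'n. (\<forall>i j. holo_on UNIV (\<lambda>q. \<Psi> q $ i $ j)) \<and> (\<forall>c. \<Psi> (c, 0) = mat 1) \<and>
      (\<forall>c z. has_matrix_derivative (\<lambda>u. \<Psi> (c, u)) (A (c, z) ** \<Psi> (c, z)) z)"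
    if A: "\<And>i j. holo_on UNIV (\<lambda>q. A q $ i $ j)" for A :: "(complex^'m) \<times> complex \<Rightarrow> complex^'n^'n"
  proof -
    have "\<forall>b. \<exists>h. (\<forall>i. holo_on UNIV (h i)) \<and> (\<forall>i c. h i (c, 0) = (if i = b then 1 else 0)) \<and>
      (\<forall>i c z. ((\<lambda>u. h i (c, u)) has_field_derivative (\<Sum>j\<in>UNIV. A (c, z) $ i $ j * h j (c, z))) (at z))"
    proof
      fix b
      show "\<exists>h. (\<forall>i. holo_on UNIV (h i)) \<and> (\<forall>i c. h i (c, 0) = (if i = b then 1 else 0)) \<and>
        (\<forall>i c z. ((\<lambda>u. h i (c, u)) has_field_derivative (\<Sum>j\<in>UNIV. A (c, z) $ i $ j * h j (c, z))) (at z))"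
        by (rule entire_fundamental_columns[of "\<lambda>i j q. A q $ i $ j" b, OF A]) blast
    qed
    from choice[OF this] obtain h where h: "\<forall>b. (\<forall>i. holo_on UNIV (h b i)) \<and> (\<forall>i c. h b i (c, 0) = (if i = b then 1 else 0)) \<and>
      (\<forall>i c z. ((\<lambda>u. h b i (c, u)) has_field_derivative (\<Sum>j\<in>UNIV. A (c, z) $ i $ j * h b j (c, z))) (at z))" by blast
    show ?thesis
      by (rule exI[of _ "\<lambda>q. \<chi> i b. h b i q"])
        (use h in \<open>simp add: vec_eq_iff mat_def has_matrix_derivative_def matrix_matrix_mult_def\<close>)
  qed
  obtain \<Psi> where \<Psi>: "\<And>i j. holo_on UNIV (\<lambda>q. \<Psi> q $ i $ j)" "\<And>c. \<Psi> (c, 0) = mat 1"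
      "\<And>c z. has_matrix_derivative (\<lambda>u. \<Psi> (c, u)) (A (c, z) ** \<Psi> (c, z)) z"
    using ex[OF A] by blast
  have "holo_on UNIV (\<lambda>q. (- transpose (A q)) $ i $ j)" for i j
    using holo_on_minus[OF A[of j i]] by (simp add: transpose_def)
  from ex[of "\<lambda>q. - transpose (A q)", OF this]
  obtain X where X: "\<And>c. X (c, 0) = mat 1"
      "\<And>c z. has_matrix_derivative (\<lambda>u. X (c, u)) ((- transpose (A (c, z))) ** X (c, z)) z"
    by blast
  have neg: "(- M) ** N = - (M ** N)" for M N :: "complex^'n^'n"
    by (simp add: vec_eq_iff matrix_matrix_mult_def sum_negf)
  have negR: "M ** (- N) = - (M ** N)" for M N :: "complex^'n^'n"
    by (simp add: vec_eq_iff matrix_matrix_mult_def sum_negf)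
  have trn: "transpose (- M) = - transpose M" for M :: "complex^'n^'n"
    by (simp add: vec_eq_iff transpose_def)
  have inv: "transpose (X (c, z)) ** \<Psi> (c, z) = mat 1" for c z
  proof -
    have "has_matrix_derivative (\<lambda>u. transpose (X (c, u)) ** \<Psi> (c, u)) 0 z" for z
    proof -
      have "transpose ((- transpose (A (c, z))) ** X (c, z)) = - (transpose (X (c, z)) ** A (c, z))"
        by (simp add: neg trn matrix_transpose_mul)
      with has_matrix_derivative_mult[OF has_matrix_derivative_transpose[OF X(2)[of c z]] \<Psi>(3)[of c z]]
      show ?thesis by (simp add: neg matrix_mul_assoc)
    qed
    from has_matrix_derivative_zero_constant[OF this convex_UNIV UNIV_I UNIV_I, of z 0]
    show ?thesis by (simp add: X \<Psi>)
  qed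
  have "invertible (\<Psi> q)" for q using left_inverse_right_inverse_matrix(2)[OF inv[of "fst q" "snd q"]] by simp
  with \<Psi> that show thesis by blast
qed

subsection \<open>Formal solutions\<close>

text \<open>The column \<open>j\<close> of the formal fundamental matrix, normalised so that its \<open>j\<close>-th entry is
  identically 1.  The coefficients are determined recursively because the leading coefficient of
  the system is diagonal with distinct entries \<open>lam\<close>.\<close>

function ncol :: "(nat \<Rightarrow> 'n::finite \<Rightarrow> 'n \<Rightarrow> complex) \<Rightarrow> ('n \<Rightarrow> complex) \<Rightarrow> nat \<Rightarrow> 'n \<Rightarrow> nat \<Rightarrow> 'n \<Rightarrow> complex" where
  "ncol C lam K j m a = (if m = 0 then (if a = j then 1 else 0) else if a = j then 0 else
     (- (\<Sum>l\<in>{1..m}. \<Sum>b\<in>UNIV. C l a b * ncol C lam K j (m - l) b)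
      + (\<Sum>l\<in>{1..<m}. (\<Sum>i\<in>{1..l}. \<Sum>b\<in>UNIV. C i j b * ncol C lam K j (l - i) b) * ncol C lam K j (m - l) a)
      - (if 0 < K \<and> K < m then of_nat (m - K) * ncol C lam K j (m - K) a else 0)) / (lam a - lam j))"
  by pat_completeness auto
termination by (relation "Wellfounded.measure (\<lambda>(C, lam, K, j, m, a). m)") auto

declare ncol.simps [simp del]

text \<open>Coefficients of the exponent belonging to the normalised column. Since the j-th entry of
  that column is 1, they are read off from row j of the equation.\<close>

definition nexp :: "(nat \<Rightarrow> 'n::finite \<Rightarrow> 'n \<Rightarrow> complex) \<Rightarrow> ('n \<Rightarrow> complex) \<Rightarrow> nat \<Rightarrow> 'n \<Rightarrow> nat \<Rightarrow> complex" where
  "nexp C lam K j m = (if m = 0 then lam j else \<Sum>i\<in>{1..m}. \<Sum>b\<in>UNIV. C i j b * ncol C lam K j (m - i) b)"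

text \<open>Coefficients of exp (- integral of tau), that is, of the power series eta with eta' = -
  eta tau and constant term 1.\<close>

fun nscale :: "(nat \<Rightarrow> complex) \<Rightarrow> nat \<Rightarrow> complex" where
  "nscale \<tau> m = (if m = 0 then 1 else - (\<Sum>i\<in>{..<m}. nscale \<tau> i * \<tau> (m - 1 - i)) / of_nat m)"

declare nscale.simps [simp del]

lemma nscale_unique:
  assumes "fps_deriv \<eta> = - (\<eta> * \<tau>)" "fps_nth \<eta> 0 = 1"
  shows "\<eta> = Abs_fps (nscale (fps_nth \<tau>))"
proof (rule fps_ext)
  fix m show "fps_nth \<eta> m = fps_nth (Abs_fps (nscale (fps_nth \<tau>))) m"
  proof (induction m rule: less_induct)
    case (less m)
    show ?case
    proof (cases m)
      case 0 thus ?thesis using assms(2) by (simp add: nscale.simps)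
    next
      case (Suc m')
      have "of_nat m * fps_nth \<eta> m = fps_nth (fps_deriv \<eta>) m'" by (simp add: Suc)
      also have "\<dots> = - (\<Sum>i\<in>{0..m'}. fps_nth \<eta> i * fps_nth \<tau> (m' - i))" by (simp add: assms(1) fps_mult_nth)
      also have "\<dots> = - (\<Sum>i\<in>{..<m}. nscale (fps_nth \<tau>) i * fps_nth \<tau> (m - 1 - i))"
        using less by (intro arg_cong[where f=uminus] sum.cong) (auto simp: Suc)
      finally have E: "of_nat m * fps_nth \<eta> m = - (\<Sum>i\<in>{..<m}. nscale (fps_nth \<tau>) i * fps_nth \<tau> (m - 1 - i))" .
      have "of_nat m \<noteq> (0::complex)" using Suc by (simp del: of_nat_Suc)
      with E have "fps_nth \<eta> m = - (\<Sum>i\<in>{..<m}. nscale (fps_nth \<tau>) i * fps_nth \<tau> (m - 1 - i)) / of_nat m"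
        by (metis nonzero_mult_div_cancel_left)
      also have "\<dots> = nscale (fps_nth \<tau>) m" unfolding nscale.simps[of _ m] using Suc by simp
      finally show ?thesis by simp
    qed
  qed
qed

lemma nscale_exists: "fps_deriv (Abs_fps (nscale \<tau>)) = - (Abs_fps (nscale \<tau>) * Abs_fps \<tau>)"
proof (rule fps_ext)
  fix m
  have "{..<Suc m} = {0..m}" by auto
  thus "fps_nth (fps_deriv (Abs_fps (nscale \<tau>))) m = fps_nth (- (Abs_fps (nscale \<tau>) * Abs_fps \<tau>)) m"
    by (simp add: fps_mult_nth nscale.simps[of _ "Suc m"] del: of_nat_Suc)
qed

text \<open>One column of the equation at infinity in the coordinate x = 1/z. Since d/dz = - x^2
  d/dx, multiplying by x^k produces the factor x^(k+2), so K will be k + 1; s stands for x^k (Q' +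
  Lambda / z).\<close>

definition column_solution ::
  "('n::finite \<Rightarrow> 'n \<Rightarrow> complex fps) \<Rightarrow> nat \<Rightarrow> 'n \<Rightarrow> ('n \<Rightarrow> complex fps) \<Rightarrow> complex fps \<Rightarrow> bool" where
  "column_solution C K j y s \<longleftrightarrow>
     (\<forall>a. (\<Sum>b\<in>UNIV. C a b * y b) - s * y a = - (fps_X ^ Suc K * fps_deriv (y a)))
     \<and> (\<forall>a. fps_nth (y a) 0 = (if a = j then 1 else 0))"

lemma column_solution_coeff:
  fixes C :: "'n::finite \<Rightarrow> 'n \<Rightarrow> complex fps"
  assumes C0: "\<And>a b. fps_nth (C a b) 0 = (if a = b then lam a else 0)"
  shows "fps_nth ((\<Sum>b\<in>UNIV. C a b * y b) - s * y a + fps_X ^ Suc K * fps_deriv (y a)) m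
    = lam a * fps_nth (y a) m + (\<Sum>l\<in>{1..m}. \<Sum>b\<in>UNIV. fps_nth (C a b) l * fps_nth (y b) (m - l))
      - (\<Sum>l\<in>{0..m}. fps_nth s l * fps_nth (y a) (m - l))
      + (if K < m then of_nat (m - K) * fps_nth (y a) (m - K) else 0)"
proof -
  have "fps_nth (\<Sum>b\<in>UNIV. C a b * y b) m = (\<Sum>l\<in>{0..m}. \<Sum>b\<in>UNIV. fps_nth (C a b) l * fps_nth (y b) (m - l))"
    by (simp add: fps_sum_nth fps_mult_nth) (rule sum.swap)
  also have "\<dots> = (\<Sum>b\<in>UNIV. fps_nth (C a b) 0 * fps_nth (y b) m) + (\<Sum>l\<in>{1..m}. \<Sum>b\<in>UNIV. fps_nth (C a b) l * fps_nth (y b) (m - l))"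
    by (simp add: sum.atLeast_Suc_atMost)
  also have "(\<Sum>b\<in>UNIV. fps_nth (C a b) 0 * fps_nth (y b) m) = lam a * fps_nth (y a) m"
    by (subst sum.mono_neutral_right[of _ "{a}"]) (auto simp: C0)
  finally have 1: "fps_nth (\<Sum>b\<in>UNIV. C a b * y b) m = lam a * fps_nth (y a) m + (\<Sum>l\<in>{1..m}. \<Sum>b\<in>UNIV. fps_nth (C a b) l * fps_nth (y b) (m - l))" .
  have 2: "fps_nth (fps_X ^ Suc K * fps_deriv (y a)) m = (if K < m then of_nat (m - K) * fps_nth (y a) (m - K) else 0)"
    unfolding fps_X_power_mult_nth by (auto simp: Suc_diff_Suc)
  show ?thesis unfolding fps_add_nth fps_sub_nth 1 2 by (simp add: fps_mult_nth)
qed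

lemma column_solution_iff_coeff:
  fixes C :: "'n::finite \<Rightarrow> 'n \<Rightarrow> complex fps"
  assumes C0: "\<And>a b. fps_nth (C a b) 0 = (if a = b then lam a else 0)"
  shows "column_solution C K j y s \<longleftrightarrow>
    (\<forall>a m. lam a * fps_nth (y a) m + (\<Sum>l\<in>{1..m}. \<Sum>b\<in>UNIV. fps_nth (C a b) l * fps_nth (y b) (m - l))
      - (\<Sum>l\<in>{0..m}. fps_nth s l * fps_nth (y a) (m - l))
      + (if K < m then of_nat (m - K) * fps_nth (y a) (m - K) else 0) = 0)
    \<and> (\<forall>a. fps_nth (y a) 0 = (if a = j then 1 else 0))"
proof -
  have "(p - q = - r) \<longleftrightarrow> (\<forall>m. fps_nth (p - q + r) m = 0)" for p q r :: "complex fps"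
    by (simp only: eq_neg_iff_add_eq_0 fps_eq_iff[of "p - q + r" 0] fps_zero_nth)
  thus ?thesis unfolding column_solution_def column_solution_coeff[OF C0, symmetric] by simp
qed

locale formal_column =
  fixes C :: "'n::finite \<Rightarrow> 'n \<Rightarrow> complex fps" and lam :: "'n \<Rightarrow> complex" and K :: nat and j :: 'n
  assumes C0: "\<And>a b. fps_nth (C a b) 0 = (if a = b then lam a else 0)"
    and lam: "inj lam" and K: "K > 0"
begin

abbreviation "Cn \<equiv> (\<lambda>l a b. fps_nth (C a b) l)"
definition "H a = Abs_fps (\<lambda>m. ncol Cn lam K j m a)"
definition "\<sigma> = Abs_fps (nexp Cn lam K j)"
definition "\<eta> = Abs_fps (nscale (\<lambda>m. nexp Cn lam K j (m + Suc K)))"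

lemma lam_neq: "a \<noteq> j \<Longrightarrow> lam a - lam j \<noteq> 0"
  using lam by (auto dest: injD)

lemma normalised_exists: "column_solution C K j H \<sigma>"
proof -
  have main: "lam a * ncol Cn lam K j m a + (\<Sum>l\<in>{1..m}. \<Sum>b\<in>UNIV. Cn l a b * ncol Cn lam K j (m - l) b)
      - (\<Sum>l\<in>{0..m}. nexp Cn lam K j l * ncol Cn lam K j (m - l) a)
      + (if K < m then of_nat (m - K) * ncol Cn lam K j (m - K) a else 0) = 0" for a m
  proof (cases "m = 0")
    case True thus ?thesis by (simp add: nexp_def ncol.simps[of _ _ _ _ 0])
  next
    case m: False
    have split: "(\<Sum>l\<in>{0..m}. nexp Cn lam K j l * ncol Cn lam K j (m - l) a) =
       lam j * ncol Cn lam K j m a + (\<Sum>l\<in>{1..<m}. nexp Cn lam K j l * ncol Cn lam K j (m - l) a) + nexp Cn lam K j m * ncol Cn lam K j 0 a"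
    proof -
      have "{0..m} = insert 0 (insert m {1..<m})" using m by auto
      thus ?thesis using m by (simp add: nexp_def[of _ _ _ _ 0])
    qed
    show ?thesis
    proof (cases "a = j")
      case True
      have "ncol Cn lam K j m' j = (if m' = 0 then 1 else 0)" for m' by (simp add: ncol.simps[of _ _ _ _ m'])
      thus ?thesis unfolding split using True m by (simp add: nexp_def[of _ _ _ _ m] cong: sum.cong_simp)
    next
      case False
      have z: "ncol Cn lam K j 0 a = 0" using False by (simp add: ncol.simps)
      have "(\<Sum>l\<in>{1..<m}. nexp Cn lam K j l * ncol Cn lam K j (m - l) a) =
        (\<Sum>l\<in>{1..<m}. (\<Sum>i\<in>{1..l}. \<Sum>b\<in>UNIV. Cn i j b * ncol Cn lam K j (l - i) b) * ncol Cn lam K j (m - l) a)"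
        by (rule sum.cong) (auto simp: nexp_def)
      moreover have "(lam a - lam j) * ncol Cn lam K j m a =
        - (\<Sum>l\<in>{1..m}. \<Sum>b\<in>UNIV. Cn l a b * ncol Cn lam K j (m - l) b)
        + (\<Sum>l\<in>{1..<m}. (\<Sum>i\<in>{1..l}. \<Sum>b\<in>UNIV. Cn i j b * ncol Cn lam K j (l - i) b) * ncol Cn lam K j (m - l) a)
        - (if K < m then of_nat (m - K) * ncol Cn lam K j (m - K) a else 0)"
        using m False K lam_neq[OF False] by (subst ncol.simps) simp
      ultimately show ?thesis unfolding split z by (simp add: algebra_simps)
    qed
  qed
  show ?thesis
    unfolding column_solution_iff_coeff[OF C0] H_def \<sigma>_def fps_nth_Abs_fps
    by (intro conjI allI main) (simp add: ncol.simps[of _ _ _ _ 0])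
qed

text \<open>Row j determines the exponent because the j-th entry is 1. Every other row a determines
  the coefficient of order m from the lower ones after division by lam a - lam j.\<close>

lemma normalised_unique:
  assumes sol: "column_solution C K j y s" and yj: "y j = 1"
  shows "y = H" "s = \<sigma>"
proof -
  note eq = sol[unfolded column_solution_iff_coeff[OF C0], THEN conjunct1, rule_format]
  note y0 = sol[unfolded column_solution_iff_coeff[OF C0], THEN conjunct2, rule_format]
  have yjn: "fps_nth (y j) m = (if m = 0 then 1 else 0)" for m using yj by simp
  have s0: "fps_nth s 0 = lam j" using eq[of j 0] by (simp add: yjn)
  have s_eq: "fps_nth s m = (\<Sum>l\<in>{1..m}. \<Sum>b\<in>UNIV. Cn l j b * fps_nth (y b) (m - l))" if "m > 0" for m
  proof -
    have "(\<Sum>l\<in>{0..m}. fps_nth s l * fps_nth (y j) (m - l)) = (\<Sum>l\<in>{0..m}. if l = m then fps_nth s l else 0)"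
      by (rule sum.cong) (auto simp: yjn)
    thus ?thesis using eq[of j m] that by (simp add: yjn split: if_splits)
  qed
  have y_eq: "\<forall>a. fps_nth (y a) m = ncol Cn lam K j m a" for m
  proof (induction m rule: less_induct)
    case (less m)
    show ?case
    proof
      fix a
      consider "m = 0" | "m > 0" "a = j" | "m > 0" "a \<noteq> j" by auto
      thus "fps_nth (y a) m = ncol Cn lam K j m a"
      proof cases
        case 1 thus ?thesis by (simp add: y0 ncol.simps)
      next
        case 2 thus ?thesis by (simp add: yjn ncol.simps)
      next
        case 3
        have "{0..m} = insert 0 (insert m {1..<m})" using 3 by auto
        hence split: "(\<Sum>l\<in>{0..m}. fps_nth s l * fps_nth (y a) (m - l)) =
           lam j * fps_nth (y a) m + (\<Sum>l\<in>{1..<m}. fps_nth s l * fps_nth (y a) (m - l))"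
          using 3 by (simp add: s0 y0)
        have A: "(\<Sum>l\<in>{1..m}. \<Sum>b\<in>UNIV. Cn l a b * fps_nth (y b) (m - l)) = (\<Sum>l\<in>{1..m}. \<Sum>b\<in>UNIV. Cn l a b * ncol Cn lam K j (m - l) b)"
          using less by (intro sum.cong) auto
        have B: "(\<Sum>l\<in>{1..<m}. fps_nth s l * fps_nth (y a) (m - l)) =
           (\<Sum>l\<in>{1..<m}. (\<Sum>i\<in>{1..l}. \<Sum>b\<in>UNIV. Cn i j b * ncol Cn lam K j (l - i) b) * ncol Cn lam K j (m - l) a)"
        proof (rule sum.cong[OF refl])
          fix l assume l: "l \<in> {1..<m}"
          have "fps_nth s l = (\<Sum>i\<in>{1..l}. \<Sum>b\<in>UNIV. Cn i j b * ncol Cn lam K j (l - i) b)"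
            using s_eq[of l] l less by (auto intro!: sum.cong)
          thus "fps_nth s l * fps_nth (y a) (m - l) = (\<Sum>i\<in>{1..l}. \<Sum>b\<in>UNIV. Cn i j b * ncol Cn lam K j (l - i) b) * ncol Cn lam K j (m - l) a"
            using less l by auto
        qed
        have D: "(if K < m then of_nat (m - K) * fps_nth (y a) (m - K) else 0) = (if 0 < K \<and> K < m then of_nat (m - K) * ncol Cn lam K j (m - K) a else 0)"
          using less K by auto
        have solve_for: "(x - y) * X = - A + B - D" if "x * X + A - (y * X + B) + D = 0" for x y X A B D :: complex
          using that by algebra
        from eq[of a m, unfolded split A B D]
        have "(lam a - lam j) * fps_nth (y a) m = - (\<Sum>l\<in>{1..m}. \<Sum>b\<in>UNIV. Cn l a b * ncol Cn lam K j (m - l) b)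
         + (\<Sum>l\<in>{1..<m}. (\<Sum>i\<in>{1..l}. \<Sum>b\<in>UNIV. Cn i j b * ncol Cn lam K j (l - i) b) * ncol Cn lam K j (m - l) a)
         - (if 0 < K \<and> K < m then of_nat (m - K) * ncol Cn lam K j (m - K) a else 0)" (is "_ = ?R")
          by (rule solve_for)
        hence "fps_nth (y a) m = ?R / (lam a - lam j)" using lam_neq[OF 3(2)] by (metis nonzero_mult_div_cancel_left)
        also have "\<dots> = ncol Cn lam K j m a" by (subst (4) ncol.simps) (use 3 in simp)
        finally show ?thesis .
      qed
    qed
  qed
  show "y = H" by (rule ext, rule fps_ext) (simp add: H_def y_eq)
  show "s = \<sigma>" by (rule fps_ext) (use s0 s_eq y_eq in \<open>auto simp: \<sigma>_def nexp_def\<close>)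
qed

text \<open>The normalised column has an exponent with infinitely many coefficients. Those of order
  at most K account for Q and Lambda; the rest is x^(K+1) times a power series, which the
  differential term can absorb through the scalar factor \<open>\<eta>\<close>.\<close>

definition "s0 = fps_cutoff (Suc K) \<sigma>"
definition "y0 a = H a * \<eta>"

lemma \<sigma>_split: "\<sigma> = s0 + fps_X ^ Suc K * fps_shift (Suc K) \<sigma>"
  unfolding s0_def using fps_shift_cutoff[of "Suc K" \<sigma>] by (simp add: mult.commute add.commute)

lemma \<eta>_deriv: "fps_deriv \<eta> = - (\<eta> * fps_shift (Suc K) \<sigma>)"
proof -
  have "fps_shift (Suc K) \<sigma> = Abs_fps (\<lambda>m. nexp Cn lam K j (m + Suc K))" by (rule fps_ext) (simp add: \<sigma>_def)
  thus ?thesis unfolding \<eta>_def using nscale_exists by simp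
qed

lemma s0_nth: "fps_nth s0 m = (if m \<le> K then nexp Cn lam K j m else 0)"
  by (simp add: s0_def \<sigma>_def less_Suc_eq_le)

lemma column_exists: "column_solution C K j y0 s0"
proof -
  have "(\<Sum>b\<in>UNIV. C a b * y0 b) - s0 * y0 a = - (fps_X ^ Suc K * fps_deriv (y0 a))" for a
  proof -
    have "(\<Sum>b\<in>UNIV. C a b * y0 b) = (\<Sum>b\<in>UNIV. C a b * H b) * \<eta>" by (simp add: y0_def sum_distrib_right mult.assoc)
    also have "(\<Sum>b\<in>UNIV. C a b * H b) = \<sigma> * H a - fps_X ^ Suc K * fps_deriv (H a)"
      using normalised_exists unfolding column_solution_def by (auto simp: algebra_simps)
    finally have 1: "(\<Sum>b\<in>UNIV. C a b * y0 b) = (\<sigma> * H a - fps_X ^ Suc K * fps_deriv (H a)) * \<eta>" .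
    define \<tau> where "\<tau> = fps_shift (Suc K) \<sigma>"
    have 2: "\<sigma> = s0 + fps_X ^ Suc K * \<tau>" unfolding \<tau>_def by (rule \<sigma>_split)
    have 3: "fps_deriv (y0 a) = fps_deriv (H a) * \<eta> - H a * (\<eta> * \<tau>)"
      unfolding y0_def \<tau>_def by (simp add: \<eta>_deriv)
    show ?thesis unfolding 1 3 unfolding y0_def by (subst 2) algebra
  qed
  moreover have "fps_nth (y0 a) 0 = (if a = j then 1 else 0)" for a
    by (simp add: y0_def H_def \<eta>_def ncol.simps[of _ _ _ _ 0] nscale.simps)
  ultimately show ?thesis by (simp add: column_solution_def)
qed

text \<open>Division by the j-th entry yields the normalised solution and changes the exponent by
  x^(K+1) times the logarithmic derivative of that entry. As s has no terms beyond order K, the tail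
  of \<open>\<sigma>\<close> is this logarithmic derivative up to sign, which forces the entry to be
  \<open>\<eta>\<close>.\<close>

lemma column_unique:
  assumes sol: "column_solution C K j y s" and s: "\<And>m. m > K \<Longrightarrow> fps_nth s m = 0"
  shows "y = y0" "s = s0"
proof -
  have y00: "fps_nth (y j) 0 = 1" using sol by (simp add: column_solution_def)
  define w where "w = inverse (y j)"
  have w: "y j * w = 1" "w * y j = 1" using y00 by (simp_all add: w_def inverse_mult_eq_1 inverse_mult_eq_1')
  define h where "h = (\<lambda>a. y a * w)"
  define g where "g = fps_deriv (y j) * w"
  have dw: "fps_deriv w = - (g * w)"
  proof -
    have "fps_deriv (y j * w) = 0" by (simp add: w)
    hence "w * (y j * fps_deriv w + fps_deriv (y j) * w) = 0" by simp
    hence "(w * y j) * fps_deriv w = - (g * w)" by (simp add: g_def algebra_simps eq_neg_iff_add_eq_0)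
    thus ?thesis by (simp add: w)
  qed
  have "column_solution C K j h (s - fps_X ^ Suc K * g)"
    unfolding column_solution_def
  proof (intro conjI allI)
    fix a
    have "(\<Sum>b\<in>UNIV. C a b * h b) = (\<Sum>b\<in>UNIV. C a b * y b) * w" by (simp add: h_def sum_distrib_right mult.assoc)
    also have "(\<Sum>b\<in>UNIV. C a b * y b) = s * y a - fps_X ^ Suc K * fps_deriv (y a)"
      using sol unfolding column_solution_def by (auto simp: algebra_simps)
    finally have 1: "(\<Sum>b\<in>UNIV. C a b * h b) = (s * y a - fps_X ^ Suc K * fps_deriv (y a)) * w" .
    have 3: "fps_deriv (h a) = fps_deriv (y a) * w - y a * (g * w)" by (simp add: h_def dw)
    show "(\<Sum>b\<in>UNIV. C a b * h b) - (s - fps_X ^ Suc K * g) * h a = - (fps_X ^ Suc K * fps_deriv (h a))"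
      unfolding 1 3 unfolding h_def by algebra
  next
    fix a
    have "fps_nth w 0 = 1" using y00 by (simp add: w_def)
    thus "fps_nth (h a) 0 = (if a = j then 1 else 0)" using sol by (simp add: h_def column_solution_def)
  qed
  moreover have "h j = 1" by (simp add: h_def w)
  ultimately have hH: "h = H" and sg: "s - fps_X ^ Suc K * g = \<sigma>" using normalised_unique by blast+
  have nth_sg: "fps_nth \<sigma> m = fps_nth s m - (if m \<le> K then 0 else fps_nth g (m - Suc K))" for m
    unfolding sg[symmetric] fps_sub_nth fps_X_power_mult_nth by auto
  show ss: "s = s0"
    by (rule fps_ext) (use s nth_sg in \<open>auto simp: s0_def\<close>)
  have "fps_shift (Suc K) \<sigma> = - g"
    by (rule fps_ext) (use s nth_sg in \<open>auto\<close>)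
  hence "fps_deriv (y j) = - (y j * fps_shift (Suc K) \<sigma>)"
  proof -
    have "y j * g = (y j * w) * fps_deriv (y j)" by (simp add: g_def)
    also have "\<dots> = fps_deriv (y j)" using w by simp
    finally show ?thesis using \<open>fps_shift (Suc K) \<sigma> = - g\<close> by simp
  qed
  from nscale_unique[OF this y00] have "y j = Abs_fps (nscale (fps_nth (fps_shift (Suc K) \<sigma>)))" .
  moreover have "fps_nth (fps_shift (Suc K) \<sigma>) = (\<lambda>m. nexp Cn lam K j (m + Suc K))"
    by (rule ext) (simp add: \<sigma>_def)
  ultimately have yj: "y j = \<eta>" by (simp only: \<eta>_def)
  show "y = y0"
  proof
    fix a
    have "y a = h a * y j" by (simp add: h_def mult.assoc w)
    thus "y a = y0 a" by (simp add: hH yj y0_def)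
  qed
qed

end

text \<open>The recursion divides only by differences of the fixed numbers \<open>lam\<close>, so
  each coefficient is a polynomial in the coefficients of the system.\<close>

lemma holo_on_ncol:
  assumes "\<And>l a b. holo_on S (\<lambda>q. C q l a b)"
  shows "holo_on S (\<lambda>q. ncol (C q) lam K j m a)"
proof (induction m arbitrary: a rule: less_induct)
  case (less m)
  have c: "holo_on S (\<lambda>q. if 0 < K \<and> K < m then of_nat (m - K) * ncol (C q) lam K j (m - K) a else 0)"
    by (cases "0 < K \<and> K < m") (auto intro!: holo_on_mult holo_on_const less)
  show ?case
    by (subst ncol.simps, unfold divide_inverse, intro c holo_on_if holo_on_mult holo_on_add holo_on_diff
        holo_on_minus holo_on_sum holo_on_const less assms) auto
qed

lemma holo_on_nexp:
  assumes "\<And>l a b. holo_on S (\<lambda>q. C q l a b)"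
  shows "holo_on S (\<lambda>q. nexp (C q) lam K j m)"
  unfolding nexp_def by (intro holo_intros assms holo_on_ncol)

lemma holo_on_nscale:
  assumes "\<And>l. holo_on S (\<lambda>q. \<tau> q l)"
  shows "holo_on S (\<lambda>q. nscale (\<tau> q) m)"
proof (induction m rule: less_induct)
  case (less m)
  show ?case
    by (subst nscale.simps, unfold divide_inverse, intro holo_intros less assms) auto
qed

section \<open>Index positions and products with diagonal matrices\<close>

lemma sum_indicator_unique:
  fixes f :: "'a::finite \<Rightarrow> 'b::semiring_1"
  assumes "\<And>b. P b \<longleftrightarrow> b = b0"
  shows "(\<Sum>b\<in>UNIV. (if P b then 1 else 0) * f b) = f b0"
  unfolding assms by (subst sum.mono_neutral_right[of _ "{b0}"]) auto

lemma pos_inj: "pos (a :: 'n::{finite,wellorder}) = pos b \<longleftrightarrow> a = b"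
  using bij_betw_pos[where 'a='n] by (auto simp: bij_betw_def inj_def)

lemma pos_less: "pos (a :: 'n::{finite,wellorder}) < CARD('n)"
  using bij_betw_pos[where 'a='n] by (auto simp: bij_betw_def)

lemma pos_surj: "i < CARD('n::{finite,wellorder}) \<Longrightarrow> \<exists>a :: 'n. pos a = i"
  using bij_betw_pos[where 'a='n] unfolding bij_betw_def by (metis imageE lessThan_iff)

lemma diag_mult_left: "(diag_mat v ** M) $ i $ j = v $ i * (M :: 'a::comm_ring_1^'n^'n) $ i $ j"
proof -
  have "(\<Sum>b\<in>UNIV. (if i = b then v $ i else 0) * M $ b $ j) = v $ i * M $ i $ j"
    by (subst sum.mono_neutral_right[of _ "{i}"]) auto
  thus ?thesis by (simp add: matrix_matrix_mult_def diag_mat_def)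
qed

lemma diag_mult_right: "((M :: 'a::comm_ring_1^'n^'n) ** diag_mat v) $ i $ j = M $ i $ j * v $ j"
proof -
  have "(\<Sum>b\<in>UNIV. M $ i $ b * (if b = j then v $ b else 0)) = M $ i $ j * v $ j"
    by (subst sum.mono_neutral_right[of _ "{j}"]) auto
  thus ?thesis by (simp add: matrix_matrix_mult_def diag_mat_def)
qed

lemma matrix_mult_add_left: "(A + B) ** (M :: 'a::semiring_1^'n^'n) = A ** M + B ** M"
  by (simp add: vec_eq_iff matrix_matrix_mult_def distrib_right sum.distrib)

lemma sum_mult_cancel_field:
  fixes X :: "'a::field"
  assumes "X \<noteq> 0"
  shows "X * ((\<Sum>b\<in>I. p b / X * u b) - y * (s / X)) = (\<Sum>b\<in>I. p b * u b) - y * s"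
  using assms by (simp add: right_diff_distrib sum_distrib_left)

section \<open>The oper connection near infinity and its formal solution\<close>

locale oper_setup =
  fixes k :: nat and f0 :: "'n::{finite,wellorder} cmat" and lam :: "'n cvec"
    and TM :: "'m::{finite,wellorder} itself"
  assumes n2: "CARD('n) \<ge> 2" and k1: "k \<ge> 1" and card_m: "CARD('m) = k * CARD('n) - 1"
    and inv_f0: "invertible f0"
    and diag: "matrix_inv f0 ** cyclic_perm_matrix ** f0 = diag_mat lam"
begin

abbreviation "fi \<equiv> matrix_inv f0"

lemma f0_fi: "f0 ** fi = mat 1" "fi ** f0 = mat 1"
  using matrix_inv_mult[OF inv_f0] by auto

definition "first = (SOME a :: 'n. pos a = 0)"

lemma pos_first: "pos first = 0"
  unfolding first_def using pos_surj[of 0, where 'n='n] n2 by (intro someI_ex[of "\<lambda>a. pos a = 0"]) auto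

lemma cyclic_f0: "cyclic_perm_matrix ** f0 = f0 ** diag_mat lam"
  using diag f0_fi by (metis matrix_mul_assoc matrix_mul_lid)

lemma f0_diag: "(f0 ** diag_mat lam) $ a $ i = f0 $ a $ i * lam $ i"
proof -
  have "(\<Sum>b\<in>UNIV. f0 $ a $ b * (if b = i then lam $ b else 0)) = f0 $ a $ i * lam $ i"
    by (subst sum.mono_neutral_right[of _ "{i}"]) auto
  thus ?thesis by (simp add: matrix_matrix_mult_def diag_mat_def)
qed

lemma f0_next:
  assumes "pos b = pos a + 1 \<or> (pos a = CARD('n) - 1 \<and> pos b = 0)"
  shows "f0 $ b $ i = f0 $ a $ i * lam $ i"
proof -
  have iff: "(pos c = pos a + 1 \<or> (pos a = CARD('n) - 1 \<and> pos c = 0)) \<longleftrightarrow> c = b" for c :: 'n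
    using assms pos_less[of b] pos_less[of c] n2 by (auto simp flip: pos_inj)
  have "(cyclic_perm_matrix ** f0) $ a $ i = (\<Sum>c\<in>UNIV. (if pos c = pos a + 1 \<or> (pos a = CARD('n) - 1 \<and> pos c = 0) then 1 else 0) * f0 $ c $ i)"
    by (simp add: matrix_matrix_mult_def cyclic_perm_matrix_def)
  also have "\<dots> = f0 $ b $ i" by (rule sum_indicator_unique[OF iff])
  finally show ?thesis using cyclic_f0 f0_diag by metis
qed

text \<open>The columns of \<open>f0\<close> are eigenvectors of the cyclic shift, so their entries
  form geometric progressions in the eigenvalue.\<close>

lemma f0_power: "f0 $ a $ i = lam $ i ^ pos a * f0 $ first $ i"
proof (induction "pos a" arbitrary: a)
  case 0
  hence "a = first" using pos_first pos_inj[of a first] by simp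
  thus ?case by (simp add: pos_first)
next
  case (Suc p)
  obtain b :: 'n where b: "pos b = p" using pos_surj[of p, where 'n='n] pos_less[of a] Suc(2) by auto
  have "f0 $ a $ i = f0 $ b $ i * lam $ i" by (rule f0_next) (use b Suc in auto)
  thus ?case using Suc(1)[of b] b unfolding Suc(2)[symmetric] by simp
qed

lemma f0_first_nz: "f0 $ first $ i \<noteq> 0"
proof
  assume 0: "f0 $ first $ i = 0"
  have "(fi ** f0) $ i $ i = (\<Sum>a\<in>UNIV. fi $ i $ a * f0 $ a $ i)" by (simp add: matrix_matrix_mult_def)
  also have "\<dots> = 0" by (subst f0_power) (simp add: 0)
  finally show False by (simp add: f0_fi mat_def)
qed

lemma lam_power: "lam $ i ^ CARD('n) = 1"
proof -
  obtain a :: 'n where a: "pos a = CARD('n) - 1" using pos_surj[of "CARD('n) - 1", where 'n='n] n2 by auto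
  have "f0 $ first $ i = f0 $ a $ i * lam $ i" by (rule f0_next) (simp add: a pos_first)
  also have "\<dots> = lam $ i ^ Suc (CARD('n) - 1) * f0 $ first $ i"
    by (simp only: f0_power[of a i] a power_Suc mult_ac)
  also have "Suc (CARD('n) - 1) = CARD('n)" using n2 by linarith
  finally have "1 * f0 $ first $ i = lam $ i ^ CARD('n) * f0 $ first $ i" by (simp only: mult_1)
  thus ?thesis using f0_first_nz[of i] by (metis mult_right_cancel)
qed

lemma lam_nz: "lam $ i \<noteq> 0"
  using lam_power[of i] n2 by (auto simp: power_0_left)

text \<open>Two columns of \<open>f0\<close> with the same eigenvalue would be proportional.\<close>

lemma lam_inj: "inj (($) lam)"
proof (rule injI, rule ccontr)
  fix i j assume eq: "lam $ i = lam $ j" and ne: "i \<noteq> j"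
  have "f0 $ a $ j * f0 $ first $ i = f0 $ a $ i * f0 $ first $ j" for a
    by (subst (1 3) f0_power) (simp add: eq)
  hence "(\<Sum>a\<in>UNIV. fi $ i $ a * (f0 $ a $ j * f0 $ first $ i)) = (\<Sum>a\<in>UNIV. fi $ i $ a * (f0 $ a $ i * f0 $ first $ j))"
    by simp
  hence "(fi ** f0) $ i $ j * f0 $ first $ i = (fi ** f0) $ i $ i * f0 $ first $ j"
    by (simp add: matrix_matrix_mult_def sum_distrib_right mult.assoc)
  thus False using ne f0_first_nz[of j] by (simp add: f0_fi mat_def)
qed

lemma pos_m: "pos (j :: 'm) + 2 \<le> k * CARD('n)"
  using pos_less[of j] card_m by simp

text \<open>The matrix x^k B in the coordinate x = 1/z, which is polynomial: the gauge
  transformation scales the superdiagonal to 1 and the corner to p(z) / z^(kn), while its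
  logarithmic derivative enters the diagonal at order x^(k+1).\<close>

definition bs :: "'m cvec \<Rightarrow> 'n \<Rightarrow> 'n \<Rightarrow> complex poly" where
  "bs c a b = (if pos b = pos a + 1 then 1 else 0)
     + (if pos a = CARD('n) - 1 \<and> pos b = 0 then 1 + (\<Sum>j\<in>UNIV. monom (c $ j) (k * CARD('n) - pos j)) else 0)
     + (if a = b then monom (of_nat ((CARD('n) - pos a) * k)) (k + 1) else 0)"

abbreviation "Bm c \<equiv> assoc_matrix k (oper_of_coeffs k (c :: 'm cvec) :: complex \<Rightarrow> 'n cmat)"

definition "ginv z = (diag_mat (\<chi> i. inverse (z ^ ((CARD('n) - pos i) * k))) :: 'n cmat)"
definition "dgauge z = (\<chi> i j. deriv (\<lambda>u. (gauge k u :: 'n cmat) $ i $ j) z)"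

lemma gauge_ginv:
  assumes "z \<noteq> 0"
  shows "gauge k z ** ginv z = mat 1"
  unfolding vec_eq_iff gauge_def diag_mult_left using assms by (simp add: ginv_def diag_mat_def mat_def)

lemma gauge_inverse:
  assumes "z \<noteq> 0"
  shows "matrix_inv (gauge k z) = ginv z" "invertible (gauge k z :: 'n cmat)" "ginv z ** gauge k z = mat 1"
  using left_inverse_right_inverse_matrix[OF gauge_ginv[OF assms]] gauge_ginv[OF assms] matrix_inv_mult by metis+

lemma gauge_deriv: "has_matrix_derivative (gauge k) (dgauge z) z"
  unfolding has_matrix_derivative_def
proof (intro allI)
  fix i j
  have "(\<lambda>u. (gauge k u :: 'n cmat) $ i $ j) field_differentiable (at z)"
    by (cases "i = j") (auto simp: gauge_def diag_mat_def intro: field_differentiable_power field_differentiable_ident)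
  thus "((\<lambda>u. (gauge k u :: 'n cmat) $ i $ j) has_field_derivative dgauge z $ i $ j) (at z)"
    by (simp add: dgauge_def field_differentiable_derivI)
qed

lemma dgauge_eq: "dgauge z $ i $ j = (if i = j then of_nat ((CARD('n) - pos i) * k) * z ^ ((CARD('n) - pos i) * k - 1) else 0)"
proof -
  have "((\<lambda>u. (gauge k u :: 'n cmat) $ i $ j) has_field_derivative
     (if i = j then of_nat ((CARD('n) - pos i) * k) * z ^ ((CARD('n) - pos i) * k - 1) else 0)) (at z)"
    by (auto simp: gauge_def diag_mat_def intro!: derivative_eq_intros)
  thus ?thesis by (simp add: dgauge_def DERIV_imp_deriv)
qed

lemma Bm_gauge:
  assumes "z \<noteq> 0"
  shows "Bm c z ** gauge k z = dgauge z + gauge k z ** oper_of_coeffs k c z"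
proof -
  have "Bm c z = dgauge z ** ginv z + gauge k z ** oper_of_coeffs k c z ** ginv z"
    by (simp add: assoc_matrix_def gauge_inverse(1)[OF assms] dgauge_def)
  thus ?thesis
    by (simp add: matrix_mult_add_left gauge_inverse(3)[OF assms] flip: matrix_mul_assoc)
qed

lemma Bm_eq:
  assumes z: "z \<noteq> 0"
  shows "Bm c z $ a $ b = z ^ k * poly (bs c a b) (1 / z)"
proof -
  let ?n = "CARD('n)"
  have 1: "(dgauge z ** ginv z) $ a $ b = z ^ k * poly (if a = b then monom (of_nat ((?n - pos a) * k)) (k + 1) else 0) (1 / z)"
  proof -
    have e: "(?n - pos a) * k > 0" using pos_less[of a] k1 by simp
    define N where "N = (?n - pos a) * k"
    have "z ^ N = z * z ^ (N - 1)" using e by (simp add: N_def flip: power_Suc)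
    moreover have "z ^ (N - 1) \<noteq> 0" using z by simp
    ultimately have "of_nat N * z ^ (N - 1) * inverse (z ^ N) = z ^ k * (of_nat N * (1 / z) ^ (k + 1))"
      using z by (simp add: power_one_over field_simps)
    thus ?thesis unfolding ginv_def diag_mult_right dgauge_eq
      by (cases "a = b") (simp_all add: N_def poly_monom)
  qed
  have conj: "(gauge k z ** A ** ginv z) $ a $ b = z ^ ((?n - pos a) * k) * A $ a $ b * inverse (z ^ ((?n - pos b) * k))" for A :: "'n cmat"
    unfolding ginv_def diag_mult_right unfolding gauge_def diag_mult_left by simp
  have 2: "(gauge k z ** oper_of_coeffs k c z ** ginv z) $ a $ b = z ^ k * poly ((if pos b = pos a + 1 then 1 else 0)
     + (if pos a = ?n - 1 \<and> pos b = 0 then 1 + (\<Sum>j\<in>UNIV. monom (c $ j) (k * ?n - pos j)) else 0)) (1 / z)"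
  proof -
    consider "pos b = pos a + 1" | "pos a = ?n - 1" "pos b = 0" "pos b \<noteq> pos a + 1" | "pos b \<noteq> pos a + 1" "\<not> (pos a = ?n - 1 \<and> pos b = 0)"
      by (cases "pos b = pos a + 1"; cases "pos a = ?n - 1 \<and> pos b = 0") auto
    thus ?thesis
    proof cases
      case 1
      have "?n - pos a = Suc (?n - pos b)" using 1 pos_less[of b] by simp
      hence "(?n - pos a) * k = k + (?n - pos b) * k" by (simp only: mult_Suc)
      thus ?thesis unfolding conj using 1 z by (simp add: oper_of_coeffs_def oper_matrix_def power_add)
    next
      case 2
      have e: "poly (monom 1 (k * ?n) + (\<Sum>j\<in>UNIV. monom (c $ j) (pos j))) z * inverse (z ^ (k * ?n))
         = poly (1 + (\<Sum>j\<in>UNIV. monom (c $ j) (k * ?n - pos j))) (1 / z)"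
      proof -
        have "z ^ pos j * inverse (z ^ (k * ?n)) = (1 / z) ^ (k * ?n - pos j)" for j :: 'm
        proof -
          have "z ^ (k * ?n) = z ^ pos j * z ^ (k * ?n - pos j)" using pos_m[of j] by (simp flip: power_add)
          thus ?thesis using z by (simp add: field_simps)
        qed
        thus ?thesis using z by (simp add: poly_sum poly_monom distrib_right sum_distrib_right mult.assoc)
      qed
      have "(?n - pos a) * k = k" using 2 n2 by simp
      thus ?thesis unfolding conj using 2 z e by (simp add: oper_of_coeffs_def oper_matrix_def mult.assoc mult.commute[of k ?n])
    next
      case 3 thus ?thesis unfolding conj by (auto simp: oper_of_coeffs_def oper_matrix_def)
    qed
  qed
  have "Bm c z = dgauge z ** ginv z + gauge k z ** oper_of_coeffs k c z ** ginv z"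
    by (simp add: assoc_matrix_def gauge_inverse(1)[OF z] dgauge_def)
  thus ?thesis by (simp add: 1 2 bs_def distrib_left)
qed

lemma bs_0: "coeff (bs c a b) 0 = (cyclic_perm_matrix :: 'n cmat) $ a $ b"
proof -
  have "coeff (\<Sum>j\<in>UNIV. monom (c $ j) (k * CARD('n) - pos j)) 0 = 0"
    unfolding coeff_sum
  proof (intro sum.neutral ballI)
    fix j :: 'm show "coeff (monom (c $ j) (k * CARD('n) - pos j)) 0 = 0"
      using pos_m[of j] by (auto simp: coeff_monom)
  qed
  thus ?thesis using n2 by (auto simp: bs_def cyclic_perm_matrix_def coeff_monom)
qed

text \<open>Two causes: p has no term of degree d - 1, so the corner starts with 1 + O(x^2), and the
  gauge term has order k + 1 >= 2. This is the source of the constant second coefficient of the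
  exponent.\<close>

lemma bs_1: "coeff (bs c a b) 1 = 0"
proof -
  have "coeff (\<Sum>j\<in>UNIV. monom (c $ j) (k * CARD('n) - pos j)) 1 = 0"
    unfolding coeff_sum
  proof (intro sum.neutral ballI)
    fix j :: 'm show "coeff (monom (c $ j) (k * CARD('n) - pos j)) 1 = 0"
      using pos_m[of j] by (auto simp: coeff_monom)
  qed
  moreover have "coeff (if P then 1 else 0 :: complex poly) 1 = 0" for P by simp
  moreover have "coeff (if P then monom x (k + 1) else 0 :: complex poly) 1 = 0" for P x
    using k1 by (cases P) (simp_all add: coeff_monom)
  ultimately show ?thesis by (cases "pos a = CARD('n) - 1 \<and> pos b = 0") (simp_all only: bs_def coeff_add if_True if_False coeff_0 coeff_1 add_0_right, simp_all)
qed

lemma bs_degree: "degree (bs c a b) \<le> k * CARD('n) + k + 1"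
proof (rule degree_le, intro allI impI)
  fix i assume i: "k * CARD('n) + k + 1 < i"
  have "coeff (\<Sum>j\<in>UNIV. monom (c $ j) (k * CARD('n) - pos j)) i = 0"
    unfolding coeff_sum
  proof (intro sum.neutral ballI)
    fix j :: 'm show "coeff (monom (c $ j) (k * CARD('n) - pos j)) i = 0"
      using i by (auto simp: coeff_monom)
  qed
  moreover have "coeff (if P then 1 else 0 :: complex poly) i = 0" for P using i by simp
  moreover have "coeff (if P then monom x (k + 1) else 0 :: complex poly) i = 0" for P x
    using i by (cases P) (simp_all add: coeff_monom)
  ultimately show "coeff (bs c a b) i = 0" using i
    by (cases "pos a = CARD('n) - 1 \<and> pos b = 0") (simp_all only: bs_def coeff_add if_True if_False coeff_0 coeff_1 add_0_right, simp_all)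
qed

lemma holo_on_bs_coeff: "holo_on S (\<lambda>q. coeff (bs (fst q) a b) l)"
proof -
  have "holo_on S (\<lambda>q. coeff (monom (fst q $ j) e) l)" for j :: 'm and e
    unfolding coeff_monom by (intro holo_on_if holo_on_fst holo_on_const)
  hence "holo_on S (\<lambda>q. coeff (if P then 1 + (\<Sum>j\<in>UNIV. monom (fst q $ j) (e j)) else 0) l)" for P and e :: "'m \<Rightarrow> nat"
    by (cases P) (auto simp: coeff_sum intro!: holo_on_add holo_on_sum holo_on_const)
  thus ?thesis unfolding bs_def coeff_add by (intro holo_on_add holo_on_const)
qed

definition C :: "'m cvec \<Rightarrow> 'n \<Rightarrow> 'n \<Rightarrow> complex fps" where
  "C c a b = (\<Sum>p\<in>UNIV. \<Sum>q\<in>UNIV. fps_const (fi $ a $ p) * fps_of_poly (bs c p q) * fps_const (f0 $ q $ b))"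

lemma C_nth: "fps_nth (C c a b) l = (\<Sum>p\<in>UNIV. \<Sum>q\<in>UNIV. fi $ a $ p * coeff (bs c p q) l * f0 $ q $ b)"
  by (simp add: C_def fps_sum_nth)

lemma C_0: "fps_nth (C c a b) 0 = (if a = b then lam $ a else 0)"
proof -
  have "fps_nth (C c a b) 0 = (fi ** cyclic_perm_matrix ** f0) $ a $ b"
    unfolding C_nth bs_0 by (simp add: matrix_matrix_mult_def sum_distrib_right) (rule sum.swap)
  thus ?thesis by (simp add: diag diag_mat_def)
qed

lemma C_1: "fps_nth (C c a b) 1 = 0"
  unfolding C_nth bs_1 by simp

lemma holo_on_C: "holo_on S (\<lambda>q. fps_nth (C (fst q) a b) l)"
  unfolding C_nth by (intro holo_intros holo_on_bs_coeff)

sublocale fc: formal_column "C c" "($) lam" "Suc k" j for c j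
  by unfold_locales (use C_0 lam_inj in auto)

text \<open>The exponent x^k (q'(1/x) + l x) as a polynomial in x; the exponent of formal monodromy
  becomes the coefficient of x^(k+1).\<close>

definition sp :: "complex \<Rightarrow> complex poly \<Rightarrow> complex poly" where
  "sp l q = (\<Sum>i\<le>k. monom (coeff (pderiv q) i) (k - i)) + monom l (Suc k)"

lemma sp_coeff: "coeff (sp l q) i = (if i \<le> k then of_nat (k - i + 1) * coeff q (k - i + 1) else if i = Suc k then l else 0)"
proof -
  have "coeff (\<Sum>i\<le>k. monom (coeff (pderiv q) i) (k - i)) i = (\<Sum>i'\<le>k. if i' = k - i \<and> i \<le> k then coeff (pderiv q) i' else 0)"
    unfolding coeff_sum coeff_monom by (intro sum.cong) auto
  also have "\<dots> = (if i \<le> k then coeff (pderiv q) (k - i) else 0)" by (simp add: sum.delta)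
  finally show ?thesis by (simp add: sp_def coeff_monom coeff_pderiv)
qed

lemma sp_poly:
  assumes "x \<noteq> 0" "degree q = k + 1"
  shows "poly (pderiv q) (1 / x) + l * x = poly (sp l q) x / x ^ k"
proof -
  have "poly (pderiv q) (1 / x) = (\<Sum>i\<le>k. coeff (pderiv q) i * (1 / x) ^ i)"
    using assms(2) by (subst poly_altdef) (simp add: degree_pderiv)
  also have "\<dots> = (\<Sum>i\<le>k. coeff (pderiv q) i * x ^ (k - i)) / x ^ k"
    unfolding sum_divide_distrib
  proof (rule sum.cong[OF refl])
    fix i assume "i \<in> {..k}"
    hence "x ^ k = x ^ i * x ^ (k - i)" by (simp flip: power_add)
    thus "coeff (pderiv q) i * (1 / x) ^ i = coeff (pderiv q) i * x ^ (k - i) / x ^ k"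
      using assms(1) by (simp add: field_simps)
  qed
  finally show ?thesis using assms(1) by (simp add: sp_def poly_sum poly_monom add_divide_distrib)
qed

lemma laurent_poly:
  assumes "\<And>x. x \<noteq> 0 \<Longrightarrow> f x = poly p x / x ^ k"
  shows "laurent_expansion f 0 = fps_to_fls (fps_of_poly p) / fls_X ^ k"
proof (rule laurent_expansion_0_eqI)
  have "(\<lambda>x. poly p x) has_fps_expansion fps_of_poly p"
    by (simp add: has_fps_expansion_def)
  hence "(\<lambda>x. poly p x / x ^ k) has_laurent_expansion fps_to_fls (fps_of_poly p) / fls_X ^ k"
    by (intro laurent_expansion_intros has_laurent_expansion_fps)
  moreover have "\<forall>\<^sub>F x in at 0. f x = poly p x / x ^ k"
    using assms by (auto simp: eventually_at_filter)
  ultimately show "f has_laurent_expansion fps_to_fls (fps_of_poly p) / fls_X ^ k"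
    using has_laurent_expansion_cong by metis
qed

lemma fps_to_fls_sum: "fps_to_fls (\<Sum>i\<in>I. f i) = (\<Sum>i\<in>I. fps_to_fls (f i :: complex fps))"
  by (induction I rule: infinite_finite_induct) (simp_all add: fps_to_fls_plus)

text \<open>The formal equation multiplied by x^k, which clears the negative powers and leaves an
  identity of power series.\<close>

definition formal_eq where
  "formal_eq c Y L Q \<longleftrightarrow> (\<forall>a j. (\<Sum>b\<in>UNIV. fps_of_poly (bs c a b) * (Y :: ((complex fps, 'n) vec, 'n) vec) $ b $ j) - Y $ a $ j * fps_of_poly (sp (L $ j) (Q $ j))
      = - (fps_X ^ (k + 2) * fps_deriv (Y $ a $ j)))"

lemma formal_solution_iff:
  "formal_solution k f0 lam (Bm c) Y L Q \<longleftrightarrow>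
     (\<forall>i j. fps_nth (Y $ i $ j) 0 = f0 $ i $ j) \<and>
     (\<forall>i. degree (Q $ i) = k + 1 \<and> coeff (Q $ i) 0 = 0 \<and> coeff (Q $ i) (k + 1) = lam $ i / of_nat (k + 1)) \<and>
     formal_eq c Y L Q"
proof -
  have "((\<chi> i j. - (fls_X ^ 2) * fls_deriv ((\<chi> i j. fps_to_fls (Y $ i $ j)) $ i $ j)) =
      (\<chi> i j. laurent_expansion (\<lambda>x. Bm c (1 / x) $ i $ j) 0) ** (\<chi> i j. fps_to_fls (Y $ i $ j)) -
      (\<chi> i j. fps_to_fls (Y $ i $ j)) ** diag_mat (\<chi> i. laurent_expansion (\<lambda>x. poly (pderiv (Q $ i)) (1 / x) + L $ i * x) 0))
      \<longleftrightarrow> formal_eq c Y L Q" (is "?lhs \<longleftrightarrow> _") if deg: "\<forall>i. degree (Q $ i) = k + 1"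
  proof -
    have 1: "laurent_expansion (\<lambda>x. Bm c (1 / x) $ i $ j) 0 = fps_to_fls (fps_of_poly (bs c i j)) / fls_X ^ k" for i j
      by (rule laurent_poly) (simp add: Bm_eq power_one_over)
    have 2: "laurent_expansion (\<lambda>x. poly (pderiv (Q $ i)) (1 / x) + L $ i * x) 0 = fps_to_fls (fps_of_poly (sp (L $ i) (Q $ i))) / fls_X ^ k" for i
      by (rule laurent_poly, rule sp_poly) (use deg in auto)
    have 3: "((\<chi> i j. fps_to_fls (Y $ i $ j)) ** diag_mat v) $ a $ j = fps_to_fls (Y $ a $ j) * v $ j" for v :: "(complex fls, 'n) vec" and a j
    proof -
      have "(\<Sum>b\<in>UNIV. fps_to_fls (Y $ a $ b) * (if b = j then v $ b else 0)) = fps_to_fls (Y $ a $ j) * v $ j"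
        by (subst sum.mono_neutral_right[of _ "{j}"]) auto
      thus ?thesis by (simp add: matrix_matrix_mult_def diag_mat_def)
    qed
    have 4: "(- (fls_X ^ 2) * fls_deriv (fps_to_fls y) = (\<Sum>b\<in>UNIV. fps_to_fls (p b) / fls_X ^ k * fps_to_fls (u b)) - fps_to_fls y * (fps_to_fls s / fls_X ^ k))
       \<longleftrightarrow> (\<Sum>b\<in>UNIV. p b * u b) - y * s = - (fps_X ^ (k + 2) * fps_deriv y)"
      for y s :: "complex fps" and p u :: "'n \<Rightarrow> complex fps"
    proof -
      have nz: "(fls_X :: complex fls) ^ k \<noteq> 0" by simp
      have "(- (fls_X ^ 2) * fls_deriv (fps_to_fls y) = (\<Sum>b\<in>UNIV. fps_to_fls (p b) / fls_X ^ k * fps_to_fls (u b)) - fps_to_fls y * (fps_to_fls s / fls_X ^ k))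
        \<longleftrightarrow> fls_X ^ k * (- (fls_X ^ 2) * fls_deriv (fps_to_fls y)) = fls_X ^ k * ((\<Sum>b\<in>UNIV. fps_to_fls (p b) / fls_X ^ k * fps_to_fls (u b)) - fps_to_fls y * (fps_to_fls s / fls_X ^ k))"
        by (rule mult_left_cancel[OF nz, symmetric])
      also have "fls_X ^ k * ((\<Sum>b\<in>UNIV. fps_to_fls (p b) / fls_X ^ k * fps_to_fls (u b)) - fps_to_fls y * (fps_to_fls s / fls_X ^ k))
        = fps_to_fls ((\<Sum>b\<in>UNIV. p b * u b) - y * s)"
        unfolding sum_mult_cancel_field[OF nz] by (simp add: fps_to_fls_sum fps_to_fls_minus fls_times_fps_to_fls)
      also have "fls_X ^ k * (- (fls_X ^ 2) * fls_deriv (fps_to_fls y)) = fps_to_fls (- (fps_X ^ (k + 2) * fps_deriv y))"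
        by (simp add: fls_times_fps_to_fls fps_to_fls_power power_add power2_eq_square fls_deriv_fps_to_fls)
      finally show ?thesis unfolding fps_to_fls_eq_iff by (rule trans[OF _ eq_commute])
    qed
    show ?thesis
      unfolding vec_eq_iff formal_eq_def vector_minus_component 3 vec_lambda_beta 2
      unfolding matrix_matrix_mult_def vec_lambda_beta 1 4 ..
  qed
  thus ?thesis unfolding formal_solution_def Let_def by blast
qed


section \<open>Reduction of the formal equation to single columns\<close>

definition "F0m = (\<chi> a b. fps_const (f0 $ a $ b))"
definition "Fim = (\<chi> a b. fps_const (fi $ a $ b))"
definition "BSm c = (\<chi> a b. fps_of_poly (bs c a b))"
definition "CCm c = (\<chi> a b. C c a b)"
definition XD :: "((complex fps, 'n) vec, 'n) vec \<Rightarrow> ((complex fps, 'n) vec, 'n) vec" where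
  "XD M = (\<chi> a j. fps_X ^ Suc (Suc k) * fps_deriv (M $ a $ j))"

lemma F0m_Fim: "F0m ** Fim = mat 1" "Fim ** F0m = mat 1"
proof -
  have gen: "(\<chi> a b. fps_const (A $ a $ b)) ** (\<chi> a b. fps_const (B $ a $ b)) = (mat 1 :: ((complex fps, 'n) vec, 'n) vec)"
    if AB: "A ** B = mat 1" for A B :: "'n cmat"
  proof -
    have "(\<Sum>b\<in>UNIV. fps_const (A $ a $ b) * fps_const (B $ b $ e)) = (if a = e then 1 else 0)" for a e
    proof -
      have "(\<Sum>b\<in>UNIV. fps_const (A $ a $ b) * fps_const (B $ b $ e)) = fps_const ((A ** B) $ a $ e)"
        by (rule fps_ext) (simp add: fps_sum_nth matrix_matrix_mult_def)
      thus ?thesis by (simp add: AB mat_def)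
    qed
    thus ?thesis by (simp add: vec_eq_iff matrix_matrix_mult_def mat_def)
  qed
  show "F0m ** Fim = mat 1" "Fim ** F0m = mat 1" unfolding F0m_def Fim_def using gen f0_fi by auto
qed

lemma CCm_eq: "CCm c = Fim ** BSm c ** F0m"
  by (simp add: vec_eq_iff CCm_def C_def matrix_matrix_mult_def Fim_def BSm_def F0m_def sum_distrib_right)
    (intro allI sum.swap)

lemma XD_const: "XD (Fim ** M) = Fim ** XD M" "XD (F0m ** M) = F0m ** XD M"
  by (simp_all add: vec_eq_iff XD_def matrix_matrix_mult_def Fim_def F0m_def sum_distrib_left fps_deriv_sum mult_ac)

lemma matrix_mult_diff: "A ** (B - D) = A ** B - A ** (D :: ((complex fps, 'n) vec, 'n) vec)"
  "A ** (- D) = - (A ** (D :: ((complex fps, 'n) vec, 'n) vec))"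
  by (simp_all add: vec_eq_iff matrix_matrix_mult_def right_diff_distrib sum_subtractf sum_negf)

lemma formal_eq_matrix:
  "formal_eq c Y L Q \<longleftrightarrow> BSm c ** Y - Y ** diag_mat (\<chi> j. fps_of_poly (sp (L $ j) (Q $ j))) = - XD Y"
  unfolding formal_eq_def vec_eq_iff vector_minus_component diag_mult_right
  by (simp add: XD_def matrix_matrix_mult_def BSm_def)

lemma column_matrix:
  "(\<forall>j. column_solution (C c) (Suc k) j (\<lambda>b. y $ b $ j) (s $ j)) \<longleftrightarrow>
     CCm c ** y - y ** diag_mat s = - XD y \<and> (\<forall>a j. fps_nth (y $ a $ j) 0 = (if a = j then 1 else 0))"
proof -
  have "CCm c ** y - y ** diag_mat s = - XD y \<longleftrightarrow>
    (\<forall>j a. (\<Sum>b\<in>UNIV. C c a b * y $ b $ j) - s $ j * y $ a $ j = - (fps_X ^ Suc (Suc k) * fps_deriv (y $ a $ j)))"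
    unfolding vec_eq_iff vector_minus_component diag_mult_right
    by (simp add: XD_def matrix_matrix_mult_def CCm_def mult.commute[of "s $ _"]) blast
  thus ?thesis unfolding column_solution_def by blast
qed

text \<open>Multiplication by the inverse of \<open>f0\<close> makes the leading coefficient
  diagonal and the constant term the identity; the matrix equation then splits into independent
  columns.\<close>

lemma formal_eq_column:
  "formal_eq c Y L Q \<and> (\<forall>i j. fps_nth (Y $ i $ j) 0 = f0 $ i $ j) \<longleftrightarrow>
    (\<forall>j. column_solution (C c) (Suc k) j (\<lambda>b. (Fim ** Y) $ b $ j) (fps_of_poly (sp (L $ j) (Q $ j))))"
proof -
  define S where "S = (\<chi> j. fps_of_poly (sp (L $ j) (Q $ j)))"
  have "CCm c ** (Fim ** Y) - Fim ** Y ** diag_mat S = Fim ** (BSm c ** Y - Y ** diag_mat S)"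
    unfolding CCm_eq matrix_mult_diff by (metis F0m_Fim(1) matrix_mul_assoc matrix_mul_lid)
  moreover have "- XD (Fim ** Y) = Fim ** (- XD Y)" by (simp add: XD_const matrix_mult_diff)
  moreover have "Fim ** A = Fim ** B \<longleftrightarrow> A = B" for A B
    by (metis F0m_Fim(1) matrix_mul_assoc matrix_mul_lid)
  ultimately have 1: "formal_eq c Y L Q \<longleftrightarrow> CCm c ** (Fim ** Y) - Fim ** Y ** diag_mat S = - XD (Fim ** Y)"
    unfolding formal_eq_matrix S_def[symmetric] by metis
  define Y0 where "Y0 = (\<chi> i j. fps_nth (Y $ i $ j) 0)"
  have "(\<chi> a j. fps_nth ((Fim ** Y) $ a $ j) 0) = fi ** Y0"
    by (simp add: vec_eq_iff Y0_def matrix_matrix_mult_def Fim_def fps_sum_nth)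
  moreover have "Y0 = f0 \<longleftrightarrow> fi ** Y0 = mat 1"
    by (metis f0_fi matrix_mul_assoc matrix_mul_lid matrix_mul_rid)
  ultimately have 2: "(\<forall>i j. fps_nth (Y $ i $ j) 0 = f0 $ i $ j) \<longleftrightarrow> (\<forall>a j. fps_nth ((Fim ** Y) $ a $ j) 0 = (if a = j then 1 else 0))"
    by (auto simp: vec_eq_iff Y0_def mat_def)
  show ?thesis
    using column_matrix[of c "Fim ** Y" S] unfolding 1 2 by (simp add: S_def)
qed

definition "ymat c = (\<chi> b j. fc.y0 c j b)"
definition "fY c = F0m ** ymat c"
definition "fL c = (\<chi> j. fps_nth (fc.s0 c j) (Suc k))"
text \<open>Antiderivative of the polar part of the exponent: the coefficient of x^i in
  \<open>s0\<close> is that of z^(k-i) in Q', hence the division by k - i + 1.\<close>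

definition "fQ c = (\<chi> j. \<Sum>i\<le>k. monom (fps_nth (fc.s0 c j) i / of_nat (k - i + 1)) (k - i + 1))"

lemma fQ_coeff: "coeff (fQ c $ j) e = (if 1 \<le> e \<and> e \<le> k + 1 then fps_nth (fc.s0 c j) (k + 1 - e) / of_nat e else 0)"
proof -
  have "coeff (fQ c $ j) e = (\<Sum>i\<le>k. if i = k + 1 - e \<and> 1 \<le> e \<and> e \<le> k + 1 then fps_nth (fc.s0 c j) (k + 1 - e) / of_nat e else 0)"
    unfolding fQ_def vec_lambda_beta coeff_sum coeff_monom by (intro sum.cong) auto
  also have "\<dots> = (if 1 \<le> e \<and> e \<le> k + 1 then fps_nth (fc.s0 c j) (k + 1 - e) / of_nat e else 0)"
    by (auto simp: sum.delta)
  finally show ?thesis .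
qed

lemma s0_0: "fps_nth (fc.s0 c j) 0 = lam $ j"
  by (simp add: fc.s0_nth nexp_def)

lemma s0_1: "fps_nth (fc.s0 c j) 1 = 0"
  using C_1 by (simp add: fc.s0_nth nexp_def)

lemma fQ_top: "coeff (fQ c $ j) (k + 1) = lam $ j / of_nat (k + 1)" "coeff (fQ c $ j) k = 0" "coeff (fQ c $ j) 0 = 0"
  using s0_1 by (simp_all add: fQ_coeff s0_0)

lemma fQ_degree: "degree (fQ c $ j) = k + 1"
proof (rule antisym)
  show "degree (fQ c $ j) \<le> k + 1" by (rule degree_le) (simp add: fQ_coeff)
  show "k + 1 \<le> degree (fQ c $ j)" using lam_nz[of j] fQ_top(1)[of c j] by (intro le_degree) (simp del: of_nat_Suc)
qed

lemma sp_formal: "fps_of_poly (sp (fL c $ j) (fQ c $ j)) = fc.s0 c j"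
proof (rule fps_ext)
  fix i
  show "fps_nth (fps_of_poly (sp (fL c $ j) (fQ c $ j))) i = fps_nth (fc.s0 c j) i"
    by (cases "i \<le> k"; cases "i = Suc k") (auto simp: sp_coeff fQ_coeff fL_def fc.s0_nth simp del: of_nat_Suc)
qed

text \<open>Once the columns are unique, comparing coefficients of the exponent recovers L at order
  k + 1 and Q from the lower orders; the constant term of Q is fixed by normalisation. Hence the
  unique description of the formal data can be evaluated.\<close>

lemma formal_solution_unique: "formal_solution k f0 lam (Bm c) Y L Q \<longleftrightarrow> Y = fY c \<and> L = fL c \<and> Q = fQ c"
proof
  assume fs: "formal_solution k f0 lam (Bm c) Y L Q"
  hence deg: "\<And>i. degree (Q $ i) = k + 1" "\<And>i. coeff (Q $ i) 0 = 0"
    and col: "\<And>j. column_solution (C c) (Suc k) j (\<lambda>b. (Fim ** Y) $ b $ j) (fps_of_poly (sp (L $ j) (Q $ j)))"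
    unfolding formal_solution_iff using formal_eq_column[of c Y L Q] by blast+
  have "m > Suc k \<Longrightarrow> fps_nth (fps_of_poly (sp (L $ j) (Q $ j))) m = 0" for m j by (simp add: sp_coeff)
  note un = fc.column_unique[OF col this]
  have "Fim ** Y = ymat c" using un(1) by (simp add: vec_eq_iff ymat_def fun_eq_iff)
  hence "Y = fY c" unfolding fY_def by (metis F0m_Fim(1) matrix_mul_assoc matrix_mul_lid)
  moreover have sp: "sp (L $ j) (Q $ j) = sp (fL c $ j) (fQ c $ j)" for j
    using un(2)[of j] sp_formal[of c j] by (simp flip: fps_of_poly_eq_iff)
  have "L $ j = fL c $ j" for j
    using arg_cong[OF sp[of j], of "\<lambda>p. coeff p (Suc k)"] by (simp add: sp_coeff)
  moreover have "Q $ j = fQ c $ j" for j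
  proof (rule poly_eqI)
    fix e
    consider "e = 0" | "1 \<le> e" "e \<le> k + 1" | "e > k + 1" by linarith
    thus "coeff (Q $ j) e = coeff (fQ c $ j) e"
    proof cases
      case 2
      hence e: "k - (k + 1 - e) + 1 = e" "k + 1 - e \<le> k" by auto
      from arg_cong[OF sp[of j], of "\<lambda>p. coeff p (k + 1 - e)"]
      have "of_nat e * coeff (Q $ j) e = of_nat e * coeff (fQ c $ j) e" unfolding sp_coeff by (simp only: e if_True)
      thus ?thesis using 2 by simp
    qed (use deg fQ_degree[of c j] fQ_top in \<open>simp_all add: coeff_eq_0\<close>)
  qed
  ultimately show "Y = fY c \<and> L = fL c \<and> Q = fQ c" by (simp add: vec_eq_iff)
next
  assume A: "Y = fY c \<and> L = fL c \<and> Q = fQ c"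
  have "Fim ** fY c = ymat c" unfolding fY_def by (metis F0m_Fim(2) matrix_mul_assoc matrix_mul_lid)
  hence "column_solution (C c) (Suc k) j (\<lambda>b. (Fim ** fY c) $ b $ j) (fps_of_poly (sp (fL c $ j) (fQ c $ j)))" for j
    using fc.column_exists[of c j] unfolding sp_formal by (simp add: ymat_def)
  hence "formal_eq c (fY c) (fL c) (fQ c) \<and> (\<forall>i j. fps_nth (fY c $ i $ j) 0 = f0 $ i $ j)"
    unfolding formal_eq_column by blast
  thus "formal_solution k f0 lam (Bm c) Y L Q"
    unfolding formal_solution_iff using A fQ_degree fQ_top by auto
qed

lemma formal_data_eq: "formal_data k f0 lam (Bm c) = (fY c, fL c, fQ c)"
  unfolding formal_data_def formal_solution_unique by (rule the_equality) auto

lemma formal_parts: "formal_Y k f0 lam (Bm c) = fY c" "formal_L k f0 lam (Bm c) = fL c" "formal_Q k f0 lam (Bm c) = fQ c"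
  by (simp_all add: formal_Y_def formal_L_def formal_Q_def formal_data_eq)

lemma fY_solution: "formal_eq c (fY c) (fL c) (fQ c)" "fps_nth (fY c $ i $ j) 0 = f0 $ i $ j"
  using formal_solution_unique[of c "fY c" "fL c" "fQ c"] unfolding formal_solution_iff by auto

lemma holo_on_s0: "holo_on S (\<lambda>q. fps_nth (fc.s0 (fst q) j) l)"
  unfolding fc.s0_nth by (intro holo_on_if holo_on_nexp holo_on_C holo_on_const)

lemma holo_on_fL: "holo_on S (\<lambda>q. fL (fst q) $ j)"
  by (simp add: fL_def holo_on_s0)

lemma holo_on_fQ: "holo_on S (\<lambda>q. coeff (fQ (fst q) $ j) e)"
  unfolding fQ_coeff divide_inverse by (intro holo_on_if holo_on_mult holo_on_s0 holo_on_const)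

lemma holo_on_fY: "holo_on S (\<lambda>q. fps_nth (fY (fst q) $ a $ j) l)"
proof -
  have "holo_on S (\<lambda>q. fps_nth (fc.y0 (fst q) j b) l)" for b
    unfolding fc.y0_def fps_mult_nth fc.H_def fc.\<eta>_def fps_nth_Abs_fps
    by (intro holo_on_sum holo_on_mult holo_on_nscale holo_on_nexp holo_on_ncol holo_on_C)
  moreover have "fps_nth (fY c $ a $ j) l = (\<Sum>b\<in>UNIV. f0 $ a $ b * fps_nth (fc.y0 c j b) l)" for c
    by (simp add: fY_def ymat_def F0m_def matrix_matrix_mult_def fps_sum_nth)
  ultimately show ?thesis by (simp only:) (intro holo_on_sum holo_on_mult holo_on_const)
qed

end

section \<open>Inverse matrices, linear equations and uniform bounds\<close>

lemma holomorphic_on_matrix_inv: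
  fixes M :: "complex \<Rightarrow> complex^'n^'n"
  assumes "\<And>i j. (\<lambda>u. M u $ i $ j) holomorphic_on S" "\<And>u. u \<in> S \<Longrightarrow> invertible (M u)"
  shows "(\<lambda>u. matrix_inv (M u) $ i $ j) holomorphic_on S"
proof -
  have nz: "det (M u) \<noteq> 0" if "u \<in> S" for u using assms(2)[OF that] by (simp add: invertible_det_nz)
  have "(\<lambda>u. det (\<chi> a b. if b = i then (if a = j then 1 else 0) else M u $ a $ b) / det (M u)) holomorphic_on S"
  proof (intro holomorphic_on_divide nz)
    have "(\<lambda>u. (if b = i then (if a = j then 1 else 0) else M u $ a $ b)) holomorphic_on S" for a b
      by (cases "b = i") (auto intro: assms)
    thus "(\<lambda>u. det (\<chi> a b. if b = i then (if a = j then 1 else 0) else M u $ a $ b)) holomorphic_on S"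
      unfolding det_def by (intro holomorphic_intros) auto
    show "(\<lambda>u. det (M u)) holomorphic_on S" unfolding det_def by (intro holomorphic_intros assms)
  qed
  thus ?thesis by (rule holomorphic_transform) (simp add: matrix_inv_cramer nz)
qed

lemma matrix_mult_minus_left: "(- A) ** (B :: 'a::comm_ring_1^'n^'n) = - (A ** B)"
  by (simp add: vec_eq_iff matrix_matrix_mult_def sum_negf)

lemma has_matrix_derivative_inv:
  fixes M :: "complex \<Rightarrow> complex^'n^'n"
  assumes S: "open S" "z \<in> S" and der: "\<And>u. u \<in> S \<Longrightarrow> has_matrix_derivative M (M' u) u"
    and inv: "\<And>u. u \<in> S \<Longrightarrow> invertible (M u)"
  shows "has_matrix_derivative (\<lambda>u. matrix_inv (M u)) (- (matrix_inv (M z) ** M' z ** matrix_inv (M z))) z"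
proof -
  have hol: "(\<lambda>u. M u $ i $ j) holomorphic_on S" for i j
    using der S by (auto simp: has_matrix_derivative_def holomorphic_on_open)
  define D where "D = (\<chi> i j. deriv (\<lambda>u. matrix_inv (M u) $ i $ j) z)"
  have D: "has_matrix_derivative (\<lambda>u. matrix_inv (M u)) D z"
    unfolding has_matrix_derivative_def D_def
    using holomorphic_derivI[OF holomorphic_on_matrix_inv[OF hol inv] S(1,2)] by simp
  have "has_matrix_derivative (\<lambda>u. M u ** matrix_inv (M u)) (M' z ** matrix_inv (M z) + M z ** D) z"
    by (rule has_matrix_derivative_mult[OF der[OF S(2)] D])
  moreover have "has_matrix_derivative (\<lambda>u. M u ** matrix_inv (M u)) 0 z"
    unfolding has_matrix_derivative_def
  proof (intro allI)
    fix i j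
    have "((\<lambda>u. (mat 1 :: complex^'n^'n) $ i $ j) has_field_derivative 0) (at z)" by (rule DERIV_const)
    hence "((\<lambda>u. (M u ** matrix_inv (M u)) $ i $ j) has_field_derivative 0) (at z)"
      by (rule has_field_derivative_transform_within_open[OF _ S]) (simp add: matrix_inv_mult_right[OF inv])
    thus "((\<lambda>u. (M u ** matrix_inv (M u)) $ i $ j) has_field_derivative (0 :: complex^'n^'n) $ i $ j) (at z)" by simp
  qed
  ultimately have "M' z ** matrix_inv (M z) + M z ** D = 0" by (rule has_matrix_derivative_unique)
  hence "M z ** D = - (M' z ** matrix_inv (M z))" by (simp add: eq_neg_iff_add_eq_0 add.commute)
  hence "matrix_inv (M z) ** (M z ** D) = matrix_inv (M z) ** (- (M' z ** matrix_inv (M z)))" by simp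
  moreover have "matrix_inv (M z) ** (M z ** D) = D"
    by (simp add: matrix_mul_assoc matrix_inv_mult_left[OF inv[OF S(2)]])
  moreover have "A ** (- B) = - (A ** B)" for A B :: "complex^'n^'n"
    by (simp add: vec_eq_iff matrix_matrix_mult_def sum_negf)
  ultimately have "D = - (matrix_inv (M z) ** M' z ** matrix_inv (M z))" by (simp add: matrix_mul_assoc)
  with D show ?thesis by simp
qed

text \<open>X^(-1) Z has derivative zero and is therefore constant on a convex set.\<close>

lemma linear_ode_unique:
  fixes X Z :: "complex \<Rightarrow> complex^'n^'n"
  assumes S: "open S" "convex S" and X: "\<And>u. u \<in> S \<Longrightarrow> has_matrix_derivative X (A u ** X u) u"
    and Z: "\<And>u. u \<in> S \<Longrightarrow> has_matrix_derivative Z (A u ** Z u) u"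
    and inv: "\<And>u. u \<in> S \<Longrightarrow> invertible (X u)" and u: "u \<in> S" "u0 \<in> S"
  shows "Z u = X u ** (matrix_inv (X u0) ** Z u0)"
proof -
  have "has_matrix_derivative (\<lambda>u. matrix_inv (X u) ** Z u) 0 u" if u: "u \<in> S" for u
  proof -
    have "matrix_inv (X u) ** (A u ** X u) ** matrix_inv (X u) = matrix_inv (X u) ** A u"
      by (metis matrix_inv_mult_right[OF inv[OF u]] matrix_mul_assoc matrix_mul_rid)
    hence "has_matrix_derivative (\<lambda>u. matrix_inv (X u)) (- (matrix_inv (X u) ** A u)) u"
      using has_matrix_derivative_inv[OF S(1) u X inv] by simp
    from has_matrix_derivative_mult[OF this Z[OF u]] show ?thesis
      by (simp add: matrix_mult_minus_left matrix_mul_assoc)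
  qed
  from has_matrix_derivative_zero_constant[OF this S(2) u]
  have "matrix_inv (X u) ** Z u = matrix_inv (X u0) ** Z u0" .
  thus ?thesis by (metis matrix_inv_mult_right[OF inv[OF u(1)]] matrix_mul_assoc matrix_mul_lid)
qed

text \<open>At x = 0 the value is the same positive number for all parameters; uniform continuity on
  a compact set keeps it positive up to a radius that does not depend on the parameter.\<close>

lemma uniform_near_zero:
  fixes f :: "(complex^'m) \<times> complex \<Rightarrow> real"
  assumes f: "continuous_on UNIV f" and v: "\<And>c. f (c, 0) = v" "v > 0"
  obtains r where "r > 0" "\<And>c x. c \<in> cball c0 1 \<Longrightarrow> norm x \<le> r \<Longrightarrow> f (c, x) > 0"
proof -
  have "uniformly_continuous_on (cball c0 1 \<times> cball 0 1) f"
    by (intro compact_uniformly_continuous compact_Times compact_cball continuous_on_subset[OF f]) auto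
  then obtain d where d: "d > 0" "\<And>p q. p \<in> cball c0 1 \<times> cball 0 1 \<Longrightarrow> q \<in> cball c0 1 \<times> cball 0 1 \<Longrightarrow> dist q p < d \<Longrightarrow> dist (f q) (f p) < v"
    using v(2) unfolding uniformly_continuous_on_def by meson
  show thesis
  proof (rule that[of "min 1 (d / 2)"])
    fix c and x :: complex assume c: "c \<in> cball c0 1" and x: "norm x \<le> min 1 (d / 2)"
    have "dist (f (c, x)) (f (c, 0)) < v"
      by (rule d(2)) (use c x d(1) in \<open>auto simp: dist_Pair_Pair\<close>)
    thus "f (c, x) > 0" by (simp add: v(1) dist_real_def abs_less_iff)
  qed (use d in auto)
qed

lemma norm_vec_le_sum: "norm (x :: 'a::real_normed_vector^'n) \<le> (\<Sum>i\<in>UNIV. norm (x $ i))"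
  unfolding norm_vec_def by (intro L2_set_le_sum) simp

lemma det_near_identity:
  "\<exists>\<delta>>0. \<forall>M :: complex^'n^'n. (\<forall>i j. norm (M $ i $ j - (if i = j then 1 else 0)) < \<delta>) \<longrightarrow> det M \<noteq> 0"
proof -
  have "continuous_on UNIV (\<lambda>M :: complex^'n^'n. det M)"
    unfolding det_def by (intro continuous_intros)
  then obtain e where e: "e > 0" and e': "\<And>M :: complex^'n^'n. dist M (mat 1) < e \<Longrightarrow> dist (det M) (det (mat 1 :: complex^'n^'n)) < 1"
    unfolding continuous_on_iff by (meson UNIV_I zero_less_one)
  have e: "e > 0" "\<And>M :: complex^'n^'n. dist M (mat 1) < e \<Longrightarrow> det M \<noteq> 0"
    using e e' by (auto simp: dist_norm) (metis det_I diff_0 less_irrefl norm_minus_cancel norm_one)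
  define \<delta> where "\<delta> = e / (2 * real (CARD('n) * CARD('n)))"
  have \<delta>: "\<delta> > 0" using e by (simp add: \<delta>_def)
  show ?thesis
  proof (intro exI[of _ \<delta>] conjI allI impI)
    show "\<delta> > 0" by (rule \<delta>)
    fix M :: "complex^'n^'n" assume M: "\<forall>i j. norm (M $ i $ j - (if i = j then 1 else 0)) < \<delta>"
    have "norm (M - mat 1) \<le> (\<Sum>i\<in>UNIV. norm ((M - mat 1) $ i))" by (rule norm_vec_le_sum)
    also have "\<dots> \<le> (\<Sum>i\<in>(UNIV::'n set). \<Sum>j\<in>(UNIV::'n set). norm ((M - mat 1) $ i $ j))"
      by (intro sum_mono norm_vec_le_sum)
    also have "\<dots> \<le> (\<Sum>i\<in>(UNIV::'n set). \<Sum>j\<in>(UNIV::'n set). \<delta>)"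
      using M by (intro sum_mono) (auto simp: mat_def less_imp_le)
    also have "\<dots> = e / 2" by (simp add: \<delta>_def)
    finally show "det M \<noteq> 0" using e by (intro e(2)) (simp add: dist_norm)
  qed
qed


lemma poly_shift_eval:
  fixes p :: "complex poly"
  assumes "\<And>l. l < s \<Longrightarrow> coeff p l = 0" "degree p \<le> n"
  shows "poly p x = x ^ s * (\<Sum>l\<le>n. coeff p (l + s) * x ^ l)"
proof -
  have "poly p x = (\<Sum>i\<le>degree p. coeff p i * x ^ i)" by (rule poly_altdef)
  also have "\<dots> = (\<Sum>i\<le>n + s. coeff p i * x ^ i)"
    using assms(2) by (intro sum.mono_neutral_left) (auto simp: coeff_eq_0)
  also have "\<dots> = (\<Sum>i\<in>{s..n + s}. coeff p i * x ^ i)"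
    using assms(1) by (intro sum.mono_neutral_right) auto
  also have "\<dots> = (\<Sum>l\<in>{0..n}. coeff p (l + s) * x ^ (l + s))"
    using sum.shift_bounds_cl_nat_ivl[of "\<lambda>i. coeff p i * x ^ i" 0 s n] by simp
  also have "\<dots> = x ^ s * (\<Sum>l\<le>n. coeff p (l + s) * x ^ l)"
    by (simp add: sum_distrib_left power_add atLeast0AtMost mult_ac)
  finally show ?thesis .
qed

subsection \<open>Solutions with prescribed asymptotics\<close>

context oper_setup
begin

abbreviation "K \<equiv> Suc k"

definition "spp c j = sp (fL c $ j) (fQ c $ j)"

definition "yp N c a j = (\<Sum>l\<le>N. monom (fps_nth (fY c $ a $ j) l) l)"

definition "YN N c x = (\<chi> a j. poly (yp N c a j) x)"

text \<open>The defect of the truncated formal solution in the equation multiplied by x^k.\<close>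

definition "num N c a j = (\<Sum>b\<in>UNIV. bs c a b * yp N c b j) - yp N c a j * spp c j + monom 1 (Suc K) * pderiv (yp N c a j)"

definition "numdeg N = k * CARD('n) + 2 * k + 2 + N"

text \<open>The defect divided by x^(N+1), again a polynomial in x, so that it is holomorphic and
  bounded near x = 0.\<close>

definition "rm N q = (\<chi> a j. \<Sum>l\<le>numdeg N. coeff (num N (fst q) a j) (l + Suc N) * snd q ^ l)"

lemma spp_coeff: "coeff (spp c j) l = fps_nth (fc.s0 c j) l"
  using arg_cong[OF sp_formal[of c j], of "\<lambda>f. fps_nth f l"] by (simp add: spp_def)

lemma yp_coeff: "coeff (yp N c a j) l = (if l \<le> N then fps_nth (fY c $ a $ j) l else 0)"
proof -
  have "coeff (yp N c a j) l = (\<Sum>i\<le>N. if i = l then fps_nth (fY c $ a $ j) i else 0)"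
    by (simp add: yp_def coeff_sum)
  thus ?thesis by (simp add: sum.delta)
qed

lemma yp_eval: "poly (yp N c a j) x = (\<Sum>l\<le>N. fps_nth (fY c $ a $ j) l * x ^ l)"
  by (simp add: yp_def poly_sum poly_monom)

text \<open>Up to order N the products involve only coefficients that the truncation keeps, so the
  formal equation applies.\<close>

lemma num_low: "l \<le> N \<Longrightarrow> coeff (num N c a j) l = 0"
proof -
  assume l: "l \<le> N"
  let ?Y = "fY c"
  have 1: "coeff (bs c a b * yp N c b j) l = fps_nth (fps_of_poly (bs c a b) * ?Y $ b $ j) l" for b
    unfolding coeff_mult fps_mult_nth atLeast0AtMost using l by (intro sum.cong) (auto simp: yp_coeff)
  have 2: "coeff (yp N c a j * spp c j) l = fps_nth (?Y $ a $ j * fps_of_poly (spp c j)) l"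
    unfolding coeff_mult fps_mult_nth atLeast0AtMost using l by (intro sum.cong) (auto simp: yp_coeff)
  have 3: "coeff (monom 1 (Suc K) * pderiv (yp N c a j)) l = fps_nth (fps_X ^ (k + 2) * fps_deriv (?Y $ a $ j)) l"
    unfolding coeff_monom_mult fps_X_power_mult_nth using l by (auto simp: coeff_pderiv yp_coeff)
  have "coeff (num N c a j) l = fps_nth ((\<Sum>b\<in>UNIV. fps_of_poly (bs c a b) * ?Y $ b $ j) - ?Y $ a $ j * fps_of_poly (spp c j) + fps_X ^ (k + 2) * fps_deriv (?Y $ a $ j)) l"
    by (simp only: num_def coeff_add coeff_diff coeff_sum fps_add_nth fps_sub_nth fps_sum_nth 1 2 3)
  also have "\<dots> = 0"
    using fY_solution(1)[of c] unfolding formal_eq_def spp_def by simp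
  finally show ?thesis .
qed

lemma yp_degree: "degree (yp N c a j) \<le> N"
  by (rule degree_le) (simp add: yp_coeff)

lemma spp_degree: "degree (spp c j) \<le> K"
  by (rule degree_le) (simp add: spp_def sp_coeff)

lemma num_degree: "degree (num N c a j) \<le> numdeg N"
proof -
  have "degree (bs c a b * yp N c b j) \<le> numdeg N" for b
    using degree_mult_le[of "bs c a b" "yp N c b j"] bs_degree[of c a b] yp_degree[of N c b j] by (simp add: numdeg_def)
  hence 1: "degree (\<Sum>b\<in>UNIV. bs c a b * yp N c b j) \<le> numdeg N" by (intro degree_sum_le) auto
  have 2: "degree (yp N c a j * spp c j) \<le> numdeg N"
    using degree_mult_le[of "yp N c a j" "spp c j"] spp_degree[of c j] yp_degree[of N c a j] by (simp add: numdeg_def)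
  have "degree (pderiv (yp N c a j)) \<le> N" using yp_degree[of N c a j] by (simp add: degree_pderiv)
  hence 3: "degree (monom 1 (Suc K) * pderiv (yp N c a j)) \<le> numdeg N"
    using degree_mult_le[of "monom (1::complex) (Suc K)" "pderiv (yp N c a j)"] degree_monom_le[of "1::complex" "Suc K"] by (simp add: numdeg_def)
  show ?thesis unfolding num_def by (intro degree_add_le degree_diff_le 1 2 3)
qed

lemma num_eval: "poly (num N c a j) x = x ^ Suc N * rm N (c, x) $ a $ j"
  unfolding rm_def by (simp only: vec_lambda_beta fst_conv snd_conv)
    (rule poly_shift_eval[OF _ num_degree], simp add: num_low less_Suc_eq_le)

lemma holo_on_coeff_mult:
  assumes "\<And>l. holo_on S (\<lambda>q. coeff (p q) l)" "\<And>l. holo_on S (\<lambda>q. coeff (r q) l)"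
  shows "holo_on S (\<lambda>q. coeff (p q * r q) l)"
  unfolding coeff_mult by (intro holo_on_sum holo_on_mult assms)

lemma holo_on_yp: "holo_on S (\<lambda>q. coeff (yp N (fst q) a j) l)"
  unfolding yp_coeff by (intro holo_on_if holo_on_fY holo_on_const)

lemma holo_on_spp: "holo_on S (\<lambda>q. coeff (spp (fst q) j) l)"
  unfolding spp_coeff by (rule holo_on_s0)

lemma holo_on_num: "holo_on S (\<lambda>q. coeff (num N (fst q) a j) l)"
proof -
  have "holo_on S (\<lambda>q. coeff (pderiv (yp N (fst q) a j)) l)" for l
    unfolding coeff_pderiv by (intro holo_on_mult holo_on_const holo_on_yp)
  thus ?thesis unfolding num_def coeff_add coeff_diff coeff_sum
    by (intro holo_on_add holo_on_diff holo_on_sum holo_on_coeff_mult holo_on_bs_coeff holo_on_yp holo_on_spp)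
      (simp_all add: holo_on_const)
qed

lemma holo_on_rm: "holo_on S (\<lambda>q. rm N q $ a $ j)"
  unfolding rm_def vec_lambda_beta by (intro holo_on_sum holo_on_mult holo_on_num holo_on_power holo_on_snd)

lemma holo_on_YN: "holo_on S (\<lambda>q. YN N (fst q) (snd q) $ a $ j)"
  unfolding YN_def vec_lambda_beta yp_eval by (intro holo_on_sum holo_on_mult holo_on_fY holo_on_power holo_on_snd)

lemma spp_eval: "poly (spp c j) x = (\<Sum>l\<le>K. coeff (spp c j) l * x ^ l)"
  using poly_shift_eval[of 0 "spp c j" K x] spp_degree by simp

lemma holo_on_spp_eval: "holo_on S (\<lambda>q. poly (spp (fst q) j) (snd q))"
  unfolding spp_eval by (intro holo_on_sum holo_on_mult holo_on_spp holo_on_power holo_on_snd)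

lemma YN_0: "YN N c 0 = f0"
  by (simp add: vec_eq_iff YN_def poly_0_coeff_0 yp_coeff fY_solution(2))

lemma spp_0: "poly (spp c j) 0 = lam $ j"
  by (simp add: poly_0_coeff_0 spp_coeff s0_0)

text \<open>The exponent \<open>Q + \<Lambda> log z\<close> in the variable \<open>w = log z\<close>.\<close>

definition "Ef c j w = poly (fQ c $ j) (exp w) + fL c $ j * w"

lemma Ef_deriv: "((\<lambda>w. Ef c j w) has_field_derivative poly (spp c j) (exp (- w)) * exp w ^ K) (at w)"
proof -
  have "poly (pderiv (fQ c $ j)) (exp w) + fL c $ j * exp (- w) = poly (spp c j) (exp (- w)) * exp w ^ k"
    using sp_poly[of "exp (- w)" "fQ c $ j" "fL c $ j"] fQ_degree[of c j]
    by (simp add: spp_def exp_minus divide_inverse flip: power_inverse)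
  hence "(poly (pderiv (fQ c $ j)) (exp w) + fL c $ j * exp (- w)) * exp w = poly (spp c j) (exp (- w)) * exp w ^ K"
    by simp
  moreover have "(poly (pderiv (fQ c $ j)) (exp w) + fL c $ j * exp (- w)) * exp w = poly (pderiv (fQ c $ j)) (exp w) * exp w + fL c $ j"
    by (simp add: distrib_right exp_minus)
  moreover have "((\<lambda>w. Ef c j w) has_field_derivative poly (pderiv (fQ c $ j)) (exp w) * exp w + fL c $ j) (at w)"
    unfolding Ef_def by (auto intro!: derivative_eq_intros)
  ultimately show ?thesis by simp
qed

lemma fQ_eval: "poly (fQ c $ j) z = (\<Sum>l\<le>K. coeff (fQ c $ j) l * z ^ l)"
  using poly_shift_eval[of 0 "fQ c $ j" K z] fQ_degree[of c j] by simp

lemma holo_on_Ef: "holo_on S (\<lambda>q. Ef (fst q) j (snd q))"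
  unfolding Ef_def fQ_eval by (intro holo_on_add holo_on_sum holo_on_mult holo_on_fQ holo_on_power holo_on_snd holo_on_fL holo_on_exp)

end

lemma uniform_entry_bound:
  fixes f :: "'n::finite \<Rightarrow> 'm::finite \<Rightarrow> 'a::topological_space \<Rightarrow> 'b::real_normed_vector"
  assumes "compact S" "\<And>a b. continuous_on S (f a b)"
  obtains B where "B \<ge> 0" "\<And>a b q. q \<in> S \<Longrightarrow> norm (f a b q) \<le> B"
proof -
  have "\<forall>p. \<exists>B\<ge>0. \<forall>q\<in>S. norm (f (fst p) (snd p) q) \<le> B"
  proof
    fix p :: "'n \<times> 'm"
    have "compact (f (fst p) (snd p) ` S)" by (intro compact_continuous_image assms)
    from compact_imp_bounded[OF this] obtain B where "\<forall>x\<in>f (fst p) (snd p) ` S. norm x \<le> B" by (auto simp: bounded_iff)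
    thus "\<exists>B\<ge>0. \<forall>q\<in>S. norm (f (fst p) (snd p) q) \<le> B" by (intro exI[of _ "max B 0"]) auto
  qed
  from choice[OF this] obtain B where B: "\<And>p. B p \<ge> 0" "\<And>p q. q \<in> S \<Longrightarrow> norm (f (fst p) (snd p) q) \<le> B p" by blast
  show thesis
  proof (rule that[of "\<Sum>p\<in>UNIV. B p"])
    show "(\<Sum>p\<in>UNIV. B p) \<ge> 0" by (intro sum_nonneg B)
    fix a b q assume "q \<in> S"
    hence "norm (f a b q) \<le> B (a, b)" using B(2)[of q "(a, b)"] by simp
    also have "\<dots> \<le> (\<Sum>p\<in>UNIV. B p)" by (intro member_le_sum B) auto
    finally show "norm (f a b q) \<le> (\<Sum>p\<in>UNIV. B p)" .
  qed
qed

lemma finite_common_positive: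
  fixes P :: "'a::finite \<Rightarrow> real \<Rightarrow> bool"
  assumes "\<And>a. \<exists>r>0. P a r" "\<And>a r r'. P a r \<Longrightarrow> 0 < r' \<Longrightarrow> r' \<le> r \<Longrightarrow> P a r'"
  obtains r where "r > 0" "\<And>a. P a r"
proof -
  have "\<forall>a. \<exists>r>0. P a r" using assms(1) by blast
  from choice[OF this] obtain r where r: "\<And>a. r a > 0" "\<And>a. P a (r a)" by blast
  have pos: "Min (range r) > 0"
  proof -
    have "Min (range r) \<in> range r" by (rule Min_in) auto
    then obtain a where "Min (range r) = r a" by blast
    thus ?thesis using r(1)[of a] by (simp only:)
  qed
  show thesis
  proof (rule that[OF pos])
    fix a
    have "Min (range r) \<le> r a" by (rule Min_le) auto
    thus "P a (Min (range r))" by (rule assms(2)[OF r(2) pos])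
  qed
qed

lemma has_field_derivative_Ln_comp: "Re v > 0 \<Longrightarrow> (Ln has_field_derivative 1 / v) (at v)"
  using has_field_derivative_Ln[of v] by (auto simp: complex_nonpos_Reals_iff divide_inverse)

context oper_setup
begin

text \<open>Here eta is an argument of z^(k+1). Both orders of a pair occur, so excluding real
  values of either sign means that eta / (k+1) is not an anti-Stokes direction.\<close>

definition "generic \<eta> \<longleftrightarrow> (\<forall>a b. a \<noteq> b \<longrightarrow> Im ((lam $ a - lam $ b) * cis \<eta>) \<noteq> 0)"

text \<open>For mu = (lam a - lam b) cis eta, the better of the two directions 1 + i kappa and 1 - i
  kappa gives the product with mu the real part Re mu + kappa |Im mu|. The condition says that every
  exponent difference grows along one edge of the cone.\<close>

definition wide :: "real \<Rightarrow> real \<Rightarrow> bool" where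
  "wide \<eta> \<kappa> \<longleftrightarrow> \<kappa> > 0 \<and> (\<forall>a b. a \<noteq> b \<longrightarrow> Re ((lam $ a - lam $ b) * cis \<eta>) + \<kappa> * \<bar>Im ((lam $ a - lam $ b) * cis \<eta>)\<bar> > 0)"

text \<open>Inverse of the coordinate v = z^(k+1) exp (- i eta), written as w = log z.\<close>

definition "wv \<eta> v = (Ln v + \<i> * of_real \<eta>) / of_nat K"

lemma wv_deriv: "Re v > 0 \<Longrightarrow> (wv \<eta> has_field_derivative 1 / (of_nat K * v)) (at v)"
  unfolding wv_def by (rule derivative_eq_intros has_field_derivative_Ln_comp refl | simp del: of_nat_Suc)+

lemma exp_wv: 
  assumes "v \<noteq> 0"
  shows "exp (wv \<eta> v) ^ K = v * cis \<eta>" "norm (exp (- wv \<eta> v)) ^ K = 1 / norm v"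
    "exp (- wv \<eta> v) ^ (K * m) = cis (- \<eta>) ^ m / v ^ m"
proof -
  have "exp (wv \<eta> v) ^ K = exp (of_nat K * wv \<eta> v)" by (rule exp_of_nat_mult[symmetric])
  also have "of_nat K * wv \<eta> v = Ln v + \<i> * of_real \<eta>" by (simp add: wv_def del: of_nat_Suc)
  finally show 1: "exp (wv \<eta> v) ^ K = v * cis \<eta>" using assms by (simp add: exp_add cis_conv_exp)
  have inv: "exp (- wv \<eta> v) ^ K = cis (- \<eta>) / v"
    unfolding exp_minus power_inverse 1 by (simp add: cis_inverse[symmetric] divide_inverse del: cis_inverse)
  have "norm (exp (- wv \<eta> v)) ^ K = norm (exp (- wv \<eta> v) ^ K)" by (rule norm_power[symmetric])
  also have "\<dots> = 1 / norm v" unfolding inv by (simp add: norm_divide)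
  finally show "norm (exp (- wv \<eta> v)) ^ K = 1 / norm v" .
  show "exp (- wv \<eta> v) ^ (K * m) = cis (- \<eta>) ^ m / v ^ m"
    unfolding power_mult inv by (simp add: power_divide)
qed

text \<open>With this truncation the defect starts at order N + 1 = K m + K. Passing from z to v
  uses up x^K, which leaves x^(K m), of size |v|^(-m), next to the factor 1/v from dw/dv.\<close>

definition "NN m = K * m + k"

lemma Suc_NN: "Suc (NN m) = K * m + K"
  by (simp add: NN_def)

text \<open>Near infinity the gauge transformation by the truncated formal solution \<open>YN\<close> leaves a
  perturbation of size \<open>v ^ - (m + 1)\<close> in the coordinate \<open>v = z ^ (k + 1) exp (- \<i> \<eta>)\<close>.\<close>

lemma local_solution:
  fixes c0 :: "'m cvec"
  assumes wide: "wide \<eta> \<kappa>" and m: "m \<ge> 1"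
  defines "N \<equiv> NN m"
  obtains R KC KY H where "R \<ge> 1" "KC \<ge> 0" "KY \<ge> 0"
    and "\<And>i j. holo_on (ball c0 1 \<times> half_cone \<kappa> R) (\<lambda>q. H q $ i $ j)"
    and "\<And>c v i j. c \<in> ball c0 1 \<Longrightarrow> v \<in> half_cone \<kappa> R \<Longrightarrow>
           norm (H (c, v) $ i $ j - (if i = j then 1 else 0)) \<le> KC / Re v ^ m"
    and "\<And>c v. c \<in> ball c0 1 \<Longrightarrow> v \<in> half_cone \<kappa> R \<Longrightarrow>
       has_matrix_derivative (\<lambda>v. H (c, v))
         (diag_mat (\<chi> i. cis \<eta> * poly (spp c i) (exp (- wv \<eta> v)) / of_nat K) ** H (c, v)
          - H (c, v) ** diag_mat (\<chi> i. cis \<eta> * poly (spp c i) (exp (- wv \<eta> v)) / of_nat K)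
          + (\<chi> i j. exp (- wv \<eta> v) ^ (K * m) / (of_nat K * v) *
               (matrix_inv (YN N c (exp (- wv \<eta> v))) ** rm N (c, exp (- wv \<eta> v))) $ i $ j) ** H (c, v)) v"
    and "\<And>c v. c \<in> ball c0 1 \<Longrightarrow> v \<in> half_cone \<kappa> R \<Longrightarrow> invertible (YN N c (exp (- wv \<eta> v)))"
    and "\<And>c v i j. c \<in> ball c0 1 \<Longrightarrow> v \<in> half_cone \<kappa> R \<Longrightarrow> norm (YN N c (exp (- wv \<eta> v)) $ i $ j) \<le> KY"
proof -
  define S where "S = ball c0 (1::real)"
  define \<mu> where "\<mu> = (\<lambda>i j. (lam $ i - lam $ j) * cis \<eta>)"
  \<comment> \<open>The ray for the entry (i, j) runs parallel to the upper or lower edge of the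
    cone, whichever lets the exponent difference increase.\<close>
  define e where "e = (\<lambda>j i. Complex 1 (if Im (\<mu> i j) \<le> 0 then \<kappa> else - \<kappa>))"
  have \<kappa>: "\<kappa> > 0" using wide by (simp add: wide_def)
  have e: "Re (e j i) = 1" "\<bar>Im (e j i)\<bar> \<le> \<kappa>" for i j using \<kappa> by (auto simp: e_def)
  have \<mu>e: "Re (\<mu> i j * e j i) > 0" if "i \<noteq> j" for i j
  proof -
    have "Re (\<mu> i j * e j i) = Re (\<mu> i j) + \<kappa> * \<bar>Im (\<mu> i j)\<bar>" by (simp add: e_def abs_if mult.commute)
    thus ?thesis using wide that by (simp add: wide_def \<mu>_def)
  qed
  define dd where "dd = (\<lambda>j i (q :: 'm cvec \<times> complex). cis \<eta> * (poly (spp (fst q) i) (snd q) - poly (spp (fst q) j) (snd q)) / of_nat K)"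
  \<comment> \<open>At x = 0 the v-derivative of the exponent difference is a positive multiple of
    (lam i - lam j) cis eta, which grows along the chosen edge. The sign persists on a disc of x
    common to all pairs and parameters.\<close>
  obtain rd where rd: "rd > 0" "\<And>p. \<forall>c\<in>cball c0 1. \<forall>x. norm x \<le> rd \<longrightarrow> Re (dd (snd p) (fst p) (c, x) * e (snd p) (fst p)) \<ge> 0"
  proof (rule finite_common_positive[of "\<lambda>p r. \<forall>c\<in>cball c0 1. \<forall>x. norm x \<le> r \<longrightarrow> Re (dd (snd p) (fst p) (c, x) * e (snd p) (fst p)) \<ge> 0"])
    fix p :: "'n \<times> 'n"
    define i where "i = fst p" define j where "j = snd p"
    show "\<exists>r>0. \<forall>c\<in>cball c0 1. \<forall>x. norm x \<le> r \<longrightarrow> Re (dd (snd p) (fst p) (c, x) * e (snd p) (fst p)) \<ge> 0"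
    proof (cases "i = j")
      case True thus ?thesis by (intro exI[of _ 1]) (simp add: dd_def i_def j_def)
    next
      case False
      have "continuous_on UNIV (\<lambda>q. Re (cis \<eta> * (poly (spp (fst q) i) (snd q) - poly (spp (fst q) j) (snd q)) * e j i))"
        by (intro continuous_on_Re holo_on_continuous holo_on_mult holo_on_diff holo_on_const holo_on_spp_eval)
      then obtain r where r: "r > 0" "\<And>c x. c \<in> cball c0 1 \<Longrightarrow> norm x \<le> r \<Longrightarrow> Re (cis \<eta> * (poly (spp c i) x - poly (spp c j) x) * e j i) > 0"
        by (rule uniform_near_zero[of _ "Re (\<mu> i j * e j i)" c0])
          (use \<mu>e[OF False] in \<open>auto simp: spp_0 \<mu>_def mult.commute\<close>)
      have "Re (dd j i (c, x) * e j i) \<ge> 0" if "c \<in> cball c0 1" "norm x \<le> r" for c x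
      proof -
        have "dd j i (c, x) * e j i = (cis \<eta> * (poly (spp c i) x - poly (spp c j) x) * e j i) / of_nat K" by (simp add: dd_def)
        hence "Re (dd j i (c, x) * e j i) = Re (cis \<eta> * (poly (spp c i) x - poly (spp c j) x) * e j i) / real K"
          by (simp only: Re_divide_of_nat)
        also have "\<dots> \<ge> 0" using r(2)[OF that] by (intro divide_nonneg_nonneg) auto
        finally show ?thesis .
      qed
      thus ?thesis using r(1) by (auto simp: i_def j_def)
    qed
  qed auto
  have "continuous_on UNIV (\<lambda>q. norm (det (YN N (fst q) (snd q) :: 'n cmat)))"
    by (intro continuous_on_norm holo_on_continuous holo_on_det holo_on_YN)
  then obtain r1 where r1: "r1 > 0" "\<And>c x. c \<in> cball c0 1 \<Longrightarrow> norm x \<le> r1 \<Longrightarrow> norm (det (YN N c x)) > 0"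
    by (rule uniform_near_zero[of _ "norm (det f0)" c0]) (use inv_f0 in \<open>auto simp: YN_0 invertible_det_nz\<close>)
  define r0 where "r0 = min rd r1"
  have r0: "r0 > 0" using rd r1 by (simp add: r0_def)
  have detn: "det (YN N c x) \<noteq> 0" if "c \<in> cball c0 1" "norm x \<le> r0" for c x
    using r1(2)[of c x] that by (auto simp: r0_def)
  define Rm where "Rm = (\<lambda>q. matrix_inv (YN N (fst q) (snd q)) ** rm N q)"
  have holo_Rm: "holo_on (cball c0 1 \<times> cball 0 r0) (\<lambda>q. Rm q $ i $ j)" for i j
    unfolding Rm_def by (intro holo_on_matrix_mult holo_on_matrix_inv holo_on_YN holo_on_rm) (auto simp: detn)
  obtain K0 where K0: "K0 \<ge> 0" "\<And>i j q. q \<in> cball c0 1 \<times> cball 0 r0 \<Longrightarrow> norm (Rm q $ i $ j) \<le> K0"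
    by (rule uniform_entry_bound[of "cball c0 1 \<times> cball (0::complex) r0" "\<lambda>i j q. Rm q $ i $ j",
          OF compact_Times[OF compact_cball compact_cball] holo_on_continuous[OF holo_Rm]]) (rule that)
  obtain KY where KY: "KY \<ge> 0" "\<And>i j q. q \<in> cball c0 1 \<times> cball 0 r0 \<Longrightarrow> norm (YN N (fst q) (snd q) $ i $ j) \<le> KY"
    by (rule uniform_entry_bound[of "cball c0 1 \<times> cball (0::complex) r0" "\<lambda>i j q. YN N (fst q) (snd q) $ i $ j",
          OF compact_Times[OF compact_cball compact_cball] holo_on_continuous[OF holo_on_YN]]) (rule that)
  define KC where "KC = 2 * (real CARD('n) * K0 * (1 + \<kappa>))"
  have KC0: "KC \<ge> 0" using K0 \<kappa> by (simp add: KC_def)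
  \<comment> \<open>KC <= R <= R^m makes the iteration contract, and R > 1 / r0^K keeps |x| =
    |v|^(-1/K) at most r0 in the whole cone.\<close>
  define R where "R = 1 + KC + 1 / r0 ^ K"
  have R: "R \<ge> 1" using KC0 r0 by (simp add: R_def)
  have Rm_le: "KC \<le> R ^ m"
  proof -
    have "KC \<le> R" using r0 by (simp add: R_def)
    also have "R \<le> R ^ m" using R m by (intro self_le_power) auto
    finally show ?thesis .
  qed
  have Rev: "Re v > R" if "v \<in> half_cone \<kappa> R" for v using half_cone_Re[OF that \<kappa>] .
  have vnz: "v \<noteq> 0" if "v \<in> half_cone \<kappa> R" for v using Rev[OF that] R by auto
  have xsmall: "norm (exp (- wv \<eta> v)) \<le> r0" if v: "v \<in> half_cone \<kappa> R" for v
  proof (rule ccontr)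
    assume "\<not> ?thesis"
    hence "r0 ^ K < norm (exp (- wv \<eta> v)) ^ K" using r0 by (intro power_strict_mono) auto
    also have "\<dots> = 1 / norm v" by (rule exp_wv(2)[OF vnz[OF v]])
    finally have "norm v < 1 / r0 ^ K" using vnz[OF v] r0 by (simp add: field_simps)
    thus False using Rev[OF v] complex_Re_le_cmod[of v] KC0 by (simp add: R_def)
  qed
  define DD where "DD = S \<times> half_cone \<kappa> R"
  have xin: "(fst q, exp (- wv \<eta> (snd q))) \<in> cball c0 1 \<times> cball 0 r0" if "q \<in> DD" for q
    using that xsmall by (auto simp: DD_def S_def simp del: norm_exp_eq_Re)
  have holo_w: "holo_on DD (\<lambda>q. wv \<eta> (snd q))"
  proof (rule holo_on_compose[OF holo_on_snd, of _ "half_cone \<kappa> R"])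
    show "wv \<eta> holomorphic_on half_cone \<kappa> R"
      unfolding holomorphic_on_open[OF open_half_cone]
    proof
      fix v assume "v \<in> half_cone \<kappa> R"
      hence "Re v > 0" using Rev[of v] R by simp
      thus "\<exists>f'. (wv \<eta> has_field_derivative f') (at v)" using wv_deriv by blast
    qed
  qed (auto simp: DD_def)
  have holo_x: "holo_on DD (\<lambda>q. exp (- wv \<eta> (snd q)))" by (intro holo_on_exp holo_on_minus holo_w)
  define M where "M = (\<lambda>i j (q :: 'm cvec \<times> complex). exp (- wv \<eta> (snd q)) ^ (K * m) / (of_nat K * snd q) * Rm (fst q, exp (- wv \<eta> (snd q))) $ i $ j)"
  have holo_M: "holo_on DD (M i j)" for i j
    unfolding M_def
  proof (intro holo_on_mult holo_on_divide holo_on_power holo_x holo_on_const holo_on_snd)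
    show "of_nat K * snd q \<noteq> 0" if "q \<in> DD" for q using that vnz by (auto simp: DD_def simp del: of_nat_Suc)
    show "holo_on DD (\<lambda>q. Rm (fst q, exp (- wv \<eta> (snd q))) $ i $ j)" by (rule holo_on_reparam[OF holo_Rm holo_x xin])
  qed
  have M_bound: "norm (M i j (c, v)) \<le> K0 / Re v ^ Suc m" if c: "c \<in> S" and v: "v \<in> half_cone \<kappa> R" for i j c v
  proof -
    have Re0: "Re v > 0" using Rev[OF v] R by simp
    have nv: "norm v \<ge> Re v" by (rule complex_Re_le_cmod)
    have "norm (M i j (c, v)) = 1 / norm v ^ m / (real K * norm v) * norm (Rm (c, exp (- wv \<eta> v)) $ i $ j)"
      unfolding M_def fst_conv snd_conv exp_wv(3)[OF vnz[OF v]]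
      by (simp add: norm_mult norm_divide norm_power del: of_nat_Suc)
    also have "\<dots> \<le> 1 / Re v ^ m / (1 * Re v) * K0"
      using Re0 nv xin[of "(c, v)"] c v by (intro mult_mono frac_le power_mono K0) (auto simp: DD_def)
    finally show ?thesis by (simp add: mult.commute)
  qed
  \<comment> \<open>The commutator with a diagonal matrix acts separately on columns: in column j
    the exponents are taken relative to the j-th one, which makes j the distinguished index of the
    series.\<close>
  have "\<forall>j. \<exists>h. (\<forall>i. holo_on DD (h i)) \<and>
      (\<forall>i c v. c \<in> S \<longrightarrow> v \<in> half_cone \<kappa> R \<longrightarrow> norm (h i (c, v) - (if i = j then 1 else 0)) \<le> KC / Re v ^ m) \<and>
      (\<forall>i c v. c \<in> S \<longrightarrow> v \<in> half_cone \<kappa> R \<longrightarrow> ((\<lambda>u. h i (c, u)) has_field_derivative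
          dd j i (c, exp (- wv \<eta> v)) * h i (c, v) + (\<Sum>l\<in>UNIV. M i l (c, v) * h l (c, v))) (at v))"
  proof
    fix j
    define d where "d = (\<lambda>i (q :: 'm cvec \<times> complex). dd j i (fst q, exp (- wv \<eta> (snd q))))"
    define E where "E = (\<lambda>i (q :: 'm cvec \<times> complex). Ef (fst q) i (wv \<eta> (snd q)) - Ef (fst q) j (wv \<eta> (snd q)))"
    have E: "holo_on (S \<times> half_cone \<kappa> R) (E i)" for i
    proof -
      have "holo_on DD (\<lambda>q. Ef (fst q) i (wv \<eta> (snd q)))" for i
        using holo_on_reparam[OF holo_on_Ef[of UNIV i] holo_w] by simp
      thus ?thesis unfolding E_def DD_def by (intro holo_on_diff)
    qed
    have dE: "((\<lambda>u. E i (c, u)) has_field_derivative d i (c, v)) (at v)" if "c \<in> S" and v: "v \<in> half_cone \<kappa> R" for i c v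
    proof -
      have Re0: "Re v > 0" using Rev[OF v] R by simp
      have "((\<lambda>u. Ef c i (wv \<eta> u)) has_field_derivative cis \<eta> * poly (spp c i) (exp (- wv \<eta> v)) / of_nat K) (at v)" for i
      proof -
        have "((\<lambda>u. Ef c i (wv \<eta> u)) has_field_derivative (poly (spp c i) (exp (- wv \<eta> v)) * exp (wv \<eta> v) ^ K) * (1 / (of_nat K * v))) (at v)"
          by (rule DERIV_chain'[OF wv_deriv[OF Re0] Ef_deriv, THEN DERIV_cong]) simp
        thus ?thesis unfolding exp_wv(1)[OF vnz[OF v]] using vnz[OF v] by (simp add: field_simps del: of_nat_Suc)
      qed
      from DERIV_diff[OF this[of i] this[of j]] show ?thesis
        unfolding E_def d_def dd_def by (simp add: right_diff_distrib diff_divide_distrib del: of_nat_Suc)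
    qed
    have pos: "Re (d i (c, v) * e j i) \<ge> 0" if c: "c \<in> S" and v: "v \<in> half_cone \<kappa> R" for i c v
      using rd(2)[of "(i, j)"] xsmall[OF v] c by (auto simp: d_def r0_def S_def simp del: norm_exp_eq_Re)
    have db: "d j q = 0" for q by (simp add: d_def dd_def)
    have R0: "R > 0" using R by simp
    obtain h where "\<And>i. holo_on DD (h i)"
      "\<And>i c v. c \<in> S \<Longrightarrow> v \<in> half_cone \<kappa> R \<Longrightarrow> norm (h i (c, v) - (if i = j then 1 else 0)) \<le> KC / Re v ^ m"
      "\<And>i c v. c \<in> S \<Longrightarrow> v \<in> half_cone \<kappa> R \<Longrightarrow> ((\<lambda>u. h i (c, u)) has_field_derivative
          d i (c, v) * h i (c, v) + (\<Sum>l\<in>UNIV. M i l (c, v) * h l (c, v))) (at v)"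
      by (rule small_perturbation_solution[where e = "e j" and E = E and d = d and b = j and M = M and K = K0
            and S = S and \<kappa> = \<kappa> and R = R and m = m, OF \<kappa> R0 m e E dE pos db holo_M[unfolded DD_def] M_bound K0(1) Rm_le[unfolded KC_def], folded DD_def KC_def];
          (assumption | rule that))
    thus "\<exists>h. (\<forall>i. holo_on DD (h i)) \<and>
      (\<forall>i c v. c \<in> S \<longrightarrow> v \<in> half_cone \<kappa> R \<longrightarrow> norm (h i (c, v) - (if i = j then 1 else 0)) \<le> KC / Re v ^ m) \<and>
      (\<forall>i c v. c \<in> S \<longrightarrow> v \<in> half_cone \<kappa> R \<longrightarrow> ((\<lambda>u. h i (c, u)) has_field_derivative
          dd j i (c, exp (- wv \<eta> v)) * h i (c, v) + (\<Sum>l\<in>UNIV. M i l (c, v) * h l (c, v))) (at v))"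
      unfolding d_def fst_conv snd_conv by blast
  qed
  from choice[OF this] obtain h where h: "\<And>i j. holo_on DD (h j i)"
      "\<And>i j c v. c \<in> S \<Longrightarrow> v \<in> half_cone \<kappa> R \<Longrightarrow> norm (h j i (c, v) - (if i = j then 1 else 0)) \<le> KC / Re v ^ m"
      "\<And>i j c v. c \<in> S \<Longrightarrow> v \<in> half_cone \<kappa> R \<Longrightarrow> ((\<lambda>u. h j i (c, u)) has_field_derivative
          dd j i (c, exp (- wv \<eta> v)) * h j i (c, v) + (\<Sum>l\<in>UNIV. M i l (c, v) * h j l (c, v))) (at v)"
    by blast
  define H where "H = (\<lambda>q. \<chi> i j. h j i q)"
  show thesis
  proof (rule that[of R KC KY H, OF R KC0 KY(1)])
    show "holo_on (ball c0 1 \<times> half_cone \<kappa> R) (\<lambda>q. H q $ i $ j)" for i j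
      using h(1) by (simp add: H_def DD_def S_def)
  next
    fix c v i j assume "c \<in> ball c0 1" "v \<in> half_cone \<kappa> R"
    thus "norm (H (c, v) $ i $ j - (if i = j then 1 else 0)) \<le> KC / Re v ^ m"
      using h(2)[of c v j i] by (simp add: H_def S_def)
  next
    fix c v assume c: "c \<in> ball c0 1" and v: "v \<in> half_cone \<kappa> R"
    show "has_matrix_derivative (\<lambda>v. H (c, v))
         (diag_mat (\<chi> i. cis \<eta> * poly (spp c i) (exp (- wv \<eta> v)) / of_nat K) ** H (c, v)
          - H (c, v) ** diag_mat (\<chi> i. cis \<eta> * poly (spp c i) (exp (- wv \<eta> v)) / of_nat K)
          + (\<chi> i j. exp (- wv \<eta> v) ^ (K * m) / (of_nat K * v) *
               (matrix_inv (YN N c (exp (- wv \<eta> v))) ** rm N (c, exp (- wv \<eta> v))) $ i $ j) ** H (c, v)) v"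
      unfolding has_matrix_derivative_def
    proof (intro allI)
      fix i j
      have "dd j i (c, exp (- wv \<eta> v)) * h j i (c, v) + (\<Sum>l\<in>UNIV. M i l (c, v) * h j l (c, v))
        = (diag_mat (\<chi> i. cis \<eta> * poly (spp c i) (exp (- wv \<eta> v)) / of_nat K) ** H (c, v)
          - H (c, v) ** diag_mat (\<chi> i. cis \<eta> * poly (spp c i) (exp (- wv \<eta> v)) / of_nat K)
          + (\<chi> i j. exp (- wv \<eta> v) ^ (K * m) / (of_nat K * v) *
               (matrix_inv (YN N c (exp (- wv \<eta> v))) ** rm N (c, exp (- wv \<eta> v))) $ i $ j) ** H (c, v)) $ i $ j"
        unfolding vector_add_component vector_minus_component diag_mult_left diag_mult_right
        unfolding matrix_matrix_mult_def[of "vec_lambda _" "H (c, v)"]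
        by (simp add: H_def dd_def M_def Rm_def left_diff_distrib right_diff_distrib diff_divide_distrib mult_ac del: of_nat_Suc)
      with h(3)[of c v j i] c v
      show "((\<lambda>u. H (c, u) $ i $ j) has_field_derivative (diag_mat (\<chi> i. cis \<eta> * poly (spp c i) (exp (- wv \<eta> v)) / of_nat K) ** H (c, v)
          - H (c, v) ** diag_mat (\<chi> i. cis \<eta> * poly (spp c i) (exp (- wv \<eta> v)) / of_nat K)
          + (\<chi> i j. exp (- wv \<eta> v) ^ (K * m) / (of_nat K * v) *
               (matrix_inv (YN N c (exp (- wv \<eta> v))) ** rm N (c, exp (- wv \<eta> v))) $ i $ j) ** H (c, v)) $ i $ j) (at v)"
        by (simp add: H_def S_def)
    qed
    show "invertible (YN N c (exp (- wv \<eta> v)))"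
      using detn[of c "exp (- wv \<eta> v)"] xsmall[OF v] c by (simp add: invertible_det_nz del: norm_exp_eq_Re)
    show "norm (YN N c (exp (- wv \<eta> v)) $ i $ j) \<le> KY" for i j
      using KY(2)[of "(c, exp (- wv \<eta> v))" i j] xsmall[OF v] c by (simp del: norm_exp_eq_Re)
  qed
qed

end

section \<open>Matrix algebra and limits in closed sectors\<close>

definition msc :: "'a::comm_ring_1 \<Rightarrow> 'a^'n^'n \<Rightarrow> 'a^'n^'n" where
  "msc a M = (\<chi> i j. a * M $ i $ j)"

lemma msc_nth: "msc a M $ i $ j = a * M $ i $ j"
  by (simp add: msc_def)

lemma msc_mult: "msc a M ** N = msc a (M ** N)" "M ** msc a N = msc a (M ** N)"
  by (simp_all add: vec_eq_iff msc_nth matrix_matrix_mult_def sum_distrib_left mult_ac)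

lemma msc_add: "msc a (M + N) = msc a M + msc a N" "msc a (M - N) = msc a M - msc a N" "msc (a + b) M = msc a M + msc b M"
  by (simp_all add: vec_eq_iff msc_nth algebra_simps)

lemma msc_msc: "msc a (msc b M) = msc (a * b) M"
  by (simp add: vec_eq_iff msc_nth mult.assoc)

lemma has_matrix_derivative_chain:
  assumes "has_matrix_derivative M M' (g z)" "(g has_field_derivative g') (at z)"
  shows "has_matrix_derivative (\<lambda>u. M (g u)) (msc g' M') z"
  unfolding has_matrix_derivative_def msc_nth
proof (intro allI)
  fix i j
  have "((\<lambda>u. M u $ i $ j) has_field_derivative M' $ i $ j) (at (g z))"
    using assms(1) by (simp add: has_matrix_derivative_def)
  from DERIV_chain2[OF this assms(2)]
  show "((\<lambda>u. M (g u) $ i $ j) has_field_derivative g' * M' $ i $ j) (at z)" by (simp add: mult.commute)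
qed

lemma diag_mat_mult: "diag_mat u ** diag_mat v = (diag_mat (\<chi> i. u $ i * v $ i) :: 'a::comm_ring_1^'n^'n)"
  unfolding vec_eq_iff diag_mult_left by (simp add: diag_mat_def)

lemma diag_mat_one: "diag_mat (\<chi> i. 1) = mat (1 :: 'a::comm_ring_1)"
  by (simp add: vec_eq_iff diag_mat_def mat_def)

lemma matrix_mult_sub_left: "(A - B) ** (M :: 'a::comm_ring_1^'n^'n) = A ** M - B ** M"
  by (simp add: vec_eq_iff matrix_matrix_mult_def left_diff_distrib sum_subtractf)

lemma matrix_mult_sub_right: "M ** (A - B) = M ** A - M ** (B :: 'a::comm_ring_1^'n^'n)"
  by (simp add: vec_eq_iff matrix_matrix_mult_def right_diff_distrib sum_subtractf)

lemma tendsto_matrix_inv: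
  fixes M :: "'a \<Rightarrow> complex^'n^'n"
  assumes lim: "\<And>i j. ((\<lambda>w. M w $ i $ j) \<longlongrightarrow> A $ i $ j) F" and inv: "invertible A"
  shows "((\<lambda>w. matrix_inv (M w) $ i $ j) \<longlongrightarrow> matrix_inv A $ i $ j) F"
    and "\<forall>\<^sub>F w in F. invertible (M w)"
proof -
  have nz: "det A \<noteq> 0" using inv by (simp add: invertible_det_nz)
  have d: "((\<lambda>w. det (M w)) \<longlongrightarrow> det A) F" unfolding det_def by (intro tendsto_intros lim)
  have ev: "\<forall>\<^sub>F w in F. det (M w) \<noteq> 0" by (rule tendsto_imp_eventually_ne[OF d nz])
  thus "\<forall>\<^sub>F w in F. invertible (M w)" by (simp add: invertible_det_nz)
  have "((\<lambda>w. det (\<chi> a b. if b = i then (if a = j then 1 else 0) else M w $ a $ b) / det (M w)) \<longlongrightarrow>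
     det (\<chi> a b. if b = i then (if a = j then 1 else 0) else A $ a $ b) / det A) F"
  proof (intro tendsto_divide d nz)
    have "((\<lambda>w. if b = i then (if a = j then 1 else 0) else M w $ a $ b) \<longlongrightarrow> (if b = i then (if a = j then 1 else 0) else A $ a $ b)) F" for a b
      by (simp add: lim)
    thus "((\<lambda>w. det (\<chi> a b. if b = i then (if a = j then 1 else 0) else M w $ a $ b)) \<longlongrightarrow>
     det (\<chi> a b. if b = i then (if a = j then 1 else 0) else A $ a $ b)) F"
      unfolding det_def by (intro tendsto_intros) simp
  qed
  thus "((\<lambda>w. matrix_inv (M w) $ i $ j) \<longlongrightarrow> matrix_inv A $ i $ j) F"
    unfolding matrix_inv_cramer[OF nz]
    by (rule Lim_transform_eventually) (use ev in \<open>auto elim!: eventually_mono simp: matrix_inv_cramer\<close>)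
qed

lemma eventually_closed_sector:
  "eventually P (closed_sector_filter \<alpha> \<beta>) \<longleftrightarrow> (\<exists>\<rho>. \<forall>w. Re w \<ge> \<rho> \<longrightarrow> Im w \<in> {\<alpha>..\<beta>} \<longrightarrow> P w)"
  unfolding closed_sector_filter_def eventually_inf_principal eventually_filtercomap eventually_at_top_linorder
  by (auto; meson)

lemma closed_sector_nontrivial: "\<alpha> \<le> \<beta> \<Longrightarrow> closed_sector_filter \<alpha> \<beta> \<noteq> bot"
proof
  assume "\<alpha> \<le> \<beta>" "closed_sector_filter \<alpha> \<beta> = bot"
  hence "eventually (\<lambda>_. False) (closed_sector_filter \<alpha> \<beta>)" by simp
  then obtain \<rho> where "\<And>w. Re w \<ge> \<rho> \<Longrightarrow> Im w \<in> {\<alpha>..\<beta>} \<Longrightarrow> False" unfolding eventually_closed_sector by blast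
  from this[of "Complex \<rho> \<alpha>"] \<open>\<alpha> \<le> \<beta>\<close> show False by simp
qed

lemma filterlim_Re_closed_sector: "filterlim Re at_top (closed_sector_filter \<alpha> \<beta>)"
  unfolding filterlim_at_top eventually_closed_sector by auto

lemma tendsto_exp_minus_closed_sector: "((\<lambda>w. exp (- w)) \<longlongrightarrow> (0::complex)) (closed_sector_filter \<alpha> \<beta>)"
proof (rule tendsto_norm_zero_cancel)
  have "((\<lambda>w. exp (- Re w)) \<longlongrightarrow> 0) (closed_sector_filter \<alpha> \<beta>)"
    by (rule filterlim_compose[OF exp_at_bot filterlim_compose[OF filterlim_uminus_at_bot_at_top filterlim_Re_closed_sector]])
  thus "((\<lambda>w. norm (exp (- w) :: complex)) \<longlongrightarrow> 0) (closed_sector_filter \<alpha> \<beta>)" by simp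
qed

lemma tendsto_w_exp_minus_closed_sector: "((\<lambda>w. w * exp (- w)) \<longlongrightarrow> (0::complex)) (closed_sector_filter \<alpha> \<beta>)"
proof (rule Lim_null_comparison)
  define B where "B = \<bar>\<alpha>\<bar> + \<bar>\<beta>\<bar>"
  show "\<forall>\<^sub>F w in closed_sector_filter \<alpha> \<beta>. norm (w * exp (- w)) \<le> (Re w + B) * exp (- Re w)"
    unfolding eventually_closed_sector
  proof (intro exI[of _ 0] allI impI)
    fix w assume w: "0 \<le> Re w" "Im w \<in> {\<alpha>..\<beta>}"
    have "norm w \<le> \<bar>Re w\<bar> + \<bar>Im w\<bar>" by (rule cmod_le)
    also have "\<dots> \<le> Re w + B" using w by (auto simp: B_def)
    finally show "norm (w * exp (- w)) \<le> (Re w + B) * exp (- Re w)" by (simp add: norm_mult mult_right_mono)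
  qed
  have "((\<lambda>t::real. (t + B) * exp (- t)) \<longlongrightarrow> 0) at_top" by real_asymp
  from filterlim_compose[OF this filterlim_Re_closed_sector]
  show "((\<lambda>w. (Re w + B) * exp (- Re w)) \<longlongrightarrow> 0) (closed_sector_filter \<alpha> \<beta>)" .
qed

context oper_setup
begin

lemma holo_on_oper: "holo_on S (\<lambda>q. (oper_of_coeffs k (fst q :: 'm cvec) (snd q) :: 'n cmat) $ i $ j)"
  unfolding oper_of_coeffs_def oper_matrix_def vec_lambda_beta poly_add poly_sum poly_monom
  by (intro holo_on_if holo_on_add holo_on_sum holo_on_mult holo_on_const holo_on_power holo_on_snd holo_on_fst)

definition "psi = (SOME \<Psi> :: ('m cvec \<times> complex) \<Rightarrow> 'n cmat. (\<forall>i j. holo_on UNIV (\<lambda>q. \<Psi> q $ i $ j)) \<and> (\<forall>q. invertible (\<Psi> q)) \<and>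
   (\<forall>c z. has_matrix_derivative (\<lambda>u. \<Psi> (c, u)) (oper_of_coeffs k c z ** \<Psi> (c, z)) z))"

lemma psi: "holo_on UNIV (\<lambda>q. psi q $ i $ j)" "invertible (psi q)"
  "has_matrix_derivative (\<lambda>u. psi (c, u)) (oper_of_coeffs k c z ** psi (c, z)) z"
proof -
  have "\<exists>\<Psi> :: ('m cvec \<times> complex) \<Rightarrow> 'n cmat. (\<forall>i j. holo_on UNIV (\<lambda>q. \<Psi> q $ i $ j)) \<and> (\<forall>q. invertible (\<Psi> q)) \<and>
   (\<forall>c z. has_matrix_derivative (\<lambda>u. \<Psi> (c, u)) (oper_of_coeffs k c z ** \<Psi> (c, z)) z)"
    by (rule entire_fundamental_matrix[of "\<lambda>q :: 'm cvec \<times> complex. oper_of_coeffs k (fst q) (snd q) :: 'n cmat", OF holo_on_oper, unfolded fst_conv snd_conv]) blast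
  from someI_ex[OF this] show "holo_on UNIV (\<lambda>q. psi q $ i $ j)" "invertible (psi q)"
  "has_matrix_derivative (\<lambda>u. psi (c, u)) (oper_of_coeffs k c z ** psi (c, z)) z"
    unfolding psi_def[symmetric] by blast+
qed

text \<open>The fundamental solution \<open>psi\<close> of the oper is entire, so that its gauge transform \<open>U\<close> is
  \<open>2 \<pi> \<i>\<close>-periodic in \<open>w = log z\<close>.\<close>

definition "U q = gauge k (exp (snd q)) ** psi (fst q, exp (snd q))"

lemma holo_on_U: "holo_on S (\<lambda>q. U q $ i $ j)"
proof -
  have 1: "holo_on UNIV (\<lambda>q :: 'm cvec \<times> complex. (gauge k (exp (snd q)) :: 'n cmat) $ i $ j)" for i j
    unfolding gauge_def diag_mat_def vec_lambda_beta by (intro holo_on_if holo_on_power holo_on_exp holo_on_snd holo_on_const)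
  have e: "holo_on UNIV (\<lambda>q :: 'm cvec \<times> complex. exp (snd q))" by (intro holo_on_exp holo_on_snd)
  have 2: "holo_on UNIV (\<lambda>q. psi (fst q, exp (snd q)) $ i $ j)" for i j
    by (rule holo_on_reparam[OF psi(1) e]) simp
  show ?thesis unfolding U_def by (rule holo_on_subset[OF holo_on_matrix_mult[OF 1 2]]) simp
qed

lemma invertible_matrix_mult: "invertible (A :: 'n cmat) \<Longrightarrow> invertible (B :: 'n cmat) \<Longrightarrow> invertible (A ** B)"
  by (simp add: invertible_det_nz det_mul)

lemma U_invertible: "invertible (U q)"
  unfolding U_def by (intro invertible_matrix_mult gauge_inverse psi) simp

lemma U_deriv: "has_matrix_derivative (\<lambda>w. U (c, w)) (msc (exp w) (Bm c (exp w)) ** U (c, w)) w"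
proof -
  have e: "(exp has_field_derivative exp w) (at w)" by (rule DERIV_exp)
  have "has_matrix_derivative (\<lambda>w. gauge k (exp w) ** psi (c, exp w))
     (msc (exp w) (dgauge (exp w)) ** psi (c, exp w) + gauge k (exp w) ** msc (exp w) (oper_of_coeffs k c (exp w) ** psi (c, exp w))) w"
    by (rule has_matrix_derivative_mult[OF has_matrix_derivative_chain[OF gauge_deriv e] has_matrix_derivative_chain[OF psi(3) e]])
  also have "msc (exp w) (dgauge (exp w)) ** psi (c, exp w) + gauge k (exp w) ** msc (exp w) (oper_of_coeffs k c (exp w) ** psi (c, exp w))
     = msc (exp w) (Bm c (exp w)) ** U (c, w)"
  proof -
    have "msc (exp w) (Bm c (exp w)) ** U (c, w) = msc (exp w) ((Bm c (exp w) ** gauge k (exp w)) ** psi (c, exp w))"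
      by (simp add: U_def msc_mult matrix_mul_assoc)
    also have "Bm c (exp w) ** gauge k (exp w) = dgauge (exp w) + gauge k (exp w) ** oper_of_coeffs k c (exp w)"
      by (rule Bm_gauge) simp
    finally show ?thesis by (simp add: msc_mult matrix_mult_add_left msc_add matrix_mul_assoc)
  qed
  finally show ?thesis by (simp add: U_def)
qed

lemma fundamental_iff: "fundamental_solution (Bm c) \<Phi> \<longleftrightarrow> (\<forall>w. invertible (\<Phi> w)) \<and>
    (\<forall>w. has_matrix_derivative \<Phi> (msc (exp w) (Bm c (exp w)) ** \<Phi> w) w)"
  by (simp add: fundamental_solution_def has_matrix_derivative_def msc_mult msc_nth)

lemma fundamental_U: "invertible Cc \<Longrightarrow> fundamental_solution (Bm c) (\<lambda>w. U (c, w) ** Cc)"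
  unfolding fundamental_iff
  using has_matrix_derivative_mult[OF U_deriv has_matrix_derivative_const[of Cc], of c]
  by (auto simp: U_invertible matrix_mul_assoc intro!: invertible_matrix_mult)

lemma fundamental_unique:
  assumes "fundamental_solution (Bm c) \<Phi>" "fundamental_solution (Bm c) \<Phi>'"
  shows "\<Phi>' w = \<Phi> w ** (matrix_inv (\<Phi> w0) ** \<Phi>' w0)"
  by (rule linear_ode_unique[of UNIV \<Phi> "\<lambda>w. msc (exp w) (Bm c (exp w))" \<Phi>'])
    (use assms in \<open>auto simp: fundamental_iff\<close>)

definition "Em c w = (diag_mat (\<chi> j. exp (Ef c j w)) :: 'n cmat)"
text \<open>The solution with the factor z^Lambda e^Q stripped off; its asymptotic expansion is what
  the formal series prescribes.\<close>

definition "normed c \<Phi> w = \<Phi> w ** (diag_mat (\<chi> j. exp (- Ef c j w)) :: 'n cmat)"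

lemma Em_normed: "normed c (\<lambda>w. \<Phi> w ** Em c w) w = \<Phi> w"
  by (simp add: normed_def Em_def diag_mat_mult diag_mat_one flip: matrix_mul_assoc exp_add)

lemma YN_deriv:
  assumes "Re v > 0"
  shows "has_matrix_derivative (\<lambda>v. YN N c (exp (- wv \<eta> v)))
    (msc (- exp (- wv \<eta> v) / (of_nat K * v)) (\<chi> a j. poly (pderiv (yp N c a j)) (exp (- wv \<eta> v)))) v"
proof -
  have "((\<lambda>v. exp (- wv \<eta> v)) has_field_derivative - exp (- wv \<eta> v) / (of_nat K * v)) (at v)"
    by (rule derivative_eq_intros wv_deriv assms refl | simp del: of_nat_Suc)+
  moreover have "has_matrix_derivative (YN N c) (\<chi> a j. poly (pderiv (yp N c a j)) x) x" for x
    by (simp add: has_matrix_derivative_def YN_def poly_DERIV)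
  ultimately show ?thesis by (intro has_matrix_derivative_chain)
qed

lemma Em_deriv:
  assumes v: "Re v > 0"
  shows "has_matrix_derivative (\<lambda>v. Em c (wv \<eta> v))
    (diag_mat (\<chi> j. cis \<eta> * poly (spp c j) (exp (- wv \<eta> v)) / of_nat K) ** Em c (wv \<eta> v)) v"
proof -
  have vnz: "v \<noteq> 0" using v by auto
  have "((\<lambda>u. exp (Ef c j (wv \<eta> u))) has_field_derivative cis \<eta> * poly (spp c j) (exp (- wv \<eta> v)) / of_nat K * exp (Ef c j (wv \<eta> v))) (at v)" for j
  proof -
    have "((\<lambda>u. Ef c j (wv \<eta> u)) has_field_derivative (poly (spp c j) (exp (- wv \<eta> v)) * exp (wv \<eta> v) ^ K) * (1 / (of_nat K * v))) (at v)"
      by (rule DERIV_chain'[OF wv_deriv[OF v] Ef_deriv, THEN DERIV_cong]) simp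
    hence "((\<lambda>u. Ef c j (wv \<eta> u)) has_field_derivative cis \<eta> * poly (spp c j) (exp (- wv \<eta> v)) / of_nat K) (at v)"
      unfolding exp_wv(1)[OF vnz] using vnz by (simp add: field_simps del: of_nat_Suc)
    from DERIV_chain2[OF DERIV_exp this] show ?thesis by (simp add: mult.commute)
  qed
  thus ?thesis
    unfolding has_matrix_derivative_def Em_def diag_mult_left by (auto simp: diag_mat_def)
qed

text \<open>The perturbation in the equation for H is precisely the defect of the truncation. In the
  product Y H exp E it combines with the derivative of Y and the exponents to give back B. Passing
  from z to v rests on v x^K = cis (- eta).\<close>

lemma gauge_transformed_equation:
  assumes v: "Re v > 0" and inv: "invertible (YN (NN m) c (exp (- wv \<eta> v)))"
    and H: "has_matrix_derivative H
         (diag_mat (\<chi> i. cis \<eta> * poly (spp c i) (exp (- wv \<eta> v)) / of_nat K) ** H v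
          - H v ** diag_mat (\<chi> i. cis \<eta> * poly (spp c i) (exp (- wv \<eta> v)) / of_nat K)
          + (\<chi> i j. exp (- wv \<eta> v) ^ (K * m) / (of_nat K * v) *
               (matrix_inv (YN (NN m) c (exp (- wv \<eta> v))) ** rm (NN m) (c, exp (- wv \<eta> v))) $ i $ j) ** H v) v"
  shows "has_matrix_derivative (\<lambda>v. YN (NN m) c (exp (- wv \<eta> v)) ** H v ** Em c (wv \<eta> v))
    (msc (exp (wv \<eta> v) / (of_nat K * v)) (Bm c (exp (wv \<eta> v))) ** (YN (NN m) c (exp (- wv \<eta> v)) ** H v ** Em c (wv \<eta> v))) v"
proof -
  define x where "x = exp (- wv \<eta> v)"
  define Y where "Y = YN (NN m) c x"
  define dY where "dY = (\<chi> a j. poly (pderiv (yp (NN m) c a j)) x)"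
  define r where "r = rm (NN m) (c, x)"
  define s where "s = (\<chi> j. poly (spp c j) x)"
  define Bx where "Bx = (\<chi> a b. poly (bs c a b) x)"
  define EE where "EE = Em c (wv \<eta> v)"
  define \<tau> where "\<tau> = (diag_mat (\<chi> i. cis \<eta> * poly (spp c i) (exp (- wv \<eta> v)) / of_nat K) :: 'n cmat)"
  have vnz: "v \<noteq> 0" using v by auto
  have xnz: "x \<noteq> 0" by (simp add: x_def)
  have \<tau>: "\<tau> = msc (cis \<eta> / of_nat K) (diag_mat s)"
    by (simp add: \<tau>_def vec_eq_iff msc_nth diag_mat_def s_def x_def)
  have xK: "x ^ K = cis (- \<eta>) / v" using exp_wv(3)[OF vnz, of \<eta> 1] by (simp add: x_def)
  have cxK: "1 / (v * x ^ K) = cis \<eta>" unfolding xK using vnz by (simp add: cis_inverse[symmetric] field_simps del: cis_inverse)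
  have num: "msc (x ^ Suc (NN m)) r = Bx ** Y - Y ** diag_mat s + msc (x ^ Suc K) dY"
    unfolding vec_eq_iff msc_nth vector_add_component vector_minus_component diag_mult_right
  proof (intro allI)
    fix a j
    have "x ^ Suc (NN m) * r $ a $ j = poly (num (NN m) c a j) x" unfolding r_def num_eval ..
    also have "\<dots> = (Bx ** Y) $ a $ j - Y $ a $ j * s $ j + x ^ Suc K * dY $ a $ j"
      unfolding num_def poly_add poly_diff poly_sum poly_mult poly_monom
      by (simp add: Bx_def Y_def YN_def s_def dY_def matrix_matrix_mult_def)
    finally show "x ^ Suc (NN m) * r $ a $ j = (Bx ** Y) $ a $ j - Y $ a $ j * s $ j + x ^ Suc K * dY $ a $ j" .
  qed
  \<comment> \<open>As \<open>Suc (NN m)\<close> is K m + K, one factor x^K can be traded against 1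
    / v for the constant cis eta.\<close>
  have YM: "msc (x ^ (K * m) / (of_nat K * v)) r = msc (cis \<eta> / of_nat K) (Bx ** Y - Y ** diag_mat s) + msc (x / (of_nat K * v)) dY"
  proof -
    have a: "x ^ (K * m) / (of_nat K * v) = (1 / (of_nat K * v * x ^ K)) * x ^ Suc (NN m)"
      unfolding Suc_NN power_add using xnz vnz by (simp add: field_simps del: of_nat_Suc power_Suc)
    have b: "1 / (of_nat K * v * x ^ K) = cis \<eta> / of_nat K" unfolding cxK[symmetric] by (simp del: of_nat_Suc power_Suc)
    have c': "1 / (of_nat K * v * x ^ K) * x ^ Suc K = x / (of_nat K * v)" using xnz by simp
    show ?thesis unfolding a msc_msc[symmetric] num msc_add(1) unfolding msc_msc c' unfolding b ..
  qed
  have Bexp: "Bm c (exp (wv \<eta> v)) = msc (exp (wv \<eta> v) ^ k) Bx"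
    by (simp add: vec_eq_iff msc_nth Bm_eq Bx_def x_def exp_minus divide_inverse)
  have coef: "exp (wv \<eta> v) / (of_nat K * v) * exp (wv \<eta> v) ^ k = cis \<eta> / of_nat K"
    using exp_wv(1)[OF vnz, of \<eta>] vnz by (simp add: field_simps del: of_nat_Suc)
  have M: "(\<chi> i j. x ^ (K * m) / (of_nat K * v) * (matrix_inv Y ** r) $ i $ j) = msc (x ^ (K * m) / (of_nat K * v)) (matrix_inv Y ** r)"
    by (simp add: msc_def)
  have "has_matrix_derivative (\<lambda>v. YN (NN m) c (exp (- wv \<eta> v)) ** H v ** Em c (wv \<eta> v))
     ((msc (- x / (of_nat K * v)) dY ** H v + Y ** (\<tau> ** H v - H v ** \<tau> + msc (x ^ (K * m) / (of_nat K * v)) (matrix_inv Y ** r) ** H v)) ** EE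
       + Y ** H v ** (\<tau> ** EE)) v"
    using has_matrix_derivative_mult[OF has_matrix_derivative_mult[OF YN_deriv[where N = "NN m" and c = c and \<eta> = \<eta>, OF v] H]
        Em_deriv[where c = c and \<eta> = \<eta>, OF v]]
    unfolding x_def[symmetric] Y_def[symmetric] dY_def[symmetric] r_def[symmetric] EE_def[symmetric] M[symmetric]
    by (simp only: \<tau>_def x_def)
  \<comment> \<open>The term with H on the left of tau cancels against the derivative of the
    exponential factor.\<close>
  also have "(msc (- x / (of_nat K * v)) dY ** H v + Y ** (\<tau> ** H v - H v ** \<tau> + msc (x ^ (K * m) / (of_nat K * v)) (matrix_inv Y ** r) ** H v)) ** EE
       + Y ** H v ** (\<tau> ** EE) = (msc (- x / (of_nat K * v)) dY + Y ** \<tau> + Y ** msc (x ^ (K * m) / (of_nat K * v)) (matrix_inv Y ** r)) ** (H v ** EE)"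
    by (simp add: matrix_mult_add_left matrix_add_ldistrib matrix_mult_sub_left matrix_mult_sub_right matrix_mul_assoc)
  also have "Y ** msc (x ^ (K * m) / (of_nat K * v)) (matrix_inv Y ** r) = msc (x ^ (K * m) / (of_nat K * v)) r"
    using matrix_inv_mult_right[OF inv] by (simp add: msc_mult matrix_mul_assoc Y_def x_def)
  also have "msc (- x / (of_nat K * v)) dY + Y ** \<tau> + msc (x ^ (K * m) / (of_nat K * v)) r = msc (cis \<eta> / of_nat K) (Bx ** Y)"
    unfolding YM \<tau> msc_mult msc_add by (simp add: vec_eq_iff msc_nth)
  also have "msc (cis \<eta> / of_nat K) (Bx ** Y) ** (H v ** EE) = msc (exp (wv \<eta> v) / (of_nat K * v)) (Bm c (exp (wv \<eta> v))) ** (Y ** H v ** EE)"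
    unfolding Bexp msc_msc coef by (simp add: msc_mult matrix_mul_assoc)
  finally show ?thesis by (simp add: Y_def x_def EE_def)
qed

text \<open>In the cone the constructed solution and \<open>U\<close> satisfy the same linear
  equation, so they differ by a constant right factor. Computed at one point, this factor is seen to
  be holomorphic in the parameter, and it continues the solution to all w.\<close>

lemma global_solution:
  fixes c0 :: "'m cvec"
  assumes wide: "wide \<eta> \<kappa>" and m: "m \<ge> 1"
  obtains R KC Cc where "R \<ge> 1" "KC \<ge> 0"
    and "\<And>i j. holo_on (ball c0 1 \<times> UNIV) (\<lambda>q. Cc (fst q) $ i $ j)"
    and "\<And>c. c \<in> ball c0 1 \<Longrightarrow> invertible (Cc c)"
    and "\<And>c v i j. c \<in> ball c0 1 \<Longrightarrow> v \<in> half_cone \<kappa> R \<Longrightarrow>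
       norm (normed c (\<lambda>w. U (c, w) ** Cc c) (wv \<eta> v) $ i $ j - YN (NN m) c (exp (- wv \<eta> v)) $ i $ j) \<le> KC / Re v ^ m"
proof -
  obtain R KC KY H where R: "R \<ge> 1" and KC: "KC \<ge> 0" and KY: "KY \<ge> 0"
    and hH: "\<And>i j. holo_on (ball c0 1 \<times> half_cone \<kappa> R) (\<lambda>q. H q $ i $ j)"
    and Hb: "\<And>c v i j. c \<in> ball c0 1 \<Longrightarrow> v \<in> half_cone \<kappa> R \<Longrightarrow>
           norm (H (c, v) $ i $ j - (if i = j then 1 else 0)) \<le> KC / Re v ^ m"
    and Hd: "\<And>c v. c \<in> ball c0 1 \<Longrightarrow> v \<in> half_cone \<kappa> R \<Longrightarrow>
       has_matrix_derivative (\<lambda>v. H (c, v))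
         (diag_mat (\<chi> i. cis \<eta> * poly (spp c i) (exp (- wv \<eta> v)) / of_nat K) ** H (c, v)
          - H (c, v) ** diag_mat (\<chi> i. cis \<eta> * poly (spp c i) (exp (- wv \<eta> v)) / of_nat K)
          + (\<chi> i j. exp (- wv \<eta> v) ^ (K * m) / (of_nat K * v) *
               (matrix_inv (YN (NN m) c (exp (- wv \<eta> v))) ** rm (NN m) (c, exp (- wv \<eta> v))) $ i $ j) ** H (c, v)) v"
    and Yi: "\<And>c v. c \<in> ball c0 1 \<Longrightarrow> v \<in> half_cone \<kappa> R \<Longrightarrow> invertible (YN (NN m) c (exp (- wv \<eta> v)))"
    and Yb: "\<And>c v i j. c \<in> ball c0 1 \<Longrightarrow> v \<in> half_cone \<kappa> R \<Longrightarrow> norm (YN (NN m) c (exp (- wv \<eta> v)) $ i $ j) \<le> KY"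
    by (rule local_solution[OF wide m, of c0]) (rule that)
  have \<kappa>: "\<kappa> > 0" using wide by (simp add: wide_def)
  have Rev: "Re v > R" "Re v > 0" if "v \<in> half_cone \<kappa> R" for v using half_cone_Re[OF that \<kappa>] R by auto
  obtain \<delta> where \<delta>: "\<delta> > 0" "\<And>M :: 'n cmat. (\<And>i j. norm (M $ i $ j - (if i = j then 1 else 0)) < \<delta>) \<Longrightarrow> det M \<noteq> 0"
    using det_near_identity[where 'n = 'n] by blast
  \<comment> \<open>Far enough out for H to be within delta of the identity, hence invertible, for
    all parameters of the ball at once.\<close>
  define t where "t = R + KC / \<delta> + 1"
  have t: "t > R" "t \<ge> 1" "t > KC / \<delta>" using R KC \<delta> by (auto simp: t_def add_nonneg_pos)
  define v1 where "v1 = complex_of_real t"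
  have v1: "v1 \<in> half_cone \<kappa> R" using t \<kappa> by (simp add: half_cone_def v1_def)
  have Hinv: "invertible (H (c, v1))" if c: "c \<in> ball c0 1" for c
    unfolding invertible_det_nz
  proof (rule \<delta>(2))
    fix i j
    have "norm (H (c, v1) $ i $ j - (if i = j then 1 else 0)) \<le> KC / t ^ m" using Hb[OF c v1, of i j] by (simp add: v1_def)
    also have "\<dots> \<le> KC / t" using KC t m self_le_power[of t m] by (intro divide_left_mono) auto
    also have "\<dots> < \<delta>" using t \<delta> by (simp add: field_simps)
    finally show "norm (H (c, v1) $ i $ j - (if i = j then 1 else 0)) < \<delta>" .
  qed
  define w1 where "w1 = wv \<eta> v1"
  define \<Phi>l where "\<Phi>l = (\<lambda>c v. YN (NN m) c (exp (- wv \<eta> v)) ** H (c, v) ** Em c (wv \<eta> v))"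
  define Cc where "Cc = (\<lambda>c. matrix_inv (U (c, w1)) ** \<Phi>l c v1)"
  have Em_inv: "invertible (Em c w)" for c w
    unfolding Em_def invertible_def
    by (rule exI[of _ "diag_mat (\<chi> j. exp (- Ef c j w))"]) (simp add: diag_mat_mult diag_mat_one flip: exp_add)
  have Cinv: "invertible (Cc c)" if "c \<in> ball c0 1" for c
    unfolding Cc_def \<Phi>l_def
    using that matrix_inv_mult[OF U_invertible] left_inverse_right_inverse_matrix
    by (intro invertible_matrix_mult Yi v1 Hinv Em_inv) blast+
  have agree: "U (c, wv \<eta> v) ** Cc c = \<Phi>l c v" if c: "c \<in> ball c0 1" and v: "v \<in> half_cone \<kappa> R" for c v
    unfolding Cc_def w1_def
  proof (rule linear_ode_unique[of "half_cone \<kappa> R" "\<lambda>v. U (c, wv \<eta> v)" "\<lambda>v. msc (exp (wv \<eta> v) / (of_nat K * v)) (Bm c (exp (wv \<eta> v)))" "\<Phi>l c", symmetric])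
    fix u assume u: "u \<in> half_cone \<kappa> R"
    have "has_matrix_derivative (\<lambda>v. U (c, wv \<eta> v)) (msc (1 / (of_nat K * u)) (msc (exp (wv \<eta> u)) (Bm c (exp (wv \<eta> u))) ** U (c, wv \<eta> u))) u"
      by (rule has_matrix_derivative_chain[OF U_deriv wv_deriv[OF Rev(2)[OF u]]])
    thus "has_matrix_derivative (\<lambda>v. U (c, wv \<eta> v)) (msc (exp (wv \<eta> u) / (of_nat K * u)) (Bm c (exp (wv \<eta> u))) ** U (c, wv \<eta> u)) u"
      by (simp add: msc_mult msc_msc del: of_nat_Suc)
    show "has_matrix_derivative (\<Phi>l c) (msc (exp (wv \<eta> u) / (of_nat K * u)) (Bm c (exp (wv \<eta> u))) ** \<Phi>l c u) u"
      unfolding \<Phi>l_def by (rule gauge_transformed_equation[OF Rev(2)[OF u] Yi[OF c u] Hd[OF c u]])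
  qed (use v v1 open_half_cone convex_half_cone U_invertible in auto)
  have hC: "holo_on (ball c0 1 \<times> UNIV) (\<lambda>q. Cc (fst q) $ i $ j)" for i j
  proof -
    have cn: "holo_on (ball c0 1 \<times> UNIV) (\<lambda>q. w)" for w :: complex by (rule holo_on_const)
    have 1: "holo_on (ball c0 1 \<times> UNIV) (\<lambda>q. matrix_inv (U (fst q, w1)) $ i $ j)" for i j
    proof -
      have "holo_on UNIV (\<lambda>q. matrix_inv (U q) $ i $ j)"
        by (intro holo_on_matrix_inv holo_on_U) (use U_invertible in \<open>auto simp: invertible_det_nz\<close>)
      from holo_on_reparam[OF this cn[of w1]] show ?thesis by simp
    qed
    have 2: "holo_on (ball c0 1 \<times> UNIV) (\<lambda>q. YN (NN m) (fst q) (exp (- wv \<eta> v1)) $ i $ j)" for i j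
      using holo_on_reparam[OF holo_on_YN[of UNIV "NN m" i j] cn[of "exp (- wv \<eta> v1)"]] by simp
    have 3: "holo_on (ball c0 1 \<times> UNIV) (\<lambda>q. H (fst q, v1) $ i $ j)" for i j
      by (rule holo_on_reparam[OF hH cn[of v1]]) (use v1 in auto)
    have 4: "holo_on (ball c0 1 \<times> UNIV) (\<lambda>q. Em (fst q) (wv \<eta> v1) $ i $ j)" for i j
    proof -
      have "holo_on (ball c0 1 \<times> UNIV) (\<lambda>q. Ef (fst q) i (wv \<eta> v1))"
        using holo_on_reparam[OF holo_on_Ef[of UNIV i] cn[of "wv \<eta> v1"]] by simp
      thus ?thesis unfolding Em_def diag_mat_def vec_lambda_beta by (intro holo_on_if holo_on_exp holo_on_const)
    qed
    show ?thesis unfolding Cc_def \<Phi>l_def by (intro holo_on_matrix_mult 1 2 3 4)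
  qed
  show thesis
  proof (rule that[of R "real CARD('n) * KY * KC" Cc, OF R _ hC Cinv])
    show "0 \<le> real CARD('n) * KY * KC" using KY KC by simp
    fix c v i j assume c: "c \<in> ball c0 1" and v: "v \<in> half_cone \<kappa> R"
    define Y where "Y = YN (NN m) c (exp (- wv \<eta> v))"
    have "normed c (\<lambda>w. U (c, w) ** Cc c) (wv \<eta> v) = \<Phi>l c v ** diag_mat (\<chi> j. exp (- Ef c j (wv \<eta> v)))"
      unfolding normed_def agree[OF c v] ..
    also have "\<dots> = Y ** H (c, v)"
      using Em_normed[of c "\<lambda>w. Y ** H (c, v)" "wv \<eta> v"] by (simp add: normed_def \<Phi>l_def Y_def)
    finally have eq: "normed c (\<lambda>w. U (c, w) ** Cc c) (wv \<eta> v) = Y ** H (c, v)" .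
    have "(Y ** H (c, v)) $ i $ j - Y $ i $ j = (Y ** H (c, v) - Y ** mat 1) $ i $ j" by simp
    also have "\<dots> = (Y ** (H (c, v) - mat 1)) $ i $ j" by (simp only: matrix_mult_sub_right)
    also have "\<dots> = (\<Sum>l\<in>UNIV. Y $ i $ l * (H (c, v) $ l $ j - (if l = j then 1 else 0)))"
      by (simp add: matrix_matrix_mult_def mat_def)
    finally have "(Y ** H (c, v)) $ i $ j - Y $ i $ j = (\<Sum>l\<in>UNIV. Y $ i $ l * (H (c, v) $ l $ j - (if l = j then 1 else 0)))" .
    moreover have "norm (\<Sum>l\<in>UNIV. Y $ i $ l * (H (c, v) $ l $ j - (if l = j then 1 else 0))) \<le> (\<Sum>l\<in>(UNIV :: 'n set). KY * (KC / Re v ^ m))"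
    proof (rule sum_norm_le)
      fix l
      show "norm (Y $ i $ l * (H (c, v) $ l $ j - (if l = j then 1 else 0))) \<le> KY * (KC / Re v ^ m)"
        unfolding norm_mult Y_def by (intro mult_mono Yb Hb c v KY) simp
    qed
    ultimately have "norm ((Y ** H (c, v)) $ i $ j - Y $ i $ j) \<le> real CARD('n) * (KY * (KC / Re v ^ m))" by simp
    thus "norm (normed c (\<lambda>w. U (c, w) ** Cc c) (wv \<eta> v) $ i $ j - YN (NN m) c (exp (- wv \<eta> v)) $ i $ j) \<le> real CARD('n) * KY * KC / Re v ^ m"
      unfolding eq by (simp add: Y_def)
  qed
qed


section \<open>Comparison of solutions with the same expansion\<close>

lemma normed_Em: "normed c \<Phi> w ** Em c w = \<Phi> w"
  by (simp add: normed_def Em_def diag_mat_mult diag_mat_one flip: matrix_mul_assoc exp_add)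

text \<open>Conjugation by \<open>exp Ef\<close> turns the constant matrix relating two solutions with the same
  asymptotics into one tending to the identity.\<close>

lemma transition:
  assumes lim: "\<And>a b. ((\<lambda>w. normed c \<Phi> w $ a $ b) \<longlongrightarrow> f0 $ a $ b) F"
    and lim': "\<And>a b. ((\<lambda>w. normed c \<Phi>' w $ a $ b) \<longlongrightarrow> f0 $ a $ b) F"
    and rel: "\<And>w. \<Phi>' w = \<Phi> w ** M" and F: "F \<noteq> bot"
  shows "M $ a $ a = 1"
    and "\<lbrakk>a \<noteq> b; \<forall>\<^sub>F w in F. Re (Ef c a w - Ef c b w) \<ge> 0\<rbrakk> \<Longrightarrow> M $ a $ b = 0"
proof -
  define T where "T = (\<lambda>w. Em c w ** M ** diag_mat (\<chi> j. exp (- Ef c j w)))"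
  have T_nth: "T w $ a $ b = M $ a $ b * exp (Ef c a w - Ef c b w)" for w a b
    unfolding T_def diag_mult_right unfolding Em_def diag_mult_left by (simp add: exp_diff exp_minus divide_inverse)
  have nT: "normed c \<Phi>' w = normed c \<Phi> w ** T w" for w
  proof -
    have "normed c \<Phi>' w = (normed c \<Phi> w ** Em c w) ** M ** diag_mat (\<chi> j. exp (- Ef c j w))"
      unfolding normed_Em unfolding normed_def rel ..
    thus ?thesis by (simp add: T_def matrix_mul_assoc)
  qed
  have ev: "\<forall>\<^sub>F w in F. invertible (normed c \<Phi> w)" by (rule tendsto_matrix_inv(2)[OF lim inv_f0])
  have "((\<lambda>w. (matrix_inv (normed c \<Phi> w) ** normed c \<Phi>' w) $ a $ b) \<longlongrightarrow> (fi ** f0) $ a $ b) F" for a b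
    unfolding matrix_matrix_mult_def vec_lambda_beta
    by (intro tendsto_sum tendsto_mult lim' tendsto_matrix_inv(1)[OF lim inv_f0])
  hence Tlim: "((\<lambda>w. T w $ a $ b) \<longlongrightarrow> (if a = b then 1 else 0)) F" for a b
    unfolding f0_fi mat_def vec_lambda_beta
  proof (rule Lim_transform_eventually)
    show "\<forall>\<^sub>F w in F. (matrix_inv (normed c \<Phi> w) ** normed c \<Phi>' w) $ a $ b = T w $ a $ b"
      using ev by eventually_elim (simp add: nT matrix_mul_assoc matrix_inv_mult_left)
  qed
  show "M $ a $ a = 1" using tendsto_unique[OF F Tlim[of a a]] by (simp add: T_nth)
  show "M $ a $ b = 0" if ab: "a \<noteq> b" and re: "\<forall>\<^sub>F w in F. Re (Ef c a w - Ef c b w) \<ge> 0"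
  proof -
    have "((\<lambda>w. norm (T w $ a $ b)) \<longlongrightarrow> 0) F" using tendsto_norm[OF Tlim[of a b]] ab by simp
    moreover have "\<forall>\<^sub>F w in F. norm (M $ a $ b) \<le> norm (T w $ a $ b)"
      using re
    proof eventually_elim
      case (elim w)
      hence "1 \<le> norm (exp (Ef c a w - Ef c b w))" by simp
      from mult_left_mono[OF this, of "norm (M $ a $ b)"] show ?case by (simp only: T_nth norm_mult norm_ge_zero) simp
    qed
    ultimately have "norm (M $ a $ b) \<le> 0"
      using tendsto_lowerbound[OF _ _ F] by blast
    thus ?thesis by simp
  qed
qed

lemma Ef_leading: "((\<lambda>w. exp (- w) ^ K * Ef c j w) \<longlongrightarrow> lam $ j / of_nat K) (closed_sector_filter \<alpha> \<beta>)"
proof -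
  have eq: "exp (- w) ^ K * Ef c j w = (\<Sum>l\<le>K. coeff (fQ c $ j) l * exp (- w) ^ (K - l)) + fL c $ j * ((w * exp (- w)) * exp (- w) ^ k)" for w
  proof -
    have "exp (- w) ^ K * exp w ^ l = exp (- w) ^ (K - l)" if "l \<le> K" for l
    proof -
      have "exp (- w) ^ K = exp (- w) ^ (K - l) * exp (- w) ^ l" using that by (simp flip: power_add)
      moreover have "exp (- w) ^ l * exp w ^ l = 1" by (simp flip: power_mult_distrib exp_add)
      ultimately show ?thesis by (simp only: mult.assoc) simp
    qed
    hence "exp (- w) ^ K * (coeff (fQ c $ j) l * exp w ^ l) = coeff (fQ c $ j) l * exp (- w) ^ (K - l)" if "l \<le> K" for l
      using that by (metis mult.left_commute)
    hence "exp (- w) ^ K * (\<Sum>l\<le>K. coeff (fQ c $ j) l * exp w ^ l) = (\<Sum>l\<le>K. coeff (fQ c $ j) l * exp (- w) ^ (K - l))"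
      unfolding sum_distrib_left by (intro sum.cong) auto
    thus ?thesis unfolding Ef_def fQ_eval distrib_left by (simp add: mult_ac)
  qed
  have "((\<lambda>w. (\<Sum>l\<le>K. coeff (fQ c $ j) l * exp (- w) ^ (K - l)) + fL c $ j * ((w * exp (- w)) * exp (- w) ^ k))
      \<longlongrightarrow> (\<Sum>l\<le>K. coeff (fQ c $ j) l * 0 ^ (K - l)) + fL c $ j * (0 * 0 ^ k)) (closed_sector_filter \<alpha> \<beta>)"
    by (intro tendsto_intros tendsto_exp_minus_closed_sector tendsto_w_exp_minus_closed_sector)
  moreover have "(\<Sum>l\<le>K. coeff (fQ c $ j) l * 0 ^ (K - l)) = (\<Sum>l\<in>{K}. coeff (fQ c $ j) l * 0 ^ (K - l))"
    by (rule sum.mono_neutral_right) auto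
  ultimately show ?thesis unfolding eq using fQ_top(1)[of c j] by simp
qed

text \<open>Along a ray the exponents are dominated by lam z^K / K, so the real part of (lam a - lam
  b) z^K decides.\<close>

lemma Ef_growth:
  assumes "Re ((lam $ a - lam $ b) * cis (real K * \<phi>)) > 0"
  shows "\<forall>\<^sub>F w in closed_sector_filter \<phi> \<phi>. Re (Ef c a w - Ef c b w) \<ge> 0"
proof -
  let ?F = "closed_sector_filter \<phi> \<phi>"
  have "((\<lambda>w. Re (cis (real K * \<phi>) * (exp (- w) ^ K * Ef c a w - exp (- w) ^ K * Ef c b w))) \<longlongrightarrow>
      Re (cis (real K * \<phi>) * (lam $ a / of_nat K - lam $ b / of_nat K))) ?F"
    by (intro tendsto_intros Ef_leading)
  moreover have "Re (cis (real K * \<phi>) * (lam $ a / of_nat K - lam $ b / of_nat K)) > 0"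
  proof -
    have "cis (real K * \<phi>) * (lam $ a / of_nat K - lam $ b / of_nat K) = ((lam $ a - lam $ b) * cis (real K * \<phi>)) / of_nat K"
      by (simp add: diff_divide_distrib[symmetric] mult.commute del: of_nat_Suc)
    thus ?thesis using assms by (simp only: Re_divide_of_nat) (simp del: of_nat_Suc)
  qed
  ultimately have ev: "\<forall>\<^sub>F w in ?F. Re (cis (real K * \<phi>) * (exp (- w) ^ K * Ef c a w - exp (- w) ^ K * Ef c b w)) > 0"
    by (rule order_tendstoD)
  have im: "\<forall>\<^sub>F w in ?F. Im w = \<phi>" unfolding eventually_closed_sector by auto
  show ?thesis using ev im
  proof eventually_elim
    case (elim w)
    have "exp w ^ K = exp (of_nat K * w)" by (rule exp_of_nat_mult[symmetric])
    also have "of_nat K * w = of_real (real K * Re w) + \<i> * of_real (real K * \<phi>)"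
      using elim(2) by (simp add: complex_eq_iff del: of_nat_Suc)
    also have "exp (of_real A + \<i> * of_real B) = of_real (exp A) * cis B" for A B
      by (simp add: exp_add cis_conv_exp exp_of_real)
    finally have ew: "exp w ^ K = of_real (exp (real K * Re w)) * cis (real K * \<phi>)" .
    have "exp w ^ K * exp (- w) ^ K = 1" by (simp only: power_mult_distrib[symmetric] exp_minus_inverse power_one)
    hence "Ef c a w - Ef c b w = exp w ^ K * (exp (- w) ^ K * Ef c a w - exp (- w) ^ K * Ef c b w)"
      by (simp only: right_diff_distrib mult.assoc[symmetric]) simp
    also have "\<dots> = of_real (exp (real K * Re w)) * (cis (real K * \<phi>) * (exp (- w) ^ K * Ef c a w - exp (- w) ^ K * Ef c b w))"
      unfolding ew by (simp only: mult.assoc)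
    finally have "Re (Ef c a w - Ef c b w) = exp (real K * Re w) * Re (cis (real K * \<phi>) * (exp (- w) ^ K * Ef c a w - exp (- w) ^ K * Ef c b w))"
      by (simp only: times_complex.simps Re_complex_of_real Im_complex_of_real mult_zero_left diff_zero)
    thus ?case using elim(1) by simp
  qed
qed

text \<open>The window is the intersection of the half-planes around eta1 and eta2. On [eta1, eta2]
  the function Im (mu cis eta) has no zero, hence a fixed sign. If it is positive at eta2, then Re
  (mu cis theta) is positive just above eta2 - pi/2; if it is negative at eta1, just below eta1 +
  pi/2.\<close>

lemma growth_direction:
  assumes "\<eta>1 \<le> \<eta>2" "\<eta>2 - \<eta>1 < pi" and gen: "\<And>\<eta>. \<eta>1 \<le> \<eta> \<Longrightarrow> \<eta> \<le> \<eta>2 \<Longrightarrow> generic \<eta>" and ab: "a \<noteq> b"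
  shows "\<exists>\<theta>. \<eta>2 - pi / 2 < \<theta> \<and> \<theta> < \<eta>1 + pi / 2 \<and> Re ((lam $ a - lam $ b) * cis \<theta>) > 0"
proof -
  define \<mu> where "\<mu> = lam $ a - lam $ b"
  define f where "f = (\<lambda>\<eta>. Im (\<mu> * cis \<eta>))"
  have cf: "continuous_on A f" for A unfolding f_def by (intro continuous_intros)
  have cr: "isCont (\<lambda>\<theta>. Re (\<mu> * cis \<theta>)) x" for x
    using continuous_on_eq_continuous_at[OF open_UNIV, of "\<lambda>\<theta>. Re (\<mu> * cis \<theta>)"] by (auto intro!: continuous_intros)
  have fnz: "f \<eta> \<noteq> 0" if "\<eta>1 \<le> \<eta>" "\<eta> \<le> \<eta>2" for \<eta>
    using gen[OF that] ab by (simp add: generic_def f_def \<mu>_def)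
  show ?thesis
  proof (cases "f \<eta>2 > 0")
    case True
    have "Re (\<mu> * cis (\<eta>2 - pi / 2)) = f \<eta>2" by (simp add: f_def cos_diff sin_diff)
    with True cr[of "\<eta>2 - pi / 2"] have "\<forall>\<^sub>F x in at (\<eta>2 - pi / 2). Re (\<mu> * cis x) > 0"
      by (intro order_tendstoD(1)[OF isContD]) auto
    hence "\<forall>\<^sub>F x in at_right (\<eta>2 - pi / 2). Re (\<mu> * cis x) > 0"
      unfolding eventually_at_split by blast
    moreover have "\<forall>\<^sub>F x in at_right (\<eta>2 - pi / 2). \<eta>2 - pi / 2 < x \<and> x < \<eta>1 + pi / 2"
      using assms(2) by (intro eventually_conj eventually_at_right_less eventually_at_rightI[of _ "\<eta>1 + pi / 2"]) auto
    ultimately have "\<forall>\<^sub>F x in at_right (\<eta>2 - pi / 2). \<eta>2 - pi / 2 < x \<and> x < \<eta>1 + pi / 2 \<and> Re (\<mu> * cis x) > 0"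
      by eventually_elim auto
    thus ?thesis unfolding \<mu>_def[symmetric] using eventually_happens'[OF trivial_limit_at_right_real] by blast
  next
    case False
    have "f \<eta>1 < 0"
    proof (rule ccontr)
      assume "\<not> f \<eta>1 < 0"
      then obtain x where "\<eta>1 \<le> x" "x \<le> \<eta>2" "f x = 0"
        using IVT2'[of f \<eta>2 0 \<eta>1] False assms(1) cf by auto
      thus False using fnz by blast
    qed
    have "Re (\<mu> * cis (\<eta>1 + pi / 2)) = - f \<eta>1" by (simp add: f_def cos_add sin_add)
    with \<open>f \<eta>1 < 0\<close> cr[of "\<eta>1 + pi / 2"] have "\<forall>\<^sub>F x in at (\<eta>1 + pi / 2). Re (\<mu> * cis x) > 0"
      by (intro order_tendstoD(1)[OF isContD]) auto
    hence "\<forall>\<^sub>F x in at_left (\<eta>1 + pi / 2). Re (\<mu> * cis x) > 0"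
      unfolding eventually_at_split by blast
    moreover have "\<forall>\<^sub>F x in at_left (\<eta>1 + pi / 2). x < \<eta>1 + pi / 2"
      by (rule eventually_at_leftI[of "\<eta>1 + pi / 2 - 1"]) auto
    moreover have "\<forall>\<^sub>F x in at_left (\<eta>1 + pi / 2). \<eta>2 - pi / 2 < x"
      using assms(2) by (intro eventually_at_leftI[of "\<eta>2 - pi / 2"]) auto
    ultimately have "\<forall>\<^sub>F x in at_left (\<eta>1 + pi / 2). \<eta>2 - pi / 2 < x \<and> x < \<eta>1 + pi / 2 \<and> Re (\<mu> * cis x) > 0"
      by eventually_elim auto
    thus ?thesis unfolding \<mu>_def[symmetric] using eventually_happens'[OF trivial_limit_at_left_real] by blast
  qed
qed

lemma eventually_wide:
  assumes "generic \<eta>"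
  obtains \<kappa>0 where "\<And>\<kappa>. \<kappa> \<ge> \<kappa>0 \<Longrightarrow> wide \<eta> \<kappa>"
proof -
  define \<mu> where "\<mu> = (\<lambda>p. (lam $ fst p - lam $ snd p) * cis \<eta>)"
  define g where "g = (\<lambda>p. (\<bar>Re (\<mu> p)\<bar> + 1) / \<bar>Im (\<mu> p)\<bar>)"
  have g0: "g p \<ge> 0" for p by (simp add: g_def)
  show thesis
  proof (rule that[of "1 + (\<Sum>p\<in>UNIV. g p)"])
    fix \<kappa> assume \<kappa>: "\<kappa> \<ge> 1 + (\<Sum>p\<in>UNIV. g p)"
    have pos: "\<kappa> > 0" using \<kappa> sum_nonneg[of UNIV g] g0 by auto
    have "Re (\<mu> (a, b)) + \<kappa> * \<bar>Im (\<mu> (a, b))\<bar> > 0" if "a \<noteq> b" for a b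
    proof -
      have im: "Im (\<mu> (a, b)) \<noteq> 0" using assms that by (simp add: generic_def \<mu>_def)
      have "g (a, b) \<le> (\<Sum>p\<in>UNIV. g p)" by (intro member_le_sum) (auto simp: g0)
      hence "g (a, b) * \<bar>Im (\<mu> (a, b))\<bar> \<le> \<kappa> * \<bar>Im (\<mu> (a, b))\<bar>" using \<kappa> by (intro mult_right_mono) auto
      moreover have "g (a, b) * \<bar>Im (\<mu> (a, b))\<bar> = \<bar>Re (\<mu> (a, b))\<bar> + 1" using im by (simp add: g_def)
      ultimately show ?thesis by linarith
    qed
    thus "wide \<eta> \<kappa>" using pos by (simp add: wide_def \<mu>_def)
  qed
qed

text \<open>On a closed sector strictly inside the half-plane the cosine of the angle has a positive
  minimum c1. This places the far part of the sector in a cone of finite slope, and makes Re v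
  comparable to |v|, so that decay in Re v becomes decay in |z|.\<close>

lemma sector_in_half_cone:
  assumes "real K * \<alpha> - \<eta> > - (pi / 2)" "real K * \<beta> - \<eta> < pi / 2"
  obtains \<kappa>s where "\<kappa>s > 0" "\<And>\<kappa> R. \<kappa> \<ge> \<kappa>s \<Longrightarrow> R \<ge> 1 \<Longrightarrow> \<exists>\<rho>. \<forall>w. Im w \<in> {\<alpha>..\<beta>} \<longrightarrow> Re w \<ge> \<rho> \<longrightarrow>
     (let v = exp (of_nat K * w - \<i> * of_real \<eta>) in v \<in> half_cone \<kappa> R \<and> wv \<eta> v = w \<and> norm v \<le> \<kappa>s * Re v \<and> Re v > 0)"
proof (cases "\<alpha> \<le> \<beta>")
  case False thus thesis by (intro that[of 1]) auto
next
  case True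
  have "\<exists>x\<in>{\<alpha>..\<beta>}. \<forall>y\<in>{\<alpha>..\<beta>}. cos (real K * x - \<eta>) \<le> cos (real K * y - \<eta>)"
    using True by (intro continuous_attains_inf) (auto intro!: continuous_intros)
  then obtain x where x: "x \<in> {\<alpha>..\<beta>}" "\<And>y. y \<in> {\<alpha>..\<beta>} \<Longrightarrow> cos (real K * x - \<eta>) \<le> cos (real K * y - \<eta>)" by blast
  have ang: "- (pi / 2) < real K * y - \<eta> \<and> real K * y - \<eta> < pi / 2" if "y \<in> {\<alpha>..\<beta>}" for y
  proof -
    have "real K * \<alpha> \<le> real K * y" "real K * y \<le> real K * \<beta>" using that by (auto intro!: mult_left_mono simp del: of_nat_Suc)
    thus ?thesis using assms by linarith
  qed
  define c1 where "c1 = cos (real K * x - \<eta>)"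
  have c1: "c1 > 0" unfolding c1_def using ang[OF x(1)] by (intro cos_gt_zero_pi) auto
  \<comment> \<open>Re v >= c1 |v| alone would allow the slope 1 / c1; the factor 2 absorbs the apex
    R, since c1 |v| > 2 R far out.\<close>
  show thesis
  proof (rule that[of "2 / c1"])
    show "2 / c1 > 0" using c1 by simp
    fix \<kappa> R :: real assume \<kappa>: "\<kappa> \<ge> 2 / c1" and R: "R \<ge> 1"
    show "\<exists>\<rho>. \<forall>w. Im w \<in> {\<alpha>..\<beta>} \<longrightarrow> Re w \<ge> \<rho> \<longrightarrow>
     (let v = exp (of_nat K * w - \<i> * of_real \<eta>) in v \<in> half_cone \<kappa> R \<and> wv \<eta> v = w \<and> norm v \<le> 2 / c1 * Re v \<and> Re v > 0)"
    proof (intro exI[of _ "2 * R / c1"] allI impI)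
      fix w assume w: "Im w \<in> {\<alpha>..\<beta>}" "Re w \<ge> 2 * R / c1"
      define v where "v = exp (of_nat K * w - \<i> * of_real \<eta>)"
      have pw: "Re w > 0" using w c1 R by (smt (verit) divide_pos_pos)
      have im: "Im (of_nat K * w - \<i> * of_real \<eta>) = real K * Im w - \<eta>" by (simp del: of_nat_Suc)
      have re: "Re (of_nat K * w - \<i> * of_real \<eta>) = real K * Re w" by (simp del: of_nat_Suc)
      have nv: "norm v = exp (real K * Re w)" unfolding v_def norm_exp_eq_Re re ..
      have "1 * Re w \<le> real K * Re w" using pw by (intro mult_right_mono) auto
      hence nv1: "norm v > 2 * R / c1" unfolding nv using exp_ge_add_one_self[of "real K * Re w"] w by linarith
      have Rev: "Re v = norm v * cos (real K * Im w - \<eta>)" unfolding nv unfolding v_def Re_exp im re ..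
      have Rec: "Re v \<ge> c1 * norm v" unfolding Rev using x(2)[OF w(1)] by (simp add: c1_def mult.commute mult_left_mono)
      have c1v: "c1 * norm v > 2 * R" using nv1 c1 by (simp add: field_simps)
      have "norm v < 2 / c1 * (c1 * norm v - R)" using nv1 c1 by (simp add: field_simps)
      also have "\<dots> \<le> 2 / c1 * (Re v - R)" using Rec c1 by (intro mult_left_mono) auto
      also have "\<dots> \<le> \<kappa> * (Re v - R)" using \<kappa> Rec c1v R by (intro mult_right_mono) auto
      finally have "v \<in> half_cone \<kappa> R" using abs_Im_le_cmod[of v] by (simp add: half_cone_def)
      moreover have "wv \<eta> v = w"
      proof -
        have "Ln v = of_nat K * w - \<i> * of_real \<eta>"
          unfolding v_def using ang[OF w(1)] im pi_gt_zero by (intro Ln_exp) linarith+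
        thus ?thesis by (simp add: wv_def del: of_nat_Suc)
      qed
      moreover have "norm v \<le> 2 / c1 * Re v"
      proof -
        have "norm v \<le> 1 / c1 * Re v" using Rec c1 by (simp add: field_simps)
        also have "\<dots> \<le> 2 / c1 * Re v" using Rec c1v R c1 by (intro mult_right_mono divide_right_mono) auto
        finally show ?thesis .
      qed
      moreover have "Re v > 0" using Rec c1v R by linarith
      ultimately show "let v = exp (of_nat K * w - \<i> * of_real \<eta>) in v \<in> half_cone \<kappa> R \<and> wv \<eta> v = w \<and> norm v \<le> 2 / c1 * Re v \<and> Re v > 0"
        unfolding Let_def v_def by blast
    qed
  qed
qed

section \<open>Solutions attached to a direction\<close>

definition "usol Z c w = U (c, w) ** (Z c :: 'n cmat)"

text \<open>Agreement with the truncated formal solution up to O(|z|^(-K m)), with constants common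
  to all parameters in a unit ball. This uniformity is what later allows differentiation in the
  parameter.\<close>

definition "estimate Z c0 m \<alpha> \<beta> \<longleftrightarrow> (\<exists>KC\<ge>0. \<exists>\<rho>. \<forall>c\<in>ball c0 1. \<forall>w. Im w \<in> {\<alpha>..\<beta>} \<longrightarrow> Re w \<ge> \<rho> \<longrightarrow>
   (\<forall>i j. norm (normed c (usol Z c) w $ i $ j - YN (NN m) c (exp (- w)) $ i $ j) \<le> KC * norm (exp (- w)) ^ (K * m)))"

lemma estimate_tendsto:
  assumes est: "estimate Z c0 m \<alpha> \<beta>" and c: "c \<in> ball c0 1" and m: "m \<ge> 1"
  shows "((\<lambda>w. normed c (usol Z c) w $ i $ j) \<longlongrightarrow> f0 $ i $ j) (closed_sector_filter \<alpha> \<beta>)"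
proof -
  let ?F = "closed_sector_filter \<alpha> \<beta>"
  obtain KC \<rho> where b: "\<And>w. Im w \<in> {\<alpha>..\<beta>} \<Longrightarrow> Re w \<ge> \<rho> \<Longrightarrow>
      norm (normed c (usol Z c) w $ i $ j - YN (NN m) c (exp (- w)) $ i $ j) \<le> KC * norm (exp (- w)) ^ (K * m)"
    using est c unfolding estimate_def by blast
  have "((\<lambda>w. normed c (usol Z c) w $ i $ j - YN (NN m) c (exp (- w)) $ i $ j) \<longlongrightarrow> 0) ?F"
  proof (rule Lim_null_comparison)
    show "\<forall>\<^sub>F w in ?F. norm (normed c (usol Z c) w $ i $ j - YN (NN m) c (exp (- w)) $ i $ j) \<le> KC * norm (exp (- w)) ^ (K * m)"
      unfolding eventually_closed_sector using b by (intro exI[of _ \<rho>]) auto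
    have "((\<lambda>w. KC * norm (exp (- w) :: complex) ^ (K * m)) \<longlongrightarrow> KC * norm (0::complex) ^ (K * m)) ?F"
      by (intro tendsto_intros tendsto_exp_minus_closed_sector)
    thus "((\<lambda>w. KC * norm (exp (- w) :: complex) ^ (K * m)) \<longlongrightarrow> 0) ?F" using m by (simp add: power_0_left)
  qed
  moreover have "((\<lambda>w. YN (NN m) c (exp (- w)) $ i $ j) \<longlongrightarrow> YN (NN m) c 0 $ i $ j) ?F"
    unfolding YN_def vec_lambda_beta by (intro tendsto_intros tendsto_exp_minus_closed_sector)
  ultimately show ?thesis using tendsto_add YN_0 by fastforce
qed

lemma estimate_limit:
  assumes "estimate Z c0 m \<alpha> \<beta>" "c \<in> ball c0 1" "m \<ge> 1" and \<phi>: "\<alpha> \<le> \<phi>" "\<phi> \<le> \<beta>"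
  shows "((\<lambda>w. normed c (usol Z c) w $ i $ j) \<longlongrightarrow> f0 $ i $ j) (closed_sector_filter \<phi> \<phi>)"
proof (rule tendsto_mono[OF _ estimate_tendsto[OF assms(1-3)]])
  show "closed_sector_filter \<phi> \<phi> \<le> closed_sector_filter \<alpha> \<beta>"
    unfolding closed_sector_filter_def using \<phi> by (intro inf_mono order_refl) auto
qed

text \<open>For each ordered pair a, b it is enough to have one ray on which both solutions have the
  limit \<open>f0\<close> and the exponent difference grows; that ray kills the entry (a, b) of M.
  Different pairs may use different rays.\<close>

lemma solution_unique:
  assumes f: "\<And>a b. a \<noteq> b \<Longrightarrow> \<exists>\<phi>. Re ((lam $ a - lam $ b) * cis (real K * \<phi>)) > 0 \<and>
      (\<forall>i j. ((\<lambda>w. normed c \<Phi> w $ i $ j) \<longlongrightarrow> f0 $ i $ j) (closed_sector_filter \<phi> \<phi>)) \<and>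
      (\<forall>i j. ((\<lambda>w. normed c \<Phi>' w $ i $ j) \<longlongrightarrow> f0 $ i $ j) (closed_sector_filter \<phi> \<phi>))"
    and rel: "\<And>w. \<Phi>' w = \<Phi> w ** M"
  shows "M = mat 1"
proof -
  have off: "M $ a $ b = 0 \<and> M $ a $ a = 1" if ab: "a \<noteq> b" for a b
  proof -
    obtain \<phi> where \<phi>: "Re ((lam $ a - lam $ b) * cis (real K * \<phi>)) > 0"
      "\<And>i j. ((\<lambda>w. normed c \<Phi> w $ i $ j) \<longlongrightarrow> f0 $ i $ j) (closed_sector_filter \<phi> \<phi>)"
      "\<And>i j. ((\<lambda>w. normed c \<Phi>' w $ i $ j) \<longlongrightarrow> f0 $ i $ j) (closed_sector_filter \<phi> \<phi>)" using f[OF ab] by blast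
    note tr = transition[OF \<phi>(2,3) rel closed_sector_nontrivial[OF order_refl]]
    show ?thesis using tr(1)[of a] tr(2)[OF ab Ef_growth[OF \<phi>(1)]] by simp
  qed
  have "\<exists>b :: 'n. b \<noteq> a" for a
  proof (rule ccontr)
    assume "\<not> (\<exists>b :: 'n. b \<noteq> a)"
    hence "(UNIV :: 'n set) = {a}" by auto
    hence "CARD('n) = 1" by (metis card_1_singleton_iff is_singletonI is_singleton_altdef)
    thus False using n2 by simp
  qed
  hence "M $ a $ a = 1" for a using off by metis
  thus ?thesis using off by (auto simp: vec_eq_iff mat_def)
qed

text \<open>The Volterra construction depends on the accuracy m, the sector and the centre of the
  parameter ball. Uniqueness on one fixed window identifies all these solutions, so a single Z,
  holomorphic on the whole parameter space, satisfies every estimate.\<close>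

lemma directional_solution:
  assumes gen: "generic \<eta>"
  shows "\<exists>Z. (\<forall>i j. holo_on UNIV (\<lambda>q. Z (fst q) $ i $ j)) \<and> (\<forall>c. invertible (Z c)) \<and>
    (\<forall>\<alpha> \<beta> m c0. m \<ge> 1 \<longrightarrow> real K * \<alpha> - \<eta> > - (pi / 2) \<longrightarrow> real K * \<beta> - \<eta> < pi / 2 \<longrightarrow> estimate Z c0 m \<alpha> \<beta>)"
proof -
  obtain \<kappa>0 where \<kappa>0: "\<And>\<kappa>. \<kappa> \<ge> \<kappa>0 \<Longrightarrow> wide \<eta> \<kappa>" by (rule eventually_wide[OF gen]) (rule that)
  have dir: "\<forall>p. \<exists>\<theta>. fst p \<noteq> snd p \<longrightarrow> \<bar>\<theta> - \<eta>\<bar> < pi / 2 \<and> Re ((lam $ fst p - lam $ snd p) * cis \<theta>) > 0"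
  proof
    fix p :: "'n \<times> 'n"
    have g: "generic \<eta>'" if "\<eta> \<le> \<eta>'" "\<eta>' \<le> \<eta>" for \<eta>' using gen that by (metis order_antisym)
    show "\<exists>\<theta>. fst p \<noteq> snd p \<longrightarrow> \<bar>\<theta> - \<eta>\<bar> < pi / 2 \<and> Re ((lam $ fst p - lam $ snd p) * cis \<theta>) > 0"
    proof (cases "fst p = snd p")
      case False
      then obtain \<theta> where \<theta>: "\<eta> - pi / 2 < \<theta>" "\<theta> < \<eta> + pi / 2" "Re ((lam $ fst p - lam $ snd p) * cis \<theta>) > 0"
        using growth_direction[of \<eta> \<eta> "fst p" "snd p"] g by auto
      have "\<bar>\<theta> - \<eta>\<bar> < pi / 2" using \<theta>(1,2) by linarith
      with \<theta>(3) show ?thesis by blast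
    qed auto
  qed
  from choice[OF dir] obtain \<theta>' where \<theta>': "\<And>p. fst p \<noteq> snd p \<Longrightarrow> \<bar>\<theta>' p - \<eta>\<bar> < pi / 2 \<and> Re ((lam $ fst p - lam $ snd p) * cis (\<theta>' p)) > 0"
    by blast
  define \<theta> where "\<theta> = (\<lambda>a b. \<theta>' (a, b))"
  have \<theta>: "\<bar>\<theta> a b - \<eta>\<bar> < pi / 2 \<and> Re ((lam $ a - lam $ b) * cis (\<theta> a b)) > 0" if "a \<noteq> b" for a b
    using \<theta>'[of "(a, b)"] that by (simp add: \<theta>_def)
  \<comment> \<open>The finitely many growth directions lie within some tau < pi/2 of eta; they span
    the window on which solutions are compared.\<close>
  define \<tau> where "\<tau> = Max (insert 0 ((\<lambda>p. \<bar>\<theta> (fst p) (snd p) - \<eta>\<bar>) ` {p. fst p \<noteq> snd p}))"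
  have \<tau>fin: "finite (insert 0 ((\<lambda>p. \<bar>\<theta> (fst p) (snd p) - \<eta>\<bar>) ` {p. fst p \<noteq> snd p}))" by simp
  have \<tau>_le: "\<bar>\<theta> a b - \<eta>\<bar> \<le> \<tau>" if "a \<noteq> b" for a b
    unfolding \<tau>_def using that by (intro Max_ge \<tau>fin insertI2 image_eqI[of _ _ "(a, b)"]) auto
  have \<tau>_lt: "\<tau> < pi / 2" unfolding \<tau>_def using \<theta> by (subst Max_less_iff) auto
  define \<alpha>1 where "\<alpha>1 = (\<eta> - \<tau>) / real K"
  define \<beta>1 where "\<beta>1 = (\<eta> + \<tau>) / real K"
  have K\<alpha>1: "real K * \<alpha>1 = \<eta> - \<tau>" "real K * \<beta>1 = \<eta> + \<tau>" by (simp_all add: \<alpha>1_def \<beta>1_def del: of_nat_Suc)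
  have a1: "real K * \<alpha>1 - \<eta> > - (pi / 2)" "real K * \<beta>1 - \<eta> < pi / 2"
    unfolding K\<alpha>1 using \<tau>_lt by simp_all
  obtain \<kappa>1 where \<kappa>1: "\<kappa>1 > 0" "\<And>\<kappa> R. \<kappa> \<ge> \<kappa>1 \<Longrightarrow> R \<ge> 1 \<Longrightarrow> \<exists>\<rho>. \<forall>w. Im w \<in> {\<alpha>1..\<beta>1} \<longrightarrow> Re w \<ge> \<rho> \<longrightarrow>
     (let v = exp (of_nat K * w - \<i> * of_real \<eta>) in v \<in> half_cone \<kappa> R \<and> wv \<eta> v = w \<and> norm v \<le> \<kappa>1 * Re v \<and> Re v > 0)"
    by (rule sector_in_half_cone[OF a1]) (rule that)
  \<comment> \<open>The slope of the cone is chosen large enough for the comparison window and for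
    the required sector at the same time.\<close>
  have local: "\<exists>Z. (\<forall>i j. holo_on (ball c0 1 \<times> UNIV) (\<lambda>q. Z (fst q) $ i $ j)) \<and> (\<forall>c\<in>ball c0 1. invertible (Z c)) \<and>
      estimate Z c0 m \<alpha>1 \<beta>1 \<and> estimate Z c0 m \<alpha> \<beta>"
    if m: "m \<ge> 1" and ab: "real K * \<alpha> - \<eta> > - (pi / 2)" "real K * \<beta> - \<eta> < pi / 2" for \<alpha> \<beta> m c0
  proof -
    obtain \<kappa>2 where \<kappa>2: "\<kappa>2 > 0" "\<And>\<kappa> R. \<kappa> \<ge> \<kappa>2 \<Longrightarrow> R \<ge> 1 \<Longrightarrow> \<exists>\<rho>. \<forall>w. Im w \<in> {\<alpha>..\<beta>} \<longrightarrow> Re w \<ge> \<rho> \<longrightarrow>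
     (let v = exp (of_nat K * w - \<i> * of_real \<eta>) in v \<in> half_cone \<kappa> R \<and> wv \<eta> v = w \<and> norm v \<le> \<kappa>2 * Re v \<and> Re v > 0)"
      by (rule sector_in_half_cone[OF ab]) (rule that)
    define \<kappa> where "\<kappa> = max \<kappa>0 (max \<kappa>1 \<kappa>2)"
    have \<kappa>: "\<kappa> \<ge> \<kappa>0" "\<kappa> \<ge> \<kappa>1" "\<kappa> \<ge> \<kappa>2" by (auto simp: \<kappa>_def)
    obtain R KC Z where R: "R \<ge> 1" and KC: "KC \<ge> 0"
      and hol: "\<And>i j. holo_on (ball c0 1 \<times> UNIV) (\<lambda>q. Z (fst q) $ i $ j)"
      and inv: "\<And>c. c \<in> ball c0 1 \<Longrightarrow> invertible (Z c)"
      and b: "\<And>c v i j. c \<in> ball c0 1 \<Longrightarrow> v \<in> half_cone \<kappa> R \<Longrightarrow>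
       norm (normed c (\<lambda>w. U (c, w) ** Z c) (wv \<eta> v) $ i $ j - YN (NN m) c (exp (- wv \<eta> v)) $ i $ j) \<le> KC / Re v ^ m"
      by (rule global_solution[OF \<kappa>0[OF \<kappa>(1)] m, of c0]) (rule that)
    have us: "(\<lambda>w. U (c, w) ** Z c) = usol Z c" for c by (rule ext) (simp add: usol_def)
    have est: "estimate Z c0 m \<alpha>' \<beta>'" if \<kappa>': "\<kappa>' > 0" "\<kappa> \<ge> \<kappa>'"
        and s: "\<And>\<kappa> R. \<kappa> \<ge> \<kappa>' \<Longrightarrow> R \<ge> 1 \<Longrightarrow> \<exists>\<rho>. \<forall>w. Im w \<in> {\<alpha>'..\<beta>'} \<longrightarrow> Re w \<ge> \<rho> \<longrightarrow>
     (let v = exp (of_nat K * w - \<i> * of_real \<eta>) in v \<in> half_cone \<kappa> R \<and> wv \<eta> v = w \<and> norm v \<le> \<kappa>' * Re v \<and> Re v > 0)" for \<alpha>' \<beta>' \<kappa>'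
    proof -
      obtain \<rho> where \<rho>: "\<And>w. Im w \<in> {\<alpha>'..\<beta>'} \<Longrightarrow> Re w \<ge> \<rho> \<Longrightarrow>
        (let v = exp (of_nat K * w - \<i> * of_real \<eta>) in v \<in> half_cone \<kappa> R \<and> wv \<eta> v = w \<and> norm v \<le> \<kappa>' * Re v \<and> Re v > 0)"
        using s[OF \<kappa>'(2) R] by blast
      show ?thesis unfolding estimate_def
      proof (rule exI[of _ "KC * \<kappa>' ^ m"], intro conjI exI[of _ \<rho>] ballI allI impI)
        show "0 \<le> KC * \<kappa>' ^ m" using KC \<kappa>' by simp
        fix c w i j assume c: "c \<in> ball c0 1" and w: "Im w \<in> {\<alpha>'..\<beta>'}" "\<rho> \<le> Re w"
        define v where "v = exp (of_nat K * w - \<i> * of_real \<eta>)"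
        have v: "v \<in> half_cone \<kappa> R" "wv \<eta> v = w" "norm v \<le> \<kappa>' * Re v" "Re v > 0"
          using \<rho>[OF w] by (simp_all add: Let_def v_def)
        have vnz: "v \<noteq> 0" using v by auto
        have "norm (normed c (usol Z c) w $ i $ j - YN (NN m) c (exp (- w)) $ i $ j) \<le> KC / Re v ^ m"
          using b[OF c v(1), of i j] unfolding us v(2) .
        also have "\<dots> \<le> KC * \<kappa>' ^ m * (1 / norm v) ^ m"
        proof -
          have "norm v ^ m \<le> \<kappa>' ^ m * Re v ^ m" using power_mono[OF v(3), of m] by (simp add: power_mult_distrib)
          hence "1 / Re v ^ m \<le> \<kappa>' ^ m / norm v ^ m" using v(4) vnz by (simp add: field_simps)
          from mult_left_mono[OF this KC] show ?thesis by (simp add: power_one_over mult.assoc)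
        qed
        also have "1 / norm v = norm (exp (- w)) ^ K" using exp_wv(2)[OF vnz, of \<eta>] unfolding v(2) by simp
        finally show "norm (normed c (usol Z c) w $ i $ j - YN (NN m) c (exp (- w)) $ i $ j) \<le> KC * \<kappa>' ^ m * norm (exp (- w)) ^ (K * m)"
          by (simp only: power_mult)
      qed
    qed
    show ?thesis using hol inv est[OF \<kappa>1(1) \<kappa>(2) \<kappa>1(2)] est[OF \<kappa>2(1) \<kappa>(3) \<kappa>2(2)] by blast
  qed
  \<comment> \<open>The window contains a growth direction for every pair, so solutions built with
    different centres or accuracies agree on common parameters.\<close>
  have uniq: "Z c = Z' c" if "estimate Z c0 m \<alpha>1 \<beta>1" "estimate Z' c0' m' \<alpha>1 \<beta>1" "m \<ge> 1" "m' \<ge> 1"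
      "c \<in> ball c0 1" "c \<in> ball c0' 1" "invertible (Z c)" for Z Z' c c0 c0' m m'
  proof -
    have "matrix_inv (Z c) ** Z' c = mat 1"
    proof (rule solution_unique)
      show "usol Z' c w = usol Z c w ** (matrix_inv (Z c) ** Z' c)" for w
        unfolding usol_def by (metis matrix_mul_assoc matrix_inv_mult_right[OF that(7)] matrix_mul_rid)
      fix a b :: 'n assume ab: "a \<noteq> b"
      define \<phi> where "\<phi> = \<theta> a b / real K"
      have K\<phi>: "real K * \<phi> = \<theta> a b" by (simp add: \<phi>_def del: of_nat_Suc)
      have "\<alpha>1 \<le> \<phi>" "\<phi> \<le> \<beta>1"
        unfolding \<alpha>1_def \<beta>1_def \<phi>_def using \<tau>_le[OF ab] by (intro divide_right_mono; simp)+
      note lims = estimate_limit[OF that(1) that(5) that(3) this] estimate_limit[OF that(2) that(6) that(4) this]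
      show "\<exists>\<phi>. Re ((lam $ a - lam $ b) * cis (real K * \<phi>)) > 0 \<and>
        (\<forall>i j. ((\<lambda>w. normed c (usol Z c) w $ i $ j) \<longlongrightarrow> f0 $ i $ j) (closed_sector_filter \<phi> \<phi>)) \<and>
        (\<forall>i j. ((\<lambda>w. normed c (usol Z' c) w $ i $ j) \<longlongrightarrow> f0 $ i $ j) (closed_sector_filter \<phi> \<phi>))"
        by (intro exI[of _ \<phi>] conjI allI lims) (use \<theta>[OF ab] in \<open>simp only: K\<phi>\<close>)
    qed
    hence "Z c ** (matrix_inv (Z c) ** Z' c) = Z c" by simp
    thus ?thesis by (simp add: matrix_mul_assoc matrix_inv_mult_right[OF that(7)])
  qed
  have "\<forall>c0. \<exists>Z. (\<forall>i j. holo_on (ball c0 1 \<times> UNIV) (\<lambda>q. Z (fst q) $ i $ j)) \<and> (\<forall>c\<in>ball c0 1. invertible (Z c)) \<and>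
      estimate Z c0 1 \<alpha>1 \<beta>1"
    using local[OF order_refl a1] by blast
  from choice[OF this] obtain C1 where C1: "\<And>c0 i j. holo_on (ball c0 1 \<times> UNIV) (\<lambda>q. C1 c0 (fst q) $ i $ j)"
    "\<And>c0 c. c \<in> ball c0 1 \<Longrightarrow> invertible (C1 c0 c)" "\<And>c0. estimate (C1 c0) c0 1 \<alpha>1 \<beta>1" by blast
  \<comment> \<open>Gluing: the value at c is taken from the solution centred at c, and on each ball
    it agrees with the one belonging to the centre of that ball.\<close>
  define Z where "Z = (\<lambda>c. C1 c c)"
  have Ceq: "Z c = C1 c0 c" if "c \<in> ball c0 1" for c c0
  proof -
    have "C1 c c = C1 c0 c"
      using uniq[OF C1(3)[of c] C1(3)[of c0] order_refl order_refl, of c] that C1(2)[of c c] by simp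
    thus ?thesis by (simp add: Z_def)
  qed
  have "holo_on UNIV (\<lambda>q. Z (fst q) $ i $ j)" for i j
  proof (rule holo_on_local)
    fix q :: "'m cvec \<times> complex"
    have "holo_on (ball (fst q) 1 \<times> UNIV) (\<lambda>p. Z (fst p) $ i $ j)"
      by (rule holo_on_cong[THEN iffD1, OF _ C1(1)[of "fst q" i j]]) (auto simp: Ceq)
    moreover have "open (ball (fst q) 1 \<times> (UNIV :: complex set))" by (intro open_Times open_ball open_UNIV)
    ultimately show "\<exists>N. open N \<and> q \<in> N \<and> holo_on (UNIV \<inter> N) (\<lambda>q. Z (fst q) $ i $ j)"
      by (intro exI[of _ "ball (fst q) 1 \<times> UNIV"]) (cases q, simp)
  qed
  moreover have "invertible (Z c)" for c unfolding Z_def by (rule C1(2)) simp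
  moreover have "estimate Z c0 m \<alpha> \<beta>" if m: "m \<ge> 1" and ab: "real K * \<alpha> - \<eta> > - (pi / 2)" "real K * \<beta> - \<eta> < pi / 2" for \<alpha> \<beta> m c0
  proof -
    obtain C2 where C2: "\<And>c. c \<in> ball c0 1 \<Longrightarrow> invertible (C2 c)" "estimate C2 c0 m \<alpha>1 \<beta>1" "estimate C2 c0 m \<alpha> \<beta>"
      using local[OF m ab, of c0] by blast
    have "C2 c = Z c" if c: "c \<in> ball c0 1" for c
      using uniq[OF C2(2) C1(3)[of c0] m order_refl c c C2(1)[OF c]] Ceq[OF c] by simp
    hence "usol C2 c = usol Z c" if "c \<in> ball c0 1" for c using that by (simp add: usol_def fun_eq_iff)
    thus ?thesis using C2(3) unfolding estimate_def by (metis (no_types, lifting))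
  qed
  ultimately show ?thesis by blast
qed

end

subsection \<open>Anti-Stokes directions\<close>

lemma down_closed_eq_lessThan:
  fixes S :: "nat set"
  assumes "finite S" "\<And>i j. i \<in> S \<Longrightarrow> j < i \<Longrightarrow> j \<in> S"
  shows "S = {..<card S}"
proof -
  define m where "m = (LEAST m. m \<notin> S)"
  have ex: "\<exists>m. m \<notin> S" using assms(1) by (metis ex_new_if_finite infinite_UNIV_nat)
  have m: "m \<notin> S" unfolding m_def using ex by (rule LeastI_ex)
  have less: "i \<in> S" if "i < m" for i using not_less_Least[of i "\<lambda>m. m \<notin> S"] that unfolding m_def by blast
  have "i < m" if "i \<in> S" for i using assms(2)[OF that, of m] m that by (metis linorder_neqE_nat)
  hence "S = {..<m}" using less by auto
  thus ?thesis by simp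
qed

lemma sorted_nth_less_iff:
  fixes ds :: "real list"
  assumes "sorted ds" "distinct ds" "i < length ds"
  shows "ds ! i < x \<longleftrightarrow> i < card {a \<in> set ds. a < x}"
proof -
  define S where "S = {i. i < length ds \<and> ds ! i < x}"
  have fin: "finite S" unfolding S_def by simp
  have "(!) ds ` S = {a \<in> set ds. a < x}" unfolding S_def by (auto simp: in_set_conv_nth)
  moreover have "inj_on ((!) ds) S" unfolding S_def using assms(2) by (auto simp: inj_on_def nth_eq_iff_index_eq)
  ultimately have card: "card {a \<in> set ds. a < x} = card S" by (metis card_image)
  have "S = {..<card S}"
  proof (rule down_closed_eq_lessThan[OF fin])
    fix i j assume "i \<in> S" "j < i"
    thus "j \<in> S" using sorted_nth_mono[OF assms(1), of j i] by (auto simp: S_def)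
  qed
  hence "i \<in> S \<longleftrightarrow> i < card S" by auto
  thus ?thesis using assms(3) unfolding card by (simp add: S_def)
qed

lemma finite_Im_cis_zero:
  assumes "\<mu> \<noteq> 0"
  shows "finite {\<eta>. a \<le> \<eta> \<and> \<eta> \<le> b \<and> Im (\<mu> * cis \<eta>) = 0}"
proof -
  define s where "s = Arg \<mu>"
  have eq: "Im (\<mu> * cis \<eta>) = norm \<mu> * sin (s + \<eta>)" for \<eta>
  proof -
    have "\<mu> = of_real (norm \<mu>) * cis s"
      unfolding s_def using rcis_cmod_Arg[of \<mu>] by (simp add: rcis_def)
    hence "\<mu> * cis \<eta> = of_real (norm \<mu>) * cis (s + \<eta>)" by (metis cis_mult mult.assoc)
    thus ?thesis by simp
  qed
  have "{\<eta>. a \<le> \<eta> \<and> \<eta> \<le> b \<and> Im (\<mu> * cis \<eta>) = 0} \<subseteq> (\<lambda>i. of_int i * pi - s) ` {\<lfloor>(a + s) / pi\<rfloor>..\<lceil>(b + s) / pi\<rceil>}"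
  proof
    fix \<eta> assume \<eta>: "\<eta> \<in> {\<eta>. a \<le> \<eta> \<and> \<eta> \<le> b \<and> Im (\<mu> * cis \<eta>) = 0}"
    hence "norm \<mu> * sin (s + \<eta>) = 0" using eq[of \<eta>] by (metis (mono_tags, lifting) mem_Collect_eq)
    hence "sin (s + \<eta>) = 0" using assms by simp
    then obtain i :: int where i: "s + \<eta> = of_int i * pi" unfolding sin_zero_iff_int2 by blast
    have "(a + s) / pi \<le> of_int i" "of_int i \<le> (b + s) / pi" using \<eta> i by (auto simp: field_simps)
    hence "\<lfloor>(a + s) / pi\<rfloor> \<le> i" "i \<le> \<lceil>(b + s) / pi\<rceil>" by linarith+
    thus "\<eta> \<in> (\<lambda>i. of_int i * pi - s) ` {\<lfloor>(a + s) / pi\<rfloor>..\<lceil>(b + s) / pi\<rceil>}"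
      using i by (intro image_eqI[of _ _ i]) auto
  qed
  thus ?thesis by (rule finite_subset) simp
qed

context oper_setup
begin

lemma lam_diff_nz: "a \<noteq> b \<Longrightarrow> lam $ a - lam $ b \<noteq> 0"
  using lam_inj by (auto dest: injD)

lemma generic_pi: "generic (\<eta> + pi) \<longleftrightarrow> generic \<eta>"
proof -
  have "cis (\<eta> + pi) = - cis \<eta>" by (simp add: complex_eq_iff)
  thus ?thesis unfolding generic_def by (simp only: mult_minus_right uminus_complex.sel neg_equal_0_iff_equal)
qed

lemma rcis_power_K: "rcis \<rho> \<theta> ^ (k + 1) = of_real (\<rho> ^ (k + 1)) * cis (real K * \<theta>)"
proof -
  have "rcis \<rho> \<theta> ^ (k + 1) = rcis (\<rho> ^ (k + 1)) (real (k + 1) * \<theta>)" by (rule DeMoivre2)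
  thus ?thesis by (simp only: rcis_def Suc_eq_plus1)
qed

text \<open>Exchanging i and j reverses the sign, so a nonzero real value for some pair already
  yields a negative one.\<close>

lemma anti_stokes_iff: "anti_stokes k lam \<theta> \<longleftrightarrow> \<not> generic (real K * \<theta>)"
proof
  assume "anti_stokes k lam \<theta>"
  then obtain i j where ij: "i \<noteq> j" "\<forall>\<rho>>0. \<exists>t<0. (lam $ i - lam $ j) * rcis \<rho> \<theta> ^ (k + 1) = complex_of_real t"
    unfolding anti_stokes_def by blast
  from ij(2)[rule_format, of 1] obtain t where "(lam $ i - lam $ j) * rcis 1 \<theta> ^ (k + 1) = complex_of_real t" by auto
  hence "(lam $ i - lam $ j) * cis (real K * \<theta>) = complex_of_real t" unfolding rcis_power_K by simp
  hence "Im ((lam $ i - lam $ j) * cis (real K * \<theta>)) = 0" by (simp only: Im_complex_of_real)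
  thus "\<not> generic (real K * \<theta>)" using ij(1) unfolding generic_def by blast
next
  assume "\<not> generic (real K * \<theta>)"
  then obtain a b where ab: "a \<noteq> b" "Im ((lam $ a - lam $ b) * cis (real K * \<theta>)) = 0" unfolding generic_def by blast
  define s where "s = Re ((lam $ a - lam $ b) * cis (real K * \<theta>))"
  have ms: "(lam $ a - lam $ b) * cis (real K * \<theta>) = of_real s"
    using ab(2) by (simp only: complex_eq_iff s_def Re_complex_of_real Im_complex_of_real)
  have "s \<noteq> 0"
  proof
    assume "s = 0"
    hence "(lam $ a - lam $ b) * cis (real K * \<theta>) = 0" using ms by simp
    thus False using lam_diff_nz[OF ab(1)] by (simp del: of_nat_Suc)
  qed
  have gen: "\<exists>t<0. (lam $ i - lam $ j) * rcis \<rho> \<theta> ^ (k + 1) = complex_of_real t"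
    if "(lam $ i - lam $ j) * cis (real K * \<theta>) = of_real s'" "s' < 0" "\<rho> > 0" for i j s' \<rho>
  proof (intro exI[of _ "\<rho> ^ (k + 1) * s'"] conjI)
    show "\<rho> ^ (k + 1) * s' < 0" using that by (intro mult_pos_neg) auto
    show "(lam $ i - lam $ j) * rcis \<rho> \<theta> ^ (k + 1) = complex_of_real (\<rho> ^ (k + 1) * s')"
      using that(1) unfolding rcis_power_K by (metis mult.left_commute of_real_mult)
  qed
  show "anti_stokes k lam \<theta>"
  proof (cases "s < 0")
    case True
    show ?thesis unfolding anti_stokes_def using ab(1) gen[OF ms True] by blast
  next
    case False
    have "(lam $ b - lam $ a) * cis (real K * \<theta>) = of_real (- s)"
      using ms by (simp add: left_diff_distrib algebra_simps)
    moreover have "- s < 0" using False \<open>s \<noteq> 0\<close> by simp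
    ultimately show ?thesis unfolding anti_stokes_def using ab(1) gen by metis
  qed
qed

lemma Suc_mult: "real (Suc i) * x = real i * x + x"
  by (simp add: algebra_simps)

abbreviation "AS \<theta> \<equiv> \<not> generic (real K * \<theta>)"
text \<open>Rays separating the groups of \<open>ell\<close> anti-Stokes directions that belong to
  one Stokes matrix. The set of anti-Stokes directions is invariant under rotation by pi / (k+1), so
  the shifts of \<open>theta0\<close> avoid it as well.\<close>

definition "tau i = theta0 TYPE('n) k + real i * (pi / real K)"

lemma AS_shift: "AS (\<theta> + pi / real K) \<longleftrightarrow> AS \<theta>"
proof -
  have "real K * (\<theta> + pi / real K) = real K * \<theta> + pi" by (simp add: distrib_left del: of_nat_Suc)
  thus ?thesis by (simp add: generic_pi del: of_nat_Suc)
qed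

lemma AS_shift_n: "AS (\<theta> + real i * (pi / real K)) \<longleftrightarrow> AS \<theta>"
proof (induction i)
  case (Suc i)
  have "\<theta> + real (Suc i) * (pi / real K) = (\<theta> + real i * (pi / real K)) + pi / real K"
    by (simp only: Suc_mult add.assoc)
  thus ?case using AS_shift[of "\<theta> + real i * (pi / real K)"] Suc by (simp only:)
qed simp

lemma two_pi: "real (2 * K) * (pi / real K) = 2 * pi"
  by (simp add: field_simps)

lemma AS_2pi: "AS (\<theta> + 2 * pi) \<longleftrightarrow> AS \<theta>"
  using AS_shift_n[of \<theta> "2 * K"] unfolding two_pi .

text \<open>The eigenvalues have norm 1, so conjugating a real value of (lam a - lam b) cis phi
  gives cis (2 phi) lam a lam b = - 1. For phi = pi / (4 n) the n-th power of this reads i = (-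
  1)^n, which is impossible; this explains the denominator 4 n in \<open>theta0\<close>.\<close>

lemma theta0_generic: "\<not> AS (theta0 TYPE('n) k)"
proof -
  let ?n = "CARD('n)"
  define \<phi> where "\<phi> = pi / (4 * real ?n)"
  have K\<theta>: "real K * theta0 TYPE('n) k = \<phi>"
    unfolding theta0_def \<phi>_def Suc_eq_plus1[symmetric] by (simp del: of_nat_Suc)
  have "generic \<phi>"
    unfolding generic_def
  proof (intro allI impI notI)
    fix a b :: 'n assume ab: "a \<noteq> b" and im: "Im ((lam $ a - lam $ b) * cis \<phi>) = 0"
    have cnj_lam: "cnj (lam $ i) = 1 / lam $ i" for i
    proof -
      have "norm (lam $ i) ^ ?n = 1" using arg_cong[OF lam_power[of i], of norm] by (simp add: norm_power)
      hence "norm (lam $ i) = 1" using power_eq_imp_eq_base[of "norm (lam $ i)" ?n 1] by simp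
      hence "lam $ i * cnj (lam $ i) = 1" by (simp add: complex_norm_square[symmetric])
      thus ?thesis using lam_nz[of i] by (simp add: field_simps)
    qed
    have "(lam $ a - lam $ b) * cis \<phi> \<in> \<real>" using im by (simp only: complex_is_Real_iff)
    hence "cnj ((lam $ a - lam $ b) * cis \<phi>) = (lam $ a - lam $ b) * cis \<phi>" by (simp only: Reals_cnj_iff)
    hence "(1 / lam $ a - 1 / lam $ b) * cis (- \<phi>) = (lam $ a - lam $ b) * cis \<phi>"
      by (simp add: cnj_lam cis_cnj)
    hence "- (lam $ a - lam $ b) * cis (- \<phi>) = (lam $ a - lam $ b) * cis \<phi> * (lam $ a * lam $ b)"
      using lam_nz[of a] lam_nz[of b] by (simp add: field_simps)
    hence "(lam $ a - lam $ b) * (- cis (- \<phi>)) = (lam $ a - lam $ b) * (cis \<phi> * (lam $ a * lam $ b))" by (simp only: mult.assoc mult_minus_left mult_minus_right)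
    hence "- cis (- \<phi>) = cis \<phi> * (lam $ a * lam $ b)" using lam_diff_nz[OF ab] by (metis mult_left_cancel)
    hence "- cis (- \<phi>) * cis \<phi> = cis \<phi> * cis \<phi> * (lam $ a * lam $ b)" by (simp add: mult_ac)
    hence "cis (2 * \<phi>) * (lam $ a * lam $ b) = - 1" by (simp add: cis_mult)
    hence "(cis (2 * \<phi>) * (lam $ a * lam $ b)) ^ ?n = (- 1) ^ ?n" by simp
    moreover have "cis (2 * \<phi>) ^ ?n = \<i>"
    proof -
      have "real ?n * (2 * \<phi>) = pi / 2" by (simp add: \<phi>_def)
      thus ?thesis by (simp only: Complex.DeMoivre cis_pi_half)
    qed
    ultimately have "\<i> = (- 1) ^ ?n" by (simp add: power_mult_distrib lam_power)
    moreover have "Im ((- 1) ^ ?n) = 0" by (cases "even ?n") auto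
    ultimately show False by (metis imaginary_unit.simps(2) zero_neq_one)
  qed
  thus ?thesis by (simp only: K\<theta> not_not)
qed

lemma tau_generic: "\<not> AS (tau i)"
  unfolding tau_def using AS_shift_n theta0_generic by blast

lemma tau_Suc: "tau (Suc i) = tau i + pi / real K"
  by (simp only: tau_def Suc_mult add.assoc)

lemma tau_add: "tau (i + 2 * K) = tau i + 2 * pi"
  unfolding tau_def of_nat_add distrib_right two_pi by simp

lemma finite_AS: "finite {\<theta>. x < \<theta> \<and> \<theta> < y \<and> AS \<theta>}"
proof -
  have "{\<theta>. x < \<theta> \<and> \<theta> < y \<and> AS \<theta>} \<subseteq> (\<Union>p\<in>{p. fst p \<noteq> snd p}. (\<lambda>\<eta>. \<eta> / real K) `
      {\<eta>. real K * x \<le> \<eta> \<and> \<eta> \<le> real K * y \<and> Im ((lam $ fst p - lam $ snd p) * cis \<eta>) = 0})"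
  proof
    fix \<theta> assume \<theta>: "\<theta> \<in> {\<theta>. x < \<theta> \<and> \<theta> < y \<and> AS \<theta>}"
    then obtain a b where ab: "a \<noteq> b" "Im ((lam $ a - lam $ b) * cis (real K * \<theta>)) = 0" unfolding generic_def by blast
    show "\<theta> \<in> (\<Union>p\<in>{p. fst p \<noteq> snd p}. (\<lambda>\<eta>. \<eta> / real K) `
      {\<eta>. real K * x \<le> \<eta> \<and> \<eta> \<le> real K * y \<and> Im ((lam $ fst p - lam $ snd p) * cis \<eta>) = 0})"
    proof (rule UN_I[of "(a, b)"], use ab(1) in simp, rule image_eqI[of _ _ "real K * \<theta>"])
      show "real K * \<theta> \<in> {\<eta>. real K * x \<le> \<eta> \<and> \<eta> \<le> real K * y \<and> Im ((lam $ fst (a, b) - lam $ snd (a, b)) * cis \<eta>) = 0}"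
        using \<theta> ab(2) by (auto intro!: mult_left_mono simp del: of_nat_Suc)
    qed (simp del: of_nat_Suc)
  qed
  moreover have "finite (\<Union>p\<in>{p :: 'n \<times> 'n. fst p \<noteq> snd p}. (\<lambda>\<eta>. \<eta> / real K) `
      {\<eta>. real K * x \<le> \<eta> \<and> \<eta> \<le> real K * y \<and> Im ((lam $ fst p - lam $ snd p) * cis \<eta>) = 0})"
    by (intro finite_UN_I finite_imageI finite_Im_cis_zero) (auto dest: lam_diff_nz)
  ultimately show ?thesis by (rule finite_subset)
qed

definition "ell = card {\<theta>. tau 0 < \<theta> \<and> \<theta> < tau 1 \<and> AS \<theta>}"

lemma tau_0: "tau 0 = theta0 TYPE('n) k"
  by (simp add: tau_def)

text \<open>Over a window of length pi / K each Im ((lam a - lam b) z^K) on the unit circle changes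
  sign, so it has a zero there.\<close>

lemma ell_pos: "ell > 0"
proof -
  obtain a b :: 'n where ab: "a \<noteq> b" using n2
    by (metis card_1_singleton_iff UNIV_eq_I insertI1 One_nat_def card.empty not_numeral_le_zero numeral_le_one_iff semiring_norm(69) singletonD)
  define f where "f = (\<lambda>\<theta>. Im ((lam $ a - lam $ b) * cis (real K * \<theta>)))"
  have cf: "continuous_on A f" for A unfolding f_def by (intro continuous_intros)
  have f1: "f (tau 1) = - f (tau 0)"
  proof -
    have "real K * tau 1 = real K * tau 0 + pi" using tau_Suc[of 0] by (simp add: distrib_left del: of_nat_Suc)
    moreover have "cis (real K * tau 0 + pi) = - cis (real K * tau 0)" by (simp add: complex_eq_iff)
    ultimately show ?thesis by (simp add: f_def del: of_nat_Suc)
  qed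
  have nz: "f (tau 0) \<noteq> 0" using tau_generic[of 0] ab unfolding generic_def f_def by blast
  have lt: "tau 0 < tau 1" using tau_Suc[of 0] by (simp del: of_nat_Suc)
  have "\<exists>\<theta>. tau 0 \<le> \<theta> \<and> \<theta> \<le> tau 1 \<and> f \<theta> = 0"
  proof (cases "f (tau 0) \<le> 0")
    case True thus ?thesis using IVT'[of f "tau 0" 0 "tau 1"] f1 lt cf by auto
  next
    case False thus ?thesis using IVT2'[of f "tau 1" 0 "tau 0"] f1 lt cf by auto
  qed
  then obtain \<theta> where \<theta>: "tau 0 \<le> \<theta>" "\<theta> \<le> tau 1" "f \<theta> = 0" by blast
  have "AS \<theta>" using \<theta>(3) ab unfolding generic_def f_def by blast
  moreover have "\<theta> \<noteq> tau 0" "\<theta> \<noteq> tau 1" using \<theta>(3) nz f1 by auto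
  ultimately have "\<theta> \<in> {\<theta>. tau 0 < \<theta> \<and> \<theta> < tau 1 \<and> AS \<theta>}" using \<theta> by auto
  thus ?thesis unfolding ell_def using finite_AS by (metis card_gt_0_iff empty_iff)
qed

lemma card_AS_window: "card {\<theta>. tau i < \<theta> \<and> \<theta> < tau (Suc i) \<and> AS \<theta>} = ell"
proof -
  define s where "s = real i * (pi / real K)"
  have t: "tau i = tau 0 + s" "tau (Suc i) = tau 1 + s"
    using tau_Suc[of i] tau_Suc[of 0] by (simp_all add: s_def tau_def del: of_nat_Suc)
  have AS: "AS (\<theta> + s) \<longleftrightarrow> AS \<theta>" for \<theta> unfolding s_def by (rule AS_shift_n)
  have "bij_betw (\<lambda>\<theta>. \<theta> + s) {\<theta>. tau 0 < \<theta> \<and> \<theta> < tau 1 \<and> AS \<theta>} {\<theta>. tau i < \<theta> \<and> \<theta> < tau (Suc i) \<and> AS \<theta>}"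
  proof (rule bij_betwI[of _ _ _ "\<lambda>\<theta>. \<theta> - s"])
    show "(\<lambda>\<theta>. \<theta> + s) \<in> {\<theta>. tau 0 < \<theta> \<and> \<theta> < tau 1 \<and> AS \<theta>} \<rightarrow> {\<theta>. tau i < \<theta> \<and> \<theta> < tau (Suc i) \<and> AS \<theta>}"
      unfolding t by (simp add: AS del: of_nat_Suc)
    show "(\<lambda>\<theta>. \<theta> - s) \<in> {\<theta>. tau i < \<theta> \<and> \<theta> < tau (Suc i) \<and> AS \<theta>} \<rightarrow> {\<theta>. tau 0 < \<theta> \<and> \<theta> < tau 1 \<and> AS \<theta>}"
      unfolding t using AS[of "_ - s"] by (auto simp del: of_nat_Suc)
  qed auto
  from bij_betw_same_card[OF this] show ?thesis by (simp add: ell_def)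
qed

lemma card_AS_upto: "card {\<theta>. tau 0 < \<theta> \<and> \<theta> < tau i \<and> AS \<theta>} = i * ell"
proof (induction i)
  case 0
  have "{\<theta>. tau 0 < \<theta> \<and> \<theta> < tau 0 \<and> AS \<theta>} = {}" by auto
  thus ?case by (simp only: card.empty mult_0)
next
  case (Suc i)
  have le: "tau 0 \<le> tau i" "tau i < tau (Suc i)"
    by (auto simp: tau_def intro!: divide_strict_right_mono mult_strict_right_mono simp del: of_nat_Suc)
  have "{\<theta>. tau 0 < \<theta> \<and> \<theta> < tau (Suc i) \<and> AS \<theta>} = {\<theta>. tau 0 < \<theta> \<and> \<theta> < tau i \<and> AS \<theta>} \<union> {\<theta>. tau i < \<theta> \<and> \<theta> < tau (Suc i) \<and> AS \<theta>}"
    using le tau_generic[of i] by (auto simp del: of_nat_Suc) (metis linorder_neqE_linordered_idom of_nat_Suc)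
  moreover have "card ({\<theta>. tau 0 < \<theta> \<and> \<theta> < tau i \<and> AS \<theta>} \<union> {\<theta>. tau i < \<theta> \<and> \<theta> < tau (Suc i) \<and> AS \<theta>})
     = card {\<theta>. tau 0 < \<theta> \<and> \<theta> < tau i \<and> AS \<theta>} + card {\<theta>. tau i < \<theta> \<and> \<theta> < tau (Suc i) \<and> AS \<theta>}"
    by (intro card_Un_disjoint finite_AS) auto
  ultimately show ?case using Suc card_AS_window[of i] by simp
qed

lemma AS_set_eq: "anti_stokes_set k lam = {\<theta>. tau 0 < \<theta> \<and> \<theta> < tau (2 * K) \<and> AS \<theta>}"
  using tau_add[of 0] by (simp add: anti_stokes_set_def anti_stokes_iff tau_0)

lemma num_dirs_eq: "num_dirs k lam = 2 * K * ell"
  unfolding num_dirs_def AS_set_eq by (rule card_AS_upto)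

lemma ell_eq: "num_dirs k lam div (2 * k + 2) = ell"
proof -
  have "2 * k + 2 = 2 * K" by simp
  moreover have "2 * K * ell div (2 * K) = ell" by (rule nonzero_mult_div_cancel_left) simp
  ultimately show ?thesis unfolding num_dirs_eq by (simp only:)
qed

definition "ds = sorted_list_of_set (anti_stokes_set k lam)"

lemma ds: "sorted ds" "distinct ds" "set ds = {\<theta>. tau 0 < \<theta> \<and> \<theta> < tau (2 * K) \<and> AS \<theta>}" "length ds = 2 * K * ell"
proof -
  have fin: "finite (anti_stokes_set k lam)" unfolding AS_set_eq by (rule finite_AS)
  show "sorted ds" "distinct ds" unfolding ds_def by simp_all
  show "set ds = {\<theta>. tau 0 < \<theta> \<and> \<theta> < tau (2 * K) \<and> AS \<theta>}" unfolding ds_def using fin by (simp add: AS_set_eq)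
  show "length ds = 2 * K * ell" using num_dirs_eq by (simp add: ds_def num_dirs_def)
qed

lemma dir_eq: "1 \<le> i \<Longrightarrow> i \<le> 2 * K * ell \<Longrightarrow> stokes_dir k lam i = ds ! (i - 1)"
  "stokes_dir k lam (2 * K * ell + 1) = ds ! 0 + 2 * pi"
  unfolding stokes_dir_def Let_def num_dirs_eq ds_def[symmetric] by simp_all

lemma ds_less_tau: "p < 2 * K * ell \<Longrightarrow> j \<le> 2 * K \<Longrightarrow> ds ! p < tau j \<longleftrightarrow> p < j * ell"
proof -
  assume p: "p < 2 * K * ell" and j: "j \<le> 2 * K"
  have "tau j \<le> tau (2 * K)" unfolding tau_def using j by (intro add_left_mono mult_right_mono) auto
  hence eq: "{a \<in> set ds. a < tau j} = {\<theta>. tau 0 < \<theta> \<and> \<theta> < tau j \<and> AS \<theta>}" unfolding ds(3) by auto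
  have "ds ! p < tau j \<longleftrightarrow> p < card {a \<in> set ds. a < tau j}"
    by (rule sorted_nth_less_iff[OF ds(1,2)]) (use p ds(4) in simp)
  thus ?thesis unfolding eq card_AS_upto .
qed

text \<open>The ray \<open>tau j\<close> lies in the sector that follows the direction number j
  \<open>ell\<close>, so the j-th group of Stokes factors leads from the sector of
  \<open>tau (j - 1)\<close> to that of \<open>tau j\<close>.\<close>

lemma dir_tau:
  assumes "1 \<le> j" "j \<le> 2 * K"
  shows "stokes_dir k lam (j * ell) < tau j" "tau j < stokes_dir k lam (j * ell + 1)"
proof -
  have le: "j * ell \<le> 2 * K * ell" using assms by (intro mult_right_mono) auto
  have pos: "1 \<le> j * ell" using assms ell_pos by (simp add: Suc_le_eq)
  have "stokes_dir k lam (j * ell) = ds ! (j * ell - 1)" by (rule dir_eq(1)[OF pos le])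
  thus "stokes_dir k lam (j * ell) < tau j" using ds_less_tau[of "j * ell - 1" j] pos le assms by auto
  show "tau j < stokes_dir k lam (j * ell + 1)"
  proof (cases "j = 2 * K")
    \<comment> \<open>Wrap-around: the last ray is \<open>tau 0\<close> + 2 pi, and the next
      direction is the first one shifted by 2 pi.\<close>
    case True
    have "0 < length ds" using ell_pos by (simp add: ds(4))
    hence "ds ! 0 \<in> set ds" by (rule nth_mem)
    hence "tau 0 < ds ! 0" unfolding ds(3) by blast
    moreover have "tau (2 * K) = tau 0 + 2 * pi" using tau_add[of 0] by simp
    ultimately show ?thesis unfolding True dir_eq(2) by linarith
  next
    case False
    hence "Suc j * ell \<le> 2 * K * ell" using assms by (intro mult_right_mono) auto
    hence lt: "j * ell < 2 * K * ell" using ell_pos by simp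
    have "ds ! (j * ell) \<in> set ds" using lt by (intro nth_mem) (simp add: ds(4))
    hence "AS (ds ! (j * ell))" unfolding ds(3) by blast
    hence "ds ! (j * ell) \<noteq> tau j" using tau_generic by metis
    moreover have "\<not> ds ! (j * ell) < tau j" using ds_less_tau[OF lt assms(2)] by simp
    moreover have "stokes_dir k lam (j * ell + 1) = ds ! (j * ell)" using dir_eq(1)[of "j * ell + 1"] lt by simp
    ultimately show ?thesis by linarith
  qed
qed

text \<open>The width bound follows from periodicity: in a wider sector the shifted direction d_i +
  pi / K would be an anti-Stokes direction in its interior.\<close>

lemma dir_gap:
  assumes i: "1 \<le> i" "i \<le> 2 * K * ell"
  shows "stokes_dir k lam i < stokes_dir k lam (i + 1)"
    and "\<And>\<theta>. stokes_dir k lam i < \<theta> \<Longrightarrow> \<theta> < stokes_dir k lam (i + 1) \<Longrightarrow> \<not> AS \<theta>"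
    and "real K * (stokes_dir k lam (i + 1) - stokes_dir k lam i) \<le> pi"
proof -
  have di: "stokes_dir k lam i = ds ! (i - 1)" by (rule dir_eq(1)[OF i])
  have mem: "ds ! p \<in> set ds" if "p < 2 * K * ell" for p using that by (intro nth_mem) (simp add: ds(4))
  have bnd: "tau 0 < ds ! p" "ds ! p < tau 0 + 2 * pi" "AS (ds ! p)" if "p < 2 * K * ell" for p
    using mem[OF that] tau_add[of 0] unfolding ds(3) by simp_all
  have i1: "i - 1 < 2 * K * ell" using i by linarith
  have z: "0 < 2 * K * ell" using i by linarith
  show lt: "stokes_dir k lam i < stokes_dir k lam (i + 1)"
  proof (cases "i = 2 * K * ell")
    case True
    show ?thesis using bnd[OF i1] bnd[OF z] unfolding di unfolding True dir_eq(2) by linarith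
  next
    case False
    hence "stokes_dir k lam (i + 1) = ds ! i" using dir_eq(1)[of "i + 1"] i by simp
    moreover have "ds ! (i - 1) < ds ! i" using sorted_wrt_nth_less[of "(<)" ds "i - 1" i] ds(1,2,4) i False
      by (simp add: strict_sorted_iff)
    ultimately show ?thesis by (simp add: di)
  qed
  show gap: "\<not> AS \<theta>" if \<theta>: "stokes_dir k lam i < \<theta>" "\<theta> < stokes_dir k lam (i + 1)" for \<theta>
  proof
    assume AS: "AS \<theta>"
    have inner: False if "\<theta> < tau 0 + 2 * pi"
    proof -
      have "\<theta> \<in> set ds" unfolding ds(3) using that AS \<theta>(1) bnd(1)[OF i1] tau_add[of 0] unfolding di by simp
      then obtain p where p: "p < length ds" "ds ! p = \<theta>" by (metis in_set_conv_nth)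
      have "\<not> p \<le> i - 1" using sorted_nth_mono[OF ds(1), of p "i - 1"] i1 \<theta>(1) p unfolding di by (auto simp: ds(4))
      hence pi: "i \<le> p" using i by linarith
      hence ne: "i \<noteq> 2 * K * ell" using p(1) by (simp add: ds(4))
      hence "stokes_dir k lam (i + 1) = ds ! i" using dir_eq(1)[of "i + 1"] i by simp
      thus False using sorted_nth_mono[OF ds(1) pi p(1)] \<theta>(2) p(2) by simp
    qed
    \<comment> \<open>What remains lies beyond \<open>tau 0\<close> + 2 pi. Only the last sector
      reaches that far, and there the direction shifted back by 2 pi would precede the first entry
      of \<open>ds\<close>.\<close>
    have ge: "\<theta> \<ge> tau 0 + 2 * pi" using inner linorder_not_less by blast
    have "i = 2 * K * ell"
    proof (rule ccontr)
      assume ne: "i \<noteq> 2 * K * ell"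
      hence "stokes_dir k lam (i + 1) = ds ! i" using dir_eq(1)[of "i + 1"] i by simp
      thus False using bnd(2)[of i] ne i \<theta>(2) ge by simp
    qed
    hence lt0: "\<theta> - 2 * pi < ds ! 0" using \<theta>(2) dir_eq(2) by simp
    have AS': "AS (\<theta> - 2 * pi)" using AS AS_2pi[of "\<theta> - 2 * pi"] unfolding diff_add_cancel by blast
    hence "\<theta> - 2 * pi \<noteq> tau 0" using tau_generic by metis
    hence "\<theta> - 2 * pi \<in> set ds" unfolding ds(3) using AS' ge lt0 bnd(2)[OF z] tau_add[of 0] by simp
    then obtain p where p: "p < length ds" "ds ! p = \<theta> - 2 * pi" by (metis in_set_conv_nth)
    show False using sorted_nth_mono[OF ds(1) le0 p(1)] lt0 p(2) by simp
  qed
  show "real K * (stokes_dir k lam (i + 1) - stokes_dir k lam i) \<le> pi"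
  proof (rule ccontr)
    assume "\<not> ?thesis"
    hence "pi / real K < stokes_dir k lam (i + 1) - stokes_dir k lam i" by (simp add: field_simps)
    hence "\<not> AS (stokes_dir k lam i + pi / real K)" by (intro gap) (auto simp del: of_nat_Suc)
    thus False using AS_shift bnd(3)[OF i1] unfolding di by blast
  qed
qed

end

subsection \<open>Canonical solutions\<close>

lemma matrix_inv_product:
  fixes A B :: "complex^'n^'n"
  assumes "invertible A" "invertible B"
  shows "matrix_inv (A ** B) = matrix_inv B ** matrix_inv A"
proof (rule left_inverse_right_inverse_matrix(3))
  have "A ** B ** (matrix_inv B ** matrix_inv A) = A ** (B ** matrix_inv B) ** matrix_inv A"
    by (simp add: matrix_mul_assoc)
  thus "A ** B ** (matrix_inv B ** matrix_inv A) = mat 1"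
    by (simp add: matrix_inv_mult_right assms)
qed

context oper_setup
begin

text \<open>Chosen for all parameters at once, so that holomorphy in the parameter is part of the
  choice.\<close>

definition "Zs \<eta> = (SOME Z. (\<forall>i j. holo_on UNIV (\<lambda>q. Z (fst q) $ i $ j)) \<and> (\<forall>c. invertible (Z c)) \<and>
    (\<forall>\<alpha> \<beta> m c0. m \<ge> 1 \<longrightarrow> real K * \<alpha> - \<eta> > - (pi / 2) \<longrightarrow> real K * \<beta> - \<eta> < pi / 2 \<longrightarrow> estimate Z c0 m \<alpha> \<beta>))"

lemma Zs:
  assumes "generic \<eta>"
  shows "holo_on UNIV (\<lambda>q. Zs \<eta> (fst q) $ i $ j)" "invertible (Zs \<eta> c)"
    and "m \<ge> 1 \<Longrightarrow> real K * \<alpha> - \<eta> > - (pi / 2) \<Longrightarrow> real K * \<beta> - \<eta> < pi / 2 \<Longrightarrow> estimate (Zs \<eta>) c0 m \<alpha> \<beta>"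
  using someI_ex[OF directional_solution[OF assms]] unfolding Zs_def[symmetric] by blast+

lemma usol_right: "usol Z c w ** M = usol (\<lambda>c. Z c ** M) c w"
  by (simp add: usol_def matrix_mul_assoc)

text \<open>While eta moves without meeting an anti-Stokes direction, every pair keeps a growth
  direction lying in the half-planes of both end positions, and this identifies the two
  solutions.\<close>

lemma Zs_eq:
  assumes "\<eta>1 \<le> \<eta>2" "\<eta>2 - \<eta>1 < pi" and gen: "\<And>\<eta>. \<eta>1 \<le> \<eta> \<Longrightarrow> \<eta> \<le> \<eta>2 \<Longrightarrow> generic \<eta>"
  shows "Zs \<eta>1 = Zs \<eta>2"
proof
  fix c
  have g: "generic \<eta>1" "generic \<eta>2" using gen assms(1) by auto
  have "matrix_inv (Zs \<eta>1 c) ** Zs \<eta>2 c = mat 1"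
  proof (rule solution_unique)
    show "usol (Zs \<eta>2) c w = usol (Zs \<eta>1) c w ** (matrix_inv (Zs \<eta>1 c) ** Zs \<eta>2 c)" for w
      unfolding usol_def by (metis matrix_mul_assoc matrix_inv_mult_right[OF Zs(2)[OF g(1)]] matrix_mul_rid)
    fix a b :: 'n assume ab: "a \<noteq> b"
    obtain \<theta> where \<theta>: "\<eta>2 - pi / 2 < \<theta>" "\<theta> < \<eta>1 + pi / 2" "Re ((lam $ a - lam $ b) * cis \<theta>) > 0"
      using growth_direction[OF assms ab] by blast
    define \<phi> where "\<phi> = \<theta> / real K"
    have K\<phi>: "real K * \<phi> = \<theta>" by (simp add: \<phi>_def del: of_nat_Suc)
    have e: "estimate (Zs \<eta>1) c 1 \<phi> \<phi>" "estimate (Zs \<eta>2) c 1 \<phi> \<phi>"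
      by (rule Zs(3)[OF g(1)] Zs(3)[OF g(2)]; use \<theta> assms(1) in \<open>simp only: K\<phi> order_refl\<close>)+
    have c: "c \<in> ball c 1" by simp
    show "\<exists>\<phi>. Re ((lam $ a - lam $ b) * cis (real K * \<phi>)) > 0 \<and>
        (\<forall>i j. ((\<lambda>w. normed c (usol (Zs \<eta>1) c) w $ i $ j) \<longlongrightarrow> f0 $ i $ j) (closed_sector_filter \<phi> \<phi>)) \<and>
        (\<forall>i j. ((\<lambda>w. normed c (usol (Zs \<eta>2) c) w $ i $ j) \<longlongrightarrow> f0 $ i $ j) (closed_sector_filter \<phi> \<phi>))"
      by (intro exI[of _ \<phi>] conjI allI estimate_limit[OF e(1) c] estimate_limit[OF e(2) c] order_refl)
        (use \<theta>(3) in \<open>simp only: K\<phi>\<close>)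
  qed
  hence "Zs \<eta>1 c ** (matrix_inv (Zs \<eta>1 c) ** Zs \<eta>2 c) = Zs \<eta>1 c" by simp
  thus "Zs \<eta>1 c = Zs \<eta>2 c" by (simp add: matrix_mul_assoc matrix_inv_mult_right[OF Zs(2)[OF g(1)]])
qed

lemma estimate_union:
  assumes "estimate Z c0 m \<alpha> \<tau>" "estimate Z c0 m \<tau> \<beta>"
  shows "estimate Z c0 m \<alpha> \<beta>"
proof -
  let ?P = "\<lambda>KC c w. \<forall>i j. norm (normed c (usol Z c) w $ i $ j - YN (NN m) c (exp (- w)) $ i $ j) \<le> KC * norm (exp (- w)) ^ (K * m)"
  obtain K1 \<rho>1 where 1: "K1 \<ge> 0" "\<And>c w. c \<in> ball c0 1 \<Longrightarrow> Im w \<in> {\<alpha>..\<tau>} \<Longrightarrow> Re w \<ge> \<rho>1 \<Longrightarrow> ?P K1 c w"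
    using assms(1) unfolding estimate_def by blast
  obtain K2 \<rho>2 where 2: "K2 \<ge> 0" "\<And>c w. c \<in> ball c0 1 \<Longrightarrow> Im w \<in> {\<tau>..\<beta>} \<Longrightarrow> Re w \<ge> \<rho>2 \<Longrightarrow> ?P K2 c w"
    using assms(2) unfolding estimate_def by blast
  have mono: "?P K1 c w \<Longrightarrow> K1 \<le> K2 \<Longrightarrow> ?P K2 c w" for K1 K2 c w
    by (meson order_trans mult_right_mono zero_le_power norm_ge_zero)
  show ?thesis unfolding estimate_def
  proof (rule exI[of _ "max K1 K2"], intro conjI exI[of _ "max \<rho>1 \<rho>2"] ballI allI impI)
    fix c w i j assume c: "c \<in> ball c0 1" and w: "Im w \<in> {\<alpha>..\<beta>}" "max \<rho>1 \<rho>2 \<le> Re w"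
    show "norm (normed c (usol Z c) w $ i $ j - YN (NN m) c (exp (- w)) $ i $ j) \<le> max K1 K2 * norm (exp (- w)) ^ (K * m)"
    proof (cases "Im w \<le> \<tau>")
      case True
      show ?thesis by (rule mono[rule_format, OF 1(2)[rule_format, OF c]]) (use True w in auto)
    next
      case False
      show ?thesis by (rule mono[rule_format, OF 2(2)[rule_format, OF c]]) (use False w in auto)
    qed
  qed (use 1 in auto)
qed

text \<open>A fixed eta controls only angles with |K arg z - eta| < pi/2. Moving eta inside the
  sector between D1 and D2 leaves the solution unchanged and extends the estimate by pi / (2 K)
  beyond both edges.\<close>

lemma Zs_estimate:
  assumes D: "real K * (D2 - D1) \<le> pi" and gen: "\<And>\<eta>. real K * D1 < \<eta> \<Longrightarrow> \<eta> < real K * D2 \<Longrightarrow> generic \<eta>"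
    and \<eta>: "real K * D1 < \<eta>" "\<eta> < real K * D2" and m: "m \<ge> 1"
    and \<alpha>: "\<alpha> > D1 - pi / (2 * real K)" and \<beta>: "\<beta> < D2 + pi / (2 * real K)"
  shows "estimate (Zs \<eta>) c0 m \<alpha> \<beta>"
proof -
  have Kp: "real K * (pi / (2 * real K)) = pi / 2" by (simp del: of_nat_Suc)
  have K0: "real K > 0" by simp
  have a: "real K * D1 < real K * \<alpha> + pi / 2" using mult_strict_left_mono[OF \<alpha> K0] unfolding right_diff_distrib Kp by linarith
  have b: "real K * \<beta> - pi / 2 < real K * D2" using mult_strict_left_mono[OF \<beta> K0] unfolding distrib_left Kp by linarith
  \<comment> \<open>Averaging with D1 gives a direction strictly inside the sector and less than
    pi/2 above K alpha; \<open>\<eta>2\<close> is its mirror image for K beta. The two estimates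
    overlap at the midpoint.\<close>
  define \<eta>1 where "\<eta>1 = (real K * D1 + min \<eta> (real K * \<alpha> + pi / 2)) / 2"
  define \<eta>2 where "\<eta>2 = (real K * D2 + max \<eta> (real K * \<beta> - pi / 2)) / 2"
  have mid: "x < (x + min y z) / 2 \<and> (x + min y z) / 2 < y \<and> (x + min y z) / 2 < z" if "x < y" "x < z" for x y z :: real
    using that by (auto simp: min_def)
  have mid': "(x + max y z) / 2 < x \<and> y < (x + max y z) / 2 \<and> z < (x + max y z) / 2" if "y < x" "z < x" for x y z :: real
    using that by (auto simp: max_def)
  have 1: "real K * D1 < \<eta>1" "\<eta>1 < \<eta>" "\<eta>1 < real K * \<alpha> + pi / 2" using mid[OF \<eta>(1) a] unfolding \<eta>1_def by blast+
  have 2: "\<eta>2 < real K * D2" "\<eta> < \<eta>2" "real K * \<beta> - pi / 2 < \<eta>2" using mid'[OF \<eta>(2) b] unfolding \<eta>2_def by blast+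
  have d: "\<eta>2 - \<eta>1 < pi" using 1 2 D unfolding right_diff_distrib by linarith
  have g: "generic \<eta>'" if "\<eta>1 \<le> \<eta>'" "\<eta>' \<le> \<eta>2" for \<eta>' using gen that 1 2 by auto
  have z1: "Zs \<eta>1 = Zs \<eta>" by (rule Zs_eq) (use 1 2 d g in auto)
  have z2: "Zs \<eta> = Zs \<eta>2" by (rule Zs_eq) (use 1 2 d g in auto)
  define \<tau> where "\<tau> = (\<eta>1 + \<eta>2) / 2 / real K"
  have K\<tau>: "real K * \<tau> = (\<eta>1 + \<eta>2) / 2" by (simp add: \<tau>_def del: of_nat_Suc)
  have "generic \<eta>1" "generic \<eta>2" "real K * \<alpha> - \<eta>1 > - (pi / 2)" "(\<eta>1 + \<eta>2) / 2 - \<eta>1 < pi / 2"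
    "(\<eta>1 + \<eta>2) / 2 - \<eta>2 > - (pi / 2)" "real K * \<beta> - \<eta>2 < pi / 2"
    using 1 2 d by (auto intro!: g simp: field_simps simp del: of_nat_Suc)
  note f = this[folded K\<tau>]
  have "estimate (Zs \<eta>1) c0 m \<alpha> \<tau>" by (rule Zs(3)[OF f(1) m f(3,4)])
  moreover have "estimate (Zs \<eta>2) c0 m \<tau> \<beta>" by (rule Zs(3)[OF f(2) m f(5,6)])
  ultimately show ?thesis unfolding z1 z2[symmetric] by (rule estimate_union)
qed

text \<open>To get the expansion to order m the estimate is used with accuracy m + 1. After
  multiplication by z^m both its error and the surplus terms of the truncation tend to 0.\<close>

lemma estimate_asymptotic:
  assumes est: "\<And>m \<alpha> \<beta>. m \<ge> 1 \<Longrightarrow> \<alpha> \<le> \<beta> \<Longrightarrow> {\<alpha>..\<beta>} \<subseteq> I \<Longrightarrow> estimate Z c m \<alpha> \<beta>"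
  shows "asymptotic_in_sector I (\<lambda>w. normed c (usol Z c) w $ a $ b) (fY c $ a $ b)"
  unfolding asymptotic_in_sector_def
proof (intro allI impI)
  fix \<alpha> \<beta> m assume sub: "{\<alpha>..\<beta>} \<subseteq> I"
  let ?F = "closed_sector_filter \<alpha> \<beta>"
  define f where "f = (\<lambda>w. normed c (usol Z c) w $ a $ b)"
  define y where "y = (\<lambda>l. fps_nth (fY c $ a $ b) l)"
  have "((\<lambda>w. exp w ^ m * (f w - (\<Sum>j\<le>m. y j * inverse (exp w) ^ j))) \<longlongrightarrow> 0) ?F"
  proof (cases "\<alpha> \<le> \<beta>")
    case False
    hence "?F = bot" by (simp add: closed_sector_filter_def)
    thus "((\<lambda>w. exp w ^ m * (f w - (\<Sum>j\<le>m. y j * inverse (exp w) ^ j))) \<longlongrightarrow> 0) ?F" by simp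
  next
    case True
    define N where "N = NN (Suc m)"
    have mN: "m \<le> N" "m < K * Suc m" by (auto simp: N_def NN_def)
    obtain KC \<rho> where b: "\<And>w. Im w \<in> {\<alpha>..\<beta>} \<Longrightarrow> Re w \<ge> \<rho> \<Longrightarrow>
      norm (f w - YN N c (exp (- w)) $ a $ b) \<le> KC * norm (exp (- w)) ^ (K * Suc m)"
      using est[OF _ True sub, of "Suc m"] unfolding estimate_def f_def N_def by (metis centre_in_ball le_add1 plus_1_eq_Suc zero_less_one)
    have ex: "exp w ^ m * exp (- w) ^ (m + l) = exp (- w) ^ l" for w :: complex and l
    proof -
      have "exp w ^ m * exp (- w) ^ m = 1" by (simp flip: power_mult_distrib exp_add)
      thus ?thesis by (simp only: power_add mult.assoc[symmetric] mult_1_left)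
    qed
    have 1: "((\<lambda>w. exp w ^ m * (f w - YN N c (exp (- w)) $ a $ b)) \<longlongrightarrow> 0) ?F"
    proof (rule Lim_null_comparison)
      show "\<forall>\<^sub>F w in ?F. norm (exp w ^ m * (f w - YN N c (exp (- w)) $ a $ b)) \<le> KC * norm (exp (- w)) ^ (K * Suc m - m)"
        unfolding eventually_closed_sector
      proof (intro exI[of _ \<rho>] allI impI)
        fix w assume w: "\<rho> \<le> Re w" "Im w \<in> {\<alpha>..\<beta>}"
        have "norm (exp w ^ m * (f w - YN N c (exp (- w)) $ a $ b)) \<le> norm (exp w ^ m) * (KC * norm (exp (- w)) ^ (K * Suc m))"
          unfolding norm_mult by (intro mult_left_mono b w) simp
        also have "norm (exp w ^ m) * (KC * norm (exp (- w)) ^ (K * Suc m)) = KC * norm (exp w ^ m * exp (- w) ^ (m + (K * Suc m - m)))"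
          using mN by (simp add: norm_mult norm_power del: norm_exp_eq_Re mult_Suc mult_Suc_right)
        finally show "norm (exp w ^ m * (f w - YN N c (exp (- w)) $ a $ b)) \<le> KC * norm (exp (- w)) ^ (K * Suc m - m)"
          unfolding ex norm_power .
      qed
      have "((\<lambda>w. KC * norm (exp (- w) :: complex) ^ (K * Suc m - m)) \<longlongrightarrow> KC * norm (0::complex) ^ (K * Suc m - m)) ?F"
        by (intro tendsto_intros tendsto_exp_minus_closed_sector)
      thus "((\<lambda>w. KC * norm (exp (- w) :: complex) ^ (K * Suc m - m)) \<longlongrightarrow> 0) ?F" using mN by (simp add: power_0_left del: mult_Suc mult_Suc_right)
    qed
    have 2: "((\<lambda>w. \<Sum>l\<in>{m<..N}. y l * exp (- w) ^ (l - m)) \<longlongrightarrow> (\<Sum>l\<in>{m<..N}. y l * 0 ^ (l - m))) ?F"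
      by (intro tendsto_intros tendsto_exp_minus_closed_sector)
    have eq: "exp w ^ m * (f w - (\<Sum>j\<le>m. y j * inverse (exp w) ^ j)) = exp w ^ m * (f w - YN N c (exp (- w)) $ a $ b) + (\<Sum>l\<in>{m<..N}. y l * exp (- w) ^ (l - m))" for w
    proof -
      have "{..N} = {..m} \<union> {m<..N}" using mN by auto
      hence "YN N c (exp (- w)) $ a $ b = (\<Sum>j\<le>m. y j * exp (- w) ^ j) + (\<Sum>l\<in>{m<..N}. y l * exp (- w) ^ l)"
        unfolding YN_def vec_lambda_beta yp_eval y_def[symmetric] by (simp only:) (rule sum.union_disjoint, auto)
      moreover have "(\<Sum>l\<in>{m<..N}. y l * exp (- w) ^ (l - m)) = exp w ^ m * (\<Sum>l\<in>{m<..N}. y l * exp (- w) ^ l)"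
        unfolding sum_distrib_left
      proof (rule sum.cong[OF refl])
        fix l assume "l \<in> {m<..N}"
        thus "y l * exp (- w) ^ (l - m) = exp w ^ m * (y l * exp (- w) ^ l)" using ex[of w "l - m"] by (simp add: mult.left_commute)
      qed
      ultimately show ?thesis by (simp add: algebra_simps exp_minus)
    qed
    have "(\<Sum>l\<in>{m<..N}. y l * 0 ^ (l - m)) = 0" by (intro sum.neutral) auto
    thus "((\<lambda>w. exp w ^ m * (f w - (\<Sum>j\<le>m. y j * inverse (exp w) ^ j))) \<longlongrightarrow> 0) ?F"
      unfolding eq using tendsto_add[OF 1 2] by simp
  qed
  thus "((\<lambda>w. exp w ^ m * (normed c (usol Z c) w $ a $ b - (\<Sum>j\<le>m. fps_nth (fY c $ a $ b) j * inverse (exp w) ^ j))) \<longlongrightarrow> 0) ?F"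
    unfolding f_def y_def .
qed

lemma asymptotic_limit:
  assumes "asymptotic_in_sector I f (fY c $ a $ b)" "\<phi> \<in> I"
  shows "(f \<longlongrightarrow> f0 $ a $ b) (closed_sector_filter \<phi> \<phi>)"
proof -
  have "{\<phi>..\<phi>} \<subseteq> I" using assms(2) by simp
  hence "((\<lambda>w. exp w ^ 0 * (f w - (\<Sum>j\<le>0. fps_nth (fY c $ a $ b) j * inverse (exp w) ^ j))) \<longlongrightarrow> 0) (closed_sector_filter \<phi> \<phi>)"
    using assms(1) unfolding asymptotic_in_sector_def by blast
  hence "((\<lambda>w. f w - f0 $ a $ b) \<longlongrightarrow> 0) (closed_sector_filter \<phi> \<phi>)" by (simp add: fY_solution(2))
  thus ?thesis by (rule LIM_zero_cancel)
qed

lemma normed_product: "\<Phi> w ** diag_mat (\<chi> j. exp (- poly (fQ c $ j) (exp w))) ** diag_mat (\<chi> j. exp (- fL c $ j * w)) = normed c \<Phi> w"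
  by (simp add: normed_def Ef_def diag_mat_mult flip: matrix_mul_assoc exp_add)

abbreviation "dir \<equiv> stokes_dir k lam"

lemma big_sector_eq: "big_sector k lam i = {dir i - pi / (2 * real K) <..< dir (i + 1) + pi / (2 * real K)}"
  by (simp add: big_sector_def)

lemma dir_estimate:
  assumes i: "1 \<le> i" "i \<le> 2 * K * ell" and \<eta>: "real K * dir i < \<eta>" "\<eta> < real K * dir (i + 1)" and m: "m \<ge> 1"
    and s: "\<alpha> \<in> big_sector k lam i" "\<beta> \<in> big_sector k lam i"
  shows "estimate (Zs \<eta>) c0 m \<alpha> \<beta>" and "generic \<eta>"
proof -
  have gen: "generic \<eta>" if "real K * dir i < \<eta>" "\<eta> < real K * dir (i + 1)" for \<eta>
  proof -
    have "\<not> AS (\<eta> / real K)" using that by (intro dir_gap(2)[OF i]) (simp_all add: field_simps del: of_nat_Suc)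
    thus ?thesis by (simp del: of_nat_Suc)
  qed
  show "generic \<eta>" by (rule gen[OF \<eta>])
  show "estimate (Zs \<eta>) c0 m \<alpha> \<beta>"
    by (rule Zs_estimate[OF dir_gap(3)[OF i] gen \<eta> m]) (use s in \<open>simp_all add: big_sector_eq\<close>)
qed

text \<open>Any other candidate is this solution times a constant matrix. The big sector contains
  the half-plane of directions around eta, hence a growth direction for every pair, so that matrix
  is the identity.\<close>

lemma canonical_solution_eq:
  assumes i: "1 \<le> i" "i \<le> 2 * K * ell" and \<eta>: "real K * dir i < \<eta>" "\<eta> < real K * dir (i + 1)"
  shows "canonical_solution k f0 lam (Bm c) i = usol (Zs \<eta>) c"
  unfolding canonical_solution_def formal_parts normed_product
proof (rule the_equality)
  have gen: "generic \<eta>"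
  proof (rule dir_estimate(2)[OF i \<eta> order_refl])
    have "pi / (2 * real K) > 0" by simp
    thus "dir i \<in> big_sector k lam i" using dir_gap(1)[OF i] unfolding big_sector_eq greaterThanLessThan_iff by linarith
    thus "dir i \<in> big_sector k lam i" .
  qed
  have inv: "invertible (Zs \<eta> c)" by (rule Zs(2)[OF gen])
  have fund: "fundamental_solution (Bm c) (usol (Zs \<eta>) c)" using fundamental_U[OF inv] by (simp add: usol_def[abs_def])
  have asym: "asymptotic_in_sector (big_sector k lam i) (\<lambda>w. normed c (usol (Zs \<eta>) c) w $ a $ b) (fY c $ a $ b)" for a b
  proof (rule estimate_asymptotic)
    fix m :: nat and \<alpha> \<beta> :: real assume "m \<ge> 1" "\<alpha> \<le> \<beta>" "{\<alpha>..\<beta>} \<subseteq> big_sector k lam i"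
    thus "estimate (Zs \<eta>) c m \<alpha> \<beta>" by (intro dir_estimate(1)[OF i \<eta>]) auto
  qed
  show "fundamental_solution (Bm c) (usol (Zs \<eta>) c) \<and>
    (\<forall>a b. asymptotic_in_sector (big_sector k lam i) (\<lambda>w. normed c (usol (Zs \<eta>) c) w $ a $ b) (fY c $ a $ b))"
    using fund asym by blast
  fix \<Phi> assume \<Phi>: "fundamental_solution (Bm c) \<Phi> \<and>
    (\<forall>a b. asymptotic_in_sector (big_sector k lam i) (\<lambda>w. normed c \<Phi> w $ a $ b) (fY c $ a $ b))"
  define M where "M = matrix_inv (usol (Zs \<eta>) c 0) ** \<Phi> 0"
  have rel: "\<Phi> w = usol (Zs \<eta>) c w ** M" for w unfolding M_def by (rule fundamental_unique[OF fund]) (use \<Phi> in blast)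
  have "M = mat 1"
  proof (rule solution_unique[OF _ rel])
    fix a b :: 'n assume ab: "a \<noteq> b"
    obtain \<theta> where \<theta>: "\<eta> - pi / 2 < \<theta>" "\<theta> < \<eta> + pi / 2" "Re ((lam $ a - lam $ b) * cis \<theta>) > 0"
      using growth_direction[OF order_refl _ _ ab, of \<eta>] gen pi_gt_zero by (metis diff_self order_antisym)
    define \<phi> where "\<phi> = \<theta> / real K"
    have K\<phi>: "real K * \<phi> = \<theta>" by (simp add: \<phi>_def del: of_nat_Suc)
    have Kp: "real K * (pi / (2 * real K)) = pi / 2" by (simp del: of_nat_Suc)
    have "real K * (dir i - pi / (2 * real K)) < real K * \<phi>" "real K * \<phi> < real K * (dir (i + 1) + pi / (2 * real K))"
      unfolding K\<phi> right_diff_distrib distrib_left Kp using \<theta> \<eta> by linarith+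
    hence \<phi>: "\<phi> \<in> big_sector k lam i" unfolding big_sector_eq by (simp only: mult_less_cancel_left_pos of_nat_0_less_iff zero_less_Suc greaterThanLessThan_iff)
    show "\<exists>\<phi>. Re ((lam $ a - lam $ b) * cis (real K * \<phi>)) > 0 \<and>
        (\<forall>i j. ((\<lambda>w. normed c (usol (Zs \<eta>) c) w $ i $ j) \<longlongrightarrow> f0 $ i $ j) (closed_sector_filter \<phi> \<phi>)) \<and>
        (\<forall>i j. ((\<lambda>w. normed c \<Phi> w $ i $ j) \<longlongrightarrow> f0 $ i $ j) (closed_sector_filter \<phi> \<phi>))"
      by (intro exI[of _ \<phi>] conjI allI asymptotic_limit[OF asym \<phi>] asymptotic_limit[OF \<Phi>[THEN conjunct2, rule_format] \<phi>])
        (use \<theta>(3) in \<open>simp only: K\<phi>\<close>)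
  qed
  thus "\<Phi> = usol (Zs \<eta>) c" using rel by (simp add: fun_eq_iff)
qed

end

subsection \<open>Stokes matrices\<close>

lemma desc_prod_empty: "b < a \<Longrightarrow> desc_prod M a b = mat 1"
  by (simp add: desc_prod_def)

lemma desc_prod_Suc: "a \<le> Suc b \<Longrightarrow> desc_prod M a (Suc b) = M (Suc b) ** desc_prod M a b"
  by (simp add: desc_prod_def)

lemma desc_prod_telescope:
  fixes G :: "nat \<Rightarrow> complex^'n^'n"
  assumes "a \<le> b" "\<And>i. a \<le> i \<Longrightarrow> i \<le> b \<Longrightarrow> invertible (G i)"
    and "\<And>i. Suc a \<le> i \<Longrightarrow> i \<le> b \<Longrightarrow> M i = matrix_inv (G i) ** G (i - 1)"
  shows "desc_prod M (Suc a) b = matrix_inv (G b) ** G a"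
  using assms
proof (induction b rule: dec_induct)
  case base
  have "invertible (G a)" by (rule base(1)) simp_all
  thus ?case by (simp only: desc_prod_empty lessI matrix_inv_mult_left)
next
  case (step n)
  have "desc_prod M (Suc a) (Suc n) = matrix_inv (G (Suc n)) ** (G n ** matrix_inv (G n)) ** G a"
    using step by (simp add: desc_prod_Suc matrix_mul_assoc)
  thus ?case using step by (simp add: matrix_inv_mult_right)
qed

lemma desc_prod_cong: "(\<And>i. a \<le> i \<Longrightarrow> i \<le> b \<Longrightarrow> M i = N i) \<Longrightarrow> desc_prod M a b = desc_prod N a b"
proof (induction b)
  case 0
  show ?case by (cases "a = 0") (use 0 in \<open>simp_all add: desc_prod_def\<close>)
next
  case (Suc b)
  show ?case
  proof (cases "a \<le> Suc b")
    case True
    have "desc_prod M a b = desc_prod N a b" by (rule Suc.IH, rule Suc.prems) simp_all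
    thus ?thesis using Suc.prems[of "Suc b"] True by (simp add: desc_prod_Suc)
  qed (simp add: desc_prod_empty)
qed

lemma desc_prod_conj:
  fixes P :: "complex^'n^'n"
  assumes "invertible P"
  shows "desc_prod (\<lambda>i. matrix_inv P ** M i ** P) 1 b = matrix_inv P ** desc_prod M 1 b ** P"
proof (induction b)
  case 0
  show ?case by (simp only: desc_prod_empty zero_less_one matrix_mul_rid matrix_inv_mult_left[OF assms])
next
  case (Suc b)
  have "desc_prod (\<lambda>i. matrix_inv P ** M i ** P) 1 (Suc b) = matrix_inv P ** M (Suc b) ** (P ** matrix_inv P) ** desc_prod M 1 b ** P"
    by (simp only: desc_prod_Suc le_add1 plus_1_eq_Suc[symmetric] Suc[unfolded One_nat_def] matrix_mul_assoc) (simp add: desc_prod_Suc Suc[unfolded One_nat_def] matrix_mul_assoc)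
  thus ?case using assms by (simp add: matrix_inv_mult_right desc_prod_Suc matrix_mul_assoc)
qed

lemma det_desc_prod:
  fixes M :: "nat \<Rightarrow> complex^'n^'n"
  shows "(\<And>i. 1 \<le> i \<Longrightarrow> i \<le> b \<Longrightarrow> det (M i) = 1) \<Longrightarrow> det (desc_prod M 1 b) = 1"
  by (induction b) (simp_all add: desc_prod_empty desc_prod_Suc det_mul)

lemma permutation_conj:
  fixes P :: "complex^'n^'n"
  assumes "bij \<sigma>" "P = (\<chi> i j. if i = \<sigma> j then 1 else 0)"
  shows "invertible P" "(matrix_inv P ** M ** P) $ i $ j = M $ \<sigma> i $ \<sigma> j"
proof -
  have pt: "transpose P ** P = mat 1"
    using assms by (auto simp: vec_eq_iff transpose_def matrix_matrix_mult_def mat_def if_distrib[of "\<lambda>x. x * _"] bij_def inj_eq cong: if_cong)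
  show "invertible P" using left_inverse_right_inverse_matrix[OF pt] by blast
  have inv: "matrix_inv P = transpose P" using left_inverse_right_inverse_matrix[OF pt] by blast
  have "(\<Sum>b\<in>UNIV. (\<Sum>a\<in>UNIV. P $ a $ i * M $ a $ b) * P $ b $ j) = M $ \<sigma> i $ \<sigma> j"
    by (simp add: assms(2) if_distrib[of "\<lambda>x. x * _"] if_distrib[of "\<lambda>x. _ * x"] cong: if_cong)
  thus "(matrix_inv P ** M ** P) $ i $ j = M $ \<sigma> i $ \<sigma> j"
    unfolding inv by (simp add: matrix_matrix_mult_def transpose_def)
qed

lemma decreasing_enumeration:
  fixes key :: "'n::{finite,wellorder} \<Rightarrow> real"
  assumes "inj key"
  obtains \<sigma> :: "'n \<Rightarrow> 'n" where "bij \<sigma>" "\<And>i j. j < i \<Longrightarrow> key (\<sigma> i) < key (\<sigma> j)"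
proof -
  define rank where "rank = (\<lambda>a. card {b. key b > key a})"
  have mono: "rank b < rank a" if "key a < key b" for a b
    unfolding rank_def using that by (intro psubset_card_mono) auto
  have inj: "inj rank"
    by (rule injI) (metis mono assms injD linorder_neqE_linordered_idom less_irrefl)
  have "rank a < CARD('n)" for a
    unfolding rank_def by (intro psubset_card_mono) auto
  hence "range rank = {..<CARD('n)}"
    using inj by (intro card_subset_eq) (auto simp: card_image)
  hence rank: "bij_betw rank UNIV {..<CARD('n)}" using inj by (simp add: bij_betw_def)
  define \<sigma> where "\<sigma> = inv_into UNIV rank \<circ> (pos :: 'n \<Rightarrow> nat)"
  have bij: "bij \<sigma>" unfolding \<sigma>_def by (rule bij_betw_trans[OF bij_betw_pos bij_betw_inv_into[OF rank]])
  have r: "rank (\<sigma> i) = pos i" for i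
    unfolding \<sigma>_def comp_def by (rule bij_betw_inv_into_right[OF rank]) (simp add: pos_less)
  show thesis
  proof (rule that[OF bij])
    fix i j :: 'n assume "j < i"
    hence "pos j < pos i" unfolding pos_def by (intro psubset_card_mono) auto
    hence "rank (\<sigma> j) < rank (\<sigma> i)" by (simp add: r)
    thus "key (\<sigma> i) < key (\<sigma> j)" using mono[of "\<sigma> j" "\<sigma> i"] by (metis assms injD linorder_neqE_linordered_idom less_irrefl less_asym)
  qed
qed

context oper_setup
begin

text \<open>The middle of the i-th sector, measured as an argument of z^(k+1).\<close>

definition "eta i = real K * ((dir i + dir (i + 1)) / 2)"

lemma eta:
  assumes "1 \<le> i" "i \<le> 2 * K * ell"
  shows "real K * dir i < eta i" "eta i < real K * dir (i + 1)"
  using dir_gap(1)[OF assms] unfolding eta_def by (auto intro!: mult_strict_left_mono simp del: of_nat_Suc)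

lemma eta_generic:
  assumes i: "1 \<le> i" "i \<le> 2 * K * ell"
  shows "generic (eta i)"
proof (rule dir_estimate(2)[OF i eta[OF i] order_refl])
  have "pi / (2 * real K) > 0" by simp
  thus "dir i \<in> big_sector k lam i" using dir_gap(1)[OF i] unfolding big_sector_eq greaterThanLessThan_iff by linarith
  thus "dir i \<in> big_sector k lam i" .
qed

definition "Dm c = (diag_mat (\<chi> j. exp (- 2 * of_real pi * \<i> * fL c $ j)) :: 'n cmat)"
text \<open>With \<open>G 0\<close> the last canonical solution continued once around infinity and corrected by the
  formal monodromy, the formula for the Stokes factors also covers the first one.\<close>

definition "G i c = (if i = 0 then Zs (eta (2 * K * ell)) c ** Dm c else Zs (eta i) c)"
text \<open>For j >= 1 the connection matrix of the sector containing \<open>tau j\<close>;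
  consecutive ones differ by a Stokes matrix.\<close>

abbreviation "T j \<equiv> G (j * ell)"

lemma Dm_inv: "invertible (Dm c)" "matrix_inv (Dm c) = diag_mat (\<chi> j. exp (2 * of_real pi * \<i> * fL c $ j))"
proof -
  have "Dm c ** diag_mat (\<chi> j. exp (2 * of_real pi * \<i> * fL c $ j)) = mat 1"
    by (simp add: Dm_def diag_mat_mult diag_mat_one flip: exp_add)
  from left_inverse_right_inverse_matrix[OF this]
  show "invertible (Dm c)" "matrix_inv (Dm c) = diag_mat (\<chi> j. exp (2 * of_real pi * \<i> * fL c $ j))" by blast+
qed

lemma r_pos: "1 \<le> 2 * K * ell"
  using ell_pos by (simp add: Suc_le_eq)

lemma G_inv: "i \<le> 2 * K * ell \<Longrightarrow> invertible (G i c)"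
  unfolding G_def using r_pos by (cases "i = 0") (auto intro!: invertible_matrix_mult Dm_inv Zs(2) eta_generic)

lemma G_holo: "i \<le> 2 * K * ell \<Longrightarrow> holo_on UNIV (\<lambda>q. G i (fst q) $ a $ b)"
proof (cases "i = 0")
  case True
  have "holo_on UNIV (\<lambda>q. Dm (fst q) $ a $ b)" for a b
    unfolding Dm_def diag_mat_def vec_lambda_beta by (intro holo_on_if holo_on_exp holo_on_mult holo_on_const holo_on_fL)
  thus ?thesis unfolding G_def if_P[OF True] using r_pos by (intro holo_on_matrix_mult Zs(1) eta_generic order_refl)
next
  case False
  moreover assume "i \<le> 2 * K * ell"
  ultimately show ?thesis unfolding G_def by (simp add: Zs(1) eta_generic)
qed

lemma usol_ratio:
  assumes "invertible (Z c)"
  shows "matrix_inv (usol Z c w) ** usol Z' c w = matrix_inv (Z c) ** Z' c"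
  unfolding usol_def matrix_inv_product[OF U_invertible assms]
  by (metis matrix_mul_assoc matrix_mul_lid matrix_inv_mult_left[OF U_invertible])

lemma usol_periodic: "usol Z c (w + 2 * of_real pi * \<i>) = usol Z c w"
  by (simp add: usol_def U_def exp_add)

lemma stokes_factor_eq:
  assumes i: "1 \<le> i" "i \<le> 2 * K * ell"
  shows "stokes_factor k f0 lam (Bm c) i = matrix_inv (G i c) ** G (i - 1) c"
proof (cases "i = 1")
  case True
  have 1: "canonical_solution k f0 lam (Bm c) 1 = usol (G 1) c"
    unfolding canonical_solution_eq[OF order_refl r_pos eta[OF order_refl r_pos]] by (simp add: usol_def G_def fun_eq_iff)
  have r: "canonical_solution k f0 lam (Bm c) (2 * K * ell) = usol (Zs (eta (2 * K * ell))) c"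
    by (rule canonical_solution_eq[OF r_pos order_refl eta[OF r_pos order_refl]])
  have "matrix_inv (usol (G 1) c w) ** usol (Zs (eta (2 * K * ell))) c w ** Dm c = matrix_inv (G 1 c) ** G 0 c" for w
    unfolding usol_ratio[OF G_inv[OF r_pos]] by (simp add: G_def matrix_mul_assoc)
  thus ?thesis
    unfolding stokes_factor_def Let_def formal_parts num_dirs_eq if_P[OF True] 1 r usol_periodic Dm_def[symmetric]
    unfolding True by simp
next
  case False
  have Gu: "canonical_solution k f0 lam (Bm c) j = usol (G j) c" if "1 \<le> j" "j \<le> 2 * K * ell" for j
    unfolding canonical_solution_eq[OF that eta[OF that]] using that by (simp add: usol_def G_def fun_eq_iff)
  have j: "1 \<le> i - 1" "i - 1 \<le> 2 * K * ell" using i False by auto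
  show ?thesis
    unfolding stokes_factor_def Let_def if_not_P[OF False] Gu[OF i] Gu[OF j] usol_ratio[OF G_inv[OF i(2)]] by simp
qed

lemma T_le: "j \<le> 2 * K \<Longrightarrow> j * ell \<le> 2 * K * ell"
  by (rule mult_le_mono1)

lemma stokes_matrix_eq:
  assumes j: "1 \<le> j" "j \<le> 2 * K"
  shows "stokes_matrix k f0 lam (Bm c) j = matrix_inv (T j c) ** T (j - 1) c"
proof -
  have "(j - 1) * ell \<le> j * ell" by simp
  hence "desc_prod (stokes_factor k f0 lam (Bm c)) (Suc ((j - 1) * ell)) (j * ell) = matrix_inv (G (j * ell) c) ** G ((j - 1) * ell) c"
    using T_le[OF j(2)] by (intro desc_prod_telescope[of _ _ "\<lambda>i. G i c"] G_inv stokes_factor_eq) auto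
  thus ?thesis unfolding stokes_matrix_def ell_eq Let_def by simp
qed

lemma T_0: "T 0 c = T (2 * K) c ** Dm c"
proof -
  have "2 * K * ell \<noteq> 0" using r_pos by linarith
  thus ?thesis unfolding G_def by (simp only: mult_zero_left if_True if_False simp_thms)
qed

text \<open>The telescoping product runs once around infinity and leaves the inverse of the formal
  monodromy; this is the monodromy relation that puts the tuple into the space of Stokes
  data.\<close>

lemma stokes_product: "desc_prod (stokes_matrix k f0 lam (Bm c)) 1 (2 * K) = Dm c"
proof -
  have "desc_prod (stokes_matrix k f0 lam (Bm c)) (Suc 0) (2 * K) = matrix_inv (T (2 * K) c) ** T 0 c"
    by (intro desc_prod_telescope[of _ _ "\<lambda>j. T j c"] G_inv T_le stokes_matrix_eq) auto
  also have "\<dots> = Dm c" by (simp only: T_0 matrix_mul_assoc matrix_inv_mult_left[OF G_inv[OF T_le[OF order_refl]]] matrix_mul_lid)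
  finally show ?thesis by (simp only: One_nat_def)
qed

lemma T_sector:
  assumes j: "1 \<le> j" "j \<le> 2 * K" and \<phi>: "tau j - pi / (2 * real K) \<le> \<phi>" "\<phi> \<le> tau j + pi / (2 * real K)"
  shows "\<phi> \<in> big_sector k lam (j * ell)"
  using dir_tau[OF j] \<phi> unfolding big_sector_eq greaterThanLessThan_iff by linarith

lemma T_estimate:
  assumes j: "1 \<le> j" "j \<le> 2 * K" and m: "m \<ge> 1"
  shows "estimate (T j) c0 m (tau j - pi / (2 * real K)) (tau j + pi / (2 * real K))"
proof -
  have i: "1 \<le> j * ell" "j * ell \<le> 2 * K * ell" using j ell_pos T_le by (auto simp: Suc_le_eq)
  have "T j = Zs (eta (j * ell))" using i by (auto simp: G_def fun_eq_iff)
  moreover have "estimate (Zs (eta (j * ell))) c0 m (tau j - pi / (2 * real K)) (tau j + pi / (2 * real K))"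
  proof (rule dir_estimate(1)[OF i eta[OF i] m])
    have p: "pi / (2 * real K) > 0" by simp
    show "tau j - pi / (2 * real K) \<in> big_sector k lam (j * ell)" by (rule T_sector[OF j order_refl]) (use p in linarith)
    show "tau j + pi / (2 * real K) \<in> big_sector k lam (j * ell)" by (rule T_sector[OF j _ order_refl]) (use p in linarith)
  qed
  ultimately show ?thesis by simp
qed

text \<open>The case j = 0 is the case j = 2 K one turn earlier: \<open>U\<close> is periodic in w,
  and the change of z^Lambda is compensated by \<open>Dm\<close>.\<close>

lemma T_limit:
  assumes j: "j \<le> 2 * K" and \<phi>: "tau j - pi / (2 * real K) \<le> \<phi>" "\<phi> \<le> tau j + pi / (2 * real K)"
  shows "((\<lambda>w. normed c (usol (T j) c) w $ a $ b) \<longlongrightarrow> f0 $ a $ b) (closed_sector_filter \<phi> \<phi>)"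
proof -
  have pos: "((\<lambda>w. normed c (usol (T j) c) w $ a $ b) \<longlongrightarrow> f0 $ a $ b) (closed_sector_filter \<phi> \<phi>)"
    if "1 \<le> j" "j \<le> 2 * K" "tau j - pi / (2 * real K) \<le> \<phi>" "\<phi> \<le> tau j + pi / (2 * real K)" for j \<phi>
    by (rule estimate_limit[OF T_estimate[OF that(1,2) order_refl, of c] _ order_refl that(3,4)]) simp
  show ?thesis
  proof (cases "j = 0")
    case False
    thus ?thesis using pos[of j \<phi>] assms by simp
  next
    case True
    have t: "tau (2 * K) = tau 0 + 2 * pi" using tau_add[of 0] by simp
    have "((\<lambda>w. normed c (usol (T (2 * K)) c) w $ a $ b) \<longlongrightarrow> f0 $ a $ b) (closed_sector_filter (\<phi> + 2 * pi) (\<phi> + 2 * pi))"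
      using \<phi> unfolding True by (intro pos; (unfold t)?; (linarith | simp))
    moreover have "filterlim (\<lambda>w. w + 2 * of_real pi * \<i>) (closed_sector_filter (\<phi> + 2 * pi) (\<phi> + 2 * pi)) (closed_sector_filter \<phi> \<phi>)"
      unfolding filterlim_iff eventually_closed_sector
    proof (intro allI impI)
      fix P :: "complex \<Rightarrow> bool" assume "\<exists>\<rho>. \<forall>w. \<rho> \<le> Re w \<longrightarrow> Im w \<in> {\<phi> + 2 * pi..\<phi> + 2 * pi} \<longrightarrow> P w"
      then obtain \<rho> where \<rho>: "\<And>w. \<rho> \<le> Re w \<Longrightarrow> Im w \<in> {\<phi> + 2 * pi..\<phi> + 2 * pi} \<Longrightarrow> P w" by blast
      show "\<exists>\<rho>. \<forall>w. \<rho> \<le> Re w \<longrightarrow> Im w \<in> {\<phi>..\<phi>} \<longrightarrow> P (w + 2 * complex_of_real pi * \<i>)"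
        by (intro exI[of _ \<rho>] allI impI \<rho>) auto
    qed
    ultimately have "((\<lambda>w. normed c (usol (T (2 * K)) c) (w + 2 * of_real pi * \<i>) $ a $ b) \<longlongrightarrow> f0 $ a $ b) (closed_sector_filter \<phi> \<phi>)"
      by (rule filterlim_compose)
    moreover have "normed c (usol (T (2 * K)) c) (w + 2 * of_real pi * \<i>) = normed c (usol (T j) c) w" for w
    proof -
      have "Ef c j (w + 2 * of_real pi * \<i>) = Ef c j w + 2 * of_real pi * \<i> * fL c $ j" for j
        by (simp add: Ef_def exp_add algebra_simps)
      hence "diag_mat (\<chi> j. exp (- Ef c j (w + 2 * of_real pi * \<i>))) = Dm c ** diag_mat (\<chi> j. exp (- Ef c j w))"
        by (simp add: Dm_def diag_mat_mult algebra_simps flip: exp_add)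
      moreover have "usol (T j) c w = usol (T (2 * K)) c w ** Dm c"
        unfolding True usol_right by (simp only: usol_def T_0)
      ultimately show ?thesis unfolding normed_def usol_periodic by (simp only: matrix_mul_assoc)
    qed
    ultimately show ?thesis by simp
  qed
qed

definition "Sm i c = matrix_inv (T i c) ** T (i - 1) c"
text \<open>Order of the eigenvalues that governs triangularity: midway between consecutive
  \<open>tau\<close>, the real part of (lam a - lam b) z^K has the sign of key a - key b up to a
  sign alternating with the index.\<close>

definition "key a = Im (lam $ a * cis (real K * tau 0))"

lemma key_inj: "inj key"
proof (rule injI)
  fix a b assume "key a = key b"
  hence "Im ((lam $ a - lam $ b) * cis (real K * tau 0)) = 0" by (simp add: key_def left_diff_distrib del: of_nat_Suc)
  thus "a = b" using tau_generic[of 0] unfolding generic_def by blast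
qed

text \<open>The two neighbouring solutions share the limit \<open>f0\<close> on a common ray. An
  entry whose exponent difference grows on it must vanish, and the rotation by pi in z^K from one
  index to the next exchanges upper and lower.\<close>

lemma Sm_triangular:
  assumes i: "1 \<le> i" "i \<le> 2 * K"
  shows "Sm i c $ a $ a = 1" and "(if odd i then key a < key b else key b < key a) \<Longrightarrow> Sm i c $ a $ b = 0"
proof -
  \<comment> \<open>The ray halfway between \<open>tau (i - 1)\<close> and \<open>tau i\<close>, the
    common edge of the two closed sectors in which the limits are known.\<close>
  define \<phi> where "\<phi> = tau i - pi / (2 * real K)"
  define \<delta> where "\<delta> = pi / (2 * real K)"
  have p: "\<delta> > 0" "pi / real K = 2 * \<delta>" by (simp_all add: \<delta>_def del: of_nat_Suc)
  have ts: "tau i = tau (i - 1) + 2 * \<delta>" using tau_Suc[of "i - 1"] i by (simp add: p(2) del: of_nat_Suc)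
  have i1: "i - 1 \<le> 2 * K" using i by simp
  have bd: "tau i - pi / (2 * real K) \<le> \<phi>" "\<phi> \<le> tau i + pi / (2 * real K)"
    "tau (i - 1) - pi / (2 * real K) \<le> \<phi>" "\<phi> \<le> tau (i - 1) + pi / (2 * real K)"
    using p ts unfolding \<phi>_def \<delta>_def[symmetric] by linarith+
  have l1: "((\<lambda>w. normed c (usol (T i) c) w $ a $ b) \<longlongrightarrow> f0 $ a $ b) (closed_sector_filter \<phi> \<phi>)" for a b
    by (rule T_limit[OF i(2) bd(1,2)])
  have l2: "((\<lambda>w. normed c (usol (T (i - 1)) c) w $ a $ b) \<longlongrightarrow> f0 $ a $ b) (closed_sector_filter \<phi> \<phi>)" for a b
    by (rule T_limit[OF i1 bd(3,4)])
  have rel: "usol (T (i - 1)) c w = usol (T i) c w ** Sm i c" for w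
    unfolding usol_def Sm_def by (metis matrix_mul_assoc matrix_inv_mult_right[OF G_inv[OF T_le[OF i(2)]]] matrix_mul_rid)
  note tr = transition[OF l1 l2 rel closed_sector_nontrivial[OF order_refl]]
  show "Sm i c $ a $ a = 1" by (rule tr(1))
  assume key: "if odd i then key a < key b else key b < key a"
  show "Sm i c $ a $ b = 0"
  proof (rule tr(2)[OF _ Ef_growth])
    show "a \<noteq> b" using key by auto
    have "real K * \<phi> = real K * tau 0 + real i * pi - pi / 2"
      by (simp add: \<phi>_def tau_def right_diff_distrib distrib_left del: of_nat_Suc)
    moreover have "cis (real i * pi) = (- 1) ^ i" using Complex.DeMoivre[of pi i] by simp
    moreover have "cis (- (pi / 2)) = - \<i>" by (simp add: complex_eq_iff)
    ultimately have "cis (real K * \<phi>) = cis (real K * tau 0) * (- 1) ^ i * (- \<i>)"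
      by (simp only: diff_conv_add_uminus cis_mult[symmetric])
    hence "Re ((lam $ a - lam $ b) * cis (real K * \<phi>)) = (- 1) ^ i * (key a - key b)"
      unfolding key_def by (cases "even i") (simp_all add: algebra_simps del: of_nat_Suc)
    thus "Re ((lam $ a - lam $ b) * cis (real K * \<phi>)) > 0" using key by (simp split: if_splits)
  qed
qed

lemma cyclic_opers_coeffs: "A \<in> cyclic_opers k \<longleftrightarrow> (\<exists>c. A = (oper_of_coeffs k (c :: 'm cvec) :: complex \<Rightarrow> 'n cmat))"
  using bij_betw_imp_surj_on[OF bij_betw_oper_of_coeffs[where 'm = 'm and 'n = 'n, OF n2 k1 card_m]] by auto

lemma stokes_matrix_Sm: "i \<in> {1..2 * k + 2} \<Longrightarrow> stokes_matrix k f0 lam (Bm c) i = Sm i c"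
  unfolding Sm_def by (rule stokes_matrix_eq) auto

text \<open>The permutation comes from a choice operator. The enumeration by decreasing
  \<open>key\<close> shows that some permutation works for all opers, and only the defining property
  of the chosen one is passed on.\<close>

lemma stokes_perm:
  obtains \<sigma> where "bij \<sigma>" "stokes_perm k f0 lam = (\<chi> i j. if i = \<sigma> j then 1 else 0)"
    and "\<And>c i. i \<in> {1..2 * k + 2} \<Longrightarrow> matrix_inv (stokes_perm k f0 lam) ** Sm i c ** stokes_perm k f0 lam \<in> unipotent_at i"
proof -
  let ?Q = "\<lambda>P :: 'n cmat. permutation_matrix P \<and> (\<forall>A\<in>cyclic_opers k. \<forall>i\<in>{1..2 * k + 2}.
        matrix_inv P ** stokes_matrix k f0 lam (assoc_matrix k A) i ** P \<in> unipotent_at i)"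
  obtain \<sigma> :: "'n \<Rightarrow> 'n" where \<sigma>: "bij \<sigma>" "\<And>i j. j < i \<Longrightarrow> key (\<sigma> i) < key (\<sigma> j)"
    by (rule decreasing_enumeration[OF key_inj]) (rule that)
  define P where "P = ((\<chi> i j. if i = \<sigma> j then 1 else 0) :: 'n cmat)"
  have "?Q P"
  proof (intro conjI ballI)
    show "permutation_matrix P" unfolding permutation_matrix_def P_def using \<sigma>(1) by blast
    fix A i assume A: "A \<in> (cyclic_opers k :: (complex \<Rightarrow> 'n cmat) set)" and i: "i \<in> {1..2 * k + 2}"
    obtain c where c: "A = oper_of_coeffs k (c :: 'm cvec)" using A cyclic_opers_coeffs by blast
    have i': "1 \<le> i" "i \<le> 2 * K" using i by auto
    show "matrix_inv P ** stokes_matrix k f0 lam (assoc_matrix k A) i ** P \<in> unipotent_at i"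
      unfolding c stokes_matrix_Sm[OF i] unipotent_at_def upper_unipotent_def lower_unipotent_def
      using Sm_triangular[OF i'] \<sigma>(2) by (auto simp: permutation_conj(2)[OF \<sigma>(1) P_def] split: if_splits)
  qed
  hence Q: "?Q (stokes_perm k f0 lam)" unfolding stokes_perm_def by (rule someI)
  then obtain \<sigma>' where "bij \<sigma>'" "stokes_perm k f0 lam = (\<chi> i j. if i = \<sigma>' j then 1 else 0)"
    unfolding permutation_matrix_def by blast
  thus thesis
  proof (rule that)
    fix c :: "'m cvec" and i assume i: "i \<in> {1..2 * k + 2}"
    have "(oper_of_coeffs k c :: complex \<Rightarrow> 'n cmat) \<in> cyclic_opers k" using cyclic_opers_coeffs by blast
    thus "matrix_inv (stokes_perm k f0 lam) ** Sm i c ** stokes_perm k f0 lam \<in> unipotent_at i"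
      using Q i stokes_matrix_Sm[OF i] by metis
  qed
qed

text \<open>The product of the tuple is diagonal as a permuted copy of \<open>Dm\<close>, and it has
  determinant 1 because every factor is unipotent.\<close>

lemma monodromy_in_stokes_space: "monodromy_map k f0 lam (oper_of_coeffs k (c :: 'm cvec)) \<in> stokes_space k"
proof -
  let ?P = "stokes_perm k f0 lam" and ?\<nu> = "monodromy_map k f0 lam (oper_of_coeffs k c)"
  obtain \<sigma> where \<sigma>: "bij \<sigma>" "?P = (\<chi> i j. if i = \<sigma> j then 1 else 0)"
    and u: "\<And>c i. i \<in> {1..2 * k + 2} \<Longrightarrow> matrix_inv ?P ** Sm i c ** ?P \<in> unipotent_at i"
    by (rule stokes_perm) (rule that)
  have \<nu>: "?\<nu> i = matrix_inv ?P ** stokes_matrix k f0 lam (Bm c) i ** ?P" if "i \<in> {1..2 * k + 2}" for i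
    using that by (simp add: monodromy_map_def)
  have \<nu>u: "?\<nu> i \<in> unipotent_at i" if "i \<in> {1..2 * k + 2}" for i
    unfolding \<nu>[OF that] stokes_matrix_Sm[OF that] by (rule u[OF that])
  have "desc_prod ?\<nu> 1 (2 * k + 2) = desc_prod (\<lambda>i. matrix_inv ?P ** stokes_matrix k f0 lam (Bm c) i ** ?P) 1 (2 * k + 2)"
    by (rule desc_prod_cong, rule \<nu>) simp
  also have "\<dots> = matrix_inv ?P ** Dm c ** ?P"
    unfolding desc_prod_conj[OF permutation_conj(1)[OF \<sigma>]] using stokes_product[of c] by simp
  finally have prod: "desc_prod ?\<nu> 1 (2 * k + 2) = matrix_inv ?P ** Dm c ** ?P" .
  have "det (desc_prod ?\<nu> 1 (2 * k + 2)) = 1"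
  proof (rule det_desc_prod)
    fix i assume "1 \<le> i" "i \<le> 2 * k + 2"
    hence "?\<nu> i \<in> unipotent_at i" by (intro \<nu>u) simp
    thus "det (?\<nu> i) = 1"
      unfolding unipotent_at_def upper_unipotent_def lower_unipotent_def
      by (auto split: if_splits simp: det_upperdiagonal det_lowerdiagonal)
  qed
  moreover have "desc_prod ?\<nu> 1 (2 * k + 2) $ i $ j = 0" if "i \<noteq> j" for i j
    unfolding prod permutation_conj(2)[OF \<sigma>] using that \<sigma>(1) by (auto simp: Dm_def diag_mat_def bij_def inj_eq)
  ultimately have "desc_prod ?\<nu> 1 (2 * k + 2) \<in> diagonal_SL" by (simp add: diagonal_SL_def)
  moreover have "?\<nu> \<in> PiE {1..2 * k + 2} unipotent_at"
    by (rule PiE_I) (use \<nu>u in \<open>auto simp: monodromy_map_def\<close>)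
  ultimately show ?thesis by (simp add: stokes_space_def)
qed

lemma Sm_holo:
  assumes "1 \<le> i" "i \<le> 2 * K"
  shows "holo_on UNIV (\<lambda>q. Sm i (fst q) $ a $ b)"
proof -
  have "i - 1 \<le> 2 * K" using assms by simp
  thus ?thesis unfolding Sm_def
    using G_inv[OF T_le[OF assms(2)]]
    by (intro holo_on_matrix_mult holo_on_matrix_inv G_holo T_le assms) (simp_all add: invertible_det_nz)
qed

end

subsection \<open>The differential of the Stokes matrices\<close>

lemma circle_derivative:
  assumes "h holomorphic_on UNIV"
  shows "deriv h 0 = integral {0..1} (\<lambda>s. h (exp (2 * of_real pi * \<i> * of_real s)) / exp (2 * of_real pi * \<i> * of_real s))"
proof -
  have "(h has_field_derivative (1 / (2 * of_real pi * \<i>) * contour_integral (circlepath 0 1) (\<lambda>u. h u / (u - 0)^2))) (at 0)"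
    by (rule Cauchy_derivative_integral_circlepath(2))
      (auto intro: holomorphic_on_subset[OF assms] holomorphic_on_imp_continuous_on)
  hence "deriv h 0 = 1 / (2 * of_real pi * \<i>) * contour_integral (circlepath 0 1) (\<lambda>u. h u / (u - 0)^2)"
    by (rule DERIV_imp_deriv)
  also have "\<dots> = 1 / (2 * of_real pi * \<i>) * integral {0..1} (\<lambda>s. 2 * of_real pi * \<i> *
      (h (exp (2 * of_real pi * \<i> * of_real s)) / exp (2 * of_real pi * \<i> * of_real s)))"
    unfolding contour_integral_integral vector_derivative_circlepath
    by (simp add: circlepath power2_eq_square mult_ac)
  finally show ?thesis by (simp only: integral_mult_right) simp
qed

text \<open>The directional derivative is written as a Cauchy integral over the unit circle, which can
  be differentiated under the integral sign.\<close>

lemma mixed_derivative: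
  fixes f g :: "(complex^'m) \<times> complex \<Rightarrow> complex"
  assumes f: "holo_on UNIV f" and g: "holo_on UNIV g"
    and d: "\<And>c z. ((\<lambda>u. f (c, u)) has_field_derivative g (c, z)) (at z)"
  shows "((\<lambda>z. deriv (\<lambda>t. f (c + t *s v, z)) 0) has_field_derivative deriv (\<lambda>t. g (c + t *s v, z)) 0) (at z)"
proof -
  define e where "e = (\<lambda>s::real. exp (2 * of_real pi * \<i> * of_real s) :: complex)"
  have eq: "deriv (\<lambda>t. h (c + t *s v, z)) 0 = integral (cbox 0 1) (\<lambda>s. h (c + e s *s v, z) / e s)" if "holo_on UNIV h" for h z
    using circle_derivative[OF holo_on_line[OF that open_UNIV], of c v z] by (simp add: e_def)
  have cont: "continuous_on S (\<lambda>p. h (c + e (snd p) *s v, fst p) / e (snd p))" if "holo_on UNIV h" for h S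
    unfolding e_def vector_scalar_mult_def
    by (intro continuous_on_divide continuous_on_compose2[OF holo_on_continuous[OF that]] continuous_intros) auto
  have "((\<lambda>z. integral (cbox 0 1) (\<lambda>s. f (c + e s *s v, z) / e s)) has_field_derivative
      integral (cbox 0 1) (\<lambda>s. g (c + e s *s v, z) / e s)) (at z within UNIV)"
  proof (rule leibniz_rule_field_derivative)
    show "((\<lambda>z. f (c + e s *s v, z) / e s) has_field_derivative g (c + e s *s v, z) / e s) (at z within UNIV)" for z s
      using d by (intro DERIV_cdivide)
    show "(\<lambda>s. f (c + e s *s v, z) / e s) integrable_on cbox 0 1" for z
    proof (rule integrable_continuous)
      have "continuous_on (cbox 0 1) (\<lambda>s. f (c + e (snd (z, s)) *s v, fst (z, s)) / e (snd (z, s)))"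
        by (rule continuous_on_compose2[OF cont[OF f, of UNIV], of _ "\<lambda>s. (z, s)"]) (auto intro!: continuous_intros)
      thus "continuous_on (cbox 0 1) (\<lambda>s. f (c + e s *s v, z) / e s)" by simp
    qed
    show "continuous_on (UNIV \<times> cbox 0 1) (\<lambda>(z, s). g (c + e s *s v, z) / e s)"
      using cont[OF g] by (simp add: case_prod_unfold)
  qed auto
  thus ?thesis by (simp add: eq[OF f] eq[OF g])
qed

definition td :: "complex^'m \<Rightarrow> complex^'m \<Rightarrow> (complex^'m \<Rightarrow> complex^'n^'n) \<Rightarrow> complex^'n^'n" where
  "td c v M = (\<chi> a b. deriv (\<lambda>t. M (c + t *s v) $ a $ b) 0)"

lemma holo_line:
  assumes "holo_on UNIV (\<lambda>q. f (fst q))"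
  shows "(\<lambda>t. f (c + t *s v)) holomorphic_on S"
  using holo_on_line[OF assms, of UNIV c v] holomorphic_on_subset by fastforce

lemma td:
  assumes "\<And>a b. holo_on UNIV (\<lambda>q. M (fst q) $ a $ b)"
  shows "has_matrix_derivative (\<lambda>t. M (c + t *s v)) (td c v M) 0"
  unfolding has_matrix_derivative_def td_def
  using holomorphic_derivI[OF holo_line[OF assms] open_UNIV] by simp

lemma td_eqI:
  assumes "\<And>a b. holo_on UNIV (\<lambda>q. M (fst q) $ a $ b)" "has_matrix_derivative (\<lambda>t. M (c + t *s v)) D 0"
  shows "td c v M = D"
  by (rule has_matrix_derivative_unique[OF td[OF assms(1)] assms(2)])

lemma td_mult:
  assumes "\<And>a b. holo_on UNIV (\<lambda>q. M (fst q) $ a $ b)" "\<And>a b. holo_on UNIV (\<lambda>q. N (fst q) $ a $ b)"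
  shows "td c v (\<lambda>c. M c ** N c) = td c v M ** N c + M c ** td c v N"
proof (rule td_eqI)
  show "holo_on UNIV (\<lambda>q. (M (fst q) ** N (fst q)) $ a $ b)" for a b by (rule holo_on_matrix_mult[OF assms])
  show "has_matrix_derivative (\<lambda>t. M (c + t *s v) ** N (c + t *s v)) (td c v M ** N c + M c ** td c v N) 0"
    using has_matrix_derivative_mult[OF td[OF assms(1), where c = c and v = v] td[OF assms(2), where c = c and v = v]] by simp
qed

lemma td_const: "td c v (\<lambda>c. M) = 0"
  by (simp add: td_def vec_eq_iff)

lemma holo_on_fix_snd: "holo_on UNIV f \<Longrightarrow> holo_on UNIV (\<lambda>q. f (fst q, w))"
  by (rule holo_on_reparam[OF _ holo_on_const]) auto

text \<open>The equation \<open>M' = [A, M] + q E\<close> for a lower triangular \<open>M\<close>, in 0-based indices: the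
  superdiagonal entries make the diagonal constant along rows, the diagonal ones then kill its
  derivative, and each subdiagonal in turn vanishes, the last one forcing \<open>q = 0\<close>.\<close>

lemma commutator_system:
  fixes M :: "nat \<Rightarrow> nat \<Rightarrow> complex \<Rightarrow> complex"
  assumes n: "n \<ge> 2" and upper: "\<And>r s z. r < s \<Longrightarrow> s < n \<Longrightarrow> M r s z = 0"
    and der: "\<And>r s z. r < n \<Longrightarrow> s < n \<Longrightarrow> (M r s has_field_derivative
       ((if r = n - 1 \<and> s = 0 then q z else 0) + (if r = n - 1 then p z * M 0 s z else M (r + 1) s z)
         - (if s = 0 then p z * M r (n - 1) z else M r (s - 1) z))) (at z)"
  shows "q z = 0"
proof -
  have zero: "((if r = n - 1 \<and> s = 0 then q z else 0) + (if r = n - 1 then p z * M 0 s z else M (r + 1) s z)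
         - (if s = 0 then p z * M r (n - 1) z else M r (s - 1) z)) = 0"
    if "r < n" "s < n" "\<And>z. M r s z = 0" for r s z
  proof -
    have "M r s = (\<lambda>z. 0)" using that(3) by auto
    thus ?thesis using der[OF that(1,2), of z] DERIV_unique[OF _ DERIV_const[of 0]] by metis
  qed
  have diag: "M r r z = M 0 0 z" if "r < n" for r z
    using that
  proof (induction r)
    case (Suc r)
    moreover from Suc.prems have "r \<noteq> n - 1" by linarith
    ultimately show ?case using zero[of r "Suc r" z] upper by auto
  qed simp
  have diag_eq: "M r r = M 0 0" if "r < n" for r using diag[OF that] by auto
  \<comment> \<open>The common derivative of all diagonal entries.\<close>
  define h where "h = (\<lambda>z. deriv (M 0 0) z)"
  have h: "h z = (if r = n - 1 then 0 else M (r + 1) r z) - (if r = 0 then 0 else M r (r - 1) z)" if "r < n" for r z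
    using DERIV_imp_deriv[OF der[OF that that, of z]] n upper[of 0 r z] upper[of r "n - 1" z] that
    by (auto simp: diag_eq[OF that] h_def split: if_splits)
  \<comment> \<open>The diagonal equations make consecutive entries of the first subdiagonal differ
    by h.\<close>
  have sub: "M (Suc r) r z = of_nat (Suc r) * h z" if "Suc r < n" for r z
    using that
  proof (induction r)
    case 0 thus ?case using h[of 0 z] by auto
  next
    case (Suc r)
    hence "Suc r < n" "Suc r \<noteq> n - 1" by linarith+
    hence "h z = M (Suc (Suc r)) (Suc r) z - M (Suc r) r z" using h[of "Suc r" z] by simp
    thus ?case using Suc.IH \<open>Suc r < n\<close> by (simp add: algebra_simps)
  qed
  \<comment> \<open>The last diagonal equation reads h = - (n - 1) h, that is, the derivative n h of
    the trace vanishes.\<close>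
  have h0: "h z = 0" for z
  proof -
    have "h z = - (of_nat (n - 1) * h z)" using h[of "n - 1" z] sub[of "n - 2" z] n by (auto simp: numeral_2_eq_2 Suc_diff_Suc)
    hence "h z + of_nat (n - 1) * h z = 0" by (metis add.right_inverse add.commute)
    hence "of_nat (Suc (n - 1)) * h z = 0" by (simp add: distrib_right)
    thus ?thesis by (metis mult_eq_0_iff of_nat_neq_0)
  qed
  \<comment> \<open>Once the entries at distance d + 1 below the diagonal vanish, their equations
    equate neighbouring entries at distance d + 2. The first of these is 0, since its equation
    involves otherwise only an entry above the diagonal.\<close>
  have "\<forall>s z. s + Suc d < n \<longrightarrow> M (s + Suc d) s z = 0" if "Suc d < n" for d
    using that
  proof (induction d)
    case 0
    thus ?case using sub h0 by simp
  next
    case (Suc d)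
    have IH: "M (s + Suc d) s z = 0" if "s + Suc d < n" for s z using Suc that by simp
    show ?case
    proof (intro allI impI)
      fix s z assume "s + Suc (Suc d) < n"
      thus "M (s + Suc (Suc d)) s z = 0"
      proof (induction s)
        case 0
        hence "Suc d \<noteq> n - 1" "Suc d < n - 1" "Suc d < n" "0 < n" by linarith+
        thus ?case using zero[of "Suc d" 0 z] IH[of 0] upper[of "Suc d" "n - 1" z] by auto
      next
        case (Suc s)
        hence "Suc s + Suc d \<noteq> n - 1" "Suc s + Suc d < n" "Suc s < n" "s + Suc (Suc d) < n" by linarith+
        thus ?case using zero[of "Suc s + Suc d" "Suc s" z] IH[of "Suc s"] Suc.IH by auto
      qed
    qed
  qed
  from this[of "n - 2"] n have "M (n - 1) 0 z = 0" for z
    by (metis One_nat_def Suc_1 Suc_diff_Suc Suc_le_eq add_0 diff_Suc_1 diff_less lessI less_le_trans zero_less_numeral pos2 zero_less_one)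
  \<comment> \<open>At the corner the two terms with p cancel because the diagonal entries
    agree.\<close>
  from zero[of "n - 1" 0 z, OF _ _ this] n diag[of "n - 1" z] show ?thesis by auto
qed

lemma has_matrix_derivative_add:
  "has_matrix_derivative M M' z \<Longrightarrow> has_matrix_derivative N N' z \<Longrightarrow> has_matrix_derivative (\<lambda>u. M u + N u) (M' + N') z"
  by (simp add: has_matrix_derivative_def DERIV_add)

section \<open>Logarithmic derivatives along a tangent vector\<close>

context oper_setup
begin

definition "Xm c v j = td c v (T j) ** matrix_inv (T j c)"

text \<open>Differentiating T (i - 1) = T i S_i with stationary S_i leaves only the variation of T
  i, and S_i cancels from the logarithmic derivative.\<close>

lemma Xm_step:
  assumes i: "2 \<le> i" "i \<le> 2 * K" and S: "\<And>a b. deriv (\<lambda>t. Sm i (c + t *s v) $ a $ b) 0 = 0"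
  shows "Xm c v (i - 1) = Xm c v i"
proof -
  have i': "1 \<le> i" "i \<le> 2 * K" "i - 1 \<le> 2 * K" using i by auto
  have inv: "invertible (T i c)" "invertible (T (i - 1) c)" for c using G_inv T_le i' by blast+
  have rel: "T (i - 1) = (\<lambda>c. T i c ** Sm i c)"
    unfolding Sm_def by (simp add: fun_eq_iff matrix_mul_assoc matrix_inv_mult_right[OF inv(1)])
  have "td c v (Sm i) = 0" using S by (simp add: td_def vec_eq_iff)
  moreover have "td c v (T (i - 1)) = td c v (T i) ** Sm i c + T i c ** td c v (Sm i)"
    unfolding rel by (rule td_mult[OF G_holo[OF T_le[OF i'(2)]] Sm_holo[OF i'(1,2)]])
  ultimately have "td c v (T (i - 1)) = td c v (T i) ** Sm i c" by simp
  hence "Xm c v (i - 1) = td c v (T i) ** (matrix_inv (T i c) ** (T (i - 1) c ** matrix_inv (T (i - 1) c)))"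
    by (simp only: Xm_def Sm_def matrix_mul_assoc)
  thus ?thesis by (simp only: matrix_inv_mult_right[OF inv(2)] Xm_def matrix_mul_rid)
qed

lemma Xm_const:
  assumes S: "\<And>i a b. 2 \<le> i \<Longrightarrow> i \<le> 2 * K \<Longrightarrow> deriv (\<lambda>t. Sm i (c + t *s v) $ a $ b) 0 = 0"
  shows "1 \<le> j \<Longrightarrow> j \<le> 2 * K \<Longrightarrow> Xm c v j = Xm c v 1"
proof (induction j rule: dec_induct)
  case (step n)
  hence "Xm c v (Suc n - 1) = Xm c v (Suc n)" by (intro Xm_step S) simp_all
  thus ?case using step by simp
qed simp

text \<open>\<open>Nm\<close> is the logarithmic derivative, in the direction \<open>v\<close>, of a solution \<open>psi ** Z\<close> with
  \<open>X\<close> that of \<open>Z\<close>.\<close>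

definition "Nm c v X z = td c v (\<lambda>c. psi (c, z)) ** matrix_inv (psi (c, z)) + psi (c, z) ** X ** matrix_inv (psi (c, z))"
definition "dA c v z = td c v (\<lambda>c. oper_of_coeffs k (c :: 'm cvec) z :: 'n cmat)"

lemma psi_holo: "holo_on UNIV (\<lambda>q. psi (fst q, z) $ a $ b)"
  by (rule holo_on_fix_snd[OF psi(1), unfolded fst_conv])

lemma oper_holo: "holo_on UNIV (\<lambda>q. (oper_of_coeffs k (fst q :: 'm cvec) z :: 'n cmat) $ a $ b)"
  using holo_on_fix_snd[OF holo_on_oper] by simp

lemma td_psi_deriv: "has_matrix_derivative (\<lambda>z. td c v (\<lambda>c. psi (c, z)))
   (dA c v z ** psi (c, z) + oper_of_coeffs k c z ** td c v (\<lambda>c. psi (c, z))) z"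
proof -
  have "((\<lambda>z. deriv (\<lambda>t. psi (c + t *s v, z) $ a $ b) 0) has_field_derivative
      deriv (\<lambda>t. (oper_of_coeffs k (c + t *s v) z ** psi (c + t *s v, z)) $ a $ b) 0) (at z)" for a b
  proof -
    have "holo_on UNIV (\<lambda>q. (oper_of_coeffs k (fst q) (snd q) ** psi q) $ a $ b)"
      by (intro holo_on_matrix_mult holo_on_oper psi(1))
    from mixed_derivative[OF psi(1) this, of a b c v z] show ?thesis
      using psi(3) by (simp add: has_matrix_derivative_def)
  qed
  hence "has_matrix_derivative (\<lambda>z. td c v (\<lambda>c. psi (c, z))) (td c v (\<lambda>c. oper_of_coeffs k c z ** psi (c, z))) z"
    by (simp add: has_matrix_derivative_def td_def)
  thus ?thesis unfolding td_mult[OF oper_holo psi_holo] dA_def .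
qed

lemma Nm_deriv: "has_matrix_derivative (Nm c v X) (dA c v z + (oper_of_coeffs k c z ** Nm c v X z - Nm c v X z ** oper_of_coeffs k c z)) z"
proof -
  let ?A = "oper_of_coeffs k c z :: 'n cmat" and ?p = "psi (c, z)" and ?q = "td c v (\<lambda>c. psi (c, z))"
  define i where "i = matrix_inv (psi (c, z))"
  have pi: "?p ** i = mat 1" unfolding i_def by (rule matrix_inv_mult_right[OF psi(2)])
  have neg: "M ** (- N) = - (M ** N)" for M N :: "'n cmat"
    by (simp add: vec_eq_iff matrix_matrix_mult_def sum_negf)
  have "has_matrix_derivative (\<lambda>z. matrix_inv (psi (c, z))) (- (matrix_inv ?p ** (?A ** ?p) ** matrix_inv ?p)) z"
    by (rule has_matrix_derivative_inv[OF open_UNIV UNIV_I psi(3) psi(2)])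
  moreover have "i ** (?A ** ?p) ** i = i ** ?A" by (simp add: pi flip: matrix_mul_assoc)
  ultimately have inv: "has_matrix_derivative (\<lambda>z. matrix_inv (psi (c, z))) (- (i ** ?A)) z" by (simp only: i_def)
  have "has_matrix_derivative (\<lambda>z. (td c v (\<lambda>c. psi (c, z)) + psi (c, z) ** X) ** matrix_inv (psi (c, z)))
     ((dA c v z ** ?p + ?A ** ?q + (?A ** ?p ** X + ?p ** 0)) ** i + (?q + ?p ** X) ** (- (i ** ?A))) z"
    unfolding i_def
    by (rule has_matrix_derivative_mult[OF has_matrix_derivative_add[OF td_psi_deriv has_matrix_derivative_mult[OF psi(3) has_matrix_derivative_const]] inv[unfolded i_def]])
  moreover have "(dA c v z ** ?p + ?A ** ?q + (?A ** ?p ** X + ?p ** 0)) ** i + (?q + ?p ** X) ** (- (i ** ?A))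
     = dA c v z + (?A ** Nm c v X z - Nm c v X z ** ?A)"
    unfolding Nm_def i_def[symmetric] neg
    by (simp add: matrix_mult_add_left matrix_add_ldistrib matrix_mul_assoc pi flip: matrix_mul_assoc[of "dA c v z"])
  ultimately show ?thesis by (simp add: Nm_def[abs_def] matrix_mult_add_left)
qed

definition "Fd c v j w = td c v (\<lambda>c. normed c (usol (T j) c) w)"
definition "Ed c v w = (\<chi> i. deriv (\<lambda>t. Ef (c + t *s v) i w) 0)"

lemma usol_holo:
  assumes "j \<le> 2 * K"
  shows "holo_on UNIV (\<lambda>q. usol (T j) (fst q) w $ a $ b)"
  unfolding usol_def by (intro holo_on_matrix_mult G_holo T_le assms) (rule holo_on_fix_snd[OF holo_on_U, unfolded fst_conv])

lemma Ef_holo: "holo_on UNIV (\<lambda>q. Ef (fst q) i w)"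
  using holo_on_fix_snd[OF holo_on_Ef] by simp

lemma normed_holo:
  assumes "j \<le> 2 * K"
  shows "holo_on UNIV (\<lambda>q. normed (fst q) (usol (T j) (fst q)) w $ a $ b)"
  unfolding normed_def diag_mult_right vec_lambda_beta
  by (intro holo_on_mult holo_on_exp holo_on_minus Ef_holo usol_holo assms)

text \<open>The variation of the same solution is computed twice, from U T and from F exp E with F
  its normalised form. The result expresses the gauge conjugate of N through the variations of F and
  of the exponents, whose growth is known.\<close>

lemma log_derivative:
  assumes j: "1 \<le> j" "j \<le> 2 * K"
  shows "gauge k (exp w) ** Nm c v (Xm c v j) (exp w) ** ginv (exp w) ** normed c (usol (T j) c) w
     = Fd c v j w + normed c (usol (T j) c) w ** diag_mat (Ed c v w)"
proof -
  let ?g = "gauge k (exp w) :: 'n cmat" and ?p = "psi (c, exp w)" and ?i = "matrix_inv (psi (c, exp w))"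
  let ?tp = "td c v (\<lambda>c. psi (c, exp w))" and ?F = "normed c (usol (T j) c) w" and ?D = "diag_mat (\<chi> j. exp (- Ef c j w)) :: 'n cmat"
  have Tinv: "invertible (T j c)" by (rule G_inv[OF T_le[OF j(2)]])
  have us: "usol (T j) c w = ?g ** (psi (c, exp w) ** T j c)" for c
    by (simp add: usol_def U_def matrix_mul_assoc)
  have TX: "Xm c v j ** T j c = td c v (T j)"
    by (simp add: Xm_def matrix_inv_mult_left[OF Tinv] flip: matrix_mul_assoc)
  have pT: "holo_on UNIV (\<lambda>q. (psi (fst q, exp w) ** T j (fst q)) $ a $ b)" for a b
    by (intro holo_on_matrix_mult psi_holo G_holo T_le j)
  have gh: "holo_on UNIV (\<lambda>q :: 'm cvec \<times> complex. ?g $ a $ b)" for a b by (rule holo_on_const)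
  have "td c v (\<lambda>c. usol (T j) c w) = ?g ** (?tp ** T j c + ?p ** td c v (T j))"
    unfolding us td_mult[OF gh pT] td_mult[OF psi_holo G_holo[OF T_le[OF j(2)]]] td_const by simp
  also have "\<dots> = ?g ** Nm c v (Xm c v j) (exp w) ** (?p ** T j c)"
    unfolding Nm_def TX[symmetric]
    by (simp add: matrix_mult_add_left matrix_add_ldistrib matrix_inv_mult_left[OF psi(2)] flip: matrix_mul_assoc)
       (simp add: matrix_mul_assoc matrix_inv_mult_left[OF psi(2)] flip: matrix_mul_assoc[of _ "?i" "?p"])
  also have "\<dots> = ?g ** Nm c v (Xm c v j) (exp w) ** (ginv (exp w) ** ?g) ** (?p ** T j c)"
    by (simp add: gauge_inverse(3))
  also have "\<dots> = ?g ** Nm c v (Xm c v j) (exp w) ** ginv (exp w) ** usol (T j) c w"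
    unfolding us by (simp only: matrix_mul_assoc)
  finally have 1: "td c v (\<lambda>c. usol (T j) c w) = ?g ** Nm c v (Xm c v j) (exp w) ** ginv (exp w) ** usol (T j) c w" .
  have Eh: "holo_on UNIV (\<lambda>q. Em (fst q) w $ a $ b)" for a b
    unfolding Em_def diag_mat_def vec_lambda_beta by (intro holo_on_if holo_on_exp Ef_holo holo_on_const)
  have tE: "td c v (\<lambda>c. Em c w) = diag_mat (Ed c v w) ** Em c w"
  proof (rule td_eqI[OF Eh])
    have "((\<lambda>t. exp (Ef (c + t *s v) i w)) has_field_derivative exp (Ef c i w) * Ed c v w $ i) (at 0)" for i
    proof -
      have "((\<lambda>t. Ef (c + t *s v) i w) has_field_derivative Ed c v w $ i) (at 0)"
        unfolding Ed_def vec_lambda_beta by (rule holomorphic_derivI[OF holo_line[OF Ef_holo] open_UNIV UNIV_I])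
      from DERIV_chain2[OF DERIV_exp this] show ?thesis by simp
    qed
    thus "has_matrix_derivative (\<lambda>t. Em (c + t *s v) w) (diag_mat (Ed c v w) ** Em c w) 0"
      unfolding has_matrix_derivative_def Em_def diag_mult_left by (auto simp: diag_mat_def mult.commute)
  qed
  have "(\<lambda>c. usol (T j) c w) = (\<lambda>c. normed c (usol (T j) c) w ** Em c w)" by (simp only: normed_Em)
  hence 2: "td c v (\<lambda>c. usol (T j) c w) = Fd c v j w ** Em c w + ?F ** (diag_mat (Ed c v w) ** Em c w)"
    using td_mult[OF normed_holo[OF j(2)] Eh, of c v w] by (simp only: Fd_def tE)
  have ED: "Em c w ** ?D = mat 1" by (simp add: Em_def diag_mat_mult diag_mat_one flip: exp_add)
  have "?g ** Nm c v (Xm c v j) (exp w) ** ginv (exp w) ** ?F = td c v (\<lambda>c. usol (T j) c w) ** ?D"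
    unfolding 1 normed_def by (simp only: matrix_mul_assoc)
  also have "\<dots> = Fd c v j w ** (Em c w ** ?D) + ?F ** diag_mat (Ed c v w) ** (Em c w ** ?D)"
    unfolding 2 by (simp only: matrix_mult_add_left matrix_mul_assoc)
  finally show ?thesis unfolding ED by simp
qed

end

lemma sum_eq_single:
  fixes f :: "'a::finite \<Rightarrow> 'b::comm_monoid_add"
  assumes "\<And>x. x \<noteq> x0 \<Longrightarrow> f x = 0"
  shows "(\<Sum>x\<in>UNIV. f x) = f x0"
  using assms by (subst sum.mono_neutral_right[of _ "{x0}"]) auto

context oper_setup
begin

text \<open>Cauchy's inequality in the parameter t turns the uniform estimate into one for the
  derivative. So the variation of F stays bounded, being close to that of the truncated formal
  solution, and the factor z^(-k) with k >= 1 sends it to 0.\<close>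

lemma Fd_limit:
  assumes j: "1 \<le> j" "j \<le> 2 * K"
  shows "((\<lambda>w. exp (- w) ^ k * Fd c v j w $ a $ b) \<longlongrightarrow> 0) (closed_sector_filter (tau j - pi / (2 * real K)) (tau j + pi / (2 * real K)))"
proof -
  obtain KC \<rho> where KC: "KC \<ge> 0" and est: "\<And>c' w. c' \<in> ball c 1 \<Longrightarrow> Im w \<in> {tau j - pi / (2 * real K)..tau j + pi / (2 * real K)} \<Longrightarrow> Re w \<ge> \<rho> \<Longrightarrow>
      norm (normed c' (usol (T j) c') w $ a $ b - YN (NN 1) c' (exp (- w)) $ a $ b) \<le> KC * norm (exp (- w)) ^ (K * 1)"
    using T_estimate[OF j order_refl, of c] unfolding estimate_def by blast
  \<comment> \<open>Keeps c + t v in the unit ball of the uniform estimate for |t| <= r; the summand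
    1 covers v = 0.\<close>
  define r where "r = 1 / (2 * (norm v + 1))"
  have r: "r > 0" by (simp add: r_def add_nonneg_pos)
  have ball: "c + t *s v \<in> ball c 1" if "norm t \<le> r" for t
  proof -
    have "norm (t *s v) = norm t * norm v"
      by (simp add: norm_vec_def L2_set_def norm_mult power_mult_distrib real_sqrt_mult sum_distrib_left[symmetric])
    also have "\<dots> \<le> r * norm v" using that by (rule mult_right_mono) simp
    also have "\<dots> < 1" by (simp add: r_def divide_simps add_nonneg_pos)
    finally show ?thesis by (simp add: dist_norm)
  qed
  define y' where "y' = (\<lambda>l. deriv (\<lambda>t. fps_nth (fY (c + t *s v) $ a $ b) l) 0)"
  define A where "A = (\<lambda>w. Fd c v j w $ a $ b - (\<Sum>l\<le>NN 1. y' l * exp (- w) ^ l))"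
  have Abound: "norm (A w) \<le> KC * norm (exp (- w)) ^ (K * 1) / r"
    if w: "Im w \<in> {tau j - pi / (2 * real K)..tau j + pi / (2 * real K)}" "Re w \<ge> \<rho>" for w
  proof -
    define h where "h = (\<lambda>t. normed (c + t *s v) (usol (T j) (c + t *s v)) w $ a $ b)"
    define y where "y = (\<lambda>t. YN (NN 1) (c + t *s v) (exp (- w)) $ a $ b)"
    have hh: "h holomorphic_on UNIV" unfolding h_def by (rule holo_line[OF normed_holo[OF j(2)]])
    have "holo_on UNIV (\<lambda>q. YN (NN 1) (fst q) (exp (- w)) $ a $ b)"
      using holo_on_fix_snd[OF holo_on_YN] by simp
    hence yh: "y holomorphic_on UNIV" unfolding y_def by (rule holo_line)
    have "(y has_field_derivative (\<Sum>l\<le>NN 1. y' l * exp (- w) ^ l)) (at 0)"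
      unfolding y_def YN_def vec_lambda_beta yp_eval y'_def
      by (intro DERIV_sum DERIV_cmult_right holomorphic_derivI[OF holo_line[OF holo_on_fY] open_UNIV UNIV_I])
    moreover have "(h has_field_derivative Fd c v j w $ a $ b) (at 0)"
      using holomorphic_derivI[OF hh open_UNIV UNIV_I] by (simp add: Fd_def td_def h_def)
    ultimately have "((\<lambda>t. h t - y t) has_field_derivative A w) (at 0)" unfolding A_def by (intro DERIV_diff)
    hence "A w = (deriv ^^ 1) (\<lambda>t. h t - y t) 0" by (simp add: DERIV_imp_deriv)
    also have "norm \<dots> \<le> fact 1 * (KC * norm (exp (- w)) ^ (K * 1)) / r ^ 1"
    proof (rule Cauchy_inequality)
      show "(\<lambda>t. h t - y t) holomorphic_on ball 0 r" "continuous_on (cball 0 r) (\<lambda>t. h t - y t)"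
        using hh yh by (auto intro!: holomorphic_intros holomorphic_on_imp_continuous_on intro: holomorphic_on_subset)
      fix t :: complex assume "norm (0 - t) = r"
      hence "c + t *s v \<in> ball c 1" by (intro ball) simp
      from est[OF this w] show "norm (h t - y t) \<le> KC * norm (exp (- w)) ^ (K * 1)" unfolding h_def y_def .
    qed (rule r)
    finally show ?thesis by simp
  qed
  have "(A \<longlongrightarrow> 0) (closed_sector_filter (tau j - pi / (2 * real K)) (tau j + pi / (2 * real K)))"
  proof (rule Lim_null_comparison)
    show "\<forall>\<^sub>F w in closed_sector_filter (tau j - pi / (2 * real K)) (tau j + pi / (2 * real K)). norm (A w) \<le> KC * norm (exp (- w)) ^ (K * 1) / r"
      unfolding eventually_closed_sector using Abound by blast
    have "((\<lambda>w. KC * norm (exp (- w) :: complex) ^ (K * 1) / r) \<longlongrightarrow> KC * norm (0::complex) ^ (K * 1) / r) (closed_sector_filter (tau j - pi / (2 * real K)) (tau j + pi / (2 * real K)))"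
      using r by (intro tendsto_intros tendsto_exp_minus_closed_sector) simp
    thus "((\<lambda>w. KC * norm (exp (- w) :: complex) ^ (K * 1) / r) \<longlongrightarrow> 0) (closed_sector_filter (tau j - pi / (2 * real K)) (tau j + pi / (2 * real K)))" by simp
  qed
  hence "((\<lambda>w. exp (- w) ^ k * (A w + (\<Sum>l\<le>NN 1. y' l * exp (- w) ^ l))) \<longlongrightarrow> 0 ^ k * (0 + (\<Sum>l\<le>NN 1. y' l * 0 ^ l))) (closed_sector_filter (tau j - pi / (2 * real K)) (tau j + pi / (2 * real K)))"
    by (intro tendsto_intros tendsto_exp_minus_closed_sector)
  thus ?thesis using k1 by (simp add: A_def power_0_left)
qed

text \<open>The two leading coefficients of the exponent do not depend on the oper.\<close>

lemma Ed_limit: "((\<lambda>w. exp (- w) ^ k * Ed c v w $ i) \<longlongrightarrow> 0) (closed_sector_filter \<alpha> \<beta>)"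
proof -
  let ?F = "closed_sector_filter \<alpha> \<beta>"
  define q' where "q' = (\<lambda>l. deriv (\<lambda>t. coeff (fQ (c + t *s v) $ i) l) 0)"
  define l' where "l' = deriv (\<lambda>t. fL (c + t *s v) $ i) 0"
  have "((\<lambda>t. Ef (c + t *s v) i w) has_field_derivative (\<Sum>l\<le>K. q' l * exp w ^ l) + l' * w) (at 0)" for w
    unfolding Ef_def fQ_eval q'_def l'_def
    by (intro DERIV_add DERIV_sum DERIV_cmult_right holomorphic_derivI[OF holo_line[OF holo_on_fQ] open_UNIV UNIV_I]
        holomorphic_derivI[OF holo_line[OF holo_on_fL] open_UNIV UNIV_I])
  hence Ed: "Ed c v w $ i = (\<Sum>l\<le>K. q' l * exp w ^ l) + l' * w" for w by (simp add: Ed_def DERIV_imp_deriv)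
  have top: "q' K = 0" "q' k = 0" using fQ_top[of _ i] by (simp_all add: q'_def)
  have pow: "exp (- w) ^ k * exp w ^ l = exp (- w) ^ (k - l)" if "l \<le> k" for l and w :: complex
  proof -
    have "exp (- w) ^ l * exp w ^ l = 1" by (simp flip: power_mult_distrib exp_add)
    moreover have "exp (- w) ^ k = exp (- w) ^ (k - l) * exp (- w) ^ l" using that by (simp flip: power_add)
    ultimately show ?thesis by (simp only: mult.assoc) simp
  qed
  have eq: "exp (- w) ^ k * Ed c v w $ i = (\<Sum>l<k. q' l * exp (- w) ^ (k - l)) + l' * ((w * exp (- w)) * exp (- w) ^ (k - 1))" for w
  proof -
    have "(\<Sum>l\<le>K. q' l * exp w ^ l) = (\<Sum>l<k. q' l * exp w ^ l)"
      using top by (simp add: lessThan_Suc_atMost[symmetric])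
    moreover have "exp (- w) ^ k * (\<Sum>l<k. q' l * exp w ^ l) = (\<Sum>l<k. q' l * exp (- w) ^ (k - l))"
      unfolding sum_distrib_left by (intro sum.cong refl) (simp add: pow mult.left_commute)
    moreover have "exp (- w) ^ k = exp (- w) * exp (- w) ^ (k - 1)" using k1 by (simp flip: power_Suc)
    ultimately show ?thesis unfolding Ed distrib_left by (simp add: mult_ac)
  qed
  have "((\<lambda>w. (\<Sum>l<k. q' l * exp (- w) ^ (k - l)) + l' * ((w * exp (- w)) * exp (- w) ^ (k - 1)))
     \<longlongrightarrow> (\<Sum>l<k. q' l * 0 ^ (k - l)) + l' * (0 * 0 ^ (k - 1))) ?F"
    by (intro tendsto_intros tendsto_exp_minus_closed_sector tendsto_w_exp_minus_closed_sector)
  moreover have "(\<Sum>l<k. q' l * 0 ^ (k - l)) = 0" by (intro sum.neutral) auto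
  ultimately show ?thesis unfolding eq by simp
qed

text \<open>F tends to the invertible matrix \<open>f0\<close>, so it can be divided out of the
  identity for the logarithmic derivative.\<close>

lemma growth_limit:
  assumes j: "1 \<le> j" "j \<le> 2 * K"
  shows "((\<lambda>w. exp (- w) ^ k * (gauge k (exp w) ** Nm c v (Xm c v j) (exp w) ** ginv (exp w)) $ a $ b) \<longlongrightarrow> 0) (closed_sector_filter (tau j - pi / (2 * real K)) (tau j + pi / (2 * real K)))"
proof -
  define F where "F = (\<lambda>w. normed c (usol (T j) c) w)"
  define M where "M = (\<lambda>w. gauge k (exp w) ** Nm c v (Xm c v j) (exp w) ** ginv (exp w) :: 'n cmat)"
  have rel: "M w ** F w = Fd c v j w + F w ** diag_mat (Ed c v w)" for w
    unfolding M_def F_def by (rule log_derivative[OF j])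
  have Flim: "((\<lambda>w. F w $ a $ b) \<longlongrightarrow> f0 $ a $ b) (closed_sector_filter (tau j - pi / (2 * real K)) (tau j + pi / (2 * real K)))" for a b
    unfolding F_def by (rule estimate_tendsto[OF T_estimate[OF j order_refl, of c] _ order_refl]) simp
  have iF: "((\<lambda>w. matrix_inv (F w) $ a $ b) \<longlongrightarrow> fi $ a $ b) (closed_sector_filter (tau j - pi / (2 * real K)) (tau j + pi / (2 * real K)))" for a b
    by (rule tendsto_matrix_inv(1)[OF Flim inv_f0])
  have "((\<lambda>w. \<Sum>d\<in>UNIV. (exp (- w) ^ k * Fd c v j w $ a $ d + F w $ a $ d * (exp (- w) ^ k * Ed c v w $ d)) * matrix_inv (F w) $ d $ b)
     \<longlongrightarrow> (\<Sum>d\<in>UNIV. (0 + f0 $ a $ d * 0) * fi $ d $ b)) (closed_sector_filter (tau j - pi / (2 * real K)) (tau j + pi / (2 * real K)))"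
    by (intro tendsto_intros Fd_limit j Ed_limit Flim iF)
  hence lim: "((\<lambda>w. \<Sum>d\<in>UNIV. (exp (- w) ^ k * Fd c v j w $ a $ d + F w $ a $ d * (exp (- w) ^ k * Ed c v w $ d)) * matrix_inv (F w) $ d $ b) \<longlongrightarrow> 0) (closed_sector_filter (tau j - pi / (2 * real K)) (tau j + pi / (2 * real K)))"
    by simp
  have "((\<lambda>w. exp (- w) ^ k * M w $ a $ b) \<longlongrightarrow> 0) (closed_sector_filter (tau j - pi / (2 * real K)) (tau j + pi / (2 * real K)))"
  proof (rule Lim_transform_eventually[OF lim])
    show "\<forall>\<^sub>F w in closed_sector_filter (tau j - pi / (2 * real K)) (tau j + pi / (2 * real K)). (\<Sum>d\<in>UNIV. (exp (- w) ^ k * Fd c v j w $ a $ d + F w $ a $ d * (exp (- w) ^ k * Ed c v w $ d)) * matrix_inv (F w) $ d $ b)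
        = exp (- w) ^ k * M w $ a $ b"
      using tendsto_matrix_inv(2)[OF Flim inv_f0]
    proof eventually_elim
      case (elim w)
      have "M w = M w ** F w ** matrix_inv (F w)"
        by (simp add: matrix_inv_mult_right[OF elim] flip: matrix_mul_assoc)
      hence "M w $ a $ b = ((Fd c v j w + F w ** diag_mat (Ed c v w)) ** matrix_inv (F w)) $ a $ b" by (simp only: rel)
      also have "\<dots> = (\<Sum>d\<in>UNIV. (Fd c v j w $ a $ d + F w $ a $ d * Ed c v w $ d) * matrix_inv (F w) $ d $ b)"
        by (simp only: matrix_matrix_mult_def[of _ "matrix_inv (F w)"] vec_lambda_beta vector_add_component diag_mult_right)
      finally show ?case by (simp add: sum_distrib_left algebra_simps)
    qed
  qed
  thus ?thesis unfolding M_def .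
qed

lemma tau_cover: "tau 1 - pi / (2 * real K) \<le> x \<Longrightarrow> x \<le> tau (Suc m) + pi / (2 * real K) \<Longrightarrow>
   \<exists>j. 1 \<le> j \<and> j \<le> Suc m \<and> tau j - pi / (2 * real K) \<le> x \<and> x \<le> tau j + pi / (2 * real K)"
proof (induction m)
  case 0 thus ?case by auto
next
  case (Suc m)
  show ?case
  proof (cases "x \<le> tau (Suc m) + pi / (2 * real K)")
    case True
    thus ?thesis using Suc by (metis le_SucI)
  next
    case False
    define \<delta> where "\<delta> = pi / (2 * real K)"
    have "tau (Suc (Suc m)) = tau (Suc m) + 2 * \<delta>" unfolding tau_Suc[of "Suc m"] by (simp add: \<delta>_def del: of_nat_Suc)
    hence "tau (Suc (Suc m)) - \<delta> \<le> x" using False unfolding \<delta>_def[symmetric] by linarith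
    thus ?thesis using Suc.prems unfolding \<delta>_def[symmetric] by (intro exI[of _ "Suc (Suc m)"]) auto
  qed
qed

text \<open>The 2 K closed sectors of width pi / K around \<open>tau 1\<close>, ...,
  \<open>tau (2 * K)\<close> cover a full turn, so every nonzero z has a logarithm in one of
  them.\<close>

lemma log_in_sectors:
  assumes "z \<noteq> 0"
  obtains w j where "exp w = z" "Re w = ln (norm z)" "1 \<le> j" "j \<le> 2 * K"
    "Im w \<in> {tau j - pi / (2 * real K)..tau j + pi / (2 * real K)}"
proof -
  define \<delta> where "\<delta> = pi / (2 * real K)"
  define s where "s = tau 1 - \<delta>"
  define u where "u = z * cis (- s)"
  define w where "w = Complex (ln (norm z)) (s + Arg2pi u)"
  have nu: "norm u = norm z" by (simp add: u_def norm_mult)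
  have "exp w = of_real (norm z) * cis (s + Arg2pi u)"
    using assms by (simp add: w_def exp_eq_polar)
  also have "\<dots> = (of_real (norm u) * exp (\<i> * of_real (Arg2pi u))) * cis s"
    unfolding nu cis_conv_exp[symmetric] by (simp add: cis_mult mult_ac add.commute)
  also have "\<dots> = z" unfolding Arg2pi_eq[of u, symmetric] by (simp add: u_def cis_mult mult.assoc)
  finally have ew: "exp w = z" .
  have "tau (2 * K) + \<delta> = tau 1 - \<delta> + 2 * pi"
  proof -
    have "tau (2 * K) = tau 0 + 2 * pi" using tau_add[of 0] by simp
    moreover have "tau 1 = tau 0 + 2 * \<delta>" using tau_Suc[of 0] by (simp add: \<delta>_def del: of_nat_Suc)
    ultimately show ?thesis by linarith
  qed
  hence "tau 1 - \<delta> \<le> Im w" "Im w \<le> tau (Suc (2 * K - 1)) + \<delta>"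
    using Arg2pi_ge_0[of u] Arg2pi_lt_2pi[of u] by (simp_all add: w_def s_def)
  from tau_cover[OF this[unfolded \<delta>_def]] obtain j where "1 \<le> j" "j \<le> Suc (2 * K - 1)" "tau j - pi / (2 * real K) \<le> Im w" "Im w \<le> tau j + pi / (2 * real K)"
    by blast
  thus thesis by (intro that[OF ew]) (simp_all add: w_def)
qed

text \<open>Conjugation by the gauge multiplies the entry (a, b) by z to the power (pos b - pos a)
  k, which is at least k above the diagonal. The bound o(z^k) therefore makes that entry of N tend
  to 0 at infinity, and it is entire.\<close>

lemma Nm_lower_triangular:
  assumes X: "\<And>j. 1 \<le> j \<Longrightarrow> j \<le> 2 * K \<Longrightarrow> Xm c v j = X" and ab: "pos a < pos b"
  shows "Nm c v X z $ a $ b = 0"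
proof -
  define N where "N = (\<lambda>z. Nm c v X z $ a $ b)"
  have "N holomorphic_on UNIV"
    using Nm_deriv[of c v X] unfolding has_matrix_derivative_def N_def by (auto simp: holomorphic_on_open)
  moreover have "(N \<longlongrightarrow> 0) at_infinity"
    unfolding Lim_at_infinity
  proof (intro allI impI)
    fix e :: real assume e: "e > 0"
    have "\<exists>\<rho>. \<forall>w. Re w \<ge> \<rho> \<longrightarrow> Im w \<in> {tau j - pi / (2 * real K)..tau j + pi / (2 * real K)} \<longrightarrow>
       norm (exp (- w) ^ k * (gauge k (exp w) ** Nm c v X (exp w) ** ginv (exp w)) $ a $ b) < e" if "1 \<le> j" "j \<le> 2 * K" for j
      using tendstoD[OF growth_limit[OF that, of c v a b] e] unfolding eventually_closed_sector X[OF that] by simp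
    hence "\<forall>j. \<exists>\<rho>. 1 \<le> j \<and> j \<le> 2 * K \<longrightarrow> (\<forall>w. Re w \<ge> \<rho> \<longrightarrow> Im w \<in> {tau j - pi / (2 * real K)..tau j + pi / (2 * real K)} \<longrightarrow>
       norm (exp (- w) ^ k * (gauge k (exp w) ** Nm c v X (exp w) ** ginv (exp w)) $ a $ b) < e)" by blast
    from choice[OF this] obtain \<rho> where \<rho>: "\<And>j w. 1 \<le> j \<Longrightarrow> j \<le> 2 * K \<Longrightarrow> Re w \<ge> \<rho> j \<Longrightarrow> Im w \<in> {tau j - pi / (2 * real K)..tau j + pi / (2 * real K)} \<Longrightarrow>
       norm (exp (- w) ^ k * (gauge k (exp w) ** Nm c v X (exp w) ** ginv (exp w)) $ a $ b) < e" by blast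
    define R where "R = Max (insert 0 (\<rho> ` {..2 * K}))"
    have R: "0 \<le> R" "j \<le> 2 * K \<Longrightarrow> \<rho> j \<le> R" for j unfolding R_def by (rule Max_ge; simp)+
    show "\<exists>B. \<forall>z. B \<le> norm z \<longrightarrow> dist (N z) 0 < e"
    proof (intro exI[of _ "exp R"] allI impI)
      fix z :: complex assume z: "exp R \<le> norm z"
      hence z1: "norm z \<ge> 1" using R(1) by (meson one_le_exp_iff order_trans)
      hence znz: "z \<noteq> 0" by auto
      obtain w j where w: "exp w = z" "Re w = ln (norm z)" "1 \<le> j" "j \<le> 2 * K"
        "Im w \<in> {tau j - pi / (2 * real K)..tau j + pi / (2 * real K)}"
        by (rule log_in_sectors[OF znz]) (rule that)
      have "R \<le> ln (norm z)" using z znz by (simp add: ln_ge_iff)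
      hence "\<rho> j \<le> Re w" using R(2)[OF w(4)] unfolding w(2) by linarith
      from \<rho>[OF w(3,4) this w(5)] have b: "norm (exp (- w) ^ k * (gauge k z ** Nm c v X z ** ginv z) $ a $ b) < e" unfolding w(1) .
      \<comment> \<open>The surplus of the gauge exponent over z^k; being nonnegative, it only
        strengthens the bound for |z| >= 1.\<close>
      define l where "l = (pos b - pos a - 1) * k"
      have "CARD('n) - pos a = (CARD('n) - pos b) + Suc (pos b - pos a - 1)" using ab pos_less[of b] by linarith
      hence ex: "(CARD('n) - pos a) * k = (CARD('n) - pos b) * k + k + l" by (simp only: l_def distrib_right mult_Suc add.assoc)
      have "exp (- w) ^ k * (gauge k z ** Nm c v X z ** ginv z) $ a $ b = z ^ l * N z"
        unfolding ginv_def diag_mult_right unfolding gauge_def diag_mult_left N_def vec_lambda_beta ex power_add exp_minus w(1)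
        using znz by (simp add: field_simps)
      moreover have "norm (N z) \<le> norm (z ^ l * N z)"
        using mult_right_mono[OF one_le_power[OF z1, of l], of "norm (N z)"] by (simp add: norm_mult norm_power)
      ultimately show "dist (N z) 0 < e" using b by simp
    qed
  qed
  ultimately have "N z = 0" by (rule Liouville_weak_0)
  thus ?thesis by (simp add: N_def)
qed

section \<open>Injectivity of the differential\<close>

lemma dA_nth: "dA c v z $ a $ b = (if pos a = CARD('n) - 1 \<and> pos b = 0 then \<Sum>j\<in>UNIV. v $ j * z ^ pos j else 0)"
proof -
  have "((\<lambda>t. (oper_of_coeffs k (c + t *s v) z :: 'n cmat) $ a $ b) has_field_derivative
     (if pos a = CARD('n) - 1 \<and> pos b = 0 then \<Sum>j\<in>UNIV. v $ j * z ^ pos j else 0)) (at 0)"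
  proof (cases "pos a = CARD('n) - 1 \<and> pos b = 0")
    case True
    thus ?thesis unfolding oper_of_coeffs_def oper_matrix_def vec_lambda_beta poly_add poly_sum poly_monom
      by (auto intro!: derivative_eq_intros DERIV_sum sum.cong)
  next
    case False
    hence "(\<lambda>t. (oper_of_coeffs k (c + t *s v) z :: 'n cmat) $ a $ b) = (\<lambda>t. if pos b = pos a + 1 then 1 else 0)"
      unfolding oper_of_coeffs_def oper_matrix_def vec_lambda_beta by (simp only: if_False)
    thus ?thesis unfolding if_not_P[OF False] by (simp only: DERIV_const)
  qed
  thus ?thesis by (simp add: dA_def td_def DERIV_imp_deriv)
qed

text \<open>S_2, ..., S_2K link the solutions T 1, ..., T (2 K), whose sectors already cover a full
  turn; hence one and the same N is controlled in all directions.\<close>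

theorem stokes_immersion:
  assumes S: "\<And>i a b. 2 \<le> i \<Longrightarrow> i \<le> 2 * K \<Longrightarrow> deriv (\<lambda>t. Sm i (c + t *s v) $ a $ b) 0 = 0"
  shows "v = 0"
proof -
  define X where "X = Xm c v 1"
  define N where "N = Nm c v X"
  \<comment> \<open>Inverse of \<open>pos\<close>, which translates the matrix equation into one
    indexed by natural numbers.\<close>
  define e where "e = (\<lambda>r. SOME a :: 'n. pos a = r)"
  have e: "pos (e r) = r" if "r < CARD('n)" for r
    unfolding e_def by (rule someI_ex[OF pos_surj[OF that]])
  have ep: "e (pos a) = a" for a using e[OF pos_less, of a] by (simp add: pos_inj)
  have UN: "(UNIV :: 'n set) = e ` {..<CARD('n)}" using ep pos_less by (metis UNIV_eq_I image_eqI lessThan_iff)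
  define p where "p = (\<lambda>z. poly (monom 1 (k * CARD('n)) + (\<Sum>j\<in>UNIV. monom (c $ j) (pos j))) z)"
  define q where "q = (\<lambda>z. \<Sum>j\<in>UNIV. v $ j * z ^ pos j)"
  have A: "(oper_of_coeffs k c z :: 'n cmat) $ a $ b = (if pos b = pos a + 1 then 1 else if pos a = CARD('n) - 1 \<and> pos b = 0 then p z else 0)" for z a b
    by (simp add: oper_of_coeffs_def oper_matrix_def p_def)
  have n0: "0 < CARD('n)" "CARD('n) - 1 < CARD('n)" using n2 by auto
  have left: "(oper_of_coeffs k c z ** M) $ e r $ b = (if r = CARD('n) - 1 then p z * M $ e 0 $ b else M $ e (r + 1) $ b)"
    if r: "r < CARD('n)" for r b z and M :: "'n cmat"
  proof -
    define s where "s = (if r = CARD('n) - 1 then 0 else r + 1)"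
    have s: "s < CARD('n)" using r n0 by (auto simp: s_def)
    have "(oper_of_coeffs k c z :: 'n cmat) $ e r $ x = 0" if "x \<noteq> e s" for x
    proof -
      have "pos x \<noteq> s" using that ep by metis
      thus ?thesis using pos_less[of x] r by (auto simp: A e s_def split: if_splits)
    qed
    hence "(oper_of_coeffs k c z ** M) $ e r $ b = (oper_of_coeffs k c z :: 'n cmat) $ e r $ e s * M $ e s $ b"
      unfolding matrix_matrix_mult_def vec_lambda_beta by (intro sum_eq_single) simp
    thus ?thesis using r n0 s by (auto simp: A e s_def)
  qed
  have right: "(M ** oper_of_coeffs k c z) $ a $ e s = (if s = 0 then p z * M $ a $ e (CARD('n) - 1) else M $ a $ e (s - 1))"
    if s: "s < CARD('n)" for s a z and M :: "'n cmat"
  proof -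
    define r where "r = (if s = 0 then CARD('n) - 1 else s - 1)"
    have r: "r < CARD('n)" using s n0 by (auto simp: r_def)
    have "(oper_of_coeffs k c z :: 'n cmat) $ x $ e s = 0" if "x \<noteq> e r" for x
    proof -
      have "pos x \<noteq> r" using that ep by metis
      thus ?thesis using pos_less[of x] s by (auto simp: A e r_def split: if_splits)
    qed
    hence "(M ** oper_of_coeffs k c z) $ a $ e s = M $ a $ e r * (oper_of_coeffs k c z :: 'n cmat) $ e r $ e s"
      unfolding matrix_matrix_mult_def vec_lambda_beta by (intro sum_eq_single) simp
    thus ?thesis using s n0 r n2 by (auto simp: A e r_def mult.commute)
  qed
  have q0: "q z = 0" for z
  proof (rule commutator_system[of "CARD('n)" "\<lambda>r s z. N z $ e r $ e s" q p])
    show "2 \<le> CARD('n)" by (rule n2)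
    show "N z $ e r $ e s = 0" if "r < s" "s < CARD('n)" for r s z
      unfolding N_def
    proof (rule Nm_lower_triangular)
      show "Xm c v j = X" if "1 \<le> j" "j \<le> 2 * K" for j unfolding X_def by (rule Xm_const[OF S that])
      show "pos (e r) < pos (e s)" using that by (simp add: e)
    qed
    fix r s z assume rs: "r < CARD('n)" "s < CARD('n)"
    have "((\<lambda>z. N z $ e r $ e s) has_field_derivative
       (dA c v z + (oper_of_coeffs k c z ** N z - N z ** oper_of_coeffs k c z)) $ e r $ e s) (at z)"
      using Nm_deriv[of c v X z] unfolding has_matrix_derivative_def N_def by blast
    thus "((\<lambda>z. N z $ e r $ e s) has_field_derivative
       ((if r = CARD('n) - 1 \<and> s = 0 then q z else 0) + (if r = CARD('n) - 1 then p z * N z $ e 0 $ e s else N z $ e (r + 1) $ e s)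
         - (if s = 0 then p z * N z $ e r $ e (CARD('n) - 1) else N z $ e r $ e (s - 1)))) (at z)"
      unfolding vector_add_component vector_minus_component left[OF rs(1)] right[OF rs(2)] dA_nth e[OF rs(1)] e[OF rs(2)] q_def
      by (simp only: add_diff_eq)
  qed
  define Q where "Q = (\<Sum>j\<in>UNIV. monom (v $ j) (pos j))"
  have "poly Q z = 0" for z using q0[of z] by (simp add: Q_def q_def poly_sum poly_monom)
  hence "Q = 0" using poly_all_0_iff_0 by blast
  have "v $ j = 0" for j
  proof -
    have "coeff Q (pos j) = v $ j"
      unfolding Q_def coeff_sum by (subst sum_eq_single[of j]) (auto simp: pos_inj)
    thus ?thesis using \<open>Q = 0\<close> by simp
  qed
  thus ?thesis by (simp add: vec_eq_iff)
qed

theorem monodromy_immersion: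
  "holomorphic_immersion_into {1..2 * k + 2} (\<lambda>c :: 'm cvec. monodromy_map k f0 lam (oper_of_coeffs k c)) (stokes_space k)"
  unfolding holomorphic_immersion_into_def
proof (intro conjI allI)
  show "range (\<lambda>c :: 'm cvec. monodromy_map k f0 lam (oper_of_coeffs k c)) \<subseteq> stokes_space k"
    using monodromy_in_stokes_space by auto
  fix c :: "'m cvec"
  obtain \<sigma> where \<sigma>: "bij \<sigma>" "stokes_perm k f0 lam = (\<chi> i j. if i = \<sigma> j then 1 else 0)"
    by (rule stokes_perm) (rule that)
  \<comment> \<open>Conjugation by the permutation matrix only relabels entries, so differentials
    can be tested on the unpermuted Stokes matrices.\<close>
  have entry: "monodromy_map k f0 lam (oper_of_coeffs k x) i $ a $ b = Sm i x $ \<sigma> a $ \<sigma> b" if "i \<in> {1..2 * k + 2}" for x :: "'m cvec" and i a b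
    using that stokes_matrix_Sm[OF that, of x] by (simp add: monodromy_map_def permutation_conj(2)[OF \<sigma>])
  define D where "D = (\<lambda>v i. (\<chi> a b. deriv (\<lambda>t. Sm i (c + t *s v) $ \<sigma> a $ \<sigma> b) 0) :: 'n cmat)"
  show "\<exists>D :: 'm cvec \<Rightarrow> nat \<Rightarrow> 'n cmat.
        (\<forall>i\<in>{1..2 * k + 2}. \<forall>a b. has_holomorphic_derivative (\<lambda>x. monodromy_map k f0 lam (oper_of_coeffs k x) i $ a $ b) (\<lambda>v. D v i $ a $ b) c) \<and>
        (\<forall>v. (\<forall>i\<in>{1..2 * k + 2}. D v i = 0) \<longrightarrow> v = 0)"
  proof (intro exI[of _ D] conjI ballI allI impI)
    fix i a b assume i: "i \<in> {1..2 * k + 2}"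
    show "has_holomorphic_derivative (\<lambda>x. monodromy_map k f0 lam (oper_of_coeffs k x) i $ a $ b) (\<lambda>v. D v i $ a $ b) c"
      unfolding entry[OF i] D_def vec_lambda_beta
      using i by (intro holo_on_imp_has_holomorphic_derivative Sm_holo) auto
  next
    fix v assume D0: "\<forall>i\<in>{1..2 * k + 2}. D v i = 0"
    show "v = 0"
    proof (rule stokes_immersion)
      fix i a b assume "2 \<le> i" "i \<le> 2 * K"
      hence "D v i $ inv \<sigma> a $ inv \<sigma> b = 0" using D0 by simp
      thus "deriv (\<lambda>t. Sm i (c + t *s v) $ a $ b) 0 = 0"
        using \<sigma>(1) by (simp add: D_def bij_is_surj surj_f_inv_f)
    qed
  qed
qed

end

theorem theorem1p1:
  fixes k :: nat
    and f0 :: "'n::{finite,wellorder} cmat"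
    and lam :: "'n cvec"
  assumes "CARD('n) \<ge> 2"
    and "k \<ge> 1"
    and "CARD('m::{finite,wellorder}) = k * CARD('n) - 1"
    and "invertible f0"
    and "matrix_inv f0 ** cyclic_perm_matrix ** f0 = diag_mat lam"
  shows "holomorphic_immersion_into {1..2 * k + 2}
           (\<lambda>c :: 'm cvec. monodromy_map k f0 lam (oper_of_coeffs k c))
           (stokes_space k)"
  by (rule oper_setup.monodromy_immersion, unfold_locales) (rule assms)+

end
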